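(* Let $N\ge 3$ and let $M_N$ be a complete hyperbolic surface of finite area, homeomorphic to the $N$-times punctured sphere. A convex polyhedron $P_N$ in $\mathbb{H}^3$ with all vertices on the sphere at infinity whose boundary surface, with its intrinsic metric, is isometric to $M_N$ is unique up to congruence: any two such polyhedra are mapped one to the other by an isometry of $\mathbb{H}^3$.
   Context: $\mathbb{H}^3$ is hyperbolic 3-space, with sphere at infinity $S^2_\infty=\mathbb{C}\cup\{\infty\}$. A convex polyhedron with all vertices at infinity (convex ideal polyhedron) is the hyperbolic convex hull of a finite set of at least three points of $S^2_\infty$ (its vertices). Its boundary surface carries the intrinsic (induced path) metric. Degenerate polyhedra are allowed: if all the vertices lie on one circle of $S^2_\infty$, then the convex hull is a planar ideal polygon, and the boundary surface is by convention the doubly covered polygon (two copies of the polygon glued along corresponding edges). Congruence means equivalence under the full isometry group of $\mathbb{H}^3$ (orientation-reversing isometries allowed). *)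

theory Defs
  imports "HOL-Analysis.Analysis"
begin

text \<open>Hyperbolic space is the Klein (projective) model: the open unit ball \<open>ball 0 1\<close> with the
  distance below. Its sphere at infinity is \<open>sphere 0 1\<close> and its geodesics are Euclidean chords;
  see \<open>Metric_space_hdist\<close> and \<open>hdist_between_iff\<close>. The value off the ball is arbitrary; \<open>0\<close> is
  chosen so that the locale \<^locale>\<open>Metric_space\<close> applies.\<close>

definition hdist :: "'a::euclidean_space \<Rightarrow> 'a \<Rightarrow> real" where
  "hdist x y =
     (if x \<in> ball 0 1 \<and> y \<in> ball 0 1
      then arcosh ((1 - x \<bullet> y) / sqrt ((1 - x \<bullet> x) * (1 - y \<bullet> y))) else 0)"

lemma
  fixes x y z :: "'a::euclidean_space"
  assumes "x \<in> ball 0 1" "y \<in> ball 0 1" "z \<in> ball 0 1"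
  shows hdist_triangle: "hdist x y \<le> hdist x z + hdist z y"
    and hdist_between_iff: "hdist x z + hdist z y = hdist x y \<longleftrightarrow> z \<in> closed_segment x y"
    and hdist_eq_0: "hdist x y = 0 \<longleftrightarrow> x = y"
    and hdist_nonneg: "0 \<le> hdist x y"
proof -
  have pos: "0 < 1 - w \<bullet> w" if "w \<in> ball 0 1" for w :: 'a
    using that by (simp add: dot_square_norm abs_square_less_1)
  define B where "B = (\<lambda>w v :: 'a. 1 - w \<bullet> v)"
  define c where "c = (\<lambda>w v. B w v / sqrt (B w w * B v v))"
  define g where "g = (\<lambda>p w :: 'a. (sqrt (B p p) *\<^sub>R w, p \<bullet> w))"
  have Bpos: "0 < B w w" if "w \<in> ball 0 1" for w
    using pos[OF that] by (simp add: B_def)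
  have Bcomm: "B w v = B v w" for w v
    by (simp add: B_def inner_commute)
  have Bpos2: "0 < B w v" if "w \<in> ball 0 1" "v \<in> ball 0 1" for w v
  proof -
    have "w \<bullet> v \<le> norm w * norm v" by (rule norm_cauchy_schwarz)
    also have "\<dots> < 1 * 1" using that by (intro mult_strict_mono) (auto intro: le_less_trans)
    finally show ?thesis by (simp add: B_def)
  qed
  have gg: "B p v * B p w = B p p * B v w + g p (v - p) \<bullet> g p (w - p)" if "p \<in> ball 0 1" for p v w
    using Bpos[OF that] by (simp add: g_def B_def algebra_simps inner_commute)
  have g0: "g p w = 0 \<longleftrightarrow> w = 0" if "p \<in> ball 0 1" for p w
    using Bpos[OF that] by (auto simp: g_def zero_prod_def)
  have Bsq: "(B p v)\<^sup>2 = B p p * B v v + (norm (g p (v - p)))\<^sup>2" if "p \<in> ball 0 1" for p v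
    using gg[OF that, of v v] by (simp add: power2_eq_square dot_square_norm)
  have h: "hdist w v = arcosh (c w v)" if "w \<in> ball 0 1" "v \<in> ball 0 1" for w v
    using that by (simp add: hdist_def c_def B_def)
  have cc: "(c w v)\<^sup>2 = 1 + (norm (g w (v - w)) / sqrt (B w w * B v v))\<^sup>2"
    if "w \<in> ball 0 1" "v \<in> ball 0 1" for w v
    using Bsq[OF that(1), of v] Bpos[OF that(1)] Bpos[OF that(2)]
    by (simp add: c_def power_divide field_simps)
  have c1: "1 \<le> c w v" if "w \<in> ball 0 1" "v \<in> ball 0 1" for w v
  proof -
    have "0 < c w v" using that Bpos Bpos2 by (simp add: c_def)
    moreover have "1\<^sup>2 \<le> (c w v)\<^sup>2" using cc[OF that] by simp
    ultimately show ?thesis by (meson less_imp_le power2_le_imp_le)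
  qed
  show nn: "0 \<le> hdist x y" using h c1 assms by simp
  have nn': "0 \<le> hdist x z" "0 \<le> hdist z y" using h c1 assms by simp_all
  show "hdist x y = 0 \<longleftrightarrow> x = y"
  proof
    assume "hdist x y = 0"
    then have "c x y = 1" using h c1 assms by simp
    then have "g x (y - x) = 0" using cc[of x y] assms(1,2) Bpos[of x] Bpos[of y] by auto
    then show "x = y" using g0 assms by simp
  next
    assume "x = y"
    then show "hdist x y = 0" using h assms Bpos[of y] by (simp add: c_def)
  qed
  let ?u = "g z (x - z)" and ?v = "g z (y - z)"
  let ?D = "sqrt (B z z * B x x) * sqrt (B z z * B y y)"
  have D: "0 < ?D" using Bpos assms by simp
  have cosh_c: "cosh (hdist w v) = c w v" if "w \<in> ball 0 1" "v \<in> ball 0 1" for w v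
    using h[OF that] c1[OF that] by simp
  have sinh_c: "sinh (hdist w v) = norm (g w (v - w)) / sqrt (B w w * B v v)"
    if "w \<in> ball 0 1" "v \<in> ball 0 1" for w v
    using h[OF that] c1[OF that] cc[OF that] Bpos[OF that(1)] Bpos[OF that(2)]
    by (simp add: sinh_arcosh_real abs_of_nonneg)
  have sym: "hdist x z = hdist z x" using assms by (simp add: h c_def Bcomm mult.commute)
  have sq: "sqrt (B z z) * sqrt (B z z) = B z z" using Bpos[OF assms(3)] by simp
  have c3: "c x y = (B z x * B z y - ?u \<bullet> ?v) / ?D"
    using gg[OF assms(3), of x y] Bpos[OF assms(3)] sq
    by (simp add: c_def real_sqrt_mult field_simps)
  have key: "cosh (hdist x z + hdist z y) - cosh (hdist x y)
               = (norm ?u * norm ?v + ?u \<bullet> ?v) / ?D"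
    unfolding sym cosh_add cosh_c[OF assms(3,1)] cosh_c[OF assms(3,2)] cosh_c[OF assms(1,2)]
      sinh_c[OF assms(3,1)] sinh_c[OF assms(3,2)] c3
    by (simp add: c_def diff_divide_distrib add_divide_distrib)
  have eq0: "hdist x z + hdist z y = hdist x y \<longleftrightarrow> norm ?u * norm ?v + ?u \<bullet> ?v = 0"
  proof -
    have "hdist x z + hdist z y = hdist x y \<longleftrightarrow> cosh (hdist x z + hdist z y) = cosh (hdist x y)"
      using nn nn' by (metis add_nonneg_nonneg arcosh_cosh_real)
    also have "\<dots> \<longleftrightarrow> (norm ?u * norm ?v + ?u \<bullet> ?v) / ?D = 0"
      unfolding key[symmetric] by (rule eq_iff_diff_eq_0)
    also have "\<dots> \<longleftrightarrow> norm ?u * norm ?v + ?u \<bullet> ?v = 0"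
      using D by (metis divide_eq_0_iff less_irrefl)
    finally show ?thesis .
  qed
  have cs: "- (norm ?u * norm ?v) \<le> ?u \<bullet> ?v"
    using Cauchy_Schwarz_ineq2[of ?u ?v] by linarith
  then have "cosh (hdist x y) \<le> cosh (hdist x z + hdist z y)"
    using key D by (smt (verit) divide_nonneg_pos)
  then show "hdist x y \<le> hdist x z + hdist z y"
    using nn nn' by (smt (verit) cosh_real_nonneg_less_iff)
  have lin: "g p (s *\<^sub>R w) = s *\<^sub>R g p w" for p s w
    by (simp add: g_def)
  have lin2: "g p (v + w) = g p v + g p w" for p v w
    by (simp add: g_def algebra_simps)
  show "hdist x z + hdist z y = hdist x y \<longleftrightarrow> z \<in> closed_segment x y"
  proof
    assume "hdist x z + hdist z y = hdist x y"
    then have "norm ?u * norm (- ?v) = ?u \<bullet> (- ?v)"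
      using eq0 by simp
    then have "norm ?u *\<^sub>R (- ?v) = norm ?v *\<^sub>R ?u"
      using norm_cauchy_schwarz_eq[of ?u "- ?v"] by simp
    then have "g z (norm ?v *\<^sub>R (x - z) + norm ?u *\<^sub>R (y - z)) = 0"
      unfolding lin lin2 by (metis add.commute add.right_inverse scaleR_minus_right)
    then have e: "norm ?v *\<^sub>R (x - z) + norm ?u *\<^sub>R (y - z) = 0"
      using g0 assms by simp
    show "z \<in> closed_segment x y"
    proof (cases "norm ?v + norm ?u = 0")
      case True
      then have "?u = 0" by (smt (verit) norm_ge_zero norm_eq_zero)
      then show ?thesis using g0 assms by simp
    next
      case False
      let ?s = "norm ?v + norm ?u"
      have "?s *\<^sub>R z = norm ?v *\<^sub>R x + norm ?u *\<^sub>R y"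
        using e by (simp add: algebra_simps)
      then have "z = (1 / ?s) *\<^sub>R (norm ?v *\<^sub>R x + norm ?u *\<^sub>R y)"
        using False by (metis divide_inverse inverse_1 inverse_eq_divide scaleR_one scaleR_scaleR
            left_inverse mult.left_neutral)
      then have "z = (norm ?v / ?s) *\<^sub>R x + (norm ?u / ?s) *\<^sub>R y"
        by (simp add: scaleR_add_right)
      moreover have "norm ?v / ?s = 1 - norm ?u / ?s"
        using False by (simp add: field_simps)
      moreover have "0 < ?s"
        using False norm_ge_zero[of ?u] norm_ge_zero[of ?v] by linarith
      then have "0 \<le> norm ?u / ?s" "norm ?u / ?s \<le> 1"
        by simp_all
      ultimately show ?thesis unfolding in_segment by metis
    qed
  next
    assume "z \<in> closed_segment x y"
    then obtain s where s: "z = (1 - s) *\<^sub>R x + s *\<^sub>R y" "0 \<le> s" "s \<le> 1"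
      by (auto simp: in_segment)
    have "x - z = s *\<^sub>R (x - y)" "y - z = (- (1 - s)) *\<^sub>R (x - y)"
      unfolding s(1) by (simp_all add: algebra_simps)
    then have u: "?u = s *\<^sub>R g z (x - y)" and v: "?v = (- (1 - s)) *\<^sub>R g z (x - y)"
      by (simp_all only: lin)
    have n: "norm ?u = s * norm (g z (x - y))" "norm ?v = (1 - s) * norm (g z (x - y))"
      unfolding u v norm_scaleR using s(2,3) by simp_all
    have "norm ?u * norm ?v + ?u \<bullet> ?v = 0"
      unfolding n unfolding u v inner_scaleR_left inner_scaleR_right dot_square_norm
      by (simp add: power2_eq_square algebra_simps)
    then show "hdist x z + hdist z y = hdist x y" using eq0 by simp
  qed
qed

lemma Metric_space_hdist: "Metric_space (ball 0 1 :: 'a::euclidean_space set) hdist"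
proof
  fix x y :: 'a
  show "0 \<le> hdist x y"
    using hdist_nonneg[of x y x] by (cases "x \<in> ball 0 1 \<and> y \<in> ball 0 1") (auto simp: hdist_def)
  show "hdist x y = hdist y x"
    by (simp add: hdist_def inner_commute mult.commute)
qed (use hdist_eq_0 hdist_triangle in blast)+

definition isometry_onto :: "'a set \<Rightarrow> ('a \<Rightarrow> 'a \<Rightarrow> 'c) \<Rightarrow> 'b set \<Rightarrow> ('b \<Rightarrow> 'b \<Rightarrow> 'c) \<Rightarrow> ('a \<Rightarrow> 'b) \<Rightarrow> bool" where
  "isometry_onto X dX Y dY f \<longleftrightarrow>
     bij_betw f X Y \<and> (\<forall>x\<in>X. \<forall>y\<in>X. dY (f x) (f y) = dX x y)"

definition curve_length :: "('a \<Rightarrow> 'a \<Rightarrow> real) \<Rightarrow> (real \<Rightarrow> 'a) \<Rightarrow> ennreal" where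
  "curve_length d g =
     (SUP (n, t) \<in> {(n :: nat, t :: nat \<Rightarrow> real). mono t \<and> range t \<subseteq> {0..1}}.
        \<Sum>i<n. ennreal (d (g (t i)) (g (t (Suc i)))))"

text \<open>The intrinsic (induced path) metric of a set \<open>S\<close> with distance \<open>d\<close>; it is \<open>\<infinity>\<close> for points
  not joined by a rectifiable curve.\<close>

definition path_dist :: "'a set \<Rightarrow> ('a \<Rightarrow> 'a \<Rightarrow> real) \<Rightarrow> 'a \<Rightarrow> 'a \<Rightarrow> ennreal" where
  "path_dist S d x y =
     (INF g \<in> {g. continuous_map (top_of_set {0..1}) (Metric_space.mtopology S d) g
                  \<and> g 0 = x \<and> g 1 = y}. curve_length d g)"

text \<open>A hyperbolic surface is a length space locally isometric to the hyperbolic plane.\<close>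

definition hyperbolic_surface :: "'a set \<Rightarrow> ('a \<Rightarrow> 'a \<Rightarrow> real) \<Rightarrow> bool" where
  "hyperbolic_surface M d \<longleftrightarrow>
     Metric_space M d \<and>
     (\<forall>x\<in>M. \<forall>y\<in>M. ennreal (d x y) = path_dist M d x y) \<and>
     (\<forall>x\<in>M. \<exists>r>0. \<exists>(p :: real^2) f. p \<in> ball 0 1 \<and>
        isometry_onto (Metric_space.mball M d x r) d
                      (Metric_space.mball (ball 0 1) hdist p r) hdist f)"

text \<open>The density is that of the Riemannian area form in the Klein disc.\<close>

definition plane_area :: "(real^2) set \<Rightarrow> ennreal" where
  "plane_area A = (\<integral>\<^sup>+x\<in>A. ennreal ((1 - x \<bullet> x) powr (- 3 / 2)) \<partial>lborel)"

text \<open>Area of a surface: the supremum of the total areas of finite families of disjoint pieces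
  \<open>U\<close>, each flattened isometrically by a map \<open>f\<close> onto a Borel set of the hyperbolic plane.\<close>

definition surface_area :: "'a set \<Rightarrow> ('a \<Rightarrow> 'a \<Rightarrow> real) \<Rightarrow> ennreal" where
  "surface_area M d =
     (SUP F \<in> {F :: ('a set \<times> ('a \<Rightarrow> real^2)) set. finite F \<and> disjoint_family_on fst F \<and>
                (\<forall>(U, f)\<in>F. U \<subseteq> M \<and> f ` U \<subseteq> ball 0 1 \<and> f ` U \<in> sets borel \<and>
                    isometry_onto U d (f ` U) hdist f)}.
        \<Sum>(U, f)\<in>F. plane_area (f ` U))"

definition punctured_sphere :: "nat \<Rightarrow> 'a topology \<Rightarrow> bool" where
  "punctured_sphere N T \<longleftrightarrow>
     (\<exists>V. V \<subseteq> sphere (0 :: real^3) 1 \<and> finite V \<and> card V = N \<and>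
          T homeomorphic_space top_of_set (sphere 0 1 - V))"

text \<open>In the Klein model, hyperbolic convexity is Euclidean convexity. By \<open>ideal_hull_eq_Inter\<close>
  this is the smallest closed, geodesically convex subset of hyperbolic space that has \<open>V\<close> in
  its closure.\<close>

definition ideal_hull :: "'a::euclidean_space set \<Rightarrow> 'a set" where
  "ideal_hull V = convex hull V \<inter> ball 0 1"

lemma ideal_hull_eq_Inter:
  fixes V :: "'a::euclidean_space set"
  assumes V: "V \<subseteq> sphere 0 1" "finite V" "card V \<ge> 2"
  shows "ideal_hull V =
    \<Inter> {C. C \<subseteq> ball 0 1 \<and> closedin (top_of_set (ball 0 1)) C \<and> V \<subseteq> closure C \<and>
         (\<forall>x\<in>C. \<forall>y\<in>C. \<forall>z\<in>ball 0 1. hdist x z + hdist z y = hdist x y \<longrightarrow> z \<in> C)}"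
    (is "_ = \<Inter> ?\<C>")
proof
  have 1: "V \<subseteq> closure (ideal_hull V)"
  proof
    fix v assume v: "v \<in> V"
    obtain w where w: "w \<in> V" "w \<noteq> v"
      using V(3) v by (metis (full_types) One_nat_def card_le_Suc0_iff_eq V(2) not_less_eq_eq
          numeral_2_eq_2)
    have "open_segment v w \<subseteq> ideal_hull V"
    proof
      fix p assume p: "p \<in> open_segment v w"
      then have "p \<in> convex hull V"
        using v w by (meson convex_contains_open_segment convex_convex_hull hull_inc subsetD)
      moreover have "dist 0 p < max (dist 0 v) (dist 0 w)"
        using dist_decreases_open_segment[OF p, of 0] by (auto simp: dist_commute)
      moreover have "norm v = 1" "norm w = 1" using v w V(1) by auto
      ultimately show "p \<in> ideal_hull V"
        by (simp add: ideal_hull_def)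
    qed
    then have "closure (open_segment v w) \<subseteq> closure (ideal_hull V)" by (rule closure_mono)
    then show "v \<in> closure (ideal_hull V)" using w by (auto simp: closure_open_segment)
  qed
  have "closed (convex hull V)"
    using V(2) by (simp add: compact_imp_closed finite_imp_compact_convex_hull)
  then have 2: "closedin (top_of_set (ball 0 1)) (ideal_hull V)"
    unfolding ideal_hull_def by (metis closedin_closed_Int inf_commute)
  have 3: "z \<in> ideal_hull V"
    if "x \<in> ideal_hull V" "y \<in> ideal_hull V" "z \<in> ball 0 1" "hdist x z + hdist z y = hdist x y"
    for x y z
    using that hdist_between_iff[of x y z] convex_convex_hull[of V]
    by (auto simp: ideal_hull_def convex_contains_segment)
  have "ideal_hull V \<subseteq> ball 0 1"
    by (simp add: ideal_hull_def)
  with 1 2 3 have "ideal_hull V \<in> ?\<C>" by blast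
  then show "\<Inter> ?\<C> \<subseteq> ideal_hull V" by (rule Inter_lower)
next
  show "ideal_hull V \<subseteq> \<Inter> ?\<C>"
  proof (intro Inter_greatest)
    fix C assume "C \<in> ?\<C>"
    then have C: "C \<subseteq> ball 0 1" "closedin (top_of_set (ball 0 1)) C" "V \<subseteq> closure C"
      "\<forall>x\<in>C. \<forall>y\<in>C. \<forall>z\<in>ball 0 1. hdist x z + hdist z y = hdist x y \<longrightarrow> z \<in> C"
      by blast+
    have "closed_segment x y \<subseteq> C" if "x \<in> C" "y \<in> C" for x y
    proof
      fix z assume z: "z \<in> closed_segment x y"
      have xy: "x \<in> ball 0 1" "y \<in> ball 0 1" using that C(1) by auto
      then have "z \<in> ball 0 1"
        using z convex_ball[of 0 1] by (meson convex_contains_segment subsetD)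
      then show "z \<in> C" using C(4) that hdist_between_iff[OF xy] z by blast
    qed
    then have "convex C" by (auto simp: convex_contains_segment)
    then have "convex hull V \<subseteq> closure C" using C(3) by (simp add: convex_closure hull_minimal)
    moreover have "closure C \<inter> ball 0 1 \<subseteq> C"
    proof -
      obtain T where "closed T" "C = ball 0 1 \<inter> T" using C(2) by (auto simp: closedin_closed)
      moreover from this have "closure C \<subseteq> T" by (simp add: closure_minimal)
      ultimately show ?thesis by blast
    qed
    ultimately show "ideal_hull V \<subseteq> C" by (auto simp: ideal_hull_def)
  qed
qed

definition ideal_polyhedron :: "(real^3) set \<Rightarrow> bool" where
  "ideal_polyhedron P \<longleftrightarrow>
     (\<exists>V. finite V \<and> card V \<ge> 3 \<and> V \<subseteq> sphere 0 1 \<and> P = ideal_hull V)"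

text \<open>The double of a planar ideal polygon \<open>P\<close>: the points of the edges \<open>P - rel_interior P\<close> occur
  once, with label \<open>True\<close>, the other points twice. The distance is that of two copies of \<open>P\<close>,
  which is convex and hence carries its own path metric, glued along the edges: points on
  different copies are joined by crossing an edge.\<close>

definition double :: "'a::euclidean_space set \<Rightarrow> ('a \<times> bool) set" where
  "double P = P \<times> {True} \<union> rel_interior P \<times> {False}"

definition double_dist :: "'a::euclidean_space set \<Rightarrow> 'a \<times> bool \<Rightarrow> 'a \<times> bool \<Rightarrow> ennreal" where
  "double_dist P = (\<lambda>(x, s) (y, t).
     if s = t then ennreal (hdist x y)
     else (INF z \<in> P - rel_interior P. ennreal (hdist x z + hdist z y)))"

text \<open>The interior of \<open>P\<close> is empty exactly when the vertices lie on one circle of the sphere at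
  infinity; then the boundary surface is the double. Otherwise it is the topological boundary
  of \<open>P\<close> in hyperbolic space with its path metric.\<close>

definition boundary_isometric_to :: "(real^3) set \<Rightarrow> 'a set \<Rightarrow> ('a \<Rightarrow> 'a \<Rightarrow> real) \<Rightarrow> bool" where
  "boundary_isometric_to P M d \<longleftrightarrow>
     (if interior P \<noteq> {}
      then \<exists>f. isometry_onto M (\<lambda>x y. ennreal (d x y))
                             (P - interior P) (path_dist (P - interior P) hdist) f
      else \<exists>f. isometry_onto M (\<lambda>x y. ennreal (d x y)) (double P) (double_dist P) f)"

definition congruent_bodies :: "(real^3) set \<Rightarrow> (real^3) set \<Rightarrow> bool" where
  "congruent_bodies P Q \<longleftrightarrow>
     (\<exists>f. isometry_onto (ball 0 1) hdist (ball 0 1) hdist f \<and> f ` P = Q)"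

end

theory Submission
  imports Defs
begin

text \<open>In the hyperboloid model a polyhedral face is a cone over null vectors \<open>hv v\<close>. Both polyhedra
  provide developments of the same surface that are isometric on faces and do not increase \<open>mk\<close>
  elsewhere. Reading the second development in the cones of the first polyhedron gives a map \<open>dev\<close>
  whose pairing with null vectors is concave, because the second polyhedron is convex along its
  edges. Cusps correspond, \<open>v\<close> to \<open>\<sigma> v\<close>, with ratios \<open>c v\<close> of horofunctions, and it suffices that
  \<open>mk (hv v) (hv u) = c v * c u * mk (hv (\<sigma> v)) (hv (\<sigma> u))\<close>: a Lorentz map then carries one polyhedron
  to the other. Otherwise, for some \<open>u\<close>, the quotient of the two sides has a maximum \<open>k > 1\<close>, at \<open>v\<close>
  say. The links of \<open>v\<close>, seen from the projection of \<open>u\<close>, are polygons with equal sides; by concavity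
  distances to the origin in the first are at most those in the second. The angles at the origin
  sum to \<open>2 * pi\<close> in the second and to at most that in the first, while by convexity the angle sum
  strictly decreases with the distances. So the distances agree, the quotient is \<open>k\<close> at all vertices
  of the faces at \<open>v\<close>, and by connectedness at the neighbours of \<open>u\<close>, which is impossible.\<close>

subsection \<open>Minkowski space and the hyperboloid\<close>

text \<open>The isometry between the two boundary surfaces need not carry edges to edges, and either
  surface may be a doubled polygon, whose projection to hyperbolic space is not injective. So no
  cell structures are matched. The polyhedra are compared through the distance \<open>d\<close>
  alone, which equals the hyperbolic distance within a face and bounds it from above elsewhere, and
  through convexity along the edges. Multiplying the second side by the maximum k gives an
  inequality at all vertices with equality at v. Equality at v makes the squared distances to the
  origin in the two links affine in the pairings with u, with the same scale; so the inequality,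
  spread over the faces by Jensen's inequality, compares distances. Strictness k > 1 keeps the
  origin in the interior of the second link, where the angles add up to exactly 2 * pi. In the first
  link the origin may be on the boundary, hence only an upper bound there. The resulting Gram
  inequality is one-sided; exchanging the polyhedra gives the other half.\<close>

definition mk :: "'a::euclidean_space \<times> real \<Rightarrow> 'a \<times> real \<Rightarrow> real" where
  "mk X Y = snd X * snd Y - fst X \<bullet> fst Y"

text \<open>The lift to height 1: points of the ball become timelike, points of the sphere null. The
  positive multiples of a null vector \<open>hv v\<close> correspond to the horospheres at
  \<open>v\<close>.\<close>

definition hv :: "'a \<Rightarrow> 'a \<times> real" where
  "hv x = (x, 1)"

definition future :: "('a::euclidean_space \<times> real) set" where
  "future = {X. mk X X > 0 \<and> snd X > 0}"

definition hyp :: "('a::euclidean_space \<times> real) set" where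
  "hyp = {X. mk X X = 1 \<and> snd X > 0}"

definition cone_on :: "'a::euclidean_space set \<Rightarrow> ('a \<times> real) set" where
  "cone_on A = {X. \<exists>t. (\<forall>v\<in>A. 0 \<le> t v) \<and> X = (\<Sum>v\<in>A. t v *\<^sub>R hv v)}"

lemma mk_commute: "mk X Y = mk Y X"
  by (simp add: mk_def inner_commute)

lemma mk_add_left: "mk (X + Y) Z = mk X Z + mk Y Z"
  and mk_add_right: "mk Z (X + Y) = mk Z X + mk Z Y"
  and mk_diff_left: "mk (X - Y) Z = mk X Z - mk Y Z"
  and mk_diff_right: "mk Z (X - Y) = mk Z X - mk Z Y"
  and mk_scale_left: "mk (a *\<^sub>R X) Z = a * mk X Z"
  and mk_scale_right: "mk Z (a *\<^sub>R X) = a * mk Z X"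
  and mk_minus_left: "mk (- X) Z = - mk X Z"
  and mk_minus_right: "mk Z (- X) = - mk Z X"
  and mk_zero_left: "mk 0 Z = 0"
  and mk_zero_right: "mk Z 0 = 0"
  by (simp_all add: mk_def inner_add_left inner_add_right inner_diff_left inner_diff_right algebra_simps)

lemmas mk_linear = mk_add_left mk_add_right mk_diff_left mk_diff_right mk_scale_left mk_scale_right
  mk_minus_left mk_minus_right mk_zero_left mk_zero_right

lemma mk_sum_left: "mk (\<Sum>i\<in>A. f i) Z = (\<Sum>i\<in>A. mk (f i) Z)"
  by (induction A rule: infinite_finite_induct) (auto simp: mk_linear)

lemma mk_sum_right: "mk Z (\<Sum>i\<in>A. f i) = (\<Sum>i\<in>A. mk Z (f i))"
  by (induction A rule: infinite_finite_induct) (auto simp: mk_linear)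

lemma continuous_on_mk [continuous_intros]:
  "continuous_on S f \<Longrightarrow> continuous_on S g \<Longrightarrow> continuous_on S (\<lambda>x. mk (f x) (g x))"
  unfolding mk_def by (intro continuous_intros)

lemma tendsto_mk [tendsto_intros]:
  "(f \<longlongrightarrow> X) F \<Longrightarrow> (g \<longlongrightarrow> Y) F \<Longrightarrow> ((\<lambda>x. mk (f x) (g x)) \<longlongrightarrow> mk X Y) F"
  unfolding mk_def by (intro tendsto_intros)

lemma snd_hv [simp]: "snd (hv v) = 1" and fst_hv [simp]: "fst (hv v) = v"
  by (simp_all add: hv_def)

lemma hv_inj [simp]: "hv v = hv w \<longleftrightarrow> v = w"
  by (simp add: hv_def)

lemma mk_hv: "mk (hv v) (hv w) = 1 - v \<bullet> w"
  by (simp add: mk_def)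

lemma mk_hv_self_sphere: "norm v = 1 \<Longrightarrow> mk (hv v) (hv v) = 0"
  by (simp add: mk_hv dot_square_norm)

lemma mk_hv_sphere_nonneg: "norm v = 1 \<Longrightarrow> norm w = 1 \<Longrightarrow> 0 \<le> mk (hv v) (hv w)"
  using norm_cauchy_schwarz[of v w] by (simp add: mk_hv)

lemma mk_hv_sphere_eq_0: 
  assumes "norm v = 1" "norm w = 1" shows "mk (hv v) (hv w) = 0 \<longleftrightarrow> v = w"
proof
  assume "mk (hv v) (hv w) = 0"
  hence "norm v *\<^sub>R w = norm w *\<^sub>R v"
    using assms norm_cauchy_schwarz_eq[of v w] by (simp add: mk_hv)
  thus "v = w" using assms by simp
qed (use assms in \<open>simp add: mk_hv dot_square_norm\<close>)

lemma mk_hv_sphere_pos: "norm v = 1 \<Longrightarrow> norm w = 1 \<Longrightarrow> v \<noteq> w \<Longrightarrow> 0 < mk (hv v) (hv w)"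
  using mk_hv_sphere_nonneg mk_hv_sphere_eq_0 by (metis less_eq_real_def)

lemma mk_self: "mk X X = (snd X)\<^sup>2 - (norm (fst X))\<^sup>2"
  by (simp add: mk_def power2_eq_square dot_square_norm)

lemma mk_self_nonneg_iff: "0 \<le> mk X X \<longleftrightarrow> norm (fst X) \<le> \<bar>snd X\<bar>"
  by (simp add: mk_self abs_le_square_iff[symmetric])

lemma mk_self_pos_iff: "0 < mk X X \<longleftrightarrow> norm (fst X) < \<bar>snd X\<bar>"
proof -
  have "norm (fst X) < \<bar>snd X\<bar> \<longleftrightarrow> \<not> \<bar>snd X\<bar> \<le> \<bar>norm (fst X)\<bar>" by auto
  also have "\<dots> \<longleftrightarrow> 0 < mk X X" by (simp only: abs_le_square_iff) (auto simp: mk_self)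
  finally show ?thesis by simp
qed

lemma mk_future_causal_pos:
  assumes "X \<in> future" "0 \<le> mk Y Y" "0 < snd Y"
  shows "0 < mk X Y"
proof -
  have "fst X \<bullet> fst Y \<le> norm (fst X) * norm (fst Y)" by (rule norm_cauchy_schwarz)
  also have "\<dots> \<le> norm (fst X) * snd Y"
    using assms by (intro mult_left_mono) (auto simp: mk_self_nonneg_iff)
  also have "\<dots> < snd X * snd Y"
    using assms by (intro mult_strict_right_mono) (auto simp: future_def mk_self_pos_iff)
  finally show ?thesis by (simp add: mk_def)
qed

lemma future_add:
  assumes "X \<in> future" "0 \<le> mk Y Y" "0 < snd Y"
  shows "X + Y \<in> future"
  using assms mk_future_causal_pos[OF assms] by (auto simp: future_def mk_linear mk_commute[of Y X])

lemma future_scale: "X \<in> future \<Longrightarrow> 0 < a \<Longrightarrow> a *\<^sub>R X \<in> future"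
  by (auto simp: future_def mk_linear)

lemma hyp_imp_future: "X \<in> hyp \<Longrightarrow> X \<in> future"
  by (auto simp: hyp_def future_def)

text \<open>The form is negative definite on the complement of a timelike vector. Orthogonality and
  Cauchy-Schwarz bound \<open>\<bar>snd Z\<bar> * \<bar>snd X\<bar>\<close> by
  \<open>\<bar>snd Z\<bar> * norm (fst X)\<close>, and
  \<open>norm (fst X) < \<bar>snd X\<bar>\<close> leaves only \<open>snd Z = 0\<close>.\<close>

lemma mk_orthogonal_timelike:
  assumes "0 < mk X X" "mk Z X = 0" "0 \<le> mk Z Z"
  shows "Z = 0"
proof -
  have "\<bar>snd Z\<bar> * \<bar>snd X\<bar> = \<bar>fst Z \<bullet> fst X\<bar>"
    using assms(2) by (simp add: mk_def flip: abs_mult)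
  also have "\<dots> \<le> norm (fst Z) * norm (fst X)" by (rule Cauchy_Schwarz_ineq2)
  also have "\<dots> \<le> \<bar>snd Z\<bar> * norm (fst X)"
    using assms(3) by (intro mult_right_mono) (auto simp: mk_self_nonneg_iff)
  finally have "\<bar>snd Z\<bar> * (\<bar>snd X\<bar> - norm (fst X)) \<le> 0" by (simp add: algebra_simps)
  moreover have "0 < \<bar>snd X\<bar> - norm (fst X)" using assms(1) by (simp add: mk_self_pos_iff)
  ultimately have "snd Z = 0"
    by (metis abs_ge_zero abs_le_zero_iff linorder_not_le mult_pos_pos order_le_less)
  moreover have "norm (fst Z) \<le> 0" using assms(3) calculation by (simp add: mk_self_nonneg_iff)
  ultimately show ?thesis by (simp add: prod_eq_iff)
qed

text \<open>The difference is null and orthogonal to \<open>X\<close>, hence 0. This turns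
  equalities of \<open>mk\<close> values, which come from distances, into equalities of
  vectors.\<close>

lemma timelike_eqI:
  assumes "0 < mk X X" "mk Y Y = mk X X" "mk X Y = mk X X"
  shows "X = Y"
  using mk_orthogonal_timelike[of X "Y - X"] assms
  by (simp add: mk_linear mk_commute[of Y X])

lemma mk_self_orthogonal_nonpos:
  assumes "0 < mk X X" "mk Z X = 0" shows "mk Z Z \<le> 0"
  using mk_orthogonal_timelike[OF assms] by (cases "0 \<le> mk Z Z") (auto simp: mk_zero_left)

lemma mk_reverse_CS:
  assumes "0 < mk X X"
  shows "mk X X * mk Y Y \<le> (mk X Y)\<^sup>2"
proof -
  define Z where "Z = mk X X *\<^sub>R Y - mk X Y *\<^sub>R X"
  have "mk Z X = 0" by (simp add: Z_def mk_linear mk_commute[of Y X])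
  hence "mk Z Z \<le> 0" using mk_self_orthogonal_nonpos assms by blast
  also have "mk Z Z = mk X X * (mk X X * mk Y Y - (mk X Y)\<^sup>2)"
    by (simp add: Z_def mk_linear mk_commute[of Y X] algebra_simps power2_eq_square)
  finally show ?thesis using assms by (simp add: mult_le_0_iff)
qed

lemma mk_hyp_ge_1:
  assumes "X \<in> hyp" "Y \<in> hyp" shows "1 \<le> mk X Y"
proof -
  have "1\<^sup>2 \<le> (mk X Y)\<^sup>2" using mk_reverse_CS[of X Y] assms by (simp add: hyp_def)
  moreover have "0 < mk X Y" using mk_future_causal_pos[of X Y] assms by (auto simp: hyp_def future_def)
  ultimately show ?thesis by (meson less_imp_le power2_le_imp_le)
qed

text \<open>Central projection of the Klein ball onto the hyperboloid.\<close>

definition ulift :: "'a::euclidean_space \<Rightarrow> 'a \<times> real" where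
  "ulift x = (1 / sqrt (1 - x \<bullet> x)) *\<^sub>R hv x"

lemma one_minus_inner_pos: "norm x < 1 \<Longrightarrow> 0 < 1 - x \<bullet> x"
  by (simp add: dot_square_norm abs_square_less_1)

lemma ulift_hyp:
  assumes "norm x < 1" shows "ulift x \<in> hyp"
  using one_minus_inner_pos[OF assms] by (simp add: ulift_def hyp_def mk_linear mk_hv)

lemma mk_ulift:
  assumes "norm x < 1" "norm y < 1"
  shows "mk (ulift x) (ulift y) = cosh (hdist x y)"
proof -
  have e: "mk (ulift x) (ulift y) = (1 - x \<bullet> y) / sqrt ((1 - x \<bullet> x) * (1 - y \<bullet> y))"
    by (simp add: ulift_def mk_linear mk_hv real_sqrt_mult)
  moreover have "1 \<le> mk (ulift x) (ulift y)" using mk_hyp_ge_1 ulift_hyp assms by blast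
  ultimately show ?thesis using assms by (simp add: hdist_def)
qed

lemma ulift_of_hyp:
  assumes "X \<in> hyp" shows "norm (fst X /\<^sub>R snd X) < 1" "ulift (fst X /\<^sub>R snd X) = X"
proof -
  have s: "0 < snd X" and m: "mk X X = 1" using assms by (auto simp: hyp_def)
  let ?x = "fst X /\<^sub>R snd X"
  have n: "norm (fst X) < snd X" using s m mk_self_pos_iff[of X] by auto
  show "norm ?x < 1" using s n by (simp add: divide_simps)
  have "1 - ?x \<bullet> ?x = mk X X / (snd X)\<^sup>2"
    using s by (simp add: mk_def field_simps power2_eq_square)
  hence "sqrt (1 - ?x \<bullet> ?x) = 1 / snd X" using s m by (simp add: real_sqrt_divide)
  thus "ulift ?x = X" using s by (simp add: ulift_def hv_def prod_eq_iff)
qed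

lemma ulift_inj:
  assumes "norm x < 1" "norm y < 1" "ulift x = ulift y" shows "x = y"
proof -
  have "sqrt (1 - x \<bullet> x) > 0" "sqrt (1 - y \<bullet> y) > 0" using assms one_minus_inner_pos by auto
  thus ?thesis using assms(3) by (auto simp: ulift_def hv_def)
qed

lemma cone_onI: "(\<And>v. v \<in> A \<Longrightarrow> 0 \<le> t v) \<Longrightarrow> (\<Sum>v\<in>A. t v *\<^sub>R hv v) \<in> cone_on A"
  unfolding cone_on_def by blast

lemma cone_onE:
  assumes "X \<in> cone_on A"
  obtains t where "\<And>v. v \<in> A \<Longrightarrow> 0 \<le> t v" "X = (\<Sum>v\<in>A. t v *\<^sub>R hv v)"
  using assms unfolding cone_on_def by blast

lemma cone_on_add: assumes "X \<in> cone_on A" "Y \<in> cone_on A" shows "X + Y \<in> cone_on A"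
proof -
  obtain t where t: "\<And>v. v \<in> A \<Longrightarrow> 0 \<le> t v" "X = (\<Sum>v\<in>A. t v *\<^sub>R hv v)"
    using cone_onE[OF assms(1)] by blast
  obtain s where s: "\<And>v. v \<in> A \<Longrightarrow> 0 \<le> s v" "Y = (\<Sum>v\<in>A. s v *\<^sub>R hv v)"
    using cone_onE[OF assms(2)] by blast
  have "X + Y = (\<Sum>v\<in>A. (t v + s v) *\<^sub>R hv v)"
    unfolding t(2) s(2) scaleR_add_left sum.distrib ..
  thus ?thesis using t(1) s(1) by (simp only:) (intro cone_onI add_nonneg_nonneg)
qed

lemma cone_on_scale: assumes "X \<in> cone_on A" "0 \<le> a" shows "a *\<^sub>R X \<in> cone_on A"
proof -
  obtain t where t: "\<And>v. v \<in> A \<Longrightarrow> 0 \<le> t v" "X = (\<Sum>v\<in>A. t v *\<^sub>R hv v)"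
    using cone_onE[OF assms(1)] by blast
  have "a *\<^sub>R X = (\<Sum>v\<in>A. (a * t v) *\<^sub>R hv v)"
    unfolding t(2) scaleR_sum_right by simp
  thus ?thesis using t(1) assms(2) by (simp only:) (intro cone_onI mult_nonneg_nonneg)
qed

lemma cone_on_zero: "0 \<in> cone_on A"
  unfolding cone_on_def by (auto intro!: exI[of _ "\<lambda>_. 0"])

lemma cone_on_hv: "finite A \<Longrightarrow> v \<in> A \<Longrightarrow> hv v \<in> cone_on A"
  unfolding cone_on_def
  by (auto intro!: exI[of _ "\<lambda>w. if w = v then 1 else 0"] simp: if_distrib[of "\<lambda>c. c *\<^sub>R _"] cong: if_cong)

lemma cone_on_mono:
  assumes "A \<subseteq> B" "finite B" shows "cone_on A \<subseteq> cone_on B"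
proof
  fix X assume "X \<in> cone_on A"
  then obtain t where t: "\<forall>v\<in>A. 0 \<le> t v" "X = (\<Sum>v\<in>A. t v *\<^sub>R hv v)" by (auto simp: cone_on_def)
  have "(\<Sum>v\<in>A. t v *\<^sub>R hv v) = (\<Sum>v\<in>B. (if v \<in> A then t v else 0) *\<^sub>R hv v)"
    using assms by (intro sum.mono_neutral_cong_left) auto
  with t show "X \<in> cone_on B" unfolding cone_on_def by (auto intro!: exI[of _ "\<lambda>v. if v \<in> A then t v else 0"])
qed

lemma cone_on_sum: "(\<And>i. i \<in> J \<Longrightarrow> f i \<in> cone_on A) \<Longrightarrow> (\<Sum>i\<in>J. f i) \<in> cone_on A"
  by (induction J rule: infinite_finite_induct) (auto intro: cone_on_add cone_on_zero)

lemma hv_cone_on_iff: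
  assumes "finite A" shows "hv x \<in> cone_on A \<longleftrightarrow> x \<in> convex hull A"
  using assms by (auto simp: cone_on_def convex_hull_finite hv_def prod_eq_iff fst_sum snd_sum)

lemma cone_on_normalize:
  assumes "0 < snd X" "finite A"
  shows "X \<in> cone_on A \<longleftrightarrow> fst X /\<^sub>R snd X \<in> convex hull A"
proof -
  have "X = snd X *\<^sub>R hv (fst X /\<^sub>R snd X)" using assms by (simp add: hv_def prod_eq_iff)
  moreover have "hv (fst X /\<^sub>R snd X) = inverse (snd X) *\<^sub>R X" using assms by (simp add: hv_def prod_eq_iff)
  ultimately show ?thesis
    using cone_on_scale assms(1) hv_cone_on_iff[OF assms(2)]
    by (metis inverse_nonnegative_iff_nonnegative less_imp_le)
qed

lemma cone_on_causal:
  assumes "finite A" "A \<subseteq> sphere 0 1" "X \<in> cone_on A"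
  shows "0 \<le> mk X X" "0 \<le> snd X" "snd X = 0 \<Longrightarrow> X = 0"
proof -
  obtain t where t: "\<forall>v\<in>A. 0 \<le> t v" "X = (\<Sum>v\<in>A. t v *\<^sub>R hv v)" using assms by (auto simp: cone_on_def)
  show "0 \<le> mk X X" using t assms(2)
    by (auto simp: mk_sum_left mk_sum_right mk_linear intro!: sum_nonneg mult_nonneg_nonneg mk_hv_sphere_nonneg)
  show "0 \<le> snd X" using t by (auto simp: snd_sum intro: sum_nonneg)
  assume "snd X = 0"
  hence "(\<Sum>v\<in>A. t v) = 0" using t by (simp add: snd_sum)
  hence "\<forall>v\<in>A. t v = 0" using t(1) assms(1) by (simp add: sum_nonneg_eq_0_iff)
  thus "X = 0" using t(2) by simp
qed

lemma cosh_eq_real_nonneg: "0 \<le> x \<Longrightarrow> 0 \<le> y \<Longrightarrow> cosh x = cosh y \<Longrightarrow> x = (y::real)"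
  by (metis arcosh_cosh_real)

text \<open>The hypothesis compares only chords across \<open>s\<close> itself, with a \<delta> that
  may shrink as \<open>s\<close> moves. After subtracting the chord from 0 to 1, a negative value at
  1/2 would give a negative minimum in the interior, and the inequality there forces equality on
  both sides of it.\<close>

lemma midpoint_concave_local:
  fixes p :: "real \<Rightarrow> real"
  assumes cont: "continuous_on {0..1} p"
    and loc: "\<And>s. 0 < s \<Longrightarrow> s < 1 \<Longrightarrow> \<exists>\<delta>>0. \<forall>a b. 0 < a \<longrightarrow> a \<le> \<delta> \<longrightarrow> 0 < b \<longrightarrow> b \<le> \<delta> \<longrightarrow>
        b * p (s - a) + a * p (s + b) \<le> (a + b) * p s"
  shows "p 0 + p 1 \<le> 2 * p (1/2)"
proof (rule ccontr)
  define v where "v s = p s - ((1 - s) * p 0 + s * p 1)" for s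
  assume "\<not> ?thesis"
  hence neg: "v (1/2) < 0" by (simp add: v_def)
  have cv: "continuous_on {0..1} v" unfolding v_def by (intro continuous_intros cont)
  obtain x0 where x0: "x0 \<in> {0..1}" "\<And>y. y \<in> {0..1} \<Longrightarrow> v x0 \<le> v y"
    using continuous_attains_inf[OF compact_Icc _ cv] by auto
  define S where "S = {x \<in> {0..1}. v x = v x0}"
  have "closed S" unfolding S_def
    by (rule continuous_closed_preimage_constant[OF cv closed_real_atLeastAtMost])
  \<comment> \<open>The leftmost point of the minimum set is taken, so that the values just to its
    left are strictly larger.\<close>
  hence "compact S" unfolding S_def by (metis (no_types, lifting) bounded_closed_interval bounded_subset compact_eq_bounded_closed mem_Collect_eq subsetI)
  moreover have "x0 \<in> S" using x0 by (simp add: S_def)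
  ultimately obtain s where s: "s \<in> S" "\<And>y. y \<in> S \<Longrightarrow> s \<le> y"
    by (metis compact_attains_inf empty_iff)
  have m: "v s < 0" "\<And>y. y \<in> {0..1} \<Longrightarrow> v s \<le> v y" using s(1) x0 neg
    by (auto simp: S_def intro: le_less_trans[of _ "v (1/2)"])
  have "v 0 = 0" "v 1 = 0" by (auto simp: v_def)
  hence s01: "0 < s" "s < 1" using s(1) m(1) by (auto simp: S_def less_le)
  obtain \<delta> where \<delta>: "\<delta> > 0" "\<And>a b. 0 < a \<Longrightarrow> a \<le> \<delta> \<Longrightarrow> 0 < b \<Longrightarrow> b \<le> \<delta> \<Longrightarrow>
        b * p (s - a) + a * p (s + b) \<le> (a + b) * p s" using loc[OF s01] by blast
  define a where "a = min \<delta> (min s (1 - s))"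
  have a: "0 < a" "a \<le> \<delta>" "s - a \<in> {0..1}" "s + a \<in> {0..1}" using \<delta>(1) s01 by (auto simp: a_def)
  have "a * p (s - a) + a * p (s + a) \<le> (a + a) * p s" using \<delta>(2) a by blast
  hence "a * (p (s - a) + p (s + a)) \<le> a * (2 * p s)" by (simp add: algebra_simps)
  hence "p (s - a) + p (s + a) \<le> 2 * p s" using a(1) by simp
  hence "v (s - a) + v (s + a) \<le> 2 * v s" by (simp add: v_def algebra_simps)
  moreover have "v s \<le> v (s + a)" using m(2) a(4) by blast
  moreover have "v s < v (s - a)"
  proof -
    have "s - a \<notin> S" using s(2)[of "s - a"] a(1) by auto
    thus ?thesis using m(2)[OF a(3)] a(3) s(1) by (auto simp: S_def)
  qed
  ultimately show False by linarith
qed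

definition kpos :: "'a::real_vector \<times> real \<Rightarrow> 'a" where
  "kpos X = fst X /\<^sub>R snd X"

definition unitv :: "'a::euclidean_space \<times> real \<Rightarrow> 'a \<times> real" where
  "unitv X = (1 / sqrt (mk X X)) *\<^sub>R X"

lemma unitv_hyp: "X \<in> future \<Longrightarrow> unitv X \<in> hyp"
  by (simp add: unitv_def hyp_def future_def mk_linear)

lemma unitv_scale: "0 < a \<Longrightarrow> unitv (a *\<^sub>R X) = unitv X"
proof -
  assume "0 < a"
  hence "sqrt (mk (a *\<^sub>R X) (a *\<^sub>R X)) = a * sqrt (mk X X)"
    by (simp add: mk_linear real_sqrt_mult)
  thus ?thesis using \<open>0 < a\<close> by (simp add: unitv_def)
qed

lemma unitv_of_hyp: "X \<in> hyp \<Longrightarrow> unitv X = X"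
  by (simp add: unitv_def hyp_def)

lemma scale_unitv: "X \<in> future \<Longrightarrow> sqrt (mk X X) *\<^sub>R unitv X = X"
  by (simp add: unitv_def future_def)

lemma kpos_scale: "a \<noteq> 0 \<Longrightarrow> kpos (a *\<^sub>R X) = kpos X"
  by (simp add: kpos_def)

lemma kpos_unitv: "X \<in> future \<Longrightarrow> kpos (unitv X) = kpos X"
  by (simp add: unitv_def kpos_scale future_def)

lemma norm_kpos: "X \<in> future \<Longrightarrow> norm (kpos X) < 1"
  using ulift_of_hyp(1)[OF unitv_hyp, of X] kpos_unitv[of X] unfolding kpos_def by metis

lemma ulift_kpos: "X \<in> future \<Longrightarrow> ulift (kpos X) = unitv X"
  using ulift_of_hyp(2)[OF unitv_hyp, of X] kpos_unitv[of X] unfolding kpos_def by metis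

definition hyd :: "'a::euclidean_space \<times> real \<Rightarrow> 'a \<times> real \<Rightarrow> real" where
  "hyd X Y = hdist (kpos X) (kpos Y)"

lemma hyd_nonneg: "X \<in> future \<Longrightarrow> Y \<in> future \<Longrightarrow> 0 \<le> hyd X Y"
  using hdist_nonneg[of "kpos X" "kpos Y" "kpos X"] by (simp add: hyd_def norm_kpos)

lemma cosh_hyd:
  assumes "X \<in> future" "Y \<in> future" shows "cosh (hyd X Y) = mk (unitv X) (unitv Y)"
  unfolding hyd_def mk_ulift[OF norm_kpos[OF assms(1)] norm_kpos[OF assms(2)], symmetric]
    ulift_kpos[OF assms(1)] ulift_kpos[OF assms(2)] ..

lemma hyd_between:
  assumes "X \<in> future" "Y \<in> future"  "0 < a" "0 < b" 
  shows "hyd X (a *\<^sub>R X + b *\<^sub>R Y) + hyd (a *\<^sub>R X + b *\<^sub>R Y) Y = hyd X Y"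
proof -
  let ?Z = "a *\<^sub>R X + b *\<^sub>R Y"
  have Z: "?Z \<in> future" using assms by (intro future_add) (auto simp: future_def mk_linear)
  have s: "0 < snd X" "0 < snd Y" using assms by (auto simp: future_def)
  let ?u = "b * snd Y / (a * snd X + b * snd Y)"
  have p: "0 < a * snd X + b * snd Y" using s assms(3,4) by (simp add: add_pos_pos)
  have "kpos ?Z = (1 - ?u) *\<^sub>R kpos X + ?u *\<^sub>R kpos Y"
  proof -
    have "1 - ?u = a * snd X / (a * snd X + b * snd Y)" using p by (simp add: field_simps)
    thus ?thesis using s p by (simp add: kpos_def scaleR_add_right field_simps)
  qed
  moreover have "0 \<le> ?u" "?u \<le> 1" using s assms(3,4) p by (simp_all add: less_imp_le)
  ultimately have "kpos ?Z \<in> closed_segment (kpos X) (kpos Y)" by (auto simp: in_segment)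
  thus ?thesis using hdist_between_iff[of "kpos X" "kpos Y" "kpos ?Z"] assms Z
    by (simp add: hyd_def norm_kpos)
qed

lemma mk_reverse_CS_strict:
  assumes "X \<in> future" "Y \<in> future" "\<And>a. 0 < a \<Longrightarrow> Y \<noteq> a *\<^sub>R X"
  shows "mk X X * mk Y Y < (mk X Y)\<^sup>2"
proof -
  have p: "0 < mk X X" "0 < mk X Y" using assms mk_future_causal_pos[of X Y] by (auto simp: future_def)
  define Z where "Z = mk X X *\<^sub>R Y - mk X Y *\<^sub>R X"
  have "mk Z X = 0" by (simp add: Z_def mk_linear mk_commute[of Y X])
  moreover have "Z \<noteq> 0"
  proof
    assume "Z = 0"
    hence "(1 / mk X X) *\<^sub>R (mk X X *\<^sub>R Y) = (1 / mk X X) *\<^sub>R (mk X Y *\<^sub>R X)"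
      by (simp add: Z_def)
    hence "Y = (mk X Y / mk X X) *\<^sub>R X" using p by simp
    thus False using assms(3)[of "mk X Y / mk X X"] p by simp
  qed
  ultimately have "mk Z Z < 0" using mk_orthogonal_timelike[OF p(1)] by (meson linorder_not_less)
  also have "mk Z Z = mk X X * (mk X X * mk Y Y - (mk X Y)\<^sup>2)"
    by (simp add: Z_def mk_linear mk_commute[of Y X] algebra_simps power2_eq_square)
  finally show ?thesis using p by (simp add: mult_less_0_iff)
qed

subsection \<open>Polyhedral surfaces\<close>

type_synonym mink = "(real^3) \<times> real"

text \<open>The convex wedge along the plane of \<open>A\<close> and \<open>B\<close>, whose two
  sides point towards \<open>Y\<close> and \<open>Z\<close>; \<alpha> and \<beta> have any sign. If
  \<open>A\<close>, \<open>B\<close> are the ends of an edge and \<open>Y\<close>, \<open>Z\<close>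
  lie in the adjacent faces, this is convexity at the edge. For a doubled polygon the wedge
  degenerates to a half space of the hyperplane.\<close>

definition in_wedge :: "mink \<Rightarrow> mink \<Rightarrow> mink \<Rightarrow> mink \<Rightarrow> mink \<Rightarrow> bool" where
  "in_wedge A B Y Z X \<longleftrightarrow>
     (\<exists>\<alpha> \<beta> s t. 0 \<le> s \<and> 0 \<le> t \<and> X = \<alpha> *\<^sub>R A + \<beta> *\<^sub>R B + s *\<^sub>R Y + t *\<^sub>R Z)"

text \<open>The positive combinations of two null vectors on the hyperboloid form the geodesic
  between the two ideal points. Its whole length is required because crossing points are moved along
  it.\<close>

definition covers_chord :: "'a set \<Rightarrow> ('a \<Rightarrow> mink) \<Rightarrow> real^3 \<Rightarrow> real^3 \<Rightarrow> bool" where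
  "covers_chord S L a b \<longleftrightarrow> (\<forall>\<alpha> \<beta>. 0 < \<alpha> \<longrightarrow> 0 < \<beta> \<longrightarrow> \<alpha> *\<^sub>R hv a + \<beta> *\<^sub>R hv b \<in> hyp \<longrightarrow>
     (\<exists>x\<in>S. L x = \<alpha> *\<^sub>R hv a + \<beta> *\<^sub>R hv b))"

text \<open>The initial piece from \<open>x0\<close> to \<open>x\<close> in \<open>face_geodesic\<close> excludes mirror images: in a double, the
  mirror image of an inner point of a chord lies between the ends of the chord as well. A vector
  \<open>\<nu> \<noteq> 0\<close> orthogonal to all \<open>hv v\<close> exists exactly if the vertices lie on one circle.\<close>

locale ideal_surface = Metric_space M d for M :: "'a set" and d +
  fixes V :: "(real^3) set" and I :: "'i set" and W :: "'i \<Rightarrow> (real^3) set"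
    and fc :: "'i \<Rightarrow> 'a set" and L :: "'a \<Rightarrow> mink"
  assumes finite_V: "finite V" and V_sphere: "V \<subseteq> sphere 0 1"
    and finite_I: "finite I" and W_sub: "i \<in> I \<Longrightarrow> W i \<subseteq> V"
    and W_two: "i \<in> I \<Longrightarrow> \<exists>v\<in>W i. \<exists>w\<in>W i. v \<noteq> w"
    and cover: "M = (\<Union>i\<in>I. fc i)"
    and L_face: "i \<in> I \<Longrightarrow> bij_betw L (fc i) (hyp \<inter> cone_on (W i))"
    and L_le: "x \<in> M \<Longrightarrow> y \<in> M \<Longrightarrow> mk (L x) (L y) \<le> cosh (d x y)"
    and L_eq: "i \<in> I \<Longrightarrow> x \<in> fc i \<Longrightarrow> y \<in> fc i \<Longrightarrow> mk (L x) (L y) = cosh (d x y)"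
    and face_geodesic: "i \<in> I \<Longrightarrow> x0 \<in> fc i \<Longrightarrow> x \<in> fc i \<Longrightarrow> z \<in> fc i \<Longrightarrow> y \<in> M \<Longrightarrow> x0 \<noteq> x \<Longrightarrow>
        d x0 x + d x y + d y z = d x0 z \<Longrightarrow> y \<in> fc i"
    and face_closed: "i \<in> I \<Longrightarrow> x \<in> M \<Longrightarrow> x \<notin> fc i \<Longrightarrow> \<exists>e>0. \<forall>y\<in>fc i. e \<le> d x y"
    and edge: "i \<in> I \<Longrightarrow> j \<in> I \<Longrightarrow> i \<noteq> j \<Longrightarrow> x \<in> fc i \<Longrightarrow> x \<in> fc j \<Longrightarrow>
        \<exists>a b. a \<in> W i \<inter> W j \<and> b \<in> W i \<inter> W j \<and> a \<noteq> b \<and>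
          (\<exists>\<alpha> \<beta>. 0 < \<alpha> \<and> 0 < \<beta> \<and> L x = \<alpha> *\<^sub>R hv a + \<beta> *\<^sub>R hv b) \<and>
          covers_chord (fc i \<inter> fc j) L a b \<and>
          (\<forall>v\<in>V. \<forall>y\<in>fc i - fc j. \<forall>z\<in>fc j - fc i. in_wedge (hv a) (hv b) (L y) (L z) (hv v))"
    and normal: "i \<in> I \<Longrightarrow> \<exists>\<nu>. \<nu> \<noteq> 0 \<and> (\<forall>v\<in>V. 0 \<le> mk \<nu> (hv v) \<and> (mk \<nu> (hv v) = 0 \<longleftrightarrow> v \<in> W i))"
    and support: "\<nu> \<noteq> 0 \<Longrightarrow> (\<forall>v\<in>V. 0 \<le> mk \<nu> (hv v)) \<Longrightarrow> \<exists>i\<in>I. {v\<in>V. mk \<nu> (hv v) = 0} \<subseteq> W i"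
    and fibre: "finite {x\<in>M. L x = X}" "card {x\<in>M. L x = X} \<le> 2"
    and not_inj: "x \<in> M \<Longrightarrow> y \<in> M \<Longrightarrow> L x = L y \<Longrightarrow> x \<noteq> y \<Longrightarrow> \<exists>\<nu>. \<nu> \<noteq> 0 \<and> (\<forall>v\<in>V. mk \<nu> (hv v) = 0)"
    and planar: "\<nu> \<noteq> 0 \<Longrightarrow> (\<forall>v\<in>V. mk \<nu> (hv v) = 0) \<Longrightarrow> i \<in> I \<Longrightarrow> W i = V"
      "\<nu> \<noteq> 0 \<Longrightarrow> (\<forall>v\<in>V. mk \<nu> (hv v) = 0) \<Longrightarrow> i \<in> I \<Longrightarrow> j \<in> I \<Longrightarrow> v \<in> V \<Longrightarrow>
        \<exists>b\<in>V. b \<noteq> v \<and> covers_chord (fc i \<inter> fc j) L v b"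
begin

lemma finite_W: "i \<in> I \<Longrightarrow> finite (W i)"
  using W_sub finite_V finite_subset by blast

lemma W_sphere: "i \<in> I \<Longrightarrow> W i \<subseteq> sphere 0 1"
  using W_sub V_sphere by blast

lemma norm_V: "v \<in> V \<Longrightarrow> norm v = 1"
  using V_sphere by auto

lemma fc_M: "i \<in> I \<Longrightarrow> x \<in> fc i \<Longrightarrow> x \<in> M"
  using cover by blast

lemma L_hyp: "x \<in> M \<Longrightarrow> L x \<in> hyp"
  using cover L_face by (auto simp: bij_betw_def)

lemma L_cone: "i \<in> I \<Longrightarrow> x \<in> fc i \<Longrightarrow> L x \<in> cone_on (W i)"
  using L_face by (auto simp: bij_betw_def)

lemma L_future: "x \<in> M \<Longrightarrow> L x \<in> future"
  using L_hyp hyp_imp_future by blast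

definition fcone :: "'i \<Rightarrow> (mink) set" where
  "fcone i = future \<inter> cone_on (W i)"

text \<open>The inverse of \<open>L\<close> on face \<open>i\<close>, extended to the cone over the
  face so as to be constant along rays.\<close>

definition sec :: "'i \<Rightarrow> mink \<Rightarrow> 'a" where
  "sec i T = the_inv_into (fc i) L (unitv T)"

lemma fcone_future: "T \<in> fcone i \<Longrightarrow> T \<in> future"
  by (simp add: fcone_def)

lemma fcone_scale: "T \<in> fcone i \<Longrightarrow> 0 < a \<Longrightarrow> a *\<^sub>R T \<in> fcone i"
  by (simp add: fcone_def future_scale cone_on_scale)

lemma fcone_add_cone:
  assumes "i \<in> I" "T \<in> fcone i" "A \<in> cone_on (W i)" shows "T + A \<in> fcone i" "A + T \<in> fcone i"
proof -
  have "T + A \<in> future"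
  proof (cases "A = 0")
    case False
    hence "0 < snd A" "0 \<le> mk A A"
      using cone_on_causal[OF finite_W[OF assms(1)] W_sphere[OF assms(1)] assms(3)] by force+
    thus ?thesis using assms by (intro future_add) (auto simp: fcone_def)
  qed (use assms in \<open>simp add: fcone_def\<close>)
  thus "T + A \<in> fcone i" using assms by (simp add: fcone_def cone_on_add)
  thus "A + T \<in> fcone i" by (simp add: add.commute)
qed

lemma fcone_comb:
  assumes "i \<in> I" "T \<in> fcone i" "T' \<in> fcone i" "0 \<le> a" "0 \<le> b" "0 < a + b"
  shows "a *\<^sub>R T + b *\<^sub>R T' \<in> fcone i"
proof (cases "a = 0")
  case True
  thus ?thesis using assms fcone_scale by simp
next
  case False
  thus ?thesis using assms fcone_scale[of T i a]
    by (intro fcone_add_cone) (auto simp: fcone_def intro: cone_on_scale)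
qed

lemma sec_props:
  assumes "i \<in> I" "T \<in> fcone i" shows "sec i T \<in> fc i" "L (sec i T) = unitv T" "sec i T \<in> M"
proof -
  have "unitv T \<in> hyp \<inter> cone_on (W i)" using assms unitv_hyp[of T]
    by (auto simp: fcone_def unitv_def future_def intro!: cone_on_scale)
  hence u: "unitv T \<in> L ` fc i" using L_face[OF assms(1)] by (simp add: bij_betw_def)
  moreover have inj: "inj_on L (fc i)" using L_face[OF assms(1)] by (simp add: bij_betw_def)
  ultimately show "sec i T \<in> fc i" "L (sec i T) = unitv T"
    unfolding sec_def by (auto intro: the_inv_into_into f_the_inv_into_f)
  thus "sec i T \<in> M" using fc_M assms by blast
qed

lemma sec_scale: "0 < a \<Longrightarrow> sec i (a *\<^sub>R T) = sec i T"
  by (simp add: sec_def unitv_scale)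

lemma sec_L: assumes "i \<in> I" "x \<in> fc i" shows "L x \<in> fcone i" "sec i (L x) = x"
proof -
  have h: "L x \<in> hyp" using L_hyp fc_M assms by blast
  show "L x \<in> fcone i" using h hyp_imp_future L_cone assms by (simp add: fcone_def)
  show "sec i (L x) = x" using assms L_face[of i] unfolding sec_def unitv_of_hyp[OF h]
    by (simp add: bij_betw_def the_inv_into_f_f)
qed

lemma sec_eqI: "i \<in> I \<Longrightarrow> T \<in> fcone i \<Longrightarrow> x \<in> fc i \<Longrightarrow> L x = unitv T \<Longrightarrow> sec i T = x"
  using L_face[of i] the_inv_into_f_f[of L "fc i" x] by (auto simp: sec_def bij_betw_def)

lemma cosh_d_sec:
  assumes "i \<in> I" "T \<in> fcone i" "T' \<in> fcone i"
  shows "cosh (d (sec i T) (sec i T')) = mk (unitv T) (unitv T')"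
  using L_eq[OF assms(1) sec_props(1) sec_props(1)] sec_props(2) assms by metis

lemma d_sec:
  assumes "i \<in> I" "T \<in> fcone i" "T' \<in> fcone i"
  shows "d (sec i T) (sec i T') = hyd T T'"
proof (rule cosh_eq_real_nonneg)
  have f: "T \<in> future" "T' \<in> future" using assms by (auto simp: fcone_def)
  show "0 \<le> hyd T T'" using f by (rule hyd_nonneg)
  show "cosh (d (sec i T) (sec i T')) = cosh (hyd T T')"
    by (simp only: cosh_d_sec[OF assms] cosh_hyd[OF f])
qed simp

lemma d_sec_between:
  assumes "i \<in> I" "X \<in> fcone i" "Y \<in> fcone i" "0 < a" "0 < b" "Z = a *\<^sub>R X + b *\<^sub>R Y"
  shows "d (sec i X) (sec i Z) + d (sec i Z) (sec i Y) = d (sec i X) (sec i Y)"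
proof -
  have "Z \<in> fcone i" using fcone_comb assms by simp
  thus ?thesis using hyd_between[of X Y a b] assms by (simp add: d_sec fcone_future)
qed

lemma sec_eq_imp:
  assumes "i \<in> I" "X \<in> fcone i" "Y \<in> fcone i" "sec i X = sec i Y"
  shows "\<exists>a>0. Y = a *\<^sub>R X"
proof -
  have u: "unitv X = unitv Y" using sec_props(2) assms by metis
  have p: "0 < mk X X" "0 < mk Y Y" using assms by (auto simp: fcone_def future_def)
  have "Y = sqrt (mk Y Y) *\<^sub>R unitv X" using scale_unitv[of Y] assms u by (simp add: fcone_def)
  hence "Y = (sqrt (mk Y Y) / sqrt (mk X X)) *\<^sub>R X" by (simp add: unitv_def)
  thus ?thesis using p by (intro exI[of _ "sqrt (mk Y Y) / sqrt (mk X X)"]) simp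
qed

end

text \<open>First variation along the edge: \<open>E\<close> is the velocity at \<open>X\<close> of
  the geodesic with ends \<open>a\<close> and \<open>b\<close>, and each summand is the derivative
  of one distance, with its hyperbolic sine in the denominator.\<close>

lemma edge_stationary:
  fixes Y Z X E :: "'a::euclidean_space \<times> real"
  assumes a: "norm a = 1" "norm b = 1" "0 < \<alpha>" "0 < \<beta>"
    and X: "X = \<alpha> *\<^sub>R hv a + \<beta> *\<^sub>R hv b" "X \<in> hyp"
    and Y: "1 < mk Y X" and Z: "1 < mk Z X"
    and min: "\<And>X' \<alpha>' \<beta>'. 0 < \<alpha>' \<Longrightarrow> 0 < \<beta>' \<Longrightarrow> X' = \<alpha>' *\<^sub>R hv a + \<beta>' *\<^sub>R hv b \<Longrightarrow> X' \<in> hyp \<Longrightarrow>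
       arcosh (mk Y X) + arcosh (mk Z X) \<le> arcosh (mk Y X') + arcosh (mk Z X')"
    and E: "E = \<alpha> *\<^sub>R hv a - \<beta> *\<^sub>R hv b"
  shows "mk Y E / sqrt ((mk Y X)\<^sup>2 - 1) + mk Z E / sqrt ((mk Z X)\<^sup>2 - 1) = 0"
proof -
  \<comment> \<open>Scaling the null ends by \<open>exp r\<close> and \<open>exp (-r)\<close> keeps
    the product of the coefficients, so the curve stays on the hyperboloid and runs along the
    geodesic.\<close>
  define c where "c r = (\<alpha> * exp r) *\<^sub>R hv a + (\<beta> * exp (-r)) *\<^sub>R hv b" for r
  define f where "f r = arcosh (mk Y (c r)) + arcosh (mk Z (c r))" for r
  have c0: "c 0 = X" by (simp add: c_def X)
  have "mk (c r) (c r) = mk X X" for r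
    using a by (simp add: c_def X(1) mk_linear mk_hv_self_sphere exp_minus mk_commute[of "hv b" "hv a"])
  hence ch: "c r \<in> hyp" for r
    using X(2) a by (simp add: hyp_def) (simp add: c_def add_pos_pos)
  have min': "f 0 \<le> f r" for r
    unfolding f_def c0 by (rule min[of "\<alpha> * exp r" "\<beta> * exp (-r)"]) (use a ch in \<open>auto simp: c_def\<close>)
  have dY: "((\<lambda>r. mk U (c r)) has_field_derivative mk U E) (at 0)" for U
    unfolding c_def mk_linear E by (auto intro!: derivative_eq_intros)
  have "((\<lambda>r. arcosh (mk U (c r))) has_field_derivative (1 / sqrt ((mk U X)\<^sup>2 - 1) * mk U E)) (at 0)"
    if "1 < mk U X" for U
    using DERIV_chain2[OF arcosh_real_has_field_derivative dY, of U] that c0 by simp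
  from DERIV_add[OF this[OF Y] this[OF Z]]
  have "(f has_field_derivative (mk Y E / sqrt ((mk Y X)\<^sup>2 - 1) + mk Z E / sqrt ((mk Z X)\<^sup>2 - 1))) (at 0)"
    unfolding f_def by simp
  thus ?thesis using DERIV_local_min[of f _ 0 1] min' by auto
qed

lemma pigeonhole_nat:
  assumes "finite J" "\<And>n::nat. \<exists>j\<in>J. P n j"
  shows "\<exists>j\<in>J. \<forall>m. \<exists>n>m. P n j"
proof (rule ccontr)
  assume "\<not> ?thesis"
  then obtain b where b: "\<And>j n. j \<in> J \<Longrightarrow> n > b j \<Longrightarrow> \<not> P n j" by metis
  obtain j where j: "j \<in> J" "P (Suc (\<Sum>j\<in>J. b j)) j" using assms(2) by blast
  have "b j \<le> (\<Sum>j\<in>J. b j)" using assms(1) j(1) by (simp add: member_le_sum)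
  thus False using b[OF j(1)] j(2) by auto
qed

section \<open>The development of one surface over the faces of another\<close>

locale two_surfaces = P: ideal_surface M d V I W fc L + Q: ideal_surface M d V' I' W' fc' L'
  for M :: "'a set" and d and V :: "(real^3) set" and I :: "'i set" and W fc L
    and V' :: "(real^3) set" and I' :: "'j set" and W' fc' L'
begin

text \<open>The factor makes \<open>dev\<close> homogeneous of degree 1, so that concavity of its
  pairings can be stated as superadditivity.\<close>

definition dev :: "'i \<Rightarrow> mink \<Rightarrow> mink" where
  "dev i T = sqrt (mk T T) *\<^sub>R L' (P.sec i T)"

lemma mk_sqrt_unitv:
  assumes "T \<in> future" "T' \<in> future"
  shows "sqrt (mk T T) * (sqrt (mk T' T') * mk (unitv T) (unitv T')) = mk T T'"
  using scale_unitv[OF assms(1)] scale_unitv[OF assms(2)] by (metis mk_scale_left mk_scale_right)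

lemma dev_scale: "0 < a \<Longrightarrow> dev i (a *\<^sub>R T) = a *\<^sub>R dev i T"
  by (simp add: dev_def mk_linear P.sec_scale real_sqrt_mult)

lemma dev_future: assumes "i \<in> I" "T \<in> P.fcone i" shows "dev i T \<in> future"
  unfolding dev_def using assms P.sec_props[of i T] Q.L_future[of "P.sec i T"]
  by (intro future_scale) (auto simp: P.fcone_def future_def)

lemma mk_dev_self: assumes "i \<in> I" "T \<in> P.fcone i" shows "mk (dev i T) (dev i T) = mk T T"
  using Q.L_hyp[OF P.sec_props(3)[OF assms]] assms
  by (simp add: dev_def mk_linear hyp_def P.fcone_def future_def)

text \<open>Within a face of the first polyhedron \<open>d\<close> is the exact distance, while for
  the second structure it is only an upper bound.\<close>

lemma mk_dev_le:
  assumes "i \<in> I" "T \<in> P.fcone i" "T' \<in> P.fcone i" shows "mk (dev i T) (dev i T') \<le> mk T T'"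
proof -
  have f: "T \<in> future" "T' \<in> future" using assms P.fcone_future by auto
  have "mk (L' (P.sec i T)) (L' (P.sec i T')) \<le> mk (unitv T) (unitv T')"
    using Q.L_le[OF P.sec_props(3) P.sec_props(3)] P.cosh_d_sec assms by metis
  hence "sqrt (mk T T) * (sqrt (mk T' T') * mk (L' (P.sec i T)) (L' (P.sec i T'))) \<le> mk T T'"
    using f unfolding mk_sqrt_unitv[OF f, symmetric]
    by (intro mult_left_mono) (auto simp: future_def)
  thus ?thesis by (simp add: dev_def mk_linear mult.left_commute)
qed

lemma mk_dev_eq:
  assumes "i \<in> I" "T \<in> P.fcone i" "T' \<in> P.fcone i" "j \<in> I'" "P.sec i T \<in> fc' j" "P.sec i T' \<in> fc' j"
  shows "mk (dev i T) (dev i T') = mk T T'"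
proof -
  have f: "T \<in> future" "T' \<in> future" using assms P.fcone_future by auto
  have "mk (L' (P.sec i T)) (L' (P.sec i T')) = mk (unitv T) (unitv T')"
    using Q.L_eq[OF assms(4-6)] P.cosh_d_sec[OF assms(1-3)] by simp
  thus ?thesis using mk_sqrt_unitv[OF f] by (simp add: dev_def mk_linear mult.left_commute)
qed

text \<open>The three points lie in a common face of each polyhedron, so all their \<open>mk\<close>
  values are preserved and \<open>timelike_eqI\<close> identifies the vectors. The signs of
  \<open>a\<close> and \<open>b\<close> are arbitrary, which allows extrapolation.\<close>

lemma dev_comb:
  assumes i: "i \<in> I" "X \<in> P.fcone i" "Y \<in> P.fcone i" "Z \<in> P.fcone i" "Z = a *\<^sub>R X + b *\<^sub>R Y"
    and j: "j \<in> I'" "P.sec i X \<in> fc' j" "P.sec i Y \<in> fc' j" "P.sec i Z \<in> fc' j"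
  shows "dev i Z = a *\<^sub>R dev i X + b *\<^sub>R dev i Y"
proof (rule timelike_eqI)
  note e = mk_dev_eq[OF i(1) _ _ j(1)]
  show "0 < mk (dev i Z) (dev i Z)" using dev_future[OF i(1,4)] by (simp add: future_def)
  show "mk (a *\<^sub>R dev i X + b *\<^sub>R dev i Y) (a *\<^sub>R dev i X + b *\<^sub>R dev i Y) = mk (dev i Z) (dev i Z)"
    using i j by (simp add: mk_linear e)
  have "mk (dev i Z) (a *\<^sub>R dev i X + b *\<^sub>R dev i Y) = mk Z (a *\<^sub>R X + b *\<^sub>R Y)"
    using i(2-4) j by (simp add: mk_add_right mk_scale_right e)
  thus "mk (dev i Z) (a *\<^sub>R dev i X + b *\<^sub>R dev i Y) = mk (dev i Z) (dev i Z)"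
    using i j e by simp
qed

text \<open>Of the points with parameter \<open>1 / Suc n\<close>, infinitely many lie in one face
  \<open>j\<close>, and face geodesics fill the gaps between them. Since \<open>A\<close> may be
  null, no point of \<open>M\<close> need correspond to the parameter 0.\<close>

lemma face_germ:
  assumes i: "i \<in> I" and A: "A \<in> cone_on (W i)" and B: "B \<in> P.fcone i"
  shows "\<exists>j\<in>I'. \<exists>\<delta>>0. \<forall>s. 0 < s \<longrightarrow> s \<le> \<delta> \<longrightarrow> P.sec i (A + s *\<^sub>R B) \<in> fc' j"
\<comment> \<open>If \<open>A\<close> is a multiple of \<open>B\<close>, then the ray gives a single
  point of \<open>M\<close>; otherwise different parameters give different points, as
  \<open>face_geodesic\<close> requires of its initial piece.\<close>
proof (cases "\<exists>a\<ge>0. A = a *\<^sub>R B")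
  case True
  then obtain a where a: "0 \<le> a" "A = a *\<^sub>R B" by blast
  obtain j where j: "j \<in> I'" "P.sec i B \<in> fc' j" using P.sec_props(3)[OF i B] Q.cover by blast
  have "P.sec i (A + s *\<^sub>R B) = P.sec i B" if "0 < s" for s
    using a that P.sec_scale[of "a + s" i B] by (simp add: scaleR_add_left)
  thus ?thesis using j by (intro bexI[of _ j] exI[of _ 1]) auto
next
  case False
  define c where "c s = A + s *\<^sub>R B" for s
  have cf: "c s \<in> P.fcone i" if "0 < s" for s
    unfolding c_def using P.fcone_add_cone(2)[OF i P.fcone_scale[OF B that] A] .
  have neq: "P.sec i (c s) \<noteq> P.sec i (c s')" if "0 < s" "0 < s'" "s \<noteq> s'" for s s'
  proof
    assume "P.sec i (c s) = P.sec i (c s')"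
    from P.sec_eq_imp[OF i cf[OF that(1)] cf[OF that(2)] this]
    obtain a where a: "0 < a" "c s' = a *\<^sub>R c s" by blast
    have sB: "0 < snd B" using B by (auto simp: P.fcone_def future_def)
    have e: "(1 - a) *\<^sub>R A = (a * s - s') *\<^sub>R B" using a(2) by (simp add: c_def algebra_simps)
    show False
    proof (cases "a = 1")
      case True
      hence "(s - s') *\<^sub>R B = 0" using e by simp
      thus False using sB that by auto
    next
      case False
      hence eq: "A = ((a * s - s') / (1 - a)) *\<^sub>R B"
        using arg_cong[OF e, of "scaleR (1 / (1 - a))"] by simp
      have "0 \<le> snd A" using cone_on_causal(2)[OF P.finite_W[OF i] P.W_sphere[OF i] A] .
      hence "0 \<le> (a * s - s') / (1 - a)" using sB arg_cong[OF eq, of snd]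
        by (metis mult.commute real_scaleR_def snd_scaleR zero_le_mult_iff linorder_not_less less_imp_le mult_less_0_iff)
      thus False using eq \<open>\<nexists>a. 0 \<le> a \<and> A = a *\<^sub>R B\<close> by blast
    qed
  qed
  have btw: "d (P.sec i (c s1)) (P.sec i (c s2)) + d (P.sec i (c s2)) (P.sec i (c s3))
      = d (P.sec i (c s1)) (P.sec i (c s3))" if "0 < s3" "s3 < s2" "s2 < s1" for s1 s2 s3
  proof (rule P.d_sec_between[OF i])
    show "c s1 \<in> P.fcone i" "c s3 \<in> P.fcone i" using that by (auto intro: cf)
    show "0 < (s2 - s3) / (s1 - s3)" "0 < (s1 - s2) / (s1 - s3)" using that by auto
    have e: "(s2 - s3) / (s1 - s3) + (s1 - s2) / (s1 - s3) = 1"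
      "(s2 - s3) / (s1 - s3) * s1 + (s1 - s2) / (s1 - s3) * s3 = s2"
      using that by (simp_all add: divide_simps) (simp_all add: algebra_simps)
    have "((s2 - s3) / (s1 - s3)) *\<^sub>R c s1 + ((s1 - s2) / (s1 - s3)) *\<^sub>R c s3
      = ((s2 - s3) / (s1 - s3) + (s1 - s2) / (s1 - s3)) *\<^sub>R A + ((s2 - s3) / (s1 - s3) * s1 + (s1 - s2) / (s1 - s3) * s3) *\<^sub>R B"
      by (simp add: c_def scaleR_add_right scaleR_add_left)
    thus "c s2 = ((s2 - s3) / (s1 - s3)) *\<^sub>R c s1 + ((s1 - s2) / (s1 - s3)) *\<^sub>R c s3"
      unfolding e by (simp add: c_def)
  qed
  have "\<exists>j\<in>I'. P.sec i (c (1 / real (Suc n))) \<in> fc' j" for n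
    using P.sec_props(3)[OF i cf, of "1 / real (Suc n)"] Q.cover by auto
  from pigeonhole_nat[OF Q.finite_I, of "\<lambda>n j. P.sec i (c (1 / real (Suc n))) \<in> fc' j", OF this] obtain j where j: "j \<in> I'"
    "\<And>m. \<exists>n>m. P.sec i (c (1 / real (Suc n))) \<in> fc' j" by blast
  obtain n1 where n1: "P.sec i (c (1 / real (Suc n1))) \<in> fc' j" using j(2) by blast
  obtain n2 where n2: "n2 > n1" "P.sec i (c (1 / real (Suc n2))) \<in> fc' j" using j(2) by blast
  \<comment> \<open>Two sample points before \<open>s\<close> serve as the initial piece and a third
    one beyond \<open>s\<close>, closer to 0, as the end.\<close>
  have "P.sec i (c s) \<in> fc' j" if s: "0 < s" "s \<le> 1 / real (Suc n2)" for s
  proof (cases "s = 1 / real (Suc n2)")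
    case False
    obtain m where m: "1 / real (Suc m) < s" using s(1) by (metis nat_approx_posE)
    obtain n3 where n3: "n3 > m" "P.sec i (c (1 / real (Suc n3))) \<in> fc' j" using j(2) by blast
    have l: "1 / real (Suc n2) < 1 / real (Suc n1)" using n2(1) by (simp add: divide_simps)
    have l3: "1 / real (Suc n3) < s" using n3(1) m by (smt (verit) frac_less2 of_nat_less_iff of_nat_0_less_iff zero_less_Suc Suc_less_eq)
    show ?thesis
    proof (rule Q.face_geodesic[OF j(1) n1 n2(2) n3(2)])
      show "P.sec i (c s) \<in> M" using P.sec_props(3)[OF i cf] s by blast
      show "P.sec i (c (1 / real (Suc n1))) \<noteq> P.sec i (c (1 / real (Suc n2)))" using l by (intro neq) auto
      show "d (P.sec i (c (1 / real (Suc n1)))) (P.sec i (c (1 / real (Suc n2)))) +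
        d (P.sec i (c (1 / real (Suc n2)))) (P.sec i (c s)) + d (P.sec i (c s)) (P.sec i (c (1 / real (Suc n3)))) =
        d (P.sec i (c (1 / real (Suc n1)))) (P.sec i (c (1 / real (Suc n3))))"
        using btw[of s "1 / real (Suc n2)" "1 / real (Suc n1)"]
          btw[of "1 / real (Suc n3)" s "1 / real (Suc n1)"] s False l l3 by simp
    qed
  qed (use n2 in simp)
  thus ?thesis using j(1) unfolding c_def
    by (intro bexI[of _ j] exI[of _ "1 / real (Suc n2)"]) auto
qed

text \<open>A timelike \<open>A\<close> does give a point of \<open>M\<close>, and it belongs to the
  same face: the points of the ray tend to it, while a point outside a face has a positive distance
  from the face.\<close>

lemma face_germ0:
  assumes i: "i \<in> I" and A: "A \<in> P.fcone i" and B: "B \<in> P.fcone i"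
  shows "\<exists>j\<in>I'. \<exists>\<delta>>0. \<forall>s. 0 \<le> s \<longrightarrow> s \<le> \<delta> \<longrightarrow> P.sec i (A + s *\<^sub>R B) \<in> fc' j"
proof -
  have Ac: "A \<in> cone_on (W i)" using A by (simp add: P.fcone_def)
  obtain j \<delta> where j: "j \<in> I'" "\<delta> > 0" "\<And>s. 0 < s \<Longrightarrow> s \<le> \<delta> \<Longrightarrow> P.sec i (A + s *\<^sub>R B) \<in> fc' j"
    using face_germ[OF i Ac B] by blast
  have "P.sec i A \<in> fc' j"
  proof (rule ccontr)
    assume "P.sec i A \<notin> fc' j"
    then obtain e where e: "e > 0" "\<And>y. y \<in> fc' j \<Longrightarrow> e \<le> d (P.sec i A) y"
      using Q.face_closed[OF j(1) P.sec_props(3)[OF i A]] by blast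
    have Af: "A \<in> future" using A P.fcone_future by blast
    have m: "mk A A > 0" using Af by (simp add: future_def)
    have "((\<lambda>s. mk (unitv A) (unitv (A + s *\<^sub>R B))) \<longlongrightarrow> mk (unitv A) (unitv (A + 0 *\<^sub>R B))) (at_right 0)"
      unfolding unitv_def by (intro tendsto_intros) (use m in auto)
    moreover have "mk (unitv A) (unitv (A + 0 *\<^sub>R B)) < cosh e"
      using unitv_hyp[OF Af] e(1) cosh_real_nonneg_less_iff[of 0 e] by (simp add: hyp_def)
    ultimately have "\<forall>\<^sub>F s in at_right 0. mk (unitv A) (unitv (A + s *\<^sub>R B)) < cosh e"
      by (rule order_tendstoD(2))
    moreover have "\<forall>\<^sub>F s in at_right 0. s < \<delta>" "\<forall>\<^sub>F s in at_right (0::real). 0 < s"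
      using j(2) by (auto simp: eventually_at_right_less intro: eventually_at_right_real[THEN eventually_mono])
    ultimately have "\<forall>\<^sub>F s in at_right 0. mk (unitv A) (unitv (A + s *\<^sub>R B)) < cosh e \<and> s < \<delta> \<and> 0 < s"
      by eventually_elim simp
    then obtain s where s: "mk (unitv A) (unitv (A + s *\<^sub>R B)) < cosh e" "s < \<delta>" "0 < s"
      using eventually_happens[of _ "at_right (0::real)"] by auto
    have f: "A + s *\<^sub>R B \<in> P.fcone i"
      using P.fcone_comb[OF i A B, of 1 s] s by simp
    have "e \<le> d (P.sec i A) (P.sec i (A + s *\<^sub>R B))" using e j(3) s by simp
    hence "cosh e \<le> cosh (d (P.sec i A) (P.sec i (A + s *\<^sub>R B)))"
      using e(1) by (simp add: cosh_real_nonneg_le_iff)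
    thus False using s(1) P.cosh_d_sec[OF i A f] by simp
  qed
  hence "P.sec i (A + s *\<^sub>R B) \<in> fc' j" if "0 \<le> s" "s \<le> \<delta>" for s
    using j(3)[of s] that by (cases "s = 0") auto
  thus ?thesis using j by blast
qed

end

text \<open>With \<open>m / (sqrt u * sqrt x)\<close> as hyperbolic cosine of a distance, the left
  side is its hyperbolic sine. In \<open>dev_kink\<close> the number \<open>G\<close> is common to
  both sides of the crossing point, so the sines differ only by elementary factors.\<close>

lemma sqrt_ratio:
  fixes m u x G b :: real
  assumes "0 < u" "0 < x" "0 < b" "m\<^sup>2 - u * x = b\<^sup>2 * G"
  shows "sqrt ((m / (sqrt u * sqrt x))\<^sup>2 - 1) = b * sqrt G / (sqrt u * sqrt x)"
proof -
  have "(m / (sqrt u * sqrt x))\<^sup>2 - 1 = (m\<^sup>2 - u * x) / (u * x)"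
    using assms by (simp add: power_divide power_mult_distrib divide_simps)
  thus ?thesis using assms by (simp add: real_sqrt_divide real_sqrt_mult)
qed

context two_surfaces
begin

text \<open>The crossing point minimises the sum of the distances along the edge, so the bend of the image
  is orthogonal to the edge, and convexity determines its sign.\<close>

lemma dev_kink:
  assumes i: "i \<in> I" and Y: "Y \<in> P.fcone i" and Z: "Z \<in> P.fcone i" and X: "X \<in> P.fcone i"
    and XYZ: "X = \<alpha> *\<^sub>R Y + \<beta> *\<^sub>R Z" and ab: "0 < \<alpha>" "0 < \<beta>"
    and j: "j \<in> I'" "P.sec i Y \<in> fc' j" "P.sec i X \<in> fc' j"
    and k: "k \<in> I'" "P.sec i X \<in> fc' k" "P.sec i Z \<in> fc' k"
    and v: "v \<in> V'"
  shows "mk (\<alpha> *\<^sub>R dev i Y + \<beta> *\<^sub>R dev i Z) (hv v) \<le> mk (dev i X) (hv v)"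
proof (cases "P.sec i Y \<in> fc' k \<or> P.sec i Z \<in> fc' j")
  case True
  thus ?thesis using dev_comb[OF i Y Z X XYZ] j k by auto
next
  case False
  hence jk: "j \<noteq> k" using j k by auto
  let ?x = "P.sec i X" and ?y = "P.sec i Y" and ?z = "P.sec i Z"
  have yz: "?y \<in> fc' j - fc' k" "?z \<in> fc' k - fc' j" using False j k by auto
  have f: "X \<in> future" "Y \<in> future" "Z \<in> future" using X Y Z P.fcone_future by auto
  hence p: "0 < mk X X" "0 < mk Y Y" "0 < mk Z Z" by (auto simp: future_def)
  have xM: "?x \<in> M" "?y \<in> M" "?z \<in> M" using P.sec_props i X Y Z by auto
  obtain a b where e: "a \<in> W' j \<inter> W' k" "b \<in> W' j \<inter> W' k" "a \<noteq> b"
    and e1: "\<exists>\<alpha> \<beta>. 0 < \<alpha> \<and> 0 < \<beta> \<and> L' ?x = \<alpha> *\<^sub>R hv a + \<beta> *\<^sub>R hv b"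
    and e2: "covers_chord (fc' j \<inter> fc' k) L' a b"
    and e3: "\<forall>v\<in>V'. \<forall>y\<in>fc' j - fc' k. \<forall>z\<in>fc' k - fc' j. in_wedge (hv a) (hv b) (L' y) (L' z) (hv v)"
    using Q.edge[OF j(1) k(1) jk j(3) k(2)]
    by - (erule exE, erule exE, (erule conjE)+, rule that; assumption)
  obtain \<alpha>0 \<beta>0 where a0: "0 < \<alpha>0" "0 < \<beta>0" "L' ?x = \<alpha>0 *\<^sub>R hv a + \<beta>0 *\<^sub>R hv b"
    using e1 by - (elim exE conjE; rule that; assumption)
  note onto = e2[unfolded covers_chord_def, rule_format]
  note wedge = e3[rule_format, OF v yz, unfolded in_wedge_def]
  have nab: "norm a = 1" "norm b = 1" using e Q.W_sphere[OF j(1)] by auto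
  define E where "E = \<alpha>0 *\<^sub>R hv a - \<beta>0 *\<^sub>R hv b"
  have Lyx: "mk (L' ?y) (L' ?x) = mk (unitv Y) (unitv X)"
    using Q.L_eq[OF j] P.cosh_d_sec[OF i Y X] by simp
  have Lzx: "mk (L' ?z) (L' ?x) = mk (unitv Z) (unitv X)"
    using Q.L_eq[OF k(1,3,2)] P.cosh_d_sec[OF i Z X] by simp
  have uform: "mk (unitv U) (unitv X) = mk U X / (sqrt (mk U U) * sqrt (mk X X))" for U
    by (simp add: unitv_def mk_linear)
  \<comment> \<open>Minus the Gram determinant of \<open>Y\<close> and \<open>Z\<close>. It is
    positive: if \<open>X\<close> were proportional to \<open>Y\<close>, then \<open>?y\<close> and
    \<open>?x\<close> would coincide and \<open>?y\<close> would lie in face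
    \<open>k\<close>.\<close>
  define G where "G = (mk Y Z)\<^sup>2 - mk Y Y * mk Z Z"
  have GY: "(mk Y X)\<^sup>2 - mk Y Y * mk X X = \<beta>\<^sup>2 * G"
    by (simp add: G_def XYZ mk_linear mk_commute[of Z Y] algebra_simps power2_eq_square)
  have GZ: "(mk Z X)\<^sup>2 - mk Z Z * mk X X = \<alpha>\<^sup>2 * G"
    by (simp add: G_def XYZ mk_linear mk_commute[of Z Y] algebra_simps power2_eq_square)
  have npr: "X \<noteq> c *\<^sub>R Y" if "0 < c" for c
    using False k(2) P.sec_scale[OF that, of i Y] by auto
  have "0 < \<beta>\<^sup>2 * G" using mk_reverse_CS_strict[OF f(2,1)] npr GY by fastforce
  hence G: "0 < G" using ab by (simp add: zero_less_mult_iff)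
  have gt1: "1 < mk (unitv U) (unitv X)" if "U \<in> future" "mk U U * mk X X < (mk U X)\<^sup>2" for U
  proof -
    have q: "0 < mk U U" "0 < mk U X" using that f mk_future_causal_pos[of U X] by (auto simp: future_def)
    have "sqrt (mk U U) * sqrt (mk X X) < sqrt ((mk U X)\<^sup>2)"
      using that(2) by (simp only: real_sqrt_mult[symmetric] real_sqrt_less_iff)
    thus ?thesis unfolding uform using q p by (simp add: divide_simps)
  qed
  have gy: "1 < mk (L' ?y) (L' ?x)" unfolding Lyx
    by (rule gt1) (use f GY G ab in \<open>auto simp: algebra_simps intro!: diff_gt_0_iff_gt[THEN iffD1]\<close>)
  have gz: "1 < mk (L' ?z) (L' ?x)" unfolding Lzx
    by (rule gt1) (use f GZ G ab in \<open>auto simp: algebra_simps intro!: diff_gt_0_iff_gt[THEN iffD1]\<close>)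
  have arc: "arcosh (mk (L' u) (L' x')) = d u x'" if "m \<in> I'" "u \<in> fc' m" "x' \<in> fc' m" for m u x'
    using Q.L_eq[OF that] by (simp add: arcosh_cosh_real)
  have dd: "d ?y ?z = d ?y ?x + d ?x ?z" using P.d_sec_between[OF i Y Z ab XYZ] by simp
  \<comment> \<open>The path from \<open>?y\<close> to \<open>?z\<close> through \<open>?x\<close>
    is shortest, so no other crossing point of the edge gives a smaller sum of distances;
    \<open>covers_chord\<close> makes every point of the edge available as a crossing point.\<close>
  have "mk (L' ?y) E / sqrt ((mk (L' ?y) (L' ?x))\<^sup>2 - 1) + mk (L' ?z) E / sqrt ((mk (L' ?z) (L' ?x))\<^sup>2 - 1) = 0"
  proof (rule edge_stationary[OF nab a0 Q.L_hyp[OF xM(1)] gy gz _ E_def])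
    fix X' \<alpha>' \<beta>' assume X': "0 < \<alpha>'" "0 < \<beta>'" "X' = \<alpha>' *\<^sub>R hv a + \<beta>' *\<^sub>R hv b" "X' \<in> hyp"
    then obtain x' where x': "x' \<in> fc' j" "x' \<in> fc' k" "L' x' = X'" using onto by blast
    have "d ?y ?z \<le> d ?y x' + d x' ?z" using P.triangle xM Q.fc_M[OF j(1) x'(1)] by blast
    thus "arcosh (mk (L' ?y) (L' ?x)) + arcosh (mk (L' ?z) (L' ?x)) \<le> arcosh (mk (L' ?y) X') + arcosh (mk (L' ?z) X')"
      unfolding x'(3)[symmetric] arc[OF j] arc[OF k(1,3,2)] arc[OF j(1,2) x'(1)] arc[OF k(1,3) x'(2)]
      using dd P.commute by metis
  qed
  hence "mk (L' ?y) E / (\<beta> * sqrt G / (sqrt (mk Y Y) * sqrt (mk X X))) + mk (L' ?z) E / (\<alpha> * sqrt G / (sqrt (mk Z Z) * sqrt (mk X X))) = 0"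
    unfolding Lyx Lzx uform sqrt_ratio[OF p(2,1) ab(2) GY] sqrt_ratio[OF p(3,1) ab(1) GZ] .
  hence "(sqrt (mk X X) / sqrt G) * (\<alpha> * (sqrt (mk Y Y) * mk (L' ?y) E) + \<beta> * (sqrt (mk Z Z) * mk (L' ?z) E)) = 0"
    using ab G p by (simp add: field_simps)
  hence "\<alpha> * (sqrt (mk Y Y) * mk (L' ?y) E) + \<beta> * (sqrt (mk Z Z) * mk (L' ?z) E) = 0"
    using G p by simp
  hence AE: "\<alpha> * mk (dev i Y) E + \<beta> * mk (dev i Z) E = 0" by (simp add: dev_def mk_linear)
  define B where "B = dev i X"
  \<comment> \<open>The bend of the image at \<open>X\<close>. It is orthogonal to
    \<open>L' ?x\<close> and to \<open>E\<close>, hence to both ends of the edge, and its pairings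
    with the two adjacent faces are not positive; so neither are those with the wedge.\<close>
  define Wv where "Wv = \<alpha> *\<^sub>R dev i Y + \<beta> *\<^sub>R dev i Z - B"
  have "mk (L' ?x) E = 0" unfolding a0(3) E_def using nab
    by (simp add: mk_linear mk_hv_self_sphere mk_commute[of "hv b" "hv a"])
  hence WE: "mk Wv E = 0" using AE by (simp add: Wv_def B_def mk_linear dev_def[of i X])
  have "mk Wv B = \<alpha> * mk Y X + \<beta> * mk Z X - mk X X"
    using mk_dev_eq[OF i Y X j] mk_dev_eq[OF i Z X k(1,3,2)] mk_dev_self[OF i X]
    by (simp add: Wv_def B_def mk_linear)
  also have "\<dots> = 0" by (simp add: XYZ mk_linear algebra_simps)
  finally have WL: "mk Wv (L' ?x) = 0" using p by (simp add: B_def dev_def mk_linear)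
  have "mk Wv (hv a) = 0"
  proof -
    have "2 * \<alpha>0 * mk Wv (hv a) = mk Wv (L' ?x) + mk Wv E" by (simp add: a0(3) E_def mk_linear)
    thus ?thesis using WE WL a0 by simp
  qed
  moreover have "mk Wv (hv b) = 0"
  proof -
    have "2 * \<beta>0 * mk Wv (hv b) = mk Wv (L' ?x) - mk Wv E" by (simp add: a0(3) E_def mk_linear)
    thus ?thesis using WE WL a0 by simp
  qed
  \<comment> \<open>Only the pairing of \<open>dev i Y\<close> with \<open>dev i Z\<close> is not
    known exactly; \<open>mk_dev_le\<close> bounds it in the right direction.\<close>
  moreover have "mk Wv (L' ?y) \<le> 0"
  proof -
    have "mk Wv (dev i Y) = \<alpha> * mk Y Y + \<beta> * mk (dev i Z) (dev i Y) - mk X Y"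
      using mk_dev_eq[OF i X Y j(1,3,2)] mk_dev_self[OF i Y] by (simp add: Wv_def B_def mk_linear)
    also have "\<dots> \<le> \<alpha> * mk Y Y + \<beta> * mk Z Y - mk X Y" using mk_dev_le[OF i Z Y] ab by simp
    also have "\<dots> = 0" by (simp add: XYZ mk_linear mk_commute[of Z Y])
    finally show ?thesis using p by (simp add: dev_def[of i Y] mk_linear mult_le_0_iff)
  qed
  moreover have "mk Wv (L' ?z) \<le> 0"
  proof -
    have "mk Wv (dev i Z) = \<alpha> * mk (dev i Y) (dev i Z) + \<beta> * mk Z Z - mk X Z"
      using mk_dev_eq[OF i X Z k] mk_dev_self[OF i Z] by (simp add: Wv_def B_def mk_linear)
    also have "\<dots> \<le> \<alpha> * mk Y Z + \<beta> * mk Z Z - mk X Z" using mk_dev_le[OF i Y Z] ab by simp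
    also have "\<dots> = 0" by (simp add: XYZ mk_linear)
    finally show ?thesis using p by (simp add: dev_def[of i Z] mk_linear mult_le_0_iff)
  qed
  moreover obtain \<alpha>1 \<beta>1 s t where "0 \<le> s" "0 \<le> t"
    "hv v = \<alpha>1 *\<^sub>R hv a + \<beta>1 *\<^sub>R hv b + s *\<^sub>R L' ?y + t *\<^sub>R L' ?z" using wedge by blast
  ultimately have "mk Wv (hv v) \<le> 0"
    by (simp add: mk_linear) (meson add_nonpos_nonpos mult_nonneg_nonpos)
  thus ?thesis by (simp add: Wv_def B_def mk_linear)
qed

definition seg :: "mink \<Rightarrow> mink \<Rightarrow> real \<Rightarrow> mink" where
  "seg T T' s = (1 - s) *\<^sub>R T + s *\<^sub>R T'"

lemma seg_comb: "p *\<^sub>R seg T T' a + q *\<^sub>R seg T T' b = (p * (1 - a) + q * (1 - b)) *\<^sub>R T + (p * a + q * b) *\<^sub>R T'"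
  by (simp add: seg_def scaleR_add_right scaleR_add_left)

lemma seg_fcone: "i \<in> I \<Longrightarrow> T \<in> P.fcone i \<Longrightarrow> T' \<in> P.fcone i \<Longrightarrow> 0 \<le> s \<Longrightarrow> s \<le> 1 \<Longrightarrow> seg T T' s \<in> P.fcone i"
  unfolding seg_def by (intro P.fcone_comb) auto

lemma seg_right_germ:
  assumes i: "i \<in> I" and T: "T \<in> P.fcone i" "T' \<in> P.fcone i" and s: "0 \<le> s" "s < 1"
  shows "\<exists>j\<in>I'. \<exists>\<eta>>0. s + \<eta> \<le> 1 \<and> (\<forall>b. 0 \<le> b \<longrightarrow> b \<le> \<eta> \<longrightarrow> P.sec i (seg T T' (s + b)) \<in> fc' j)"
proof -
  obtain j \<delta> where j: "j \<in> I'" "\<delta> > 0" "\<And>r. 0 \<le> r \<Longrightarrow> r \<le> \<delta> \<Longrightarrow> P.sec i (seg T T' s + r *\<^sub>R T') \<in> fc' j"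
    using face_germ0[OF i seg_fcone[OF i T] T(2), of s] s by auto
  define \<eta> where "\<eta> = min ((1 - s) / 2) (\<delta> * (1 - s) / 2)"
  have \<eta>: "\<eta> > 0" "s + \<eta> \<le> 1" "\<eta> \<le> (1 - s) / 2" "\<eta> \<le> \<delta> * (1 - s) / 2"
  proof -
    have h: "0 < (1 - s) / 2" "0 < \<delta> * (1 - s) / 2" using s j(2) by auto
    show "\<eta> > 0" using h by (simp only: \<eta>_def min_less_iff_conj)
    show "\<eta> \<le> (1 - s) / 2" "\<eta> \<le> \<delta> * (1 - s) / 2" by (simp_all only: \<eta>_def min.cobounded1 min.cobounded2)
    have "\<eta> \<le> 1 - s" using min.cobounded1[of "(1 - s) / 2" "\<delta> * (1 - s) / 2"] s unfolding \<eta>_def by simp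
    thus "s + \<eta> \<le> 1" by simp
  qed
  have "P.sec i (seg T T' (s + b)) \<in> fc' j" if b: "0 \<le> b" "b \<le> \<eta>" for b
  proof -
    \<comment> \<open>Up to the factor \<open>1 + r\<close>, the point of the segment at
      \<open>s + b\<close> is the point at \<open>s\<close> moved by \<open>r *\<^sub>R T'\<close>.
      The choice of \<eta> keeps the denominator at least \<open>(1 - s) / 2\<close> and thus
      \<open>r\<close> at most \<delta>.\<close>
    define r where "r = b / (1 - s - b)"
    have q: "0 < 1 - s - b" "(1 - s) / 2 \<le> 1 - s - b" using b \<eta> s by (auto simp: field_simps)
    have r0: "0 \<le> r" using b q by (simp add: r_def)
    have "b \<le> \<delta> * ((1 - s) / 2)" using b \<eta> by simp
    also have "\<dots> \<le> \<delta> * (1 - s - b)" using q j(2) by (intro mult_left_mono) auto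
    finally have r1: "r \<le> \<delta>" using q by (simp add: r_def divide_simps)
    have e: "(1 + r) * (1 - (s + b)) = 1 - s" "(1 + r) * (s + b) = s + r"
      using q by (simp_all add: r_def field_simps)
    have "(1 + r) *\<^sub>R seg T T' (s + b) = seg T T' s + r *\<^sub>R T'"
      unfolding seg_def scaleR_add_right scaleR_scaleR e by (simp add: algebra_simps)
    thus ?thesis using j(3)[OF r0 r1] P.sec_scale[of "1 + r" i "seg T T' (s + b)"] r0 by simp
  qed
  thus ?thesis using j(1) \<eta> by blast
qed

lemma seg_swap: "seg T T' s = seg T' T (1 - s)"
  by (simp add: seg_def)

lemma seg_left_germ:
  assumes i: "i \<in> I" and T: "T \<in> P.fcone i" "T' \<in> P.fcone i" and s: "0 < s" "s \<le> 1"
  shows "\<exists>j\<in>I'. \<exists>\<eta>>0. \<eta> \<le> s \<and> (\<forall>b. 0 \<le> b \<longrightarrow> b \<le> \<eta> \<longrightarrow> P.sec i (seg T T' (s - b)) \<in> fc' j)"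
proof -
  obtain j \<eta> where j: "j \<in> I'" "\<eta> > 0" "1 - s + \<eta> \<le> 1" "\<And>b. 0 \<le> b \<Longrightarrow> b \<le> \<eta> \<Longrightarrow> P.sec i (seg T' T (1 - s + b)) \<in> fc' j"
    using seg_right_germ[OF i T(2,1), of "1 - s"] s by auto
  have "seg T' T (1 - s + b) = seg T T' (s - b)" for b
    by (simp add: seg_def algebra_simps)
  thus ?thesis using j by (intro bexI[of _ j] exI[of _ \<eta>]) auto
qed

text \<open>On either side of each parameter the pairing is affine for a while, since a germ of the
  segment stays in one face of the second polyhedron, and \<open>dev_kink\<close> decides the sign
  of the break. \<open>midpoint_concave_local\<close> makes this global, and homogeneity removes the
  factor 1/2.\<close>

lemma dev_superadditive:
  assumes i: "i \<in> I" and T: "T \<in> P.fcone i" "T' \<in> P.fcone i" and v: "v \<in> V'"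
  shows "mk (dev i T) (hv v) + mk (dev i T') (hv v) \<le> mk (dev i (T + T')) (hv v)"
proof -
  define q where "q S S' s = mk (dev i (seg S S' s)) (hv v)" for S S' s
  define p where "p = q T T'"
  have germ: "\<exists>m. \<exists>\<eta>>0. \<forall>b. 0 \<le> b \<longrightarrow> b \<le> \<eta> \<longrightarrow> q S S' (s + b) = q S S' s + m * b"
    if s: "0 \<le> s" "s < 1" and S: "S \<in> P.fcone i" "S' \<in> P.fcone i" for s S S'
  proof -
    obtain j \<eta> where j: "j \<in> I'" "\<eta> > 0" "s + \<eta> \<le> 1" "\<And>b. 0 \<le> b \<Longrightarrow> b \<le> \<eta> \<Longrightarrow> P.sec i (seg S S' (s + b)) \<in> fc' j"
      using seg_right_germ[OF i S s] by blast
    have "q S S' (s + b) = q S S' s + (q S S' (s + \<eta>) - q S S' s) / \<eta> * b" if b: "0 \<le> b" "b \<le> \<eta>" for b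
    proof -
      have e: "(1 - b / \<eta>) * (1 - s) + b / \<eta> * (1 - (s + \<eta>)) = 1 - (s + b)"
        "(1 - b / \<eta>) * s + b / \<eta> * (s + \<eta>) = s + b" using j(2) by (simp_all add: field_simps)
      have eq: "seg S S' (s + b) = (1 - b / \<eta>) *\<^sub>R seg S S' s + (b / \<eta>) *\<^sub>R seg S S' (s + \<eta>)"
        unfolding seg_comb e by (simp only: seg_def)
      have "dev i (seg S S' (s + b)) = (1 - b / \<eta>) *\<^sub>R dev i (seg S S' s) + (b / \<eta>) *\<^sub>R dev i (seg S S' (s + \<eta>))"
        using dev_comb[OF i _ _ _ eq j(1)] seg_fcone[OF i S] s j(2,3) b j(4)[of 0] j(4)[of b] j(4)[of \<eta>] by simp
      hence "q S S' (s + b) = (1 - b / \<eta>) * q S S' s + b / \<eta> * q S S' (s + \<eta>)" by (simp only: q_def mk_linear)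
      thus ?thesis by (simp add: algebra_simps diff_divide_distrib)
    qed
    thus ?thesis using j(2) by blast
  qed
  have right: "(p \<longlongrightarrow> p s) (at_right s)" if s: "0 \<le> s" "s < 1" for s
  proof -
    obtain m \<eta> where h: "\<eta> > 0" "\<And>b. 0 \<le> b \<Longrightarrow> b \<le> \<eta> \<Longrightarrow> p (s + b) = p s + m * b" using germ[OF s T] unfolding p_def by blast
    have "p s + m * (t - s) = p t" if "s < t" "t < s + \<eta>" for t using h(2)[of "t - s"] that by simp
    hence "eventually (\<lambda>t. p s + m * (t - s) = p t) (at_right s)"
      unfolding eventually_at_right_field using h(1) by (intro exI[of _ "s + \<eta>"] conjI allI impI) (simp, blast)
    moreover have "((\<lambda>t. p s + m * (t - s)) \<longlongrightarrow> p s + m * (s - s)) (at_right s)" by (intro tendsto_intros)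
    ultimately show ?thesis using Lim_transform_eventually by fastforce
  qed
  have left: "(p \<longlongrightarrow> p s) (at_left s)" if s: "0 < s" "s \<le> 1" for s
  proof -
    have pq: "p t = q T' T (1 - t)" for t by (simp add: p_def q_def seg_swap[of T T'])
    obtain m \<eta> where h: "\<eta> > 0" "\<And>b. 0 \<le> b \<Longrightarrow> b \<le> \<eta> \<Longrightarrow> q T' T (1 - s + b) = p s + m * b"
      using germ[of "1 - s" T' T] s T unfolding pq by auto
    have "p s + m * (s - t) = p t" if "s - \<eta> < t" "t < s" for t using h(2)[of "s - t"] that by (simp add: pq)
    hence "eventually (\<lambda>t. p s + m * (s - t) = p t) (at_left s)"
      unfolding eventually_at_left_field using h(1) by (intro exI[of _ "s - \<eta>"] conjI allI impI) (simp, blast)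
    moreover have "((\<lambda>t. p s + m * (s - t)) \<longlongrightarrow> p s + m * (s - s)) (at_left s)" by (intro tendsto_intros)
    ultimately show ?thesis using Lim_transform_eventually by fastforce
  qed
  have cont: "continuous_on {0..1} p"
    by (rule continuous_on_IccI) (use left right in \<open>auto intro: filterlim_split_at\<close>)
  have "p 0 + p 1 \<le> 2 * p (1/2)"
  proof (rule midpoint_concave_local[OF cont])
    fix s :: real assume s: "0 < s" "s < 1"
    obtain k \<eta>1 where k: "k \<in> I'" "\<eta>1 > 0" "s + \<eta>1 \<le> 1" "\<And>b. 0 \<le> b \<Longrightarrow> b \<le> \<eta>1 \<Longrightarrow> P.sec i (seg T T' (s + b)) \<in> fc' k"
      using seg_right_germ[OF i T, of s] s by auto
    obtain j \<eta>2 where j: "j \<in> I'" "\<eta>2 > 0" "\<eta>2 \<le> s" "\<And>b. 0 \<le> b \<Longrightarrow> b \<le> \<eta>2 \<Longrightarrow> P.sec i (seg T T' (s - b)) \<in> fc' j"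
      using seg_left_germ[OF i T, of s] s by auto
    have "b * p (s - a) + a * p (s + b) \<le> (a + b) * p s"
      if ab: "0 < a" "a \<le> min \<eta>1 \<eta>2" "0 < b" "b \<le> min \<eta>1 \<eta>2" for a b
    proof -
      have e: "b / (a + b) * (1 - (s - a)) + a / (a + b) * (1 - (s + b)) = 1 - s"
        "b / (a + b) * (s - a) + a / (a + b) * (s + b) = s"
      proof -
        have "b / (a + b) + a / (a + b) = 1" using ab by (simp flip: add_divide_distrib)
        moreover have "b / (a + b) * a = a / (a + b) * b" by simp
        ultimately show "b / (a + b) * (1 - (s - a)) + a / (a + b) * (1 - (s + b)) = 1 - s"
          "b / (a + b) * (s - a) + a / (a + b) * (s + b) = s" by algebra+
      qed
      have eq: "seg T T' s = (b / (a + b)) *\<^sub>R seg T T' (s - a) + (a / (a + b)) *\<^sub>R seg T T' (s + b)"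
        unfolding seg_comb e by (simp only: seg_def)
      have "mk ((b / (a + b)) *\<^sub>R dev i (seg T T' (s - a)) + (a / (a + b)) *\<^sub>R dev i (seg T T' (s + b))) (hv v) \<le> mk (dev i (seg T T' s)) (hv v)"
      proof (rule dev_kink[OF i _ _ _ eq _ _ j(1) _ _ k(1) _ _ v])
        show "seg T T' (s - a) \<in> P.fcone i" using seg_fcone[OF i T] s j(2,3) ab by simp
        show "seg T T' (s + b) \<in> P.fcone i" using seg_fcone[OF i T] s k(2,3) ab by simp
        show "seg T T' s \<in> P.fcone i" using seg_fcone[OF i T] s by simp
        show "0 < b / (a + b)" "0 < a / (a + b)" using ab by auto
        show "P.sec i (seg T T' (s - a)) \<in> fc' j" using j(4)[of a] ab by simp
        show "P.sec i (seg T T' s) \<in> fc' j" using j(4)[of 0] j(2) by simp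
        show "P.sec i (seg T T' s) \<in> fc' k" using k(4)[of 0] k(2) by simp
        show "P.sec i (seg T T' (s + b)) \<in> fc' k" using k(4)[of b] ab by simp
      qed
      hence "b / (a + b) * p (s - a) + a / (a + b) * p (s + b) \<le> p s" by (simp add: p_def q_def mk_linear)
      hence "(a + b) * (b / (a + b) * p (s - a) + a / (a + b) * p (s + b)) \<le> (a + b) * p s"
        using ab by (intro mult_left_mono) auto
      moreover have "(a + b) * (b / (a + b) * p (s - a) + a / (a + b) * p (s + b)) = b * p (s - a) + a * p (s + b)"
        using ab by (simp add: distrib_left)
      ultimately show ?thesis by simp
    qed
    thus "\<exists>\<delta>>0. \<forall>a b. 0 < a \<longrightarrow> a \<le> \<delta> \<longrightarrow> 0 < b \<longrightarrow> b \<le> \<delta> \<longrightarrow> b * p (s - a) + a * p (s + b) \<le> (a + b) * p s"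
      using j(2) k(2) by (intro exI[of _ "min \<eta>1 \<eta>2"]) auto
  qed
  moreover have "seg T T' (1/2) = (1/2) *\<^sub>R (T + T')" by (simp add: seg_def scaleR_add_right)
  ultimately show ?thesis by (simp add: p_def q_def dev_scale mk_linear) (simp add: seg_def)
qed

end

subsection \<open>The link of a cusp\<close>

lemma orthonormal3_expand:
  fixes e1 e2 e3 :: "real^3"
  assumes "e1 \<bullet> e1 = 1" "e2 \<bullet> e2 = 1" "e3 \<bullet> e3 = 1" "e1 \<bullet> e2 = 0" "e1 \<bullet> e3 = 0" "e2 \<bullet> e3 = 0"
  shows "x = (x \<bullet> e1) *\<^sub>R e1 + (x \<bullet> e2) *\<^sub>R e2 + (x \<bullet> e3) *\<^sub>R e3"
proof -
  have d: "e1 \<noteq> e2" "e1 \<noteq> e3" "e2 \<noteq> e3" using assms by auto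
  let ?B = "{e1, e2, e3}"
  have orth: "pairwise orthogonal ?B" using assms
    by (auto simp: pairwise_def orthogonal_def inner_commute)
  have n1: "\<And>b. b \<in> ?B \<Longrightarrow> norm b = 1" using assms by (auto simp: norm_eq_1)
  have "0 \<notin> ?B" using n1 by fastforce
  hence ind: "independent ?B" using orth pairwise_orthogonal_independent by blast
  have "card ?B = 3" using d by simp
  hence "dim ?B = DIM(real^3)" using dim_eq_card_independent[OF ind] by simp
  hence "span ?B = UNIV" by (simp only: dim_eq_full)
  hence "(\<Sum>i\<in>?B. (x \<bullet> i) *\<^sub>R i) = x"
    using orthonormal_basis_expand[OF orth n1, of x] by simp
  thus ?thesis using d by (simp add: add.assoc)
qed

text \<open>The complement of two null vectors is a negative definite plane with basis
  \<open>B1\<close>, \<open>B2\<close>. In the basis with \<open>e3\<close> along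
  \<open>v - q\<close> and \<open>e1\<close> orthogonal to both points, \<open>v\<close> and
  \<open>q\<close> become \<open>s *\<^sub>R e2 + l *\<^sub>R e3\<close> and
  \<open>s *\<^sub>R e2 - l *\<^sub>R e3\<close>.\<close>

lemma null_frame:
  fixes v q :: "real^3"
  assumes "norm v = 1" "norm q = 1" "v \<noteq> q"
  shows "\<exists>B1 B2. mk B1 B1 = - 1 \<and> mk B2 B2 = - 1 \<and> mk B1 B2 = 0 \<and> (\<forall>X. X = (mk X (hv q) / mk (hv v) (hv q)) *\<^sub>R hv v + (mk X (hv v) / mk (hv v) (hv q)) *\<^sub>R hv q
     - mk X B1 *\<^sub>R B1 - mk X B2 *\<^sub>R B2)"
proof -
  define l where "l = norm (v - q) / 2"
  define e3 where "e3 = (1 / norm (v - q)) *\<^sub>R (v - q)"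
  have l: "l > 0" using assms by (simp add: l_def)
  have e33: "e3 \<bullet> e3 = 1" using assms by (simp add: e3_def dot_square_norm power2_eq_square)
  have "dim {v, q} < DIM(real^3)"
    using dim_le_card[of "{v, q}" "{v, q}"] card_insert_le_m1[of 2 "{q}" v] by (auto simp: span_superset)
  then obtain u where u: "u \<noteq> 0" "\<And>y. y \<in> span {v, q} \<Longrightarrow> orthogonal u y"
    using orthogonal_to_subspace_exists by blast
  define e1 where "e1 = (1 / norm u) *\<^sub>R u"
  have e11: "e1 \<bullet> e1 = 1" using u by (simp add: e1_def dot_square_norm power2_eq_square)
  have e1v: "e1 \<bullet> v = 0" "e1 \<bullet> q = 0"
    using u(2)[of v] u(2)[of q] by (simp_all add: e1_def orthogonal_def span_base)
  hence e13: "e1 \<bullet> e3 = 0" by (simp add: e3_def inner_diff_right)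
  have "dim {e1, e3} < DIM(real^3)"
    using dim_le_card[of "{e1, e3}" "{e1, e3}"] card_insert_le_m1[of 2 "{e3}" e1] by (auto simp: span_superset)
  then obtain u' where u': "u' \<noteq> 0" "\<And>y. y \<in> span {e1, e3} \<Longrightarrow> orthogonal u' y"
    using orthogonal_to_subspace_exists by blast
  define e2 where "e2 = (1 / norm u') *\<^sub>R u'"
  have e22: "e2 \<bullet> e2 = 1" using u' by (simp add: e2_def dot_square_norm power2_eq_square)
  have e2o: "e2 \<bullet> e1 = 0" "e2 \<bullet> e3 = 0"
    using u'(2)[of e1] u'(2)[of e3] by (simp_all add: e2_def orthogonal_def span_base)
  note ex = orthonormal3_expand[OF e11 e22 e33 _ e13 e2o(2), unfolded inner_commute[of e1 e2], OF e2o(1)]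
  define s where "s = e2 \<bullet> v"
  have "e2 \<bullet> (v - q) = 0" using e2o(2) assms by (simp add: e3_def)
  hence sq: "e2 \<bullet> q = s" by (simp add: s_def inner_diff_right)
  have vv: "v \<bullet> v = 1" "q \<bullet> q = 1" using assms by (simp_all add: dot_square_norm)
  have vq: "v - q = (2 * l) *\<^sub>R e3" using assms by (simp add: l_def e3_def)
  have "(v - q) \<bullet> v = - ((v - q) \<bullet> q)" using vv by (simp add: inner_diff_left inner_commute[of q v])
  hence "l * (e3 \<bullet> v + e3 \<bullet> q) = 0" unfolding vq by (simp add: algebra_simps)
  hence "e3 \<bullet> v = - (e3 \<bullet> q)" using l by simp
  moreover have "e3 \<bullet> v - e3 \<bullet> q = 2 * l"
    using arg_cong[OF vq, of "\<lambda>x. e3 \<bullet> x"] e33 by (simp add: inner_diff_right)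
  ultimately have e3v: "e3 \<bullet> v = l" "e3 \<bullet> q = - l" by auto
  have v: "v = s *\<^sub>R e2 + l *\<^sub>R e3"
    using ex[of v] e1v e3v by (simp add: s_def inner_commute)
  have q: "q = s *\<^sub>R e2 - l *\<^sub>R e3"
    using ex[of q] e1v e3v sq by (simp add: inner_commute)
  have sl: "s\<^sup>2 + l\<^sup>2 = 1"
    using vv(1) e22 e33 e2o unfolding v by (simp add: inner_add_left inner_add_right inner_commute power2_eq_square)
  have vq': "v \<bullet> q = s\<^sup>2 - l\<^sup>2"
    unfolding v q using e22 e33 e2o by (simp add: inner_add_left inner_diff_right inner_commute[of e3 e2] power2_eq_square)
  have \<kappa>: "mk (hv v) (hv q) = 2 * l\<^sup>2" using sl vq' by (simp add: mk_hv)
  define B1 :: "mink" where "B1 = (e1, 0)"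
  \<comment> \<open>The combination of \<open>e2\<close> and the time axis that is orthogonal to
    both null vectors; \<open>s\<^sup>2 + l\<^sup>2 = 1\<close> normalizes it to -1.\<close>
  define B2 :: "mink" where "B2 = ((1 / l) *\<^sub>R e2, s / l)"
  have "X = (mk X (hv q) / mk (hv v) (hv q)) *\<^sub>R hv v + (mk X (hv v) / mk (hv v) (hv q)) *\<^sub>R hv q
     - mk X B1 *\<^sub>R B1 - mk X B2 *\<^sub>R B2" (is "X = ?R") for X
  proof -
    define x1 x2 x3 t where "x1 = fst X \<bullet> e1" and "x2 = fst X \<bullet> e2" and "x3 = fst X \<bullet> e3" and "t = snd X"
    have fx: "fst X = x1 *\<^sub>R e1 + x2 *\<^sub>R e2 + x3 *\<^sub>R e3" using ex[of "fst X"] by (simp add: x1_def x2_def x3_def)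
    have m: "mk X (hv v) = t - s * x2 - l * x3" "mk X (hv q) = t - s * x2 + l * x3"
      "mk X B1 = - x1" "mk X B2 = (t * s - x2) / l"
      using l by (simp_all add: mk_def hv_def v q B1_def B2_def x1_def x2_def x3_def t_def inner_add_right inner_diff_right diff_divide_distrib)
    have cs: "fst ?R = ((mk X (hv q) / (2 * l\<^sup>2)) * s + (mk X (hv v) / (2 * l\<^sup>2)) * s - mk X B2 / l) *\<^sub>R e2
       + (mk X (hv q) / (2 * l\<^sup>2) * l - mk X (hv v) / (2 * l\<^sup>2) * l) *\<^sub>R e3 - mk X B1 *\<^sub>R e1"
      unfolding \<kappa> by (simp add: hv_def v q B1_def B2_def algebra_simps)
    have l0: "l \<noteq> 0" using l by simp
    have "(mk X (hv q) / (2 * l\<^sup>2)) * s + (mk X (hv v) / (2 * l\<^sup>2)) * s - mk X B2 / l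
       = ((t - s * x2) * s - (t * s - x2)) / l\<^sup>2" unfolding m using l0 by (simp add: field_simps power2_eq_square)
    also have "(t - s * x2) * s - (t * s - x2) = x2 * l\<^sup>2" using sl by algebra
    finally have c2: "(mk X (hv q) / (2 * l\<^sup>2)) * s + (mk X (hv v) / (2 * l\<^sup>2)) * s - mk X B2 / l = x2"
      using l0 by simp
    have c3: "mk X (hv q) / (2 * l\<^sup>2) * l - mk X (hv v) / (2 * l\<^sup>2) * l = x3"
      unfolding m using l0 by (simp add: field_simps power2_eq_square)
    have "fst ?R = x2 *\<^sub>R e2 + x3 *\<^sub>R e3 - mk X B1 *\<^sub>R e1" by (simp only: cs c2 c3)
    also have "\<dots> = fst X" by (simp add: fx m(3))
    finally have "fst ?R = fst X" .
    moreover have "snd ?R = (mk X (hv q) + mk X (hv v)) / (2 * l\<^sup>2) - mk X B2 * (s / l)"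
      unfolding \<kappa> by (simp add: B1_def B2_def add_divide_distrib)
    moreover have "(mk X (hv q) + mk X (hv v)) / (2 * l\<^sup>2) - mk X B2 * (s / l) = (t - s * x2 - (t * s - x2) * s) / l\<^sup>2"
      unfolding m using l0 by (simp add: field_simps power2_eq_square)
    moreover have "t - s * x2 - (t * s - x2) * s = t * l\<^sup>2" using sl by algebra
    ultimately show ?thesis using l0 by (simp add: prod_eq_iff t_def)
  qed
  moreover have "mk B1 B1 = - 1" "mk B1 B2 = 0" using e11 e2o by (simp_all add: B1_def B2_def mk_def inner_commute)
  moreover have "mk B2 B2 = - 1"
  proof -
    have "mk B2 B2 = (s\<^sup>2 - 1) / l\<^sup>2" using e22 by (simp add: B2_def mk_def power2_eq_square diff_divide_distrib)
    also have "s\<^sup>2 - 1 = - (l\<^sup>2)" using sl by simp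
    finally show ?thesis using l by simp
  qed
  ultimately show ?thesis by blast
qed

text \<open>Pairing \<open>hv p\<close> with itself, written as a convex combination, gives a
  vanishing sum of nonnegative terms; a vertex of positive weight is therefore
  \<open>p\<close>.\<close>

lemma sphere_hull_mem:
  fixes A :: "'a::euclidean_space set"
  assumes "finite A" "A \<subseteq> sphere 0 1" "p \<in> convex hull A" "norm p = 1"
  shows "p \<in> A"
proof -
  obtain t where t: "\<And>v. v \<in> A \<Longrightarrow> 0 \<le> t v" "hv p = (\<Sum>v\<in>A. t v *\<^sub>R hv v)"
    using cone_onE[of "hv p" A] hv_cone_on_iff[OF assms(1), of p] assms(3) by blast
  have "0 = mk (hv p) (hv p)" using assms by (simp add: mk_hv_self_sphere)
  also have "\<dots> = (\<Sum>v\<in>A. t v * mk (hv v) (hv p))"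
    by (subst t(2)) (simp add: mk_sum_left mk_linear)
  finally have s0: "(\<Sum>v\<in>A. t v * mk (hv v) (hv p)) = 0" by simp
  have "0 \<le> t v * mk (hv v) (hv p)" if "v \<in> A" for v
    using t(1)[OF that] assms that by (intro mult_nonneg_nonneg mk_hv_sphere_nonneg) auto
  hence all0: "t v * mk (hv v) (hv p) = 0" if "v \<in> A" for v
    using s0 sum_nonneg_eq_0_iff[OF assms(1), of "\<lambda>v. t v * mk (hv v) (hv p)"] that by blast
  have "(\<Sum>v\<in>A. t v) = 1" using arg_cong[OF t(2), of snd] by (simp add: snd_sum)
  then obtain v where v: "v \<in> A" "t v \<noteq> 0" by (metis sum.neutral zero_neq_one)
  hence "v = p" using all0[OF v(1)] assms mk_hv_sphere_eq_0[of v p] by auto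
  thus ?thesis using v by simp
qed

context ideal_surface
begin

text \<open>Large \<open>a\<close> means a small horoball at \<open>v\<close>, which misses the hull
  of the other vertices: these pair with \<open>hv v\<close> to at least \<mu>, and points of the
  hyperboloid have height at least 1. The constant \<open>2 / \<mu>\<close> makes the inequality
  strict.\<close>

lemma exists_horoball:
  assumes "v \<in> V"
  shows "\<exists>a0>0. \<forall>a\<ge>a0. \<forall>X\<in>hyp \<inter> cone_on (V - {v}). 1 < mk X (a *\<^sub>R hv v)"
proof (cases "V - {v} = {}")
  case True
  have "cone_on (V - {v}) = {0}" unfolding cone_on_def True by simp
  hence "hyp \<inter> cone_on (V - {v}) = {}" by (simp add: hyp_def mk_linear)
  thus ?thesis by (intro exI[of _ 1]) auto
next
  case False
  define \<mu> where "\<mu> = Min ((\<lambda>w. mk (hv w) (hv v)) ` (V - {v}))"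
  have fin: "finite ((\<lambda>w. mk (hv w) (hv v)) ` (V - {v}))" "(\<lambda>w. mk (hv w) (hv v)) ` (V - {v}) \<noteq> {}"
    using finite_V False by auto
  have "\<mu> > 0" unfolding \<mu>_def using fin
    by (subst Min_gr_iff) (auto intro!: mk_hv_sphere_pos norm_V assms)
  have \<mu>: "\<mu> \<le> mk (hv w) (hv v)" if "w \<in> V - {v}" for w unfolding \<mu>_def using fin that by (intro Min_le) auto
  have "1 < mk X (a *\<^sub>R hv v)" if a: "2 / \<mu> \<le> a" and X: "X \<in> hyp" "X \<in> cone_on (V - {v})" for a X
  proof -
    obtain t where t: "\<And>w. w \<in> V - {v} \<Longrightarrow> 0 \<le> t w" "X = (\<Sum>w\<in>V - {v}. t w *\<^sub>R hv w)"
      using cone_onE[OF X(2)] by blast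
    have "snd X * \<mu> = (\<Sum>w\<in>V - {v}. t w * \<mu>)" by (simp add: t(2) snd_sum sum_distrib_right)
    also have "\<dots> \<le> (\<Sum>w\<in>V - {v}. t w * mk (hv w) (hv v))"
      by (intro sum_mono mult_left_mono \<mu> t(1))
    also have "\<dots> = mk X (hv v)" by (simp add: t(2) mk_sum_left mk_linear)
    finally have 1: "snd X * \<mu> \<le> mk X (hv v)" .
    have "1 \<le> (snd X)\<^sup>2" using X(1) by (simp add: hyp_def mk_self) (metis add_increasing2 le_numeral_extra(4) zero_le_power2 add.commute diff_eq_eq)
    hence "1 \<le> snd X" using X(1) by (simp add: hyp_def) (metis abs_le_square_iff abs_of_pos abs_one one_power2)
    hence "\<mu> \<le> mk X (hv v)" using 1 \<open>\<mu> > 0\<close> by (smt (verit) mult_le_cancel_right1)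
    moreover have "2 \<le> a * \<mu>" using a \<open>\<mu> > 0\<close> by (simp add: divide_simps mult.commute split: if_splits)
    moreover have "0 < a" using a \<open>\<mu> > 0\<close> by (smt (verit) divide_pos_pos)
    ultimately have "2 \<le> a * mk X (hv v)" by (smt (verit) mult_left_mono)
    thus ?thesis by (simp add: mk_linear)
  qed
  thus ?thesis using \<open>\<mu> > 0\<close> by (intro exI[of _ "2 / \<mu>"]) auto
qed

end

lemma complex_inner_eq: "n \<bullet> Complex a b = Re n * a + Im n * b"
  by (simp add: inner_complex_def)

text \<open>The weights are indexed by \<open>S\<close> and not by the image, so \<open>f\<close>
  may identify points; in a chart at a cusp the indices stay vertices of the polyhedron.\<close>

lemma convex_hull_image_sum:
  fixes f :: "'b \<Rightarrow> 'c::real_vector"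
  assumes "finite S" "z \<in> convex hull (f ` S)"
  shows "\<exists>u. (\<forall>x\<in>S. 0 \<le> u x) \<and> sum u S = 1 \<and> z = (\<Sum>x\<in>S. u x *\<^sub>R f x)"
proof -
  define C where "C = {z. \<exists>u. (\<forall>x\<in>S. 0 \<le> u x) \<and> sum u S = 1 \<and> z = (\<Sum>x\<in>S. u x *\<^sub>R f x)}"
  have "convex C"
  proof (rule convexI)
    fix z1 z2 s t assume z: "z1 \<in> C" "z2 \<in> C" and st: "0 \<le> s" "0 \<le> t" "s + t = (1::real)"
    obtain u1 where u1: "\<forall>x\<in>S. 0 \<le> u1 x" "sum u1 S = 1" "z1 = (\<Sum>x\<in>S. u1 x *\<^sub>R f x)" using z(1) C_def by blast
    obtain u2 where u2: "\<forall>x\<in>S. 0 \<le> u2 x" "sum u2 S = 1" "z2 = (\<Sum>x\<in>S. u2 x *\<^sub>R f x)" using z(2) C_def by blast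
    have "\<forall>x\<in>S. 0 \<le> s * u1 x + t * u2 x" using u1 u2 st by simp
    moreover have "(\<Sum>x\<in>S. s * u1 x + t * u2 x) = 1" using u1 u2 st by (simp add: sum.distrib flip: sum_distrib_left)
    moreover have "s *\<^sub>R z1 + t *\<^sub>R z2 = (\<Sum>x\<in>S. (s * u1 x + t * u2 x) *\<^sub>R f x)"
      by (simp add: u1(3) u2(3) scaleR_sum_right sum.distrib scaleR_add_left)
    ultimately show "s *\<^sub>R z1 + t *\<^sub>R z2 \<in> C" unfolding C_def mem_Collect_eq
      by (intro exI[of _ "\<lambda>x. s * u1 x + t * u2 x"] conjI)
  qed
  moreover have "f ` S \<subseteq> C"
  proof
    fix z assume "z \<in> f ` S"
    then obtain x where x: "x \<in> S" "z = f x" by blast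
    thus "z \<in> C" unfolding C_def using assms(1)
      by (auto intro!: exI[of _ "\<lambda>w. if w = x then 1 else 0"] simp: if_distrib[of "\<lambda>c. c *\<^sub>R _"] cong: if_cong)
  qed
  ultimately have "convex hull (f ` S) \<subseteq> C" by (simp add: hull_minimal)
  thus ?thesis using assms(2) C_def by blast
qed

text \<open>Upper half space coordinates with the cusp \<open>v\<close> at infinity and \<open>q\<close> over the origin: \<open>H\<close> is a
  horosphere section, \<open>y\<close> its projection to the boundary plane and \<open>K\<close> the link of \<open>v\<close>.\<close>

locale cusp_chart = ideal_surface M d V I W fc L
  for M :: "'a set" and d V and I :: "'i set" and W fc L +
  fixes v q :: "real^3" and a b :: real and B1 B2 :: "mink" and N Q :: "mink"
  assumes vq: "v \<in> V" "q \<in> V" "v \<noteq> q" and a: "0 < a" and b: "0 < b"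
    and N: "N = a *\<^sub>R hv v" and Q: "Q = b *\<^sub>R hv q"
    and BB: "mk B1 B1 = - 1" "mk B2 B2 = - 1" "mk B1 B2 = 0"
    and frame: "\<And>X. X = (mk X Q / mk N Q) *\<^sub>R N + (mk X N / mk N Q) *\<^sub>R Q - mk X B1 *\<^sub>R B1 - mk X B2 *\<^sub>R B2"
    and horoball: "\<And>X. X \<in> hyp \<Longrightarrow> X \<in> cone_on (V - {v}) \<Longrightarrow> 1 < mk X N"
begin

definition y :: "mink \<Rightarrow> complex" where
  "y X = Complex (mk X B1 / mk X N) (mk X B2 / mk X N)"

definition H :: "'a set" where
  "H = {x\<in>M. mk (L x) N = 1}"

definition K :: "complex set" where
  "K = convex hull ((y \<circ> hv) ` (V - {v}))"

lemma NN: "mk N N = 0" and QQ: "mk Q Q = 0" and NQ: "0 < mk N Q"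
  using vq a b norm_V mk_hv_sphere_pos[of v q] by (auto simp: N Q mk_linear mk_hv_self_sphere)

lemma mk_expand:
  "mk X Y = (mk X N * mk Y Q + mk Y N * mk X Q) / mk N Q - mk X B1 * mk Y B1 - mk X B2 * mk Y B2"
proof -
  have "mk X Y = mk ((mk X Q / mk N Q) *\<^sub>R N + (mk X N / mk N Q) *\<^sub>R Q - mk X B1 *\<^sub>R B1 - mk X B2 *\<^sub>R B2) Y"
    using frame[of X] by simp
  thus ?thesis
    by (simp add: mk_linear mk_commute[of _ Y] add_divide_distrib algebra_simps)
qed

text \<open>Expanding the null vector \<open>N\<close> or \<open>Q\<close> against itself leaves
  only minus a sum of two squares.\<close>

lemma B_orth: "mk N B1 = 0" "mk N B2 = 0" "mk Q B1 = 0" "mk Q B2 = 0"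
proof -
  have "x = 0 \<and> y = 0" if "- (x * x) = y * y" for x y :: real
  proof -
    have "x * x = 0" "y * y = 0" using that zero_le_square[of x] zero_le_square[of y] by linarith+
    thus ?thesis by simp
  qed
  moreover have "- (mk N B1 * mk N B1) = mk N B2 * mk N B2" using mk_expand[of N N] NN by simp
  moreover have "- (mk Q B1 * mk Q B1) = mk Q B2 * mk Q B2" using mk_expand[of Q Q] QQ by simp
  ultimately show "mk N B1 = 0" "mk N B2 = 0" "mk Q B1 = 0" "mk Q B2 = 0" by blast+
qed

lemma y_Q: "y Q = 0" "y (hv q) = 0"
proof -
  show "y Q = 0" using B_orth by (simp add: y_def zero_complex.code)
  have "mk (hv q) B1 = 0" "mk (hv q) B2 = 0" using B_orth b by (simp_all add: Q mk_linear)
  thus "y (hv q) = 0" by (simp add: y_def zero_complex.code)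
qed

text \<open>A horosphere is a Euclidean plane and the chart is an isometry for it. Hence lengths in
  the links depend only on distances within faces and agree for both polyhedra.\<close>

lemma y_dist:
  assumes "mk X N = 1" "mk Y N = 1" "X \<in> hyp" "Y \<in> hyp"
  shows "(norm (y X - y Y))\<^sup>2 = 2 * (mk X Y - 1)"
proof -
  have "mk (X - Y) (X - Y) = - (mk (X - Y) B1)\<^sup>2 - (mk (X - Y) B2)\<^sup>2"
    using mk_expand[of "X - Y" "X - Y"] assms by (simp add: mk_linear power2_eq_square)
  moreover have "mk (X - Y) (X - Y) = 2 - 2 * mk X Y"
    using assms by (simp add: mk_linear hyp_def mk_commute[of Y X])
  ultimately show ?thesis using assms
    by (simp add: y_def complex_diff cmod_power2 mk_linear)
qed

lemma y_inj:
  assumes "mk X N = 1" "mk Y N = 1" "X \<in> hyp" "Y \<in> hyp" "y X = y Y"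
  shows "X = Y"
proof (rule timelike_eqI)
  show "mk X Y = mk X X" using y_dist[OF assms(1-4)] assms by (simp add: hyp_def)
qed (use assms in \<open>auto simp: hyp_def\<close>)

text \<open>On the horosphere the squared distance to the origin is affine in the pairing with
  \<open>Q\<close>. This is how comparisons of pairings become comparisons of distances.\<close>

lemma y_norm:
  assumes "mk X N = 1" "X \<in> hyp"
  shows "(norm (y X))\<^sup>2 = 2 * mk X Q / mk N Q - 1"
proof -
  have "1 = 2 * mk X Q / mk N Q - (mk X B1)\<^sup>2 - (mk X B2)\<^sup>2"
    using mk_expand[of X X] assms by (simp add: hyp_def power2_eq_square)
  thus ?thesis using assms by (simp add: y_def cmod_power2)
qed

lemma y_add_N: "y (X + c *\<^sub>R N) = y X" "mk (X + c *\<^sub>R N) N = mk X N"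
  by (simp_all add: y_def mk_linear NN B_orth)

lemma mk_hv_N: "w \<in> V \<Longrightarrow> w \<noteq> v \<Longrightarrow> 0 < mk (hv w) N"
  using vq a norm_V mk_hv_sphere_pos[of w v] by (simp add: N mk_linear)

lemma mk_hv_v_N: "mk (hv v) N = 0"
  using vq norm_V by (simp add: N mk_linear mk_hv_self_sphere)

lemma hv_v_orth: "mk N (hv v) = 0" "mk B1 (hv v) = 0" "mk B2 (hv v) = 0"
proof -
  have "hv v = (1 / a) *\<^sub>R N" using a unfolding N by simp
  thus "mk N (hv v) = 0" "mk B1 (hv v) = 0" "mk B2 (hv v) = 0"
    by (simp_all only: mk_scale_right NN B_orth mk_commute[of B1 N] mk_commute[of B2 N] mult_zero_right)
qed

text \<open>Vectors orthogonal to \<open>N\<close> act in the chart as affine functions: hyperplanes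
  through the cusp correspond to lines of the plane.\<close>

lemma linear_in_chart:
  "mk X N \<noteq> 0 \<Longrightarrow> mk (Re n *\<^sub>R B1 + Im n *\<^sub>R B2 - c *\<^sub>R N) X = mk X N * (n \<bullet> y X - c)"
  by (simp add: y_def complex_inner_eq mk_linear mk_commute[of _ X] field_simps)

lemma frame_vector_neq_0: "n \<noteq> 0 \<Longrightarrow> Re n *\<^sub>R B1 + Im n *\<^sub>R B2 - c *\<^sub>R N \<noteq> 0"
proof
  assume "n \<noteq> 0" and z: "Re n *\<^sub>R B1 + Im n *\<^sub>R B2 - c *\<^sub>R N = 0"
  have "mk (Re n *\<^sub>R B1 + Im n *\<^sub>R B2 - c *\<^sub>R N) B1 = - Re n" "mk (Re n *\<^sub>R B1 + Im n *\<^sub>R B2 - c *\<^sub>R N) B2 = - Im n"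
    by (simp_all add: mk_linear BB B_orth mk_commute[of B2 B1])
  hence "Re n = 0" "Im n = 0" unfolding z by (simp_all add: mk_zero_left)
  thus False using \<open>n \<noteq> 0\<close> by (simp add: complex_eq_iff)
qed

text \<open>The chart is projective, and a weight \<open>t w\<close> becomes
  \<open>t w * mk (hv w) N / mk T N\<close>. The cusp \<open>v\<close> is at infinity and its weight
  becomes 0.\<close>

lemma y_cone:
  assumes A: "A \<subseteq> V" and T: "T \<in> cone_on A" "0 < mk T N"
  shows "y T \<in> convex hull ((y \<circ> hv) ` (A - {v}))"
proof -
  have fA: "finite A" using A finite_V finite_subset by blast
  obtain t where t: "\<And>w. w \<in> A \<Longrightarrow> 0 \<le> t w" "T = (\<Sum>w\<in>A. t w *\<^sub>R hv w)"
    using cone_onE[OF T(1)] by blast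
  define u where "u w = t w * mk (hv w) N / mk T N" for w
  have TN: "mk T N = (\<Sum>w\<in>A - {v}. t w * mk (hv w) N)"
  proof -
    have "mk T N = (\<Sum>w\<in>A. t w * mk (hv w) N)" by (simp add: t(2) mk_sum_left mk_linear)
    also have "\<dots> = (\<Sum>w\<in>A - {v}. t w * mk (hv w) N)"
      using fA by (intro sum.mono_neutral_right) (auto simp: mk_hv_v_N)
    finally show ?thesis .
  qed
  have u1: "(\<Sum>w\<in>A - {v}. u w) = 1" using T(2) unfolding u_def TN by (simp flip: sum_divide_distrib)
  have u0: "0 \<le> u w" if "w \<in> A - {v}" for w
    unfolding u_def using t(1) T(2) mk_hv_N[of w] A that by (intro divide_nonneg_pos mult_nonneg_nonneg) auto
  have TB: "mk T B = (\<Sum>w\<in>A - {v}. t w * mk (hv w) B)" if "mk N B = 0" for B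
  proof -
    have "mk (hv v) B = 0" using that a by (simp add: N mk_linear)
    moreover have "mk T B = (\<Sum>w\<in>A. t w * mk (hv w) B)" by (simp add: t(2) mk_sum_left mk_linear)
    moreover have "(\<Sum>w\<in>A. t w * mk (hv w) B) = (\<Sum>w\<in>A - {v}. t w * mk (hv w) B)"
      using fA calculation(1) by (intro sum.mono_neutral_right) auto
    ultimately show ?thesis by simp
  qed
  have e: "mk T B / mk T N = (\<Sum>w\<in>A - {v}. u w * (mk (hv w) B / mk (hv w) N))" if "mk N B = 0" for B
    unfolding TB[OF that] sum_divide_distrib
  proof (rule sum.cong[OF refl])
    fix w assume "w \<in> A - {v}"
    hence "0 < mk (hv w) N" using mk_hv_N[of w] A by auto
    thus "t w * mk (hv w) B / mk T N = u w * (mk (hv w) B / mk (hv w) N)" by (simp add: u_def)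
  qed
  have "y T = (\<Sum>w\<in>A - {v}. u w *\<^sub>R y (hv w))"
    by (rule complex_eqI) (simp_all add: y_def e[OF B_orth(1)] e[OF B_orth(2)])
  also have "\<dots> \<in> convex hull ((y \<circ> hv) ` (A - {v}))"
    using fA u0 u1 by (intro convex_sum[OF _ convex_convex_hull]) (auto intro!: hull_inc)
  finally show ?thesis .
qed

text \<open>A combination \<open>T\<close> of the other vertices lies over \<open>z\<close>. Adding
  a multiple of \<open>N\<close>, that is moving vertically towards the cusp, changes neither
  \<open>y\<close> nor the pairing with \<open>N\<close> and reaches the hyperboloid.\<close>

lemma chart_lift:
  assumes A: "A \<subseteq> V" "v \<in> A" and z: "z \<in> convex hull ((y \<circ> hv) ` (A - {v}))"
  shows "\<exists>X\<in>hyp \<inter> cone_on A. mk X N = 1 \<and> y X = z"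
proof -
  have fA: "finite A" using A finite_V finite_subset by blast
  obtain u where u: "\<And>w. w \<in> A - {v} \<Longrightarrow> 0 \<le> u w" "sum u (A - {v}) = 1" "z = (\<Sum>w\<in>A - {v}. u w *\<^sub>R y (hv w))"
    using convex_hull_image_sum[OF _ z] fA by auto
  define T where "T = (\<Sum>w\<in>A - {v}. (u w / mk (hv w) N) *\<^sub>R hv w)"
  have pN: "0 < mk (hv w) N" if "w \<in> A - {v}" for w using mk_hv_N A that by auto
  have TN: "mk T N = 1"
  proof -
    have "mk T N = (\<Sum>w\<in>A - {v}. u w)" unfolding T_def mk_sum_left mk_scale_left
      using pN by (intro sum.cong) (auto simp: less_imp_neq[symmetric])
    thus ?thesis using u by simp
  qed
  have Tc: "T \<in> cone_on (A - {v})" unfolding T_def using u pN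
    by (intro cone_onI divide_nonneg_pos) auto
  have yT: "y T = z"
  proof (rule complex_eqI)
    have e: "mk T B = (\<Sum>w\<in>A - {v}. u w * (mk (hv w) B / mk (hv w) N))" for B
      by (simp add: T_def mk_sum_left mk_scale_left)
    show "Re (y T) = Re z" "Im (y T) = Im z"
      by (simp_all only: y_def TN e[symmetric] u(3) Re_sum Im_sum scaleR_complex.simps complex.sel div_by_1)
  qed
  define \<rho> where "\<rho> = (1 - mk T T) / 2"
  \<comment> \<open>The multiple must be nonnegative for the sum to stay in the cone. Otherwise the
    normalized \<open>T\<close> would be a point of the hull of the other vertices inside the
    horoball.\<close>
  have "mk T T \<le> 1"
  proof (rule ccontr)
    assume c: "\<not> mk T T \<le> 1"
    have TV: "T \<in> cone_on (V - {v})" using Tc cone_on_mono[of "A - {v}" "V - {v}"] A finite_V by auto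
    have sp: "finite (V - {v})" "V - {v} \<subseteq> sphere 0 1" using finite_V V_sphere by auto
    have "T \<noteq> 0" using c by (auto simp: mk_zero_left)
    hence fut: "T \<in> future"
      using c cone_on_causal[OF sp TV] by (auto simp: future_def less_le)
    have "1 < mk (unitv T) N"
      using fut TV by (intro horoball unitv_hyp) (auto simp: unitv_def future_def intro!: cone_on_scale)
    hence "1 < 1 / sqrt (mk T T)" by (simp add: unitv_def mk_linear TN)
    moreover have "1 < sqrt (mk T T)" using c by simp
    ultimately show False by (simp add: divide_simps split: if_splits)
  qed
  hence \<rho>: "0 \<le> \<rho>" by (simp add: \<rho>_def)
  define X where "X = T + \<rho> *\<^sub>R N"
  have XN: "mk X N = 1" "y X = z" using y_add_N TN yT by (simp_all add: X_def)
  have "mk X X = mk T T + 2 * \<rho> * mk T N" by (simp add: X_def mk_linear NN mk_commute[of N T])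
  hence XX: "mk X X = 1" by (simp add: TN \<rho>_def field_simps)
  have vc: "N \<in> cone_on A" unfolding N using a A fA by (intro cone_on_scale cone_on_hv) auto
  have Xc: "X \<in> cone_on A"
    unfolding X_def using Tc cone_on_mono[of "A - {v}" A] fA \<rho> vc by (intro cone_on_add cone_on_scale) auto
  have "snd X \<noteq> 0" using cone_on_causal(3)[OF fA _ Xc] A V_sphere XX by (auto simp: mk_zero_left)
  hence "X \<in> hyp" using XX cone_on_causal(2)[OF fA _ Xc] A V_sphere by (auto simp: hyp_def less_le)
  thus ?thesis using Xc XN by blast
qed

lemma H_M: "x \<in> H \<Longrightarrow> x \<in> M" "x \<in> H \<Longrightarrow> mk (L x) N = 1" "x \<in> H \<Longrightarrow> L x \<in> hyp"
  using L_hyp by (auto simp: H_def)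

text \<open>A face without the vertex \<open>v\<close> lies in the cone of the other vertices and so
  misses the horoball.\<close>

lemma H_face:
  assumes "x \<in> H" "i \<in> I" "x \<in> fc i" shows "v \<in> W i"
proof (rule ccontr)
  assume "v \<notin> W i"
  hence "cone_on (W i) \<subseteq> cone_on (V - {v})" using W_sub[OF assms(2)] finite_V by (intro cone_on_mono) auto
  thus False using horoball[of "L x"] H_M[OF assms(1)] L_cone[OF assms(2,3)] by auto
qed

lemma H_cover: "x \<in> H \<Longrightarrow> \<exists>i\<in>I. v \<in> W i \<and> x \<in> fc i"
  using H_M(1)[of x] H_face[of x] cover by blast

lemma y_H_face:
  assumes "i \<in> I" "v \<in> W i"
  shows "(y \<circ> L) ` (H \<inter> fc i) = convex hull ((y \<circ> hv) ` (W i - {v}))"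
proof
  show "(y \<circ> L) ` (H \<inter> fc i) \<subseteq> convex hull ((y \<circ> hv) ` (W i - {v}))"
    using y_cone[OF W_sub[OF assms(1)] L_cone[OF assms(1)]] H_M(2) by fastforce
  show "convex hull ((y \<circ> hv) ` (W i - {v})) \<subseteq> (y \<circ> L) ` (H \<inter> fc i)"
  proof
    fix z assume "z \<in> convex hull ((y \<circ> hv) ` (W i - {v}))"
    then obtain X where X: "X \<in> hyp \<inter> cone_on (W i)" "mk X N = 1" "y X = z"
      using chart_lift[OF W_sub[OF assms(1)] assms(2)] by blast
    then obtain x where "x \<in> fc i" "L x = X" using L_face[OF assms(1)] by (metis bij_betw_imp_surj_on imageE)
    thus "z \<in> (y \<circ> L) ` (H \<inter> fc i)" using X fc_M[OF assms(1)] by (force simp: H_def)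
  qed
qed

lemma y_H_face_ex:
  assumes "i \<in> I" "v \<in> W i" "z \<in> convex hull ((y \<circ> hv) ` (W i - {v}))"
  shows "\<exists>x. x \<in> H \<and> x \<in> fc i \<and> y (L x) = z"
  using assms(3) unfolding y_H_face[OF assms(1,2), symmetric] by auto

lemma y_H_face_mem:
  assumes "i \<in> I" "x \<in> H" "x \<in> fc i"
  shows "y (L x) \<in> convex hull ((y \<circ> hv) ` (W i - {v}))"
  using y_H_face[OF assms(1) H_face[OF assms(2,1,3)]] assms by (auto simp: set_eq_iff image_iff)

lemma y_H_K: "x \<in> H \<Longrightarrow> y (L x) \<in> K"
proof -
  assume x: "x \<in> H"
  then obtain i where i: "i \<in> I" "x \<in> fc i" using H_cover by blast
  have "L x \<in> cone_on V" using L_cone[OF i] cone_on_mono[OF W_sub[OF i(1)] finite_V] by blast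
  thus ?thesis unfolding K_def using y_cone[of V] H_M(2)[OF x] by simp
qed

lemma zero_K: "0 \<in> K"
  unfolding K_def using vq y_Q by (intro hull_inc) (force simp: image_iff)

lemma compact_K: "compact K" and convex_K: "convex K"
  unfolding K_def using finite_V by (auto intro!: finite_imp_compact_convex_hull)

lemma K_halfplane: "(\<And>w. w \<in> V - {v} \<Longrightarrow> c \<le> n \<bullet> y (hv w)) \<Longrightarrow> z \<in> K \<Longrightarrow> c \<le> n \<bullet> z"
  using hull_minimal[of "(y \<circ> hv) ` (V - {v})" "{z. n \<bullet> z \<ge> c}" convex] convex_halfspace_ge[of c n]
  unfolding K_def by auto

text \<open>The normal vector of a face at \<open>v\<close> is orthogonal to \<open>N\<close>, so in
  the chart it is an affine function; its zero line supports \<open>K\<close> and contains exactly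
  the projections of the vertices of the face.\<close>

lemma face_line:
  assumes i: "i \<in> I" "v \<in> W i"
  shows "\<exists>n c. n \<noteq> 0 \<and> (\<forall>z\<in>K. c \<le> n \<bullet> z) \<and> (\<forall>w\<in>V - {v}. n \<bullet> y (hv w) = c \<longleftrightarrow> w \<in> W i)"
proof -
  obtain \<nu> where \<nu>: "\<nu> \<noteq> 0" "\<And>w. w \<in> V \<Longrightarrow> 0 \<le> mk \<nu> (hv w)" "\<And>w. w \<in> V \<Longrightarrow> mk \<nu> (hv w) = 0 \<longleftrightarrow> w \<in> W i"
    using normal[OF i(1)] by blast
  have \<nu>N: "mk \<nu> N = 0" using \<nu>(3)[OF vq(1)] i by (simp add: N mk_linear)
  define n where "n = Complex (- mk \<nu> B1) (- mk \<nu> B2)"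
  define c where "c = - mk \<nu> Q / mk N Q"
  have e: "mk \<nu> (hv w) = mk (hv w) N * (n \<bullet> y (hv w) - c)" if "w \<in> V - {v}" for w
  proof -
    have P: "0 < mk (hv w) N" using mk_hv_N that by blast
    define r1 r2 where "r1 = mk (hv w) B1 / mk (hv w) N" and "r2 = mk (hv w) B2 / mk (hv w) N"
    have B: "mk (hv w) B1 = r1 * mk (hv w) N" "mk (hv w) B2 = r2 * mk (hv w) N" using P by (auto simp: r1_def r2_def)
    have "mk \<nu> (hv w) = mk (hv w) N * mk \<nu> Q / mk N Q - r1 * mk (hv w) N * mk \<nu> B1 - r2 * mk (hv w) N * mk \<nu> B2"
      using mk_expand[of "hv w" \<nu>] \<nu>N by (simp add: B mk_commute[of \<nu> "hv w"])
    also have "\<dots> = mk (hv w) N * (- mk \<nu> B1 * r1 + - mk \<nu> B2 * r2 - c)"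
      by (simp add: c_def algebra_simps)
    finally show ?thesis unfolding n_def y_def complex_inner_eq r1_def[symmetric] r2_def[symmetric] by simp
  qed
  have n0: "n \<noteq> 0"
  proof
    assume "n = 0"
    hence B: "mk \<nu> B1 = 0" "mk \<nu> B2 = 0" by (auto simp: n_def complex_eq_iff)
    obtain w where w: "w \<in> W i" "w \<noteq> v" using W_two[OF i(1)] by blast
    hence wV: "w \<in> V - {v}" using W_sub[OF i(1)] by blast
    have "mk \<nu> (hv w) = 0" using \<nu>(3) w wV by blast
    hence "c = 0" using e[OF wV] mk_hv_N[of w] wV \<open>n = 0\<close> by auto
    hence "mk \<nu> Q = 0" using NQ by (simp add: c_def)
    thus False using frame[of \<nu>] \<nu>N B \<nu>(1) by simp
  qed
  have "c \<le> n \<bullet> y (hv w)" if w: "w \<in> V - {v}" for w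
    using e[OF w] \<nu>(2)[of w] mk_hv_N[of w] w by (simp add: zero_le_mult_iff)
  hence "\<forall>z\<in>K. c \<le> n \<bullet> z" using K_halfplane by blast
  moreover have "\<forall>w\<in>V - {v}. n \<bullet> y (hv w) = c \<longleftrightarrow> w \<in> W i"
  proof
    fix w assume w: "w \<in> V - {v}"
    hence "0 < mk (hv w) N" using mk_hv_N by blast
    hence "n \<bullet> y (hv w) = c \<longleftrightarrow> mk \<nu> (hv w) = 0" unfolding e[OF w] by simp
    thus "n \<bullet> y (hv w) = c \<longleftrightarrow> w \<in> W i" using \<nu>(3) w by blast
  qed
  ultimately show ?thesis using n0 by blast
qed

lemma face_line_hull:
  assumes "\<And>w. w \<in> W i - {v} \<Longrightarrow> n \<bullet> y (hv w) = c" "z \<in> convex hull ((y \<circ> hv) ` (W i - {v}))"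
  shows "n \<bullet> z = c"
  using hull_minimal[of "(y \<circ> hv) ` (W i - {v})" "{z. n \<bullet> z = c}" convex] convex_hyperplane[of n c] assms by auto

text \<open>The link of a planar polygon is a segment without interior; there the line containing it
  supports it at every point, also at relatively interior ones.\<close>

lemma support_K: 
  assumes "z \<in> K" "z \<notin> interior K"
  shows "\<exists>n. n \<noteq> 0 \<and> (\<forall>k\<in>K. n \<bullet> z \<le> n \<bullet> k)"
proof (cases "interior K = {}")
  case True
  then obtain n c where "n \<noteq> 0" "K \<subseteq> {x. n \<bullet> x = c}"
    using empty_interior_subset_hyperplane[OF convex_K] by metis
  hence "n \<bullet> k = c" if "k \<in> K" for k using that by blast
  thus ?thesis using assms(1) \<open>n \<noteq> 0\<close> by (intro exI[of _ n]) simp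
next
  case False
  hence "z \<notin> rel_interior K" using assms interior_rel_interior_gen[of K] rel_interior_nonempty_interior[of K] by auto
  thus ?thesis using supporting_hyperplane_rel_boundary[OF convex_K assms(1)] by metis
qed

text \<open>A supporting line at \<open>z\<close> comes from a vector \<nu>, and
  \<open>support\<close> provides a face containing all vertices where \<nu> vanishes. In a convex
  combination for \<open>z\<close> the other vertices have weight 0.\<close>

lemma boundary_K:
  assumes "z \<in> K" "z \<notin> interior K"
  shows "\<exists>i\<in>I. v \<in> W i \<and> z \<in> convex hull ((y \<circ> hv) ` (W i - {v}))"
proof -
  obtain n where n: "n \<noteq> 0" "\<And>k. k \<in> K \<Longrightarrow> n \<bullet> z \<le> n \<bullet> k" using support_K[OF assms] by blast
  define \<nu> where "\<nu> = Re n *\<^sub>R B1 + Im n *\<^sub>R B2 - (n \<bullet> z) *\<^sub>R N"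
  have yK: "y (hv w) \<in> K" if "w \<in> V - {v}" for w unfolding K_def using that by (auto intro!: hull_inc)
  have e: "mk \<nu> (hv w) = mk (hv w) N * (n \<bullet> y (hv w) - n \<bullet> z)" "0 < mk (hv w) N" if "w \<in> V - {v}" for w
    using linear_in_chart[of "hv w" n "n \<bullet> z"] mk_hv_N[of w] that by (auto simp: \<nu>_def)
  have v0: "mk \<nu> (hv v) = 0" by (simp add: \<nu>_def mk_linear hv_v_orth)
  have "0 \<le> mk \<nu> (hv w)" if "w \<in> V" for w
    using e[of w] n(2)[OF yK[of w]] that v0 by (cases "w = v") auto
  moreover have "\<nu> \<noteq> 0" unfolding \<nu>_def using frame_vector_neq_0[OF n(1)] .
  ultimately obtain i where i: "i \<in> I" "{w\<in>V. mk \<nu> (hv w) = 0} \<subseteq> W i"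
    using support[of \<nu>] by blast
  have fV: "finite (V - {v})" using finite_V by simp
  obtain u where u: "\<forall>w\<in>V - {v}. 0 \<le> u w" "sum u (V - {v}) = 1" "z = (\<Sum>w\<in>V - {v}. u w *\<^sub>R y (hv w))"
    using convex_hull_image_sum[OF fV, of z "y \<circ> hv"] assms(1) unfolding K_def by auto
  have "(\<Sum>w\<in>V - {v}. u w * (n \<bullet> y (hv w) - n \<bullet> z)) = n \<bullet> z - n \<bullet> z"
  proof -
    have "(\<Sum>w\<in>V - {v}. u w * (n \<bullet> y (hv w) - n \<bullet> z)) = (\<Sum>w\<in>V - {v}. u w * (n \<bullet> y (hv w))) - sum u (V - {v}) * (n \<bullet> z)"
      by (simp only: right_diff_distrib sum_subtractf sum_distrib_right)
    also have "(\<Sum>w\<in>V - {v}. u w * (n \<bullet> y (hv w))) = n \<bullet> z"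
      by (subst u(3)) (simp only: inner_sum_right inner_scaleR_right)
    finally show ?thesis by (simp only: u(2) mult_1)
  qed
  hence s0: "(\<Sum>w\<in>V - {v}. u w * (n \<bullet> y (hv w) - n \<bullet> z)) = 0" by simp
  have "0 \<le> u w * (n \<bullet> y (hv w) - n \<bullet> z)" if w: "w \<in> V - {v}" for w
    using u(1)[rule_format, OF w] n(2)[OF yK[OF w]] by (intro mult_nonneg_nonneg) auto
  hence u0: "u w * (n \<bullet> y (hv w) - n \<bullet> z) = 0" if "w \<in> V - {v}" for w
    using s0 sum_nonneg_eq_0_iff[OF fV, of "\<lambda>w. u w * (n \<bullet> y (hv w) - n \<bullet> z)"] that by blast
  hence uW: "u w = 0" if "w \<in> (V - {v}) - (W i - {v})" for w
  proof -
    have w: "w \<in> V - {v}" "w \<notin> W i" using that by auto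
    hence "mk \<nu> (hv w) \<noteq> 0" using i(2) by blast
    thus ?thesis using e(1)[OF w(1)] u0[OF w(1)] by auto
  qed
  have sub: "W i - {v} \<subseteq> V - {v}" using W_sub[OF i(1)] by blast
  have uW': "\<forall>w\<in>V - {v} - (W i - {v}). u w = 0" using uW by blast
  hence uW'': "\<forall>w\<in>V - {v} - (W i - {v}). u w *\<^sub>R y (hv w) = 0" by (metis scaleR_zero_left)
  have z: "z = (\<Sum>w\<in>W i - {v}. u w *\<^sub>R (y \<circ> hv) w)"
    unfolding u(3) sum.mono_neutral_right[OF fV sub uW''] by simp
  have 1: "sum u (W i - {v}) = 1"
    using sum.mono_neutral_right[OF fV sub uW'] u(2) by metis
  have "z \<in> convex hull ((y \<circ> hv) ` (W i - {v}))"
    unfolding z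
  proof (rule convex_sum[OF finite_subset[OF sub fV] convex_convex_hull 1])
    fix w assume w: "w \<in> W i - {v}"
    thus "0 \<le> u w" using u(1) sub by blast
    show "(y \<circ> hv) w \<in> convex hull ((y \<circ> hv) ` (W i - {v}))" using w by (intro hull_inc imageI)
  qed
  thus ?thesis using i v0 vq by blast
qed

definition nonplanar :: bool where
  "nonplanar \<longleftrightarrow> (\<forall>\<nu>. (\<forall>w\<in>V. mk \<nu> (hv w) = 0) \<longrightarrow> \<nu> = 0)"

lemma interior_K:
  assumes nonplanar shows "interior K \<noteq> {}"
proof
  assume "interior K = {}"
  then obtain n c where n: "n \<noteq> 0" "K \<subseteq> {x. n \<bullet> x = c}"
    using empty_interior_subset_hyperplane[OF convex_K] by metis
  define \<nu> where "\<nu> = Re n *\<^sub>R B1 + Im n *\<^sub>R B2 - c *\<^sub>R N"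
  have "mk \<nu> (hv w) = 0" if w: "w \<in> V" for w
  proof (cases "w = v")
    case True
    show ?thesis unfolding True by (simp add: \<nu>_def mk_linear hv_v_orth)
  next
    case False
    hence "y (hv w) \<in> K" unfolding K_def using w by (auto intro!: hull_inc)
    thus ?thesis using linear_in_chart[of "hv w" n c] mk_hv_N[OF w False] n(2) by (auto simp: \<nu>_def)
  qed
  thus False using assms frame_vector_neq_0[OF n(1)] \<nu>_def nonplanar_def by blast
qed

lemma nonplanar_inj:
  assumes nonplanar "x \<in> M" "x' \<in> M" "L x = L x'" shows "x = x'"
  using not_inj[OF assms(2-4)] assms(1) nonplanar_def by blast

lemma finite_fibre: "finite {x\<in>H. y (L x) = z}" "card {x\<in>H. y (L x) = z} \<le> 2"
proof -
  have "\<exists>X. {x\<in>H. y (L x) = z} \<subseteq> {x\<in>M. L x = X}"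
  proof (cases "{x\<in>H. y (L x) = z} = {}")
    case False
    then obtain x0 where x0: "x0 \<in> H" "y (L x0) = z" by blast
    have "L x = L x0" if "x \<in> H" "y (L x) = z" for x
      using y_inj[of "L x" "L x0"] that x0 H_M by auto
    thus ?thesis using H_M by blast
  qed blast
  then obtain X where X: "{x\<in>H. y (L x) = z} \<subseteq> {x\<in>M. L x = X}" by blast
  show "finite {x\<in>H. y (L x) = z}" using finite_subset[OF X fibre(1)] .
  show "card {x\<in>H. y (L x) = z} \<le> 2" using card_mono[OF fibre(1) X] fibre(2)[of X] by linarith
qed

text \<open>An edge meeting the horosphere ends at \<open>v\<close>, since otherwise it would lie in
  the cone of the other vertices. In the chart it is vertical, thus one point over its other end,
  and the wedge along it becomes a plane angle at this point.\<close>

lemma edge_in_chart: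
  assumes i: "i \<in> I" "j \<in> I" "i \<noteq> j" and x: "x \<in> H" "x \<in> fc i" "x \<in> fc j"
  shows "\<exists>w\<in>V - {v}. y (L x) = y (hv w)"
    and "x1 \<in> H \<Longrightarrow> x2 \<in> H \<Longrightarrow> x1 \<in> fc i - fc j \<Longrightarrow> x2 \<in> fc j - fc i \<Longrightarrow> w \<in> V - {v} \<Longrightarrow>
      \<exists>s t. 0 \<le> s \<and> 0 \<le> t \<and> y (hv w) - y (L x) = s *\<^sub>R (y (L x1) - y (L x)) + t *\<^sub>R (y (L x2) - y (L x))"
proof -
  obtain e1 e2 where e: "e1 \<in> W i \<inter> W j" "e2 \<in> W i \<inter> W j" "e1 \<noteq> e2"
    and ex: "\<exists>\<alpha> \<beta>. 0 < \<alpha> \<and> 0 < \<beta> \<and> L x = \<alpha> *\<^sub>R hv e1 + \<beta> *\<^sub>R hv e2"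
    and wedge: "\<forall>w\<in>V. \<forall>y\<in>fc i - fc j. \<forall>z\<in>fc j - fc i. in_wedge (hv e1) (hv e2) (L y) (L z) (hv w)"
    using edge[OF i x(2,3)]
    by - (erule exE, erule exE, (erule conjE)+, rule that; assumption)
  obtain \<alpha> \<beta> where ab: "0 < \<alpha>" "0 < \<beta>" "L x = \<alpha> *\<^sub>R hv e1 + \<beta> *\<^sub>R hv e2"
    using ex by - (elim exE conjE; rule that; assumption)
  have eV: "e1 \<in> V" "e2 \<in> V" using e W_sub i by auto
  have "e1 = v \<or> e2 = v"
  proof (rule ccontr)
    assume "\<not> ?thesis"
    hence "L x \<in> cone_on (V - {v})" unfolding ab(3) using ab eV finite_V
      by (intro cone_on_add cone_on_scale cone_on_hv) auto
    thus False using horoball[of "L x"] H_M[OF x(1)] by auto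
  qed
  then obtain b' \<alpha>' \<beta>' where b': "b' \<in> V - {v}" "0 < \<beta>'" "L x = \<alpha>' *\<^sub>R hv v + \<beta>' *\<^sub>R hv b'"
    and wedge': "\<And>w y z. w \<in> V \<Longrightarrow> y \<in> fc i - fc j \<Longrightarrow> z \<in> fc j - fc i \<Longrightarrow> in_wedge (hv v) (hv b') (L y) (L z) (hv w)"
  proof
    assume v1: "e1 = v"
    show thesis
      by (rule that[of e2 \<beta> \<alpha>]) (use v1 e eV ab wedge in auto)
  next
    assume v2: "e2 = v"
    show thesis
    proof (rule that[of e1 \<alpha> \<beta>])
      fix w y z assume "w \<in> V" "y \<in> fc i - fc j" "z \<in> fc j - fc i"
      then obtain \<alpha> \<beta> s t where "0 \<le> s \<and> 0 \<le> t \<and> hv w = \<alpha> *\<^sub>R hv e1 + \<beta> *\<^sub>R hv e2 + s *\<^sub>R L y + t *\<^sub>R L z"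
        using wedge unfolding in_wedge_def by blast
      thus "in_wedge (hv v) (hv e1) (L y) (L z) (hv w)"
        unfolding in_wedge_def using v2 by (intro exI[of _ \<beta>] exI[of _ \<alpha>] exI[of _ s] exI[of _ t]) (simp add: add.commute)
    qed (use v2 e eV ab in \<open>auto simp: add.commute\<close>)
  qed
  have pb: "0 < mk (hv b') N" using mk_hv_N b' by blast
  have B0: "mk (hv v) B1 = 0" "mk (hv v) B2 = 0" using B_orth a by (auto simp: N mk_linear)
  have yx: "y (L x) = y (hv b')"
    using b' pb by (simp add: y_def mk_linear B0 mk_hv_v_N)
  thus "\<exists>w\<in>V - {v}. y (L x) = y (hv w)" using b' by blast
  assume x12: "x1 \<in> H" "x2 \<in> H" "x1 \<in> fc i - fc j" "x2 \<in> fc j - fc i" and w: "w \<in> V - {v}"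
  obtain \<alpha> \<beta> s t where st: "0 \<le> s" "0 \<le> t" and hw: "hv w = \<alpha> *\<^sub>R hv v + \<beta> *\<^sub>R hv b' + s *\<^sub>R L x1 + t *\<^sub>R L x2"
    using wedge'[of w x1 x2] w x12 unfolding in_wedge_def by blast
  define m where "m = mk (hv w) N"
  have m: "0 < m" using mk_hv_N w by (auto simp: m_def)
  have mN: "m = \<beta> * mk (hv b') N + s + t"
    unfolding m_def hw using H_M(2)[OF x12(1)] H_M(2)[OF x12(2)] by (simp add: mk_linear mk_hv_v_N)
  have c: "mk (hv w) B / m - mk (hv b') B / mk (hv b') N
     = s / m * (mk (L x1) B - mk (hv b') B / mk (hv b') N) + t / m * (mk (L x2) B - mk (hv b') B / mk (hv b') N)"
    if "mk (hv v) B = 0" for B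
  proof -
    define r where "r = mk (hv b') B / mk (hv b') N"
    have "mk (hv w) B = \<beta> * mk (hv b') B + s * mk (L x1) B + t * mk (L x2) B"
      unfolding hw using that by (simp add: mk_linear)
    also have "mk (hv b') B = r * mk (hv b') N" using pb by (simp add: r_def)
    finally have "mk (hv w) B - m * r = s * (mk (L x1) B - r) + t * (mk (L x2) B - r)"
      unfolding mN by (simp add: algebra_simps)
    hence "(mk (hv w) B - m * r) / m = (s * (mk (L x1) B - r) + t * (mk (L x2) B - r)) / m" by simp
    thus ?thesis using m by (simp add: r_def[symmetric] diff_divide_distrib add_divide_distrib)
  qed
  have "y (hv w) - y (L x) = (s / m) *\<^sub>R (y (L x1) - y (L x)) + (t / m) *\<^sub>R (y (L x2) - y (L x))"
    unfolding yx by (rule complex_eqI)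
      (use c[OF B0(1)] c[OF B0(2)] H_M(2)[OF x12(1)] H_M(2)[OF x12(2)] in \<open>simp_all add: y_def m_def\<close>)
  thus "\<exists>s t. 0 \<le> s \<and> 0 \<le> t \<and> y (hv w) - y (L x) = s *\<^sub>R (y (L x1) - y (L x)) + t *\<^sub>R (y (L x2) - y (L x))"
    using st m by (intro exI[of _ "s / m"] exI[of _ "t / m"]) auto
qed

lemma finite_edge_points: "finite {x\<in>H. \<exists>i\<in>I. \<exists>j\<in>I. i \<noteq> j \<and> x \<in> fc i \<and> x \<in> fc j}"
proof (rule finite_subset)
  show "{x\<in>H. \<exists>i\<in>I. \<exists>j\<in>I. i \<noteq> j \<and> x \<in> fc i \<and> x \<in> fc j} \<subseteq> (\<Union>w\<in>V. {x\<in>H. y (L x) = y (hv w)})"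
    using edge_in_chart(1) by fastforce
  show "finite (\<Union>w\<in>V. {x\<in>H. y (L x) = y (hv w)})" using finite_V finite_fibre by blast
qed

text \<open>The images of the faces at \<open>v\<close> are closed sets covering the frontier of
  \<open>K\<close>, which is connected. Faces with a common point in the chart share a point of
  \<open>M\<close>, as \<open>L\<close> is injective here; so a set of faces closed under adjacency
  cannot be proper.\<close>

lemma face_chain:
  assumes np: nonplanar and A: "A \<subseteq> {i\<in>I. v \<in> W i}" "A \<noteq> {}"
    and step: "\<And>i j. i \<in> A \<Longrightarrow> j \<in> I \<Longrightarrow> v \<in> W j \<Longrightarrow> fc i \<inter> fc j \<noteq> {} \<Longrightarrow> j \<in> A"
  shows "A = {i\<in>I. v \<in> W i}"
proof (rule ccontr)
  assume nA: "A \<noteq> {i\<in>I. v \<in> W i}"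
  define B where "B = {i\<in>I. v \<in> W i} - A"
  define S where "S i = convex hull ((y \<circ> hv) ` (W i - {v}))" for i
  have B: "B \<noteq> {}" using A nA by (auto simp: B_def)
  have sub: "S i \<subseteq> frontier K" "S i \<noteq> {}" if i: "i \<in> I" "v \<in> W i" for i
  proof -
    obtain n c where n: "n \<noteq> 0" "\<forall>z\<in>K. c \<le> n \<bullet> z" "\<forall>w\<in>V - {v}. n \<bullet> y (hv w) = c \<longleftrightarrow> w \<in> W i"
      using face_line[OF i] by blast
    have nS: "n \<bullet> z = c" if "z \<in> S i" for z
      using face_line_hull[of i n c z] n(3) that W_sub[OF i(1)] unfolding S_def by blast
    have SK: "S i \<subseteq> K" unfolding S_def K_def using W_sub[OF i(1)] by (intro hull_mono) auto
    have "z \<notin> interior K" if z: "z \<in> S i" for z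
    proof
      assume "z \<in> interior K"
      then obtain e where e: "e > 0" "cball z e \<subseteq> K" by (metis mem_interior_cball)
      have "z - (e / norm n) *\<^sub>R n \<in> cball z e" using n(1) e(1) by (simp add: dist_norm)
      hence "c \<le> n \<bullet> (z - (e / norm n) *\<^sub>R n)" using e n(2) by blast
      also have "\<dots> = c - e * norm n" using nS[OF z] n(1)
        by (simp add: inner_diff_right dot_square_norm power2_eq_square)
      finally show False using e(1) n(1) by (simp add: mult_le_0_iff)
    qed
    thus "S i \<subseteq> frontier K" using SK compact_K by (auto simp: frontier_def compact_imp_closed)
    show "S i \<noteq> {}" using W_two[OF i(1)] by (auto simp: S_def)
  qed
  have cover_fr: "frontier K \<subseteq> \<Union>(S ` A) \<union> \<Union>(S ` B)"
  proof
    fix z assume "z \<in> frontier K"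
    hence "z \<in> K" "z \<notin> interior K" using compact_K by (auto simp: frontier_def compact_imp_closed)
    thus "z \<in> \<Union>(S ` A) \<union> \<Union>(S ` B)" using boundary_K unfolding S_def B_def by blast
  qed
  have disj: "\<Union>(S ` A) \<inter> \<Union>(S ` B) = {}"
  proof (rule ccontr)
    assume "\<not> ?thesis"
    then obtain i j z where ij: "i \<in> A" "j \<in> B" "z \<in> S i" "z \<in> S j" by blast
    have i: "i \<in> I" "v \<in> W i" and j: "j \<in> I" "v \<in> W j" using ij A by (auto simp: B_def)
    obtain x where x: "x \<in> H" "x \<in> fc i" "y (L x) = z" using y_H_face_ex[OF i] ij(3) unfolding S_def by blast
    obtain x' where x': "x' \<in> H" "x' \<in> fc j" "y (L x') = z" using y_H_face_ex[OF j] ij(4) unfolding S_def by blast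
    have "L x = L x'" using y_inj[of "L x" "L x'"] x x' H_M by auto
    hence "x = x'" using nonplanar_inj[OF np] H_M x x' by blast
    hence "j \<in> A" using step[OF ij(1) j] x x' by blast
    thus False using ij(2) by (simp add: B_def)
  qed
  have "finite {i\<in>I. v \<in> W i}" using finite_I by simp
  hence fin: "finite A" "finite B" using finite_subset[OF A(1)] by (auto simp: B_def)
  have cl: "closed (S i)" if "i \<in> I" for i
    unfolding S_def using finite_W[OF that]
    by (intro compact_imp_closed finite_imp_compact_convex_hull finite_imageI finite_Diff)
  have "closed (\<Union>(S ` A))" "closed (\<Union>(S ` B))" using fin cl A by (auto simp: B_def intro!: closed_UN)
  moreover have "connected (frontier K)"
  proof -
    have "aff_dim K = 2" using aff_dim_nonempty_interior[OF interior_K[OF np]] by simp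
    hence "connected (rel_frontier K)" using compact_K convex_K by (intro connected_sphere_gen) (auto simp: compact_imp_bounded)
    thus ?thesis using rel_frontier_nonempty_interior[OF interior_K[OF np]] by simp
  qed
  moreover have "\<Union>(S ` A) \<inter> frontier K \<noteq> {}"
  proof -
    obtain i where "i \<in> A" using A(2) by blast
    moreover from this have "i \<in> I" "v \<in> W i" using A(1) by auto
    ultimately show ?thesis using sub[of i] by blast
  qed
  moreover have "\<Union>(S ` B) \<inter> frontier K \<noteq> {}"
  proof -
    obtain i where "i \<in> B" using B by blast
    moreover from this have "i \<in> I" "v \<in> W i" by (auto simp: B_def)
    ultimately show ?thesis using sub[of i] by blast
  qed
  moreover have "\<Union>(S ` A) \<inter> \<Union>(S ` B) \<inter> frontier K = {}" using disj by (simp only: Int_empty_left)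
  ultimately show False using cover_fr unfolding connected_closed by (metis (no_types))
qed

end

subsection \<open>The correspondence of cusps\<close>

lemma quadratic_vanishing:
  fixes a b c \<delta> :: real
  assumes "0 < \<delta>" "\<And>s. 0 < s \<Longrightarrow> s \<le> \<delta> \<Longrightarrow> a + b * s + c * s\<^sup>2 = 0"
  shows "a = 0" "b = 0" "c = 0"
proof -
  have e: "a + b * \<delta> + c * \<delta>\<^sup>2 = 0" "a + b * \<delta> / 2 + c * \<delta>\<^sup>2 / 4 = 0" "a + b * \<delta> / 4 + c * \<delta>\<^sup>2 / 16 = 0"
    using assms(2)[of \<delta>] assms(2)[of "\<delta> / 2"] assms(2)[of "\<delta> / 4"] assms(1) by (simp_all add: power_divide)
  thus "a = 0" by linarith
  have "b * \<delta> = 0" "c * \<delta>\<^sup>2 = 0" using e by linarith+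
  thus "b = 0" "c = 0" using assms(1) by simp_all
qed

lemma affine_agree:
  fixes A B C D :: "'a::real_vector"
  assumes "0 < \<delta>" "\<And>s. 0 < s \<Longrightarrow> s \<le> \<delta> \<Longrightarrow> A + s *\<^sub>R B = C + s *\<^sub>R D"
  shows "A = C" "B = D"
proof -
  have e: "A + \<delta> *\<^sub>R B = C + \<delta> *\<^sub>R D" "A + (\<delta> / 2) *\<^sub>R B = C + (\<delta> / 2) *\<^sub>R D"
    using assms by auto
  have "(\<delta> / 2) *\<^sub>R (B - D) = (A + \<delta> *\<^sub>R B - (C + \<delta> *\<^sub>R D)) - (A + (\<delta> / 2) *\<^sub>R B - (C + (\<delta> / 2) *\<^sub>R D))"
    by (simp add: algebra_simps flip: scaleR_left.add)
  thus "B = D" using e assms(1) by simp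
  thus "A = C" using e by simp
qed

context ideal_surface
begin

text \<open>The vector \<open>hv v\<close> itself is a supporting vector that vanishes at
  \<open>v\<close>.\<close>

lemma V_in_face: assumes "v \<in> V" shows "\<exists>i\<in>I. v \<in> W i"
proof -
  have "hv v \<noteq> 0" by (simp add: hv_def zero_prod_def)
  moreover have "\<forall>w\<in>V. 0 \<le> mk (hv v) (hv w)" using mk_hv_sphere_nonneg norm_V assms by blast
  ultimately obtain i where "i \<in> I" "{w\<in>V. mk (hv v) (hv w) = 0} \<subseteq> W i" using support by blast
  thus ?thesis using assms mk_hv_self_sphere[OF norm_V[OF assms]] by blast
qed

lemma hv_fcone: "i \<in> I \<Longrightarrow> v \<in> W i \<Longrightarrow> hv v \<in> cone_on (W i)"
  using cone_on_hv finite_W by blast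

lemma two_vertices_fcone:
  assumes i: "i \<in> I" and vw: "v \<in> W i" "w \<in> W i" "v \<noteq> w" and ab: "0 < \<alpha>" "0 < \<beta>"
  shows "\<alpha> *\<^sub>R hv v + \<beta> *\<^sub>R hv w \<in> fcone i"
proof -
  have n: "norm v = 1" "norm w = 1" using W_sphere[OF i] vw by auto
  have "0 < \<alpha> * \<beta> * mk (hv v) (hv w)" using mk_hv_sphere_pos[OF n vw(3)] ab by simp
  hence "0 < mk (\<alpha> *\<^sub>R hv v + \<beta> *\<^sub>R hv w) (\<alpha> *\<^sub>R hv v + \<beta> *\<^sub>R hv w)"
    using n by (simp add: mk_linear mk_hv_self_sphere mk_commute[of "hv w" "hv v"] algebra_simps)
  thus ?thesis unfolding fcone_def future_def using ab vw hv_fcone[OF i]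
    by (auto intro!: cone_on_add cone_on_scale)
qed

lemma fcone_nonempty: "i \<in> I \<Longrightarrow> v \<in> W i \<Longrightarrow> \<exists>T. T \<in> fcone i"
  using W_two[of i] two_vertices_fcone[of i _ _ 1 1] zero_less_one by blast

lemma cusp_chart_exists:
  assumes "v \<in> V" "q \<in> V" "v \<noteq> q"
  shows "\<exists>a0>0. \<forall>a\<ge>a0. \<forall>b>0. \<exists>B1 B2. cusp_chart M d V I W fc L v q a b B1 B2 (a *\<^sub>R hv v) (b *\<^sub>R hv q)"
proof -
  obtain B1 B2 where B: "mk B1 B1 = - 1" "mk B2 B2 = - 1" "mk B1 B2 = 0"
    "\<And>X. X = (mk X (hv q) / mk (hv v) (hv q)) *\<^sub>R hv v + (mk X (hv v) / mk (hv v) (hv q)) *\<^sub>R hv q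
     - mk X B1 *\<^sub>R B1 - mk X B2 *\<^sub>R B2"
    using null_frame[OF norm_V[OF assms(1)] norm_V[OF assms(2)] assms(3)] by blast
  obtain a0 where a0: "a0 > 0" "\<And>a X. a \<ge> a0 \<Longrightarrow> X \<in> hyp \<inter> cone_on (V - {v}) \<Longrightarrow> 1 < mk X (a *\<^sub>R hv v)"
    using exists_horoball[OF assms(1)] by blast
  have "cusp_chart M d V I W fc L v q a b B1 B2 (a *\<^sub>R hv v) (b *\<^sub>R hv q)" if "a0 \<le> a" "0 < b" for a b
  proof unfold_locales
    show "X = (mk X (b *\<^sub>R hv q) / mk (a *\<^sub>R hv v) (b *\<^sub>R hv q)) *\<^sub>R a *\<^sub>R hv v +
         (mk X (a *\<^sub>R hv v) / mk (a *\<^sub>R hv v) (b *\<^sub>R hv q)) *\<^sub>R b *\<^sub>R hv q -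
         mk X B1 *\<^sub>R B1 - mk X B2 *\<^sub>R B2" for X
      using that a0(1) by (subst B(4)) (simp add: mk_linear)
    show "1 < mk X (a *\<^sub>R hv v)" if "X \<in> hyp" "X \<in> cone_on (V - {v})" for X
      using a0(2) \<open>a0 \<le> a\<close> that by blast
  qed (use assms that a0(1) B in auto)
  thus ?thesis using a0(1) by blast
qed

lemma cusp_chart_exists2:
  assumes "v \<in> V"
  shows "\<exists>q a b B1 B2 N Q. cusp_chart M d V I W fc L v q a b B1 B2 N Q"
proof -
  obtain i where i: "i \<in> I" "v \<in> W i" using V_in_face[OF assms] by blast
  obtain w w' where "w \<in> W i" "w' \<in> W i" "w \<noteq> w'" using W_two[OF i(1)] by blast
  then obtain q where q: "q \<in> V" "v \<noteq> q" using W_sub[OF i(1)] by (cases "v = w") auto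
  obtain a0 where "a0 > 0" and a0: "\<And>a b. a0 \<le> a \<Longrightarrow> 0 < b \<Longrightarrow>
      \<exists>B1 B2. cusp_chart M d V I W fc L v q a b B1 B2 (a *\<^sub>R hv v) (b *\<^sub>R hv q)"
    using cusp_chart_exists[OF assms q] by blast
  thus ?thesis using a0[OF order_refl zero_less_one] by blast
qed

lemma planar_or_inj: "(\<exists>\<nu>. \<nu> \<noteq> 0 \<and> (\<forall>w\<in>V. mk \<nu> (hv w) = 0)) \<or> inj_on L M"
proof (cases "inj_on L M")
  case False
  then obtain x y where "x \<in> M" "y \<in> M" "L x = L y" "x \<noteq> y" unfolding inj_on_def by blast
  from not_inj[OF this] show ?thesis ..
qed simp

end

context two_surfaces
begin

lemma swap: "two_surfaces M d V' I' W' fc' L' V I W fc L"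
  by unfold_locales

section \<open>The development along rays issuing from a cusp\<close>

lemma dev_fcone:
  assumes "i \<in> I" "T \<in> P.fcone i" "j \<in> I'" "P.sec i T \<in> fc' j"
  shows "dev i T \<in> Q.fcone j" "Q.sec j (dev i T) = P.sec i T" "unitv (dev i T) = L' (P.sec i T)"
proof -
  have p: "0 < sqrt (mk T T)" using assms(2) by (auto simp: P.fcone_def future_def)
  show u: "unitv (dev i T) = L' (P.sec i T)"
    unfolding dev_def unitv_scale[OF p] by (rule unitv_of_hyp[OF Q.L_hyp[OF P.sec_props(3)[OF assms(1,2)]]])
  show f: "dev i T \<in> Q.fcone j" unfolding dev_def
    using Q.sec_L(1)[OF assms(3,4)] p by (intro Q.fcone_scale)
  show "Q.sec j (dev i T) = P.sec i T" using Q.sec_eqI[OF assms(3) f assms(4)] u by simp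
qed

text \<open>Near a vertex the development along the ray is affine, \<open>A + s *\<^sub>R Y\<close>.
  Comparing coefficients of \<open>mk\<close> with itself makes \<open>A\<close> null and nonzero,
  so it is a multiple of some \<open>hv p'\<close>. As a limit of points of one face,
  \<open>p'\<close> lies in the hull of its vertices, hence is one of them.\<close>

lemma dev_ray:
  assumes i: "i \<in> I" and p: "p \<in> W i" and T: "T \<in> P.fcone i"
  shows "\<exists>p' c \<delta> Y. \<exists>j\<in>I'. p' \<in> W' j \<and> 0 < c \<and> 0 < \<delta> \<and>
    (\<forall>s. 0 < s \<longrightarrow> s \<le> \<delta> \<longrightarrow> P.sec i (hv p + s *\<^sub>R T) \<in> fc' j \<and> dev i (hv p + s *\<^sub>R T) = c *\<^sub>R hv p' + s *\<^sub>R Y)"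
proof -
  define X where "X s = hv p + s *\<^sub>R T" for s
  have Xf: "X s \<in> P.fcone i" if "0 < s" for s
    unfolding X_def using P.fcone_add_cone(2)[OF i P.fcone_scale[OF T that] P.hv_fcone[OF i p]] .
  obtain j \<delta> where j: "j \<in> I'" "\<delta> > 0" "\<And>s. 0 < s \<Longrightarrow> s \<le> \<delta> \<Longrightarrow> P.sec i (X s) \<in> fc' j"
    using face_germ[OF i P.hv_fcone[OF i p] T] unfolding X_def by blast
  \<comment> \<open>The affine function through the values at \<open>\<delta> / 2\<close> and
    \<delta>; \<open>A\<close> is its extrapolation to the parameter 0, where the ray is null and
    \<open>dev\<close> has no meaning.\<close>
  define D1 D2 where "D1 = dev i (X (\<delta> / 2))" and "D2 = dev i (X \<delta>)"
  define A Y where "A = 2 *\<^sub>R D1 - D2" and "Y = (2 / \<delta>) *\<^sub>R (D2 - D1)"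
  have devX: "dev i (X s) = A + s *\<^sub>R Y" if s: "0 < s" "s \<le> \<delta>" for s
  proof -
    \<comment> \<open>Negative for \<open>s < \<delta> / 2\<close>; \<open>dev_comb\<close> allows
      this.\<close>
    define r where "r = 2 * s / \<delta> - 1"
    have rs: "(1 - r) * (\<delta> / 2) + r * \<delta> = s" using j(2) by (simp add: r_def field_simps)
    have "(1 - r) *\<^sub>R X (\<delta> / 2) + r *\<^sub>R X \<delta> = hv p + ((1 - r) * (\<delta> / 2) + r * \<delta>) *\<^sub>R T"
      unfolding X_def by (simp only: scaleR_add_right scaleR_scaleR scaleR_add_left scaleR_left_diff_distrib)
        (simp add: algebra_simps)
    hence eq: "X s = (1 - r) *\<^sub>R X (\<delta> / 2) + r *\<^sub>R X \<delta>" unfolding rs by (simp only: X_def)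
    have "dev i (X s) = (1 - r) *\<^sub>R D1 + r *\<^sub>R D2" unfolding D1_def D2_def
      by (rule dev_comb[OF i Xf Xf Xf eq j(1) j(3) j(3) j(3)]) (use s j(2) in auto)
    also have "\<dots> = A + (r + 1) *\<^sub>R (D2 - D1)" by (simp add: A_def algebra_simps scaleR_2)
    also have "r + 1 = s * (2 / \<delta>)" by (simp add: r_def)
    finally show ?thesis by (simp add: Y_def)
  qed
  have np: "norm p = 1" using P.W_sphere[OF i] p by auto
  have Tfut: "T \<in> future" using T P.fcone_future by blast
  have q0: "mk A A + (2 * mk A Y - 2 * mk (hv p) T) * s + (mk Y Y - mk T T) * s\<^sup>2 = 0" if s: "0 < s" "s \<le> \<delta>" for s
  proof -
    have "mk (A + s *\<^sub>R Y) (A + s *\<^sub>R Y) = mk (X s) (X s)" using mk_dev_self[OF i Xf[OF s(1)]] devX[OF s] by simp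
    thus ?thesis unfolding X_def
      by (simp add: mk_linear mk_hv_self_sphere[OF np] mk_commute[of Y A] mk_commute[of T "hv p"] algebra_simps power2_eq_square)
  qed
  have AA: "mk A A = 0" and AY: "mk A Y = mk (hv p) T"
    using quadratic_vanishing[OF j(2) q0] by auto
  have pT: "0 < mk (hv p) T" using mk_future_causal_pos[OF Tfut, of "hv p"] np
    by (simp add: mk_hv_self_sphere mk_commute)
  have lim: "((\<lambda>s. snd (A + s *\<^sub>R Y)) \<longlongrightarrow> snd (A + 0 *\<^sub>R Y)) (at_right 0)" by (intro tendsto_intros)
  have ev: "\<forall>\<^sub>F s in at_right (0::real). 0 < s \<and> s \<le> \<delta>"
    using eventually_at_right_real[OF j(2)] by (rule eventually_mono) auto
  hence "\<forall>\<^sub>F s in at_right (0::real). 0 \<le> snd (A + s *\<^sub>R Y)"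
  proof eventually_elim
    case (elim s)
    thus ?case using devX[of s] dev_future[OF i Xf[of s]] by (auto simp: future_def)
  qed
  hence A0: "0 \<le> snd A" using tendsto_lowerbound[OF lim] by simp
  have "snd A \<noteq> 0"
  proof
    assume "snd A = 0"
    hence "A = 0" using AA by (simp add: mk_self prod_eq_iff)
    thus False using AY pT by (simp add: mk_zero_left)
  qed
  define c where "c = snd A"
  have c: "0 < c" using A0 \<open>snd A \<noteq> 0\<close> by (simp add: c_def)
  define p' where "p' = fst A /\<^sub>R c"
  have A: "A = c *\<^sub>R hv p'" using c by (simp add: p'_def c_def hv_def prod_eq_iff)
  have "c\<^sup>2 * mk (hv p') (hv p') = 0" using AA by (simp add: A mk_linear power2_eq_square)
  hence np': "norm p' = 1" using c by (simp add: mk_hv dot_square_norm power2_eq_1_iff) 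
      (metis abs_norm_cancel abs_1 abs_minus_cancel)
  have "((\<lambda>s. fst (A + s *\<^sub>R Y) /\<^sub>R snd (A + s *\<^sub>R Y)) \<longlongrightarrow> fst (A + 0 *\<^sub>R Y) /\<^sub>R snd (A + 0 *\<^sub>R Y)) (at_right 0)"
    by (intro tendsto_intros) (use \<open>snd A \<noteq> 0\<close> in auto)
  moreover have "\<forall>\<^sub>F s in at_right (0::real). fst (A + s *\<^sub>R Y) /\<^sub>R snd (A + s *\<^sub>R Y) \<in> convex hull (W' j)"
    using ev
  proof eventually_elim
    case (elim s)
    have "dev i (X s) \<in> Q.fcone j" using dev_fcone(1)[OF i Xf j(1) j(3)] elim by blast
    thus ?case using cone_on_normalize[of "dev i (X s)" "W' j"] Q.finite_W[OF j(1)] devX[of s] elim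
      by (auto simp: Q.fcone_def future_def)
  qed
  ultimately have "fst (A + 0 *\<^sub>R Y) /\<^sub>R snd (A + 0 *\<^sub>R Y) \<in> convex hull (W' j)"
    by (intro Lim_in_closed_set[OF _ _ _ ]) (auto simp: Q.finite_W[OF j(1)] finite_imp_compact_convex_hull compact_imp_closed)
  hence "p' \<in> convex hull (W' j)" by (simp add: p'_def c_def)
  hence "p' \<in> W' j" using sphere_hull_mem[OF Q.finite_W[OF j(1)] Q.W_sphere[OF j(1)]] np' by blast
  thus ?thesis using j c devX A unfolding X_def
    by (intro exI[of _ p'] exI[of _ c] exI[of _ \<delta>] exI[of _ Y] bexI[of _ j]) auto
qed

end

context two_surfaces
begin

text \<open>The point \<open>p'\<close> and the ratio \<open>c\<close> are the same for all
  directions \<open>T\<close>; only \<delta>, \<open>Y\<close> and the face may vary with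
  \<open>T\<close>.\<close>

definition ray_data :: "'i \<Rightarrow> real^3 \<Rightarrow> real^3 \<Rightarrow> real \<Rightarrow> bool" where
  "ray_data i p p' c \<longleftrightarrow> (\<forall>T\<in>P.fcone i. \<exists>\<delta> Y. \<exists>j\<in>I'. p' \<in> W' j \<and> 0 < c \<and> 0 < \<delta> \<and>
    (\<forall>s. 0 < s \<longrightarrow> s \<le> \<delta> \<longrightarrow> P.sec i (hv p + s *\<^sub>R T) \<in> fc' j \<and> dev i (hv p + s *\<^sub>R T) = c *\<^sub>R hv p' + s *\<^sub>R Y))"

lemma ray_data_E:
  assumes "ray_data i p p' c" "T \<in> P.fcone i"
  obtains \<delta> Y j where "j \<in> I'" "p' \<in> W' j" "0 < c" "0 < \<delta>"
    "\<And>s. 0 < s \<Longrightarrow> s \<le> \<delta> \<Longrightarrow> P.sec i (hv p + s *\<^sub>R T) \<in> fc' j"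
    "\<And>s. 0 < s \<Longrightarrow> s \<le> \<delta> \<Longrightarrow> dev i (hv p + s *\<^sub>R T) = c *\<^sub>R hv p' + s *\<^sub>R Y"
  using assms unfolding ray_data_def by blast

lemma ray_fcone: "i \<in> I \<Longrightarrow> p \<in> W i \<Longrightarrow> T \<in> P.fcone i \<Longrightarrow> 0 < s \<Longrightarrow> hv p + s *\<^sub>R T \<in> P.fcone i"
  using P.fcone_add_cone(2) P.fcone_scale P.hv_fcone by blast

lemma ray_mk:
  assumes i: "i \<in> I" "p \<in> W i" "T \<in> P.fcone i" and c: "0 < \<delta>" "norm p' = 1"
    and dev: "\<And>s. 0 < s \<Longrightarrow> s \<le> \<delta> \<Longrightarrow> dev i (hv p + s *\<^sub>R T) = c *\<^sub>R hv p' + s *\<^sub>R Y"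
  shows "c * mk (hv p') Y = mk (hv p) T" "mk Y Y = mk T T"
proof -
  have np: "norm p = 1" using P.W_sphere[OF i(1)] i(2) by auto
  have q0: "0 + (2 * (c * mk (hv p') Y) - 2 * mk (hv p) T) * s + (mk Y Y - mk T T) * s\<^sup>2 = 0" if s: "0 < s" "s \<le> \<delta>" for s
  proof -
    have "mk (c *\<^sub>R hv p' + s *\<^sub>R Y) (c *\<^sub>R hv p' + s *\<^sub>R Y) = mk (hv p + s *\<^sub>R T) (hv p + s *\<^sub>R T)"
      using mk_dev_self[OF i(1) ray_fcone[OF i s(1)]] dev[OF s] by simp
    thus ?thesis
      by (simp add: mk_linear mk_hv_self_sphere[OF np] mk_hv_self_sphere[OF c(2)] mk_commute[of Y "hv p'"]
          mk_commute[of T "hv p"] algebra_simps power2_eq_square)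
  qed
  show "c * mk (hv p') Y = mk (hv p) T" "mk Y Y = mk T T"
    using quadratic_vanishing[OF c(1) q0] by auto
qed

text \<open>\<open>mk_dev_le\<close> is applied to the parameters \<open>s\<close> and
  \<open>k * s\<close> on the two rays. For \<open>s\<close> tending to 0 it gives
  \<open>mk (hv p1) (hv p2) \<le> 0\<close>, so the limit points agree. In the next order it gives
  an inequality for every \<open>k > 0\<close>: large \<open>k\<close> exclude
  \<open>c1 / c2 > 1\<close>, small \<open>k\<close> exclude \<open>c1 / c2 < 1\<close>.\<close>

lemma ray_compare:
  assumes i: "i \<in> I" "p \<in> W i" and T: "T1 \<in> P.fcone i" "T2 \<in> P.fcone i"
    and p: "norm p1 = 1" "norm p2 = 1" and c: "0 < c1" "0 < c2" "0 < \<delta>1" "0 < \<delta>2"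
    and d1: "\<And>s. 0 < s \<Longrightarrow> s \<le> \<delta>1 \<Longrightarrow> dev i (hv p + s *\<^sub>R T1) = c1 *\<^sub>R hv p1 + s *\<^sub>R Y1"
    and d2: "\<And>s. 0 < s \<Longrightarrow> s \<le> \<delta>2 \<Longrightarrow> dev i (hv p + s *\<^sub>R T2) = c2 *\<^sub>R hv p2 + s *\<^sub>R Y2"
  shows "p1 = p2" "c1 = c2"
proof -
  have np: "norm p = 1" using P.W_sphere[OF i(1)] i(2) by auto
  define A1 A2 where "A1 = mk (hv p) T1" and "A2 = mk (hv p) T2"
  have A: "0 < A1" "0 < A2" unfolding A1_def A2_def
    using mk_future_causal_pos[of T1 "hv p"] mk_future_causal_pos[of T2 "hv p"] np T P.fcone_future
    by (auto simp: mk_hv_self_sphere mk_commute)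
  have e1: "c1 * mk (hv p1) Y1 = A1" "c2 * mk (hv p2) Y2 = A2"
    unfolding A1_def A2_def using ray_mk(1)[OF i T(1) c(3) p(1) d1] ray_mk(1)[OF i T(2) c(4) p(2) d2] by auto
  have ineq: "c1 * c2 * mk (hv p1) (hv p2) + s * (k * (c1 * mk (hv p1) Y2) + c2 * mk (hv p2) Y1) + s\<^sup>2 * (k * mk Y1 Y2)
      \<le> s * (k * A2 + A1) + s\<^sup>2 * (k * mk T1 T2)"
    if s: "0 < s" "s \<le> \<delta>1" "k * s \<le> \<delta>2" and k: "0 < k" for s k
  proof -
    have "0 < k * s" using s k by simp
    hence "mk (c1 *\<^sub>R hv p1 + s *\<^sub>R Y1) (c2 *\<^sub>R hv p2 + (k * s) *\<^sub>R Y2) \<le> mk (hv p + s *\<^sub>R T1) (hv p + (k * s) *\<^sub>R T2)"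
      using mk_dev_le[OF i(1) ray_fcone[OF i T(1) s(1)] ray_fcone[OF i T(2), of "k * s"]]
        d1[OF s(1,2)] d2[of "k * s"] s by simp
    thus ?thesis
      by (simp add: mk_linear mk_hv_self_sphere[OF np] A1_def A2_def mk_commute[of Y1 "hv p2"]
          mk_commute[of T1 "hv p"] algebra_simps power2_eq_square)
  qed
  have ev: "\<forall>\<^sub>F s in at_right (0::real). 0 < s \<and> s \<le> \<delta>1 \<and> k * s \<le> \<delta>2" if "0 < k" for k
  proof -
    have "0 < min \<delta>1 (\<delta>2 / k)" using c that by simp
    from eventually_at_right_real[OF this] show ?thesis
      by (rule eventually_mono) (use that in \<open>auto simp: field_simps\<close>)
  qed
  have "((\<lambda>s. c1 * c2 * mk (hv p1) (hv p2) + s * (1 * (c1 * mk (hv p1) Y2) + c2 * mk (hv p2) Y1) + s\<^sup>2 * (1 * mk Y1 Y2))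
     \<longlongrightarrow> c1 * c2 * mk (hv p1) (hv p2) + 0 * (1 * (c1 * mk (hv p1) Y2) + c2 * mk (hv p2) Y1) + 0\<^sup>2 * (1 * mk Y1 Y2)) (at_right 0)"
    by (intro tendsto_intros)
  moreover have "((\<lambda>s. s * (1 * A2 + A1) + s\<^sup>2 * (1 * mk T1 T2)) \<longlongrightarrow> 0 * (1 * A2 + A1) + 0\<^sup>2 * (1 * mk T1 T2)) (at_right 0)"
    by (intro tendsto_intros)
  moreover have "\<forall>\<^sub>F s in at_right 0. c1 * c2 * mk (hv p1) (hv p2) + s * (1 * (c1 * mk (hv p1) Y2) + c2 * mk (hv p2) Y1) + s\<^sup>2 * (1 * mk Y1 Y2)
      \<le> s * (1 * A2 + A1) + s\<^sup>2 * (1 * mk T1 T2)"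
    using ev[OF zero_less_one] by (rule eventually_mono) (rule ineq, auto)
  ultimately have "c1 * c2 * mk (hv p1) (hv p2) \<le> 0"
    using tendsto_le[of "at_right (0::real)"] by fastforce
  hence "mk (hv p1) (hv p2) \<le> 0" using c by (simp add: mult_le_0_iff)
  hence m0: "mk (hv p1) (hv p2) = 0" using mk_hv_sphere_nonneg[OF p] by simp
  thus pp: "p1 = p2" using mk_hv_sphere_eq_0 p by blast
  \<comment> \<open>With \<open>p1 = p2\<close> the terms of order 0 vanish, so the inequality may
    be divided by \<open>s\<close> before the limit.\<close>
  have lin: "k * (c1 * mk (hv p1) Y2) + c2 * mk (hv p2) Y1 \<le> k * A2 + A1" if k: "0 < k" for k
  proof -
    have "((\<lambda>s. (k * (c1 * mk (hv p1) Y2) + c2 * mk (hv p2) Y1) + s * (k * mk Y1 Y2))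
     \<longlongrightarrow> (k * (c1 * mk (hv p1) Y2) + c2 * mk (hv p2) Y1) + 0 * (k * mk Y1 Y2)) (at_right 0)"
      by (intro tendsto_intros)
    moreover have "((\<lambda>s. (k * A2 + A1) + s * (k * mk T1 T2)) \<longlongrightarrow> (k * A2 + A1) + 0 * (k * mk T1 T2)) (at_right 0)"
      by (intro tendsto_intros)
    moreover have "\<forall>\<^sub>F s in at_right 0. (k * (c1 * mk (hv p1) Y2) + c2 * mk (hv p2) Y1) + s * (k * mk Y1 Y2)
        \<le> (k * A2 + A1) + s * (k * mk T1 T2)"
      using ev[OF k]
    proof eventually_elim
      case (elim s)
      hence "s * ((k * (c1 * mk (hv p1) Y2) + c2 * mk (hv p2) Y1) + s * (k * mk Y1 Y2)) \<le> s * ((k * A2 + A1) + s * (k * mk T1 T2))"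
        using ineq[of s k] k m0 by (simp add: algebra_simps power2_eq_square)
      thus ?case using elim by simp
    qed
    ultimately show ?thesis using tendsto_le[of "at_right (0::real)"] by fastforce
  qed
  have m: "mk (hv p1) Y2 = A2 / c2" "mk (hv p2) Y1 = A1 / c1" using e1 c pp by (auto simp: field_simps)
  define r where "r = c1 / c2"
  have r: "0 < r" using c by (simp add: r_def)
  have lin': "k * r * A2 + A1 / r \<le> k * A2 + A1" if "0 < k" for k
    using lin[OF that] c unfolding m r_def by (simp add: field_simps)
  have "r \<le> 1"
  proof (rule ccontr)
    assume "\<not> r \<le> 1"
    define x where "x = (r - 1) * A2"
    have x: "0 < x" using \<open>\<not> r \<le> 1\<close> A by (simp add: x_def)
    define k where "k = A1 / x"
    have "0 < k" using x A by (simp add: k_def)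
    from lin'[OF this] have "k * x + A1 / r \<le> A1" by (simp add: x_def algebra_simps)
    moreover have "k * x = A1" using x by (simp add: k_def)
    moreover have "0 < A1 / r" using A r by simp
    ultimately show False by linarith
  qed
  moreover have "1 \<le> r"
  proof (rule ccontr)
    assume "\<not> 1 \<le> r"
    define g where "g = A1 / r - A1"
    have g: "0 < g" using \<open>\<not> 1 \<le> r\<close> A r by (simp add: g_def field_simps)
    define k where "k = g / (2 * A2)"
    have "0 < k" using g A by (simp add: k_def)
    from lin'[OF this] have "k * r * A2 + g \<le> k * A2" by (simp add: g_def)
    moreover have "k * A2 = g / 2" using A by (simp add: k_def)
    moreover have "0 < k * r * A2" using \<open>0 < k\<close> r A by simp
    ultimately show False using g by linarith
  qed
  ultimately show "c1 = c2" using c by (simp add: r_def)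
qed

lemma ray_data_exists:
  assumes i: "i \<in> I" "p \<in> W i" shows "\<exists>p' c. ray_data i p p' c"
proof -
  obtain T0 where T0: "T0 \<in> P.fcone i" using P.fcone_nonempty[OF i] by blast
  obtain p' c \<delta> Y j where 0: "j \<in> I'" "p' \<in> W' j" "0 < c" "0 < \<delta>"
    "\<And>s. 0 < s \<Longrightarrow> s \<le> \<delta> \<Longrightarrow> dev i (hv p + s *\<^sub>R T0) = c *\<^sub>R hv p' + s *\<^sub>R Y"
    using dev_ray[OF i T0] by blast
  have n0: "norm p' = 1" using Q.W_sphere[OF 0(1)] 0(2) by auto
  have "ray_data i p p' c" unfolding ray_data_def
  proof
    fix T assume T: "T \<in> P.fcone i"
    obtain p2 c2 \<delta>2 Y2 j2 where 2: "j2 \<in> I'" "p2 \<in> W' j2" "0 < c2" "0 < \<delta>2"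
      "\<And>s. 0 < s \<Longrightarrow> s \<le> \<delta>2 \<Longrightarrow> P.sec i (hv p + s *\<^sub>R T) \<in> fc' j2"
      "\<And>s. 0 < s \<Longrightarrow> s \<le> \<delta>2 \<Longrightarrow> dev i (hv p + s *\<^sub>R T) = c2 *\<^sub>R hv p2 + s *\<^sub>R Y2"
      using dev_ray[OF i T] by blast
    have n2: "norm p2 = 1" using Q.W_sphere[OF 2(1)] 2(2) by auto
    have "p' = p2" "c = c2" using ray_compare[OF i T0 T n0 n2 0(3) 2(3) 0(4) 2(4) 0(5) 2(6)] by auto
    thus "\<exists>\<delta> Y. \<exists>j\<in>I'. p' \<in> W' j \<and> 0 < c \<and> 0 < \<delta> \<and>
        (\<forall>s. 0 < s \<longrightarrow> s \<le> \<delta> \<longrightarrow> P.sec i (hv p + s *\<^sub>R T) \<in> fc' j \<and> dev i (hv p + s *\<^sub>R T) = c *\<^sub>R hv p' + s *\<^sub>R Y)"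
      using 2 by blast
  qed
  thus ?thesis by blast
qed

lemma ray_data_share:
  assumes i: "i \<in> I" "p \<in> W i" and j: "j \<in> I" "p \<in> W j" and T: "T \<in> P.fcone i" "T \<in> P.fcone j"
    and eq: "\<And>s. 0 < s \<Longrightarrow> P.sec i (hv p + s *\<^sub>R T) = P.sec j (hv p + s *\<^sub>R T)"
    and r: "ray_data i p p1 c1" "ray_data j p p2 c2"
  shows "p1 = p2" "c1 = c2"
proof -
  obtain \<delta>1 Y1 k1 where 1: "0 < \<delta>1"
    "\<And>s. 0 < s \<Longrightarrow> s \<le> \<delta>1 \<Longrightarrow> dev i (hv p + s *\<^sub>R T) = c1 *\<^sub>R hv p1 + s *\<^sub>R Y1"
    using ray_data_E[OF r(1) T(1)] by metis
  obtain \<delta>2 Y2 k2 where 2: "0 < \<delta>2"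
    "\<And>s. 0 < s \<Longrightarrow> s \<le> \<delta>2 \<Longrightarrow> dev j (hv p + s *\<^sub>R T) = c2 *\<^sub>R hv p2 + s *\<^sub>R Y2"
    using ray_data_E[OF r(2) T(2)] by metis
  have "c1 *\<^sub>R hv p1 + s *\<^sub>R Y1 = c2 *\<^sub>R hv p2 + s *\<^sub>R Y2" if s: "0 < s" "s \<le> min \<delta>1 \<delta>2" for s
  proof -
    have "dev i (hv p + s *\<^sub>R T) = dev j (hv p + s *\<^sub>R T)" using eq[OF s(1)] by (simp add: dev_def)
    thus ?thesis using 1(2) 2(2) s by simp
  qed
  hence e: "c1 *\<^sub>R hv p1 = c2 *\<^sub>R hv p2"
    using affine_agree(1)[of "min \<delta>1 \<delta>2" "c1 *\<^sub>R hv p1" Y1 "c2 *\<^sub>R hv p2" Y2] 1(1) 2(1) by auto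
  have c0: "0 < c1" using ray_data_E[OF r(1) T(1)] by metis
  show "c1 = c2" using arg_cong[OF e, of snd] by simp
  thus "p1 = p2" using e c0 by simp
qed

text \<open>It suffices to have a ray lying in both faces. If all vertices are on one circle, then
  the faces share a chord ending in \<open>p\<close>; otherwise \<open>face_chain\<close> reduces to
  adjacent faces, and the ray points to a common point of theirs.\<close>

lemma ray_data_indep:
  assumes i: "i \<in> I" "p \<in> W i" and j: "j \<in> I" "p \<in> W j" and r: "ray_data i p p' c"
  shows "ray_data j p p' c"
proof (cases "\<exists>\<nu>. \<nu> \<noteq> 0 \<and> (\<forall>w\<in>V. mk \<nu> (hv w) = 0)")
  case True
  then obtain \<nu> where \<nu>: "\<nu> \<noteq> 0" "\<forall>w\<in>V. mk \<nu> (hv w) = 0" by blast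
  have pV: "p \<in> V" using P.W_sub i by blast
  obtain b where b: "b \<in> V" "b \<noteq> p"
    "\<And>\<alpha> \<beta>. 0 < \<alpha> \<Longrightarrow> 0 < \<beta> \<Longrightarrow> \<alpha> *\<^sub>R hv p + \<beta> *\<^sub>R hv b \<in> hyp \<Longrightarrow> \<exists>x\<in>fc i \<inter> fc j. L x = \<alpha> *\<^sub>R hv p + \<beta> *\<^sub>R hv b"
    using P.planar(2)[OF \<nu> i(1) j(1) pV] unfolding covers_chord_def by blast
  have W: "W i = V" "W j = V" using P.planar(1)[OF \<nu>] i j by auto
  let ?T = "hv p + hv b"
  have T: "?T \<in> P.fcone i" "?T \<in> P.fcone j"
    using P.two_vertices_fcone[OF i(1,2) _ b(2)[symmetric], of 1 1] P.two_vertices_fcone[OF j(1,2) _ b(2)[symmetric], of 1 1] W b(1) by auto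
  have eq: "P.sec i (hv p + s *\<^sub>R ?T) = P.sec j (hv p + s *\<^sub>R ?T)" if s: "0 < s" for s
  proof -
    let ?X = "hv p + s *\<^sub>R ?T"
    have f: "?X \<in> P.fcone i" "?X \<in> P.fcone j" using ray_fcone[OF i T(1) s] ray_fcone[OF j T(2) s] by auto
    have q: "0 < 1 / sqrt (mk ?X ?X)" using f(1) by (auto simp: P.fcone_def future_def)
    have u: "unitv ?X = ((1 / sqrt (mk ?X ?X)) * (1 + s)) *\<^sub>R hv p + ((1 / sqrt (mk ?X ?X)) * s) *\<^sub>R hv b"
    proof -
      have "q *\<^sub>R ?X = (q * (1 + s)) *\<^sub>R hv p + (q * s) *\<^sub>R hv b" for q by (simp add: algebra_simps)
      thus ?thesis unfolding unitv_def .
    qed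
    have "unitv ?X \<in> hyp" using f(1) unitv_hyp P.fcone_future by blast
    then obtain x where x: "x \<in> fc i" "x \<in> fc j" "L x = unitv ?X"
      using b(3)[of "(1 / sqrt (mk ?X ?X)) * (1 + s)" "(1 / sqrt (mk ?X ?X)) * s"] q s unfolding u[symmetric] by auto
    show ?thesis using P.sec_eqI[OF i(1) f(1) x(1,3)] P.sec_eqI[OF j(1) f(2) x(2,3)] by simp
  qed
  obtain p2 c2 where r2: "ray_data j p p2 c2" using ray_data_exists[OF j] by blast
  thus ?thesis using ray_data_share[OF i j T eq r r2] by simp
next
  case False
  hence inj: "inj_on L M" using P.planar_or_inj by blast
  have pV: "p \<in> V" using P.W_sub i by blast
  obtain q a b B1 B2 N Q where ch: "cusp_chart M d V I W fc L p q a b B1 B2 N Q"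
    using P.cusp_chart_exists2[OF pV] by blast
  interpret C: cusp_chart M d V I W fc L p q a b B1 B2 N Q by (rule ch)
  define A where "A = {k\<in>I. p \<in> W k \<and> ray_data k p p' c}"
  have "A = {k\<in>I. p \<in> W k}"
  proof (rule C.face_chain)
    show "C.nonplanar" using False unfolding C.nonplanar_def by blast
    show "A \<subseteq> {k\<in>I. p \<in> W k}" "A \<noteq> {}" using i r by (auto simp: A_def)
    fix k l assume kl: "k \<in> A" "l \<in> I" "p \<in> W l" "fc k \<inter> fc l \<noteq> {}"
    hence k: "k \<in> I" "p \<in> W k" "ray_data k p p' c" by (auto simp: A_def)
    obtain x where x: "x \<in> fc k" "x \<in> fc l" using kl(4) by blast
    let ?T = "L x"
    have T: "?T \<in> P.fcone k" "?T \<in> P.fcone l" using P.sec_L(1) k kl x by auto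
    have eq: "P.sec k (hv p + s *\<^sub>R ?T) = P.sec l (hv p + s *\<^sub>R ?T)" if s: "0 < s" for s
      using P.sec_props(2,3)[OF k(1) ray_fcone[OF k(1,2) T(1) s]] P.sec_props(2,3)[OF kl(2) ray_fcone[OF kl(2,3) T(2) s]]
        inj by (simp add: inj_on_def)
    obtain p2 c2 where r2: "ray_data l p p2 c2" using ray_data_exists[OF kl(2,3)] by blast
    hence "ray_data l p p' c" using ray_data_share[OF k(1,2) kl(2,3) T eq k(3) r2] by simp
    thus "l \<in> A" using kl by (simp add: A_def)
  qed
  thus ?thesis using j by (auto simp: A_def)
qed

definition cusp_map :: "real^3 \<Rightarrow> real^3 \<Rightarrow> real \<Rightarrow> bool" where
  "cusp_map p p' c \<longleftrightarrow> p \<in> V \<and> (\<forall>i\<in>I. p \<in> W i \<longrightarrow> ray_data i p p' c)"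

lemma cusp_map_exists: assumes "p \<in> V" shows "\<exists>p' c. cusp_map p p' c"
proof -
  obtain i where i: "i \<in> I" "p \<in> W i" using P.V_in_face[OF assms] by blast
  obtain p' c where "ray_data i p p' c" using ray_data_exists[OF i] by blast
  hence "cusp_map p p' c" unfolding cusp_map_def using ray_data_indep[OF i] assms by blast
  thus ?thesis by blast
qed

lemma cusp_map_V: assumes "cusp_map p p' c" shows "p \<in> V" "p' \<in> V'" "0 < c"
proof -
  show p: "p \<in> V" using assms by (simp add: cusp_map_def)
  obtain i where i: "i \<in> I" "p \<in> W i" using P.V_in_face[OF p] by blast
  obtain T where T: "T \<in> P.fcone i" using P.fcone_nonempty[OF i] by blast
  have "ray_data i p p' c" using assms i by (simp add: cusp_map_def)
  from ray_data_E[OF this T] obtain j where "j \<in> I'" "p' \<in> W' j" "0 < c" by metis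
  thus "p' \<in> V'" "0 < c" using Q.W_sub by auto
qed

text \<open>On a common face the two developments undo each other. Developing the image ray back
  must reproduce \<open>hv p + s *\<^sub>R T\<close>, and comparing the constant terms gives the
  point \<open>p\<close> and the ratio \<open>1 / c\<close>.\<close>

lemma cusp_map_inverse:
  assumes m: "cusp_map p p' c"
  shows "two_surfaces.cusp_map V' I' W' fc' L' I W fc L p' p (1 / c)"
proof -
  interpret S: two_surfaces M d V' I' W' fc' L' V I W fc L by (rule swap)
  have p: "p \<in> V" "p' \<in> V'" "0 < c" using cusp_map_V[OF m] by auto
  obtain i where i: "i \<in> I" "p \<in> W i" using P.V_in_face[OF p(1)] by blast
  obtain T where T: "T \<in> P.fcone i" using P.fcone_nonempty[OF i] by blast
  have "ray_data i p p' c" using m i by (simp add: cusp_map_def)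
  from ray_data_E[OF this T] obtain \<delta> Y j where j: "j \<in> I'" "p' \<in> W' j" "0 < \<delta>"
    "\<And>s. 0 < s \<Longrightarrow> s \<le> \<delta> \<Longrightarrow> P.sec i (hv p + s *\<^sub>R T) \<in> fc' j"
    "\<And>s. 0 < s \<Longrightarrow> s \<le> \<delta> \<Longrightarrow> dev i (hv p + s *\<^sub>R T) = c *\<^sub>R hv p' + s *\<^sub>R Y" by metis
  obtain p2 c2 where r2: "S.cusp_map p' p2 c2" using S.cusp_map_exists[OF p(2)] by blast
  \<comment> \<open>The image of the ray at its end \<delta> serves as the direction for the ray
    from \<open>p'\<close>.\<close>
  define T0 where "T0 = c *\<^sub>R hv p' + \<delta> *\<^sub>R Y"
  have T0: "T0 \<in> Q.fcone j"
    using dev_fcone(1)[OF i(1) ray_fcone[OF i T j(3)] j(1) j(4)] j(3) j(5) by (simp add: T0_def)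
  have "S.ray_data j p' p2 c2" using r2 j by (simp add: S.cusp_map_def)
  from S.ray_data_E[OF this T0] obtain \<eta> Z where z: "0 < \<eta>"
    "\<And>s. 0 < s \<Longrightarrow> s \<le> \<eta> \<Longrightarrow> S.dev j (hv p' + s *\<^sub>R T0) = c2 *\<^sub>R hv p2 + s *\<^sub>R Z" by metis
  \<comment> \<open>The bound \<open>\<delta> / 2\<close> gives \<open>c / 2 \<le> k\<close> below,
    and with it the other bound gives \<open>r \<le> \<eta>\<close>.\<close>
  define \<epsilon> where "\<epsilon> = min (\<delta> / 2) (\<eta> * c * \<delta> / 2)"
  have \<epsilon>: "0 < \<epsilon>" "\<epsilon> \<le> \<delta> / 2" "\<epsilon> \<le> \<eta> * c * \<delta> / 2" using j(3) z(1) p(3) by (auto simp: \<epsilon>_def)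
  have "c *\<^sub>R c2 *\<^sub>R hv p2 + s *\<^sub>R ((1 / \<delta>) *\<^sub>R (Z - c *\<^sub>R c2 *\<^sub>R hv p2)) = hv p + s *\<^sub>R T" if s: "0 < s" "s \<le> \<epsilon>" for s
  proof -
    let ?X = "hv p + s *\<^sub>R T"
    have s\<delta>: "s \<le> \<delta>" "s < \<delta>" using s \<epsilon> j(3) by auto
    have f: "?X \<in> P.fcone i" using ray_fcone[OF i T s(1)] .
    note Xj = j(4)[OF s(1) s\<delta>(1)]
    note dX = j(5)[OF s(1) s\<delta>(1)]
    \<comment> \<open>Solves \<open>c *\<^sub>R hv p' + s *\<^sub>R Y = k *\<^sub>R (hv p' + r
      *\<^sub>R T0)\<close>; homogeneity takes care of the factor \<open>k\<close>.\<close>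
    define k where "k = c * (1 - s / \<delta>)"
    have k: "0 < k" using s\<delta> p(3) j(3) by (simp add: k_def)
    define r where "r = (s / \<delta>) / k"
    have "c / 2 \<le> k" using p(3) s \<epsilon> j(3) by (simp add: k_def field_simps)
    hence "s \<le> \<eta> * \<delta> * k"
    proof -
      have "\<eta> * \<delta> * (c / 2) \<le> \<eta> * \<delta> * k" using \<open>c / 2 \<le> k\<close> z(1) j(3) by (intro mult_left_mono) auto
      moreover have "\<eta> * c * \<delta> / 2 = \<eta> * \<delta> * (c / 2)" by simp
      ultimately show ?thesis using s(2) \<epsilon>(3) by linarith
    qed
    hence r: "0 < r" "r \<le> \<eta>" using s(1) j(3) k by (auto simp: r_def field_simps)
    have "k *\<^sub>R (hv p' + r *\<^sub>R T0) = (k + (s / \<delta>) * c) *\<^sub>R hv p' + ((s / \<delta>) * \<delta>) *\<^sub>R Y"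
      using k by (simp add: T0_def r_def scaleR_add_right scaleR_add_left)
    also have "\<dots> = dev i ?X" using j(3) by (simp add: dX k_def algebra_simps)
    finally have kd: "k *\<^sub>R (hv p' + r *\<^sub>R T0) = dev i ?X" .
    have "S.dev j (dev i ?X) = k *\<^sub>R (c2 *\<^sub>R hv p2 + r *\<^sub>R Z)"
      unfolding kd[symmetric] S.dev_scale[OF k] z(2)[OF r] ..
    moreover have "S.dev j (dev i ?X) = ?X"
    proof -
      have "S.dev j (dev i ?X) = sqrt (mk ?X ?X) *\<^sub>R L (P.sec i ?X)"
        unfolding S.dev_def dev_fcone(2)[OF i(1) f j(1) Xj] mk_dev_self[OF i(1) f] ..
      also have "\<dots> = ?X" using P.sec_props(2)[OF i(1) f] scale_unitv[of ?X] P.fcone_future[OF f] by simp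
      finally show ?thesis .
    qed
    ultimately have "?X = k *\<^sub>R (c2 *\<^sub>R hv p2 + r *\<^sub>R Z)" by simp
    also have "\<dots> = (k * c2) *\<^sub>R hv p2 + (s / \<delta>) *\<^sub>R Z" using k by (simp add: r_def scaleR_add_right)
    finally show ?thesis by (simp add: k_def algebra_simps)
  qed
  hence e: "c *\<^sub>R c2 *\<^sub>R hv p2 = hv p" using affine_agree(1)[OF \<epsilon>(1)] by blast
  have "c * c2 = 1" using arg_cong[OF e, of snd] by simp
  hence "p2 = p" "c2 = 1 / c" using e p(3) by (simp, simp add: field_simps)
  thus ?thesis using r2 by simp
qed

text \<open>Superadditivity for \<open>hv p + (\<delta> / 2) *\<^sub>R L x\<close> and
  \<open>(\<delta> / 2) *\<^sub>R L x\<close>: both this ray point and the sum have known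
  developments, whose constant term pairs to 0 with \<open>hv p'\<close>, and the pairing of
  \<open>Y\<close> is fixed by the norms.\<close>

lemma horofunction_le:
  assumes m: "cusp_map p p' c" and i: "i \<in> I" "p \<in> W i" and x: "x \<in> fc i"
  shows "c * mk (L' x) (hv p') \<le> mk (L x) (hv p)"
proof -
  have pp: "p' \<in> V'" "0 < c" using cusp_map_V[OF m] by auto
  note np' = Q.norm_V[OF pp(1)]
  let ?T = "L x"
  have T: "?T \<in> P.fcone i" "P.sec i ?T = x" using P.sec_L[OF i(1) x] by auto
  have "ray_data i p p' c" using m i by (simp add: cusp_map_def)
  from ray_data_E[OF this T(1)] obtain \<delta> Y where j: "0 < \<delta>"
    "\<And>s. 0 < s \<Longrightarrow> s \<le> \<delta> \<Longrightarrow> dev i (hv p + s *\<^sub>R ?T) = c *\<^sub>R hv p' + s *\<^sub>R Y" by metis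
  have Y: "c * mk (hv p') Y = mk (hv p) ?T" using ray_mk(1)[OF i T(1) j(1) np' j(2)] .
  let ?b = "\<lambda>X. mk (dev i X) (hv p')"
  have f: "hv p + (\<delta> / 2) *\<^sub>R ?T \<in> P.fcone i" "(\<delta> / 2) *\<^sub>R ?T \<in> P.fcone i"
    using ray_fcone[OF i T(1)] P.fcone_scale[OF T(1)] j(1) by auto
  have "?b (hv p + (\<delta> / 2) *\<^sub>R ?T) + ?b ((\<delta> / 2) *\<^sub>R ?T) \<le> ?b (hv p + (\<delta> / 2) *\<^sub>R ?T + (\<delta> / 2) *\<^sub>R ?T)"
    by (rule dev_superadditive[OF i(1) f pp(1)])
  moreover have "hv p + (\<delta> / 2) *\<^sub>R ?T + (\<delta> / 2) *\<^sub>R ?T = hv p + \<delta> *\<^sub>R ?T"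
    by (simp add: add.assoc flip: scaleR_left.add)
  moreover have "dev i ((\<delta> / 2) *\<^sub>R ?T) = (\<delta> / 2) *\<^sub>R L' x"
    using dev_scale[of "\<delta> / 2" i ?T] j(1) T(2) P.L_hyp[OF P.fc_M[OF i(1) x]] by (simp add: dev_def hyp_def)
  ultimately have "\<delta> / 2 * mk Y (hv p') + \<delta> / 2 * mk (L' x) (hv p') \<le> \<delta> * mk Y (hv p')"
    using j by (simp add: mk_linear mk_hv_self_sphere[OF np'])
  hence "\<delta> / 2 * mk (L' x) (hv p') \<le> \<delta> / 2 * mk Y (hv p')" by simp
  hence "mk (L' x) (hv p') \<le> mk Y (hv p')" using j(1) by simp
  hence "c * mk (L' x) (hv p') \<le> c * mk Y (hv p')" using pp(2) by simp
  thus ?thesis using Y by (simp add: mk_commute)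
qed

end

subsection \<open>Angle sums\<close>

text \<open>Squared distances determine the angle at the apex of a triangle with opposite side \<open>l\<close>. If
  the apex coincides with an end of the side, the value is \<open>arccos 0 = pi / 2\<close> because of
  \<open>x / 0 = 0\<close>; this is the one-sided limit needed below.\<close>

definition apex_angle :: "real \<Rightarrow> real \<Rightarrow> real \<Rightarrow> real" where
  "apex_angle l a b = arccos ((a + b - l\<^sup>2) / (2 * sqrt (a * b)))"

text \<open>By Heron's formula, 16 times the squared area of the triangle with side \<open>l\<close>
  and squared sides \<open>a\<close>, \<open>b\<close>; nonnegativity is the triangle
  inequality.\<close>

definition gram_tri :: "real \<Rightarrow> real \<Rightarrow> real \<Rightarrow> real" where
  "gram_tri l a b = 4 * a * b - (a + b - l\<^sup>2)\<^sup>2"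

lemma gram_tri_alt: "gram_tri l a b = 4 * b * l\<^sup>2 - (a - b - l\<^sup>2)\<^sup>2"
  "gram_tri l a b = 4 * a * l\<^sup>2 - (b - a - l\<^sup>2)\<^sup>2"
  by (simp_all add: gram_tri_def power2_eq_square algebra_simps)

text \<open>For fixed \<open>l\<close> it is minus the square of \<open>a - b\<close> plus an affine
  function.\<close>

lemma gram_tri_concave:
  assumes "0 \<le> t" "t \<le> 1"
  shows "(1 - t) * gram_tri l a b + t * gram_tri l a' b'
    \<le> gram_tri l ((1 - t) * a + t * a') ((1 - t) * b + t * b')"
proof -
  have "gram_tri l ((1 - t) * a + t * a') ((1 - t) * b + t * b')
    - ((1 - t) * gram_tri l a b + t * gram_tri l a' b') = t * (1 - t) * ((a - b) - (a' - b'))\<^sup>2"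
    by (simp add: gram_tri_def power2_eq_square algebra_simps)
  moreover have "0 \<le> t * (1 - t) * ((a - b) - (a' - b'))\<^sup>2" using assms by simp
  ultimately show ?thesis by linarith
qed

lemma apex_cos_bound:
  assumes "0 < a" "0 < b" "0 \<le> gram_tri l a b"
  shows "\<bar>(a + b - l\<^sup>2) / (2 * sqrt (a * b))\<bar> \<le> 1"
    and "0 < gram_tri l a b \<Longrightarrow> \<bar>(a + b - l\<^sup>2) / (2 * sqrt (a * b))\<bar> < 1"
    and "sqrt (1 - ((a + b - l\<^sup>2) / (2 * sqrt (a * b)))\<^sup>2) = sqrt (gram_tri l a b) / (2 * sqrt (a * b))"
proof -
  let ?u = "(a + b - l\<^sup>2) / (2 * sqrt (a * b))"
  have e: "1 - ?u\<^sup>2 = gram_tri l a b / (4 * (a * b))"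
  proof -
    have "?u\<^sup>2 = (a + b - l\<^sup>2)\<^sup>2 / (4 * (a * b))"
      unfolding power_divide power_mult_distrib using assms by simp
    moreover have "gram_tri l a b / (4 * (a * b)) = 1 - (a + b - l\<^sup>2)\<^sup>2 / (4 * (a * b))"
      unfolding gram_tri_def diff_divide_distrib using assms by simp
    ultimately show ?thesis by simp
  qed
  have "0 \<le> 1 - ?u\<^sup>2" unfolding e using assms by (intro divide_nonneg_pos) auto
  thus "\<bar>?u\<bar> \<le> 1" by (simp only: abs_square_le_1[symmetric] diff_ge_0_iff_ge)
  show "\<bar>?u\<bar> < 1" if "0 < gram_tri l a b"
  proof -
    have "0 < 1 - ?u\<^sup>2" unfolding e using assms that by (intro divide_pos_pos) auto
    thus ?thesis by (simp only: abs_square_less_1[symmetric] diff_gt_0_iff_gt)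
  qed
  show "sqrt (1 - ?u\<^sup>2) = sqrt (gram_tri l a b) / (2 * sqrt (a * b))"
    unfolding e using real_sqrt_mult[of 4 "a * b"] by (simp add: real_sqrt_divide)
qed

text \<open>The coefficients of the logarithmic derivatives are half the cotangents of the two base
  angles.\<close>

lemma apex_angle_deriv:
  fixes A B :: "real \<Rightarrow> real"
  assumes dA: "(A has_real_derivative da) (at t)" and dB: "(B has_real_derivative db) (at t)"
    and pos: "0 < A t" "0 < B t" "0 < gram_tri l (A t) (B t)"
  shows "((\<lambda>t. apex_angle l (A t) (B t)) has_real_derivative
     - ((A t + l\<^sup>2 - B t) / (2 * sqrt (gram_tri l (A t) (B t))) * (da / A t)
       + (B t + l\<^sup>2 - A t) / (2 * sqrt (gram_tri l (A t) (B t))) * (db / B t))) (at t)"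
proof -
  define a b D r where "a = A t" and "b = B t" and "D = gram_tri l a b" and "r = sqrt (a * b)"
  have p: "0 < a" "0 < b" "0 < D" "0 < r" "r\<^sup>2 = a * b" using pos by (auto simp: a_def b_def D_def r_def)
  let ?u = "\<lambda>t. (A t + B t - l\<^sup>2) / (2 * sqrt (A t * B t))"
  have dr: "((\<lambda>t. sqrt (A t * B t)) has_real_derivative ((da * b + a * db) / (2 * r))) (at t)"
  proof -
    have "0 < A t * B t" using pos by simp
    from DERIV_chain2[OF DERIV_real_sqrt[OF this] DERIV_mult[OF dA dB]] show ?thesis
      by (rule DERIV_cong) (simp add: a_def b_def r_def inverse_eq_divide mult.commute add.commute)
  qed
  have du: "(?u has_real_derivative ((da + db) * (2 * r) - (a + b - l\<^sup>2) * (2 * ((da * b + a * db) / (2 * r)))) / (2 * r)\<^sup>2) (at t)"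
  proof -
    have num: "((\<lambda>t. A t + B t - l\<^sup>2) has_real_derivative (da + db)) (at t)"
      by (auto intro!: derivative_eq_intros dA dB)
    have den: "((\<lambda>t. 2 * sqrt (A t * B t)) has_real_derivative (2 * ((da * b + a * db) / (2 * r)))) (at t)"
      by (rule DERIV_cmult[OF dr])
    have r: "2 * sqrt (A t * B t) = 2 * r" by (simp add: r_def a_def b_def)
    have "2 * sqrt (A t * B t) \<noteq> 0" unfolding r using p(4) by simp
    from DERIV_divide[OF num den this] show ?thesis unfolding r by (simp add: a_def b_def power2_eq_square)
  qed
  have ub: "-1 < ?u t" "?u t < 1"
    using apex_cos_bound(2)[OF pos(1,2) less_imp_le[OF pos(3)] pos(3)] unfolding abs_less_iff by linarith+
  have "((\<lambda>t. arccos (?u t)) has_real_derivative inverse (- sqrt (1 - (?u t)\<^sup>2)) *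
      (((da + db) * (2 * r) - (a + b - l\<^sup>2) * (2 * ((da * b + a * db) / (2 * r)))) / (2 * r)\<^sup>2)) (at t)"
    using DERIV_chain2[OF DERIV_arccos[OF ub] du] .
  moreover have "sqrt (1 - (?u t)\<^sup>2) = sqrt D / (2 * r)"
    using apex_cos_bound(3)[of "A t" "B t" l] pos by (simp add: a_def b_def D_def r_def)
  moreover have "inverse (- (sqrt D / (2 * r))) *
      (((da + db) * (2 * r) - (a + b - l\<^sup>2) * (2 * ((da * b + a * db) / (2 * r)))) / (2 * r)\<^sup>2)
     = - ((a + l\<^sup>2 - b) / (2 * sqrt D) * (da / a) + (b + l\<^sup>2 - a) / (2 * sqrt D) * (db / b))"
  proof -
    define w where "w = sqrt D"
    have w: "0 < w" using p by (simp add: w_def)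
    have "((da + db) * (2 * r) - (a + b - l\<^sup>2) * (2 * ((da * b + a * db) / (2 * r)))) / (2 * r)\<^sup>2
       = (2 * (da + db) * r\<^sup>2 - (a + b - l\<^sup>2) * (da * b + a * db)) / (4 * r * r\<^sup>2)"
      using p(4) by (simp add: field_simps power2_eq_square)
    also have "\<dots> = (da * b * (a - b + l\<^sup>2) + db * a * (b - a + l\<^sup>2)) / (4 * r * (a * b))"
      unfolding p(5) by (simp add: algebra_simps)
    finally have e: "((da + db) * (2 * r) - (a + b - l\<^sup>2) * (2 * ((da * b + a * db) / (2 * r)))) / (2 * r)\<^sup>2
       = (da * b * (a - b + l\<^sup>2) + db * a * (b - a + l\<^sup>2)) / (4 * r * (a * b))" .
    show ?thesis unfolding e w_def[symmetric] using p w by (simp add: field_simps)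
  qed
  ultimately show ?thesis unfolding apex_angle_def a_def b_def D_def by simp
qed

lemma div_sqrt_strict_mono:
  fixes x y c :: real
  assumes "x < y" "x\<^sup>2 < c" "y\<^sup>2 < c"
  shows "x / sqrt (c - x\<^sup>2) < y / sqrt (c - y\<^sup>2)"
proof -
  have pos: "x / sqrt (c - x\<^sup>2) < y / sqrt (c - y\<^sup>2)" if "0 \<le> x" "x < y" "y\<^sup>2 < c" for x y :: real
  proof -
    have "x\<^sup>2 < y\<^sup>2" using that by (simp add: power_strict_mono)
    hence "0 < sqrt (c - y\<^sup>2)" "sqrt (c - y\<^sup>2) < sqrt (c - x\<^sup>2)" using that by auto
    thus ?thesis using that by (intro frac_less) auto
  qed
  consider "0 \<le> x" | "x < 0" "0 \<le> y" | "y < 0" by linarith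
  thus ?thesis
  proof cases
    case 1 thus ?thesis using pos assms by blast
  next
    case 2
    have "x / sqrt (c - x\<^sup>2) < 0" using 2 assms by (intro divide_neg_pos) auto
    moreover have "0 \<le> y / sqrt (c - y\<^sup>2)" using 2 assms by (intro divide_nonneg_pos) auto
    ultimately show ?thesis by linarith
  next
    case 3
    thus ?thesis using pos[of "- y" "- x"] assms by simp
  qed
qed

text \<open>For points of the plane with squared norms \<open>a\<close>, \<open>b\<close>,
  \<open>c\<close> and sides \<open>l\<close>, \<open>l'\<close>: twice the inner product of the
  middle point with the sum of the unit vectors towards its neighbours. It is not positive when the
  polygon is convex there as seen from the origin, and it is affine in \<open>a\<close>,
  \<open>b\<close>, \<open>c\<close>, so it survives linear interpolation.\<close>

definition bend :: "real \<Rightarrow> real \<Rightarrow> real \<Rightarrow> real \<Rightarrow> real \<Rightarrow> real" where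
  "bend l l' a b c = (a - b - l\<^sup>2) / l + (c - b - l'\<^sup>2) / l'"

text \<open>The two halved cotangents are minus half the values of
  \<open>x / sqrt (4 * b - x\<^sup>2)\<close>, a strictly increasing odd function, at the two
  summands of \<open>bend\<close>.\<close>

lemma base_cot_sum:
  assumes l: "0 < l" "0 < l'" and D: "0 < gram_tri l a b" "0 < gram_tri l' b c"
    and kink: "bend l l' a b c \<le> 0"
    and S: "S = (b + l\<^sup>2 - a) / (2 * sqrt (gram_tri l a b)) + (b + l'\<^sup>2 - c) / (2 * sqrt (gram_tri l' b c))"
  shows "0 \<le> S"
    and "S = 0 \<Longrightarrow> bend l l' a b c = 0"
proof -
  define x y where "x = (a - b - l\<^sup>2) / l" and "y = (c - b - l'\<^sup>2) / l'"
  have D1: "gram_tri l a b = l\<^sup>2 * (4 * b - x\<^sup>2)" using l by (simp add: gram_tri_alt(1) x_def power_divide right_diff_distrib)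
  have D2: "gram_tri l' b c = l'\<^sup>2 * (4 * b - y\<^sup>2)" using l by (simp add: gram_tri_alt(2) y_def power_divide right_diff_distrib)
  have sq: "x\<^sup>2 < 4 * b" "y\<^sup>2 < 4 * b" using D l unfolding D1 D2 by (auto simp: zero_less_mult_iff)
  have t1: "(b + l\<^sup>2 - a) / (2 * sqrt (gram_tri l a b)) = - (x / sqrt (4 * b - x\<^sup>2)) / 2"
  proof -
    have "b + l\<^sup>2 - a = - (l * x)" using l by (simp add: x_def)
    thus ?thesis unfolding D1 using l by (simp add: real_sqrt_mult)
  qed
  have t2: "(b + l'\<^sup>2 - c) / (2 * sqrt (gram_tri l' b c)) = - (y / sqrt (4 * b - y\<^sup>2)) / 2"
  proof -
    have "b + l'\<^sup>2 - c = - (l' * y)" using l by (simp add: y_def)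
    thus ?thesis unfolding D2 using l by (simp add: real_sqrt_mult)
  qed
  have "x \<le> - y" using kink by (simp add: bend_def x_def y_def)
  then consider "x = - y" | "x < - y" by linarith
  hence "S = 0 \<and> x = - y \<or> 0 < S"
  proof cases
    case 1 thus ?thesis unfolding S t1 t2 by simp
  next
    case 2
    hence "x / sqrt (4 * b - x\<^sup>2) < (- y) / sqrt (4 * b - (- y)\<^sup>2)"
      using sq by (intro div_sqrt_strict_mono) auto
    thus ?thesis unfolding S t1 t2 by simp
  qed
  thus "0 \<le> S" "S = 0 \<Longrightarrow> bend l l' a b c = 0"
    by (auto simp: bend_def x_def[symmetric] y_def[symmetric])
qed

text \<open>The delicate point is \<open>t = 0\<close> with the apex at an end of the side. Then
  \<open>a + b = l\<^sup>2\<close>, the cosine is \<open>sqrt t\<close> times a continuous function,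
  and its limit 0 agrees with the value given by division by 0.\<close>

lemma apex_angle_cont:
  assumes l: "0 < l" and f: "0 \<le> a" "0 \<le> b" "0 \<le> gram_tri l a b"
    and g: "0 < a'" "0 < b'" "0 < gram_tri l a' b'"
  shows "continuous_on {0..1} (\<lambda>t. apex_angle l ((1 - t) * a + t * a') ((1 - t) * b + t * b'))"
proof -
  let ?A = "\<lambda>t. (1 - t) * a + t * a'" and ?B = "\<lambda>t. (1 - t) * b + t * b'"
  let ?u = "\<lambda>t. (?A t + ?B t - l\<^sup>2) / (2 * sqrt (?A t * ?B t))"
  have D: "0 \<le> gram_tri l (?A t) (?B t)" if "t \<in> {0..1}" for t
  proof -
    have "0 \<le> (1 - t) * gram_tri l a b + t * gram_tri l a' b'" using that f g by auto
    thus ?thesis using gram_tri_concave[of t l a b a' b'] that by auto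
  qed
  have cu: "continuous_on {0..1} ?u"
  proof (cases "a = 0 \<or> b = 0")
    case False
    hence "0 < a" "0 < b" using f by auto
    have "0 < ?A t" "0 < ?B t" if "t \<in> {0..1}" for t
    proof -
      show "0 < ?A t" using that \<open>0 < a\<close> g(1) by (cases "t = 0") (auto intro!: add_nonneg_pos)
      show "0 < ?B t" using that \<open>0 < b\<close> g(2) by (cases "t = 0") (auto intro!: add_nonneg_pos)
    qed
    thus ?thesis by (intro continuous_intros) (auto simp: less_imp_neq[symmetric])
  next
    case True
    define C where "C = a' + b' - l\<^sup>2"
    have "(a + b - l\<^sup>2)\<^sup>2 \<le> 0" using True f(3) by (auto simp: gram_tri_def)
    hence ab: "a + b = l\<^sup>2" by simp
    have num: "?A t + ?B t - l\<^sup>2 = t * C" for t unfolding C_def using ab by algebra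
    have key: "continuous_on {0..1} (\<lambda>t. (t * C) / (2 * sqrt ((t * p) * ((1 - t) * l\<^sup>2 + t * q))))" if pq: "0 < p" "0 < q" for p q
    proof -
      have E: "0 < (1 - t) * l\<^sup>2 + t * q" if "t \<in> {0..1}" for t
        using that l pq by (cases "t = 0") (auto intro!: add_nonneg_pos)
      have "continuous_on {0..1} (\<lambda>t. sqrt t * (C / (2 * sqrt (p * ((1 - t) * l\<^sup>2 + t * q)))))"
        by (intro continuous_intros) (use E pq in \<open>auto simp: less_imp_neq[symmetric]\<close>)
      moreover have "sqrt t * (C / (2 * sqrt (p * ((1 - t) * l\<^sup>2 + t * q)))) = (t * C) / (2 * sqrt ((t * p) * ((1 - t) * l\<^sup>2 + t * q)))"
        if "t \<in> {0..1}" for t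
      proof -
        have "sqrt ((t * p) * ((1 - t) * l\<^sup>2 + t * q)) = sqrt t * sqrt (p * ((1 - t) * l\<^sup>2 + t * q))"
          by (simp only: real_sqrt_mult mult.assoc)
        hence "(t * C) / (2 * sqrt ((t * p) * ((1 - t) * l\<^sup>2 + t * q)))
            = (t / sqrt t) * (C / (2 * sqrt (p * ((1 - t) * l\<^sup>2 + t * q))))"
          by (simp only: times_divide_times_eq mult.left_commute)
        moreover have st: "t / sqrt t = sqrt t" using that by (simp add: real_div_sqrt)
        ultimately show ?thesis by (simp only:)
      qed
      ultimately show ?thesis by (rule continuous_on_eq)
    qed
    show ?thesis
    proof (cases "a = 0")
      case True
      hence "b = l\<^sup>2" using ab by simp
      thus ?thesis using key[OF g(1,2)] True unfolding num by simp
    next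
      case False
      hence "b = 0" "a = l\<^sup>2" using \<open>a = 0 \<or> b = 0\<close> ab by auto
      thus ?thesis using key[OF g(2,1)] unfolding num by (simp add: mult.commute)
    qed
  qed
  have "\<bar>?u t\<bar> \<le> 1" if t: "t \<in> {0..1}" for t
  proof (cases "?A t = 0 \<or> ?B t = 0")
    case False
    have "0 \<le> ?A t" "0 \<le> ?B t" using t f g by auto
    thus ?thesis using apex_cos_bound(1)[of "?A t" "?B t" l] D[OF t] False by simp
  qed auto
  hence "\<forall>t\<in>{0..1}. - 1 \<le> ?u t \<and> ?u t \<le> 1" unfolding abs_le_iff by (metis minus_le_iff)
  thus ?thesis unfolding apex_angle_def by (rule continuous_on_arccos[OF cu])
qed

lemma sum_shift_periodic:
  fixes a :: "nat \<Rightarrow> real"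
  assumes "\<And>k. a (k + n) = a k"
  shows "(\<Sum>k<n. a (Suc k)) = (\<Sum>k<n. a k)"
proof -
  have "(\<Sum>k<n. a (Suc k)) + a 0 = (\<Sum>k<n. a k) + a n"
    by (metis sum.lessThan_Suc sum.lessThan_Suc_shift add.commute)
  thus ?thesis using assms[of 0] by simp
qed

lemma periodic_mod:
  fixes a :: "nat \<Rightarrow> 'a"
  assumes "\<And>k. a (k + n) = a k"
  shows "a (k mod n + j) = a (k + j)"
proof -
  have "a (i + m * n) = a i" for i m
  proof (induction m)
    case (Suc m)
    have "i + Suc m * n = (i + m * n) + n" by simp
    thus ?case using Suc assms by (simp only:)
  qed simp
  from this[of "k mod n + j" "k div n"] show ?thesis by (simp add: add.commute add.left_commute)
qed

text \<open>Along the linear interpolation from \<open>f\<close> to \<open>g\<close> the angle sum has the derivative \<open>d\<Theta> \<le> 0\<close>, since the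
  sums of the cotangents of the base angles at each node are nonnegative.\<close>

lemma angle_sum_rigidity:
  fixes f g l :: "nat \<Rightarrow> real"
  assumes n: "0 < n" and per: "\<And>k. f (k + n) = f k" "\<And>k. g (k + n) = g k" "\<And>k. l (k + n) = l k"
    and l: "\<And>k. 0 < l k" and f0: "\<And>k. 0 \<le> f k" and fg: "\<And>k. f k \<le> g k" and g0: "\<And>k. 0 < g k"
    and Df: "\<And>k. 0 \<le> gram_tri (l k) (f k) (f (Suc k))" and Dg: "\<And>k. 0 < gram_tri (l k) (g k) (g (Suc k))"
    and kf: "\<And>k. bend (l k) (l (Suc k)) (f k) (f (Suc k)) (f (Suc (Suc k))) \<le> 0"
    and kg: "\<And>k. bend (l k) (l (Suc k)) (g k) (g (Suc k)) (g (Suc (Suc k))) \<le> 0"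
    and sum: "(\<Sum>k<n. apex_angle (l k) (f k) (f (Suc k))) \<le> (\<Sum>k<n. apex_angle (l k) (g k) (g (Suc k)))"
  shows "f k = g k"
proof -
  define \<delta> where "\<delta> k = g k - f k" for k
  have \<delta>0: "0 \<le> \<delta> k" for k using fg by (simp add: \<delta>_def)
  define F where "F t k = (1 - t) * f k + t * g k" for t k
  have Fp: "0 < F t k" if "0 < t" "t \<le> 1" for t k
    unfolding F_def using that f0[of k] g0[of k] by (intro add_nonneg_pos) auto
  have FD: "0 < gram_tri (l k) (F t k) (F t (Suc k))" if "0 < t" "t \<le> 1" for t k
  proof -
    have "0 < (1 - t) * gram_tri (l k) (f k) (f (Suc k)) + t * gram_tri (l k) (g k) (g (Suc k))"
      using that Df[of k] Dg[of k] by (intro add_nonneg_pos) auto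
    thus ?thesis unfolding F_def using gram_tri_concave[of t "l k"] that by (smt (verit))
  qed
  define kk where "kk h k = bend (l k) (l (Suc k)) (h k) (h (Suc k)) (h (Suc (Suc k)))" for h k
  have kF: "kk (F t) k = (1 - t) * kk f k + t * kk g k" for t k
  proof -
    have e: "(F t a - F t b - c) / d = (1 - t) * ((f a - f b - c) / d) + t * ((g a - g b - c) / d)" for a b c d
      unfolding F_def by (simp add: diff_divide_distrib add_divide_distrib algebra_simps)
    show ?thesis unfolding kk_def bend_def e by (simp add: distrib_left)
  qed
  have kk0: "kk f k \<le> 0" "kk g k \<le> 0" for k using kf kg by (auto simp: kk_def)
  have kF0: "kk (F t) k \<le> 0" if "0 < t" "t \<le> 1" for t k
  proof -
    have "(1 - t) * kk f k \<le> 0" "t * kk g k \<le> 0" using that kk0[of k] by (auto simp: mult_nonneg_nonpos)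
    thus ?thesis unfolding kF by linarith
  qed
  define p where "p t k = (F t k + (l k)\<^sup>2 - F t (Suc k)) / (2 * sqrt (gram_tri (l k) (F t k) (F t (Suc k))))" for t k
  define q where "q t k = (F t (Suc k) + (l k)\<^sup>2 - F t k) / (2 * sqrt (gram_tri (l k) (F t k) (F t (Suc k))))" for t k
  define \<Theta> where "\<Theta> t = (\<Sum>k<n. apex_angle (l k) (F t k) (F t (Suc k)))" for t
  have perF: "F t (k + n) = F t k" for t k by (simp add: F_def per)
  have per\<delta>: "\<delta> (k + n) = \<delta> k" for k by (simp add: \<delta>_def per)
  have perp: "p t (k + n) = p t k" for t k
    using perF[of t "Suc k"] by (simp add: p_def perF per)
  have S: "0 \<le> q t k + p t (Suc k)" "q t k + p t (Suc k) = 0 \<Longrightarrow> kk (F t) k = 0" if t: "0 < t" "t \<le> 1" for t k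
  proof -
    note b = base_cot_sum[OF l[of k] l[of "Suc k"] FD[OF t, of k] FD[OF t, of "Suc k"] kF0[OF t, of k, unfolded kk_def]]
    have e: "q t k + p t (Suc k) = (F t (Suc k) + (l k)\<^sup>2 - F t k) / (2 * sqrt (gram_tri (l k) (F t k) (F t (Suc k)))) +
      (F t (Suc k) + (l (Suc k))\<^sup>2 - F t (Suc (Suc k))) / (2 * sqrt (gram_tri (l (Suc k)) (F t (Suc k)) (F t (Suc (Suc k)))))"
      by (simp add: p_def q_def)
    show "0 \<le> q t k + p t (Suc k)" by (rule b(1)[OF e])
    show "kk (F t) k = 0" if "q t k + p t (Suc k) = 0" unfolding kk_def by (rule b(2)[OF e that])
  qed
  \<comment> \<open>The sum over sides is regrouped by nodes: the term of a side at its first end is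
    shifted to the preceding index, which periodicity allows.\<close>
  define d\<Theta> where "d\<Theta> t = - (\<Sum>k<n. (q t k + p t (Suc k)) * (\<delta> (Suc k) / F t (Suc k)))" for t
  have der: "(\<Theta> has_real_derivative d\<Theta> t) (at t)" if t: "0 < t" "t \<le> 1" for t
  proof -
    have dF: "((\<lambda>t. F t k) has_real_derivative \<delta> k) (at t)" for k
      unfolding F_def \<delta>_def by (auto intro!: derivative_eq_intros)
    have "(\<Theta> has_real_derivative (\<Sum>k<n. - (p t k * (\<delta> k / F t k) + q t k * (\<delta> (Suc k) / F t (Suc k))))) (at t)"
      unfolding \<Theta>_def p_def q_def
      by (intro DERIV_sum apex_angle_deriv dF Fp[OF t] FD[OF t])
    moreover have "(\<Sum>k<n. p t (Suc k) * (\<delta> (Suc k) / F t (Suc k))) = (\<Sum>k<n. p t k * (\<delta> k / F t k))"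
      by (rule sum_shift_periodic) (simp add: perp per\<delta> perF)
    ultimately show ?thesis
      by (simp only: d\<Theta>_def distrib_right sum.distrib sum_negf add.commute)
  qed
  have dneg: "d\<Theta> t \<le> 0" if t: "0 < t" "t \<le> 1" for t
    unfolding d\<Theta>_def using S(1)[OF t] \<delta>0 Fp[OF t]
    by (auto intro!: sum_nonneg mult_nonneg_nonneg divide_nonneg_pos)
  have cont: "continuous_on {0..1} \<Theta>" unfolding \<Theta>_def F_def
    by (intro continuous_on_sum apex_angle_cont l f0 Df g0 Dg)
  have mono: "\<Theta> b \<le> \<Theta> a" if "0 \<le> a" "a \<le> b" "b \<le> 1" for a b
  proof (rule DERIV_nonpos_imp_decreasing_open[OF that(2)])
    show "\<exists>y. DERIV \<Theta> x :> y \<and> y \<le> 0" if "a < x" "x < b" for x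
      using der[of x] dneg[of x] that \<open>0 \<le> a\<close> \<open>b \<le> 1\<close> by auto
    show "continuous_on {a..b} \<Theta>" using continuous_on_subset[OF cont] that by auto
  qed
  have "\<Theta> 0 \<le> \<Theta> 1" using sum by (simp add: \<Theta>_def F_def)
  \<comment> \<open>The angle sum is nonincreasing, but its value at 0 is at most that at 1; so it
    is constant and the derivative at 1/2 vanishes.\<close>
  hence const: "\<Theta> t = \<Theta> (1/2)" if "0 \<le> t" "t \<le> 1" for t
    using mono[of 0 t] mono[of t 1] mono[of 0 "1/2"] mono[of "1/2" 1] that by auto
  have "d\<Theta> (1/2) = 0"
  proof (rule DERIV_local_const)
    show "(\<Theta> has_real_derivative d\<Theta> (1/2)) (at (1/2))" by (rule der) auto
    show "0 < (1/2 :: real)" by simp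
    show "\<forall>y. \<bar>1/2 - y\<bar> < 1/2 \<longrightarrow> \<Theta> (1/2) = \<Theta> y"
    proof (intro allI impI)
      fix y :: real assume "\<bar>1/2 - y\<bar> < 1/2"
      hence "0 \<le> y" "y \<le> 1" by linarith+
      thus "\<Theta> (1/2) = \<Theta> y" by (rule const[symmetric])
    qed
  qed
  hence "(\<Sum>k<n. (q (1/2) k + p (1/2) (Suc k)) * (\<delta> (Suc k) / F (1/2) (Suc k))) = 0" by (simp add: d\<Theta>_def)
  moreover have nn: "0 \<le> (q (1/2) k + p (1/2) (Suc k)) * (\<delta> (Suc k) / F (1/2) (Suc k))" for k
    using S(1)[of "1/2" k] \<delta>0[of "Suc k"] Fp[of "1/2" "Suc k"] by (intro mult_nonneg_nonneg divide_nonneg_pos) auto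
  ultimately have z: "(q (1/2) k + p (1/2) (Suc k)) * (\<delta> (Suc k) / F (1/2) (Suc k)) = 0" if "k < n" for k
    using that by (simp add: sum_nonneg_eq_0_iff)
  \<comment> \<open>Where the distances differ, the factor of the cotangent sum is positive, so that
    sum vanishes. Then the bend of the interpolation is 0, and as the mean of two nonpositive bends
    it makes both vanish.\<close>
  have kz: "kk f k = 0 \<and> kk g k = 0" if "k < n" "0 < \<delta> (Suc k)" for k
  proof -
    have "\<delta> (Suc k) / F (1/2) (Suc k) \<noteq> 0" using that Fp[of "1/2" "Suc k"] by auto
    hence "q (1/2) k + p (1/2) (Suc k) = 0" using z[OF that(1)] by simp
    hence "kk (F (1/2)) k = 0" using S(2)[of "1/2" k] by simp
    thus ?thesis using kF[of "1/2" k] kk0[of k] by auto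
  qed
  have kkper: "kk h (k mod n) = kk h k" if "\<And>k. h (k + n) = h k" for h k
  proof -
    have "h (k mod n) = h k" "l (k mod n) = l k" "h (Suc (k mod n)) = h (Suc k)" "l (Suc (k mod n)) = l (Suc k)"
      "h (Suc (Suc (k mod n))) = h (Suc (Suc k))"
      using periodic_mod[of h, OF that, of k 0] periodic_mod[of h, OF that, of k 1] periodic_mod[of h, OF that, of k 2]
        periodic_mod[of l, OF per(3), of k 0] periodic_mod[of l, OF per(3), of k 1] by simp_all
    thus ?thesis by (simp only: kk_def)
  qed
  have \<delta>mod: "\<delta> (j mod n) = \<delta> j" for j
    using periodic_mod[of \<delta>, OF per\<delta>, of j 0] by simp
  show ?thesis
  proof (rule ccontr)
    assume ne: "f k \<noteq> g k"
    define m where "m = Max (\<delta> ` {..<n})"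
    have mle: "\<delta> j \<le> m" for j
      unfolding m_def using \<delta>mod[of j] n by (intro Max_ge_iff[THEN iffD2]) (auto intro!: bexI[of _ "j mod n"])
    have "0 < \<delta> k" using ne \<delta>0[of k] by (auto simp: \<delta>_def less_le)
    hence mpos: "0 < m" using mle[of k] by linarith
    have "m \<in> \<delta> ` {..<n}" unfolding m_def using n by (intro Max_in) auto
    then obtain j where j: "j < n" "\<delta> j = m" by auto
    have kz': "kk f i = 0 \<and> kk g i = 0" if "0 < \<delta> (Suc i)" for i
    proof -
      have "\<delta> (Suc (i mod n)) = \<delta> (Suc i)" by (metis \<delta>mod mod_Suc_eq)
      thus ?thesis using kz[of "i mod n"] that n kkper[of f i] kkper[of g i] per by auto
    qed
    \<comment> \<open>Maximum principle: a vanishing difference of bends says that a weighted second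
      difference of \<delta> is 0, so a maximum is passed on to the next node.\<close>
    have step: "\<delta> (Suc (Suc i)) = m" if "\<delta> (Suc i) = m" for i
    proof -
      have k0: "kk f i = 0" "kk g i = 0" using kz'[of i] that mpos by auto
      have "kk g i - kk f i = (\<delta> i - \<delta> (Suc i)) / l i + (\<delta> (Suc (Suc i)) - \<delta> (Suc i)) / l (Suc i)"
        by (simp add: kk_def bend_def \<delta>_def diff_divide_distrib)
      hence "(\<delta> i - m) / l i + (\<delta> (Suc (Suc i)) - m) / l (Suc i) = 0" using k0 that by simp
      moreover have "(\<delta> i - m) / l i \<le> 0" "(\<delta> (Suc (Suc i)) - m) / l (Suc i) \<le> 0"
        using mle l by (auto simp: divide_nonpos_pos)
      ultimately have "(\<delta> (Suc (Suc i)) - m) / l (Suc i) = 0" by linarith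
      thus ?thesis using l[of "Suc i"] by simp
    qed
    have all: "\<delta> (j + n + i) = m" for i
    proof (induction i)
      case 0 show ?case using per\<delta>[of j] j by simp
    next
      case (Suc i)
      have "j + n + i \<noteq> 0" using n by simp
      then obtain u where "j + n + i = Suc u" using not0_implies_Suc by blast
      thus ?case using step[of u] Suc by simp
    qed
    have "kk f i = 0" for i
    proof -
      have "\<exists>u. \<delta> (Suc i) = \<delta> (j + n + u)"
      proof -
        \<comment> \<open>Chosen so that \<open>j + n + u\<close> is congruent to
          \<open>Suc i\<close> modulo \<open>n\<close>; the maximum thus reaches every node.\<close>
        define u where "u = Suc i + n * (j + n) - (j + n)"
        have "1 * (j + n) \<le> n * (j + n)" using n by (intro mult_right_mono) auto
        hence "j + n \<le> Suc i + n * (j + n)" unfolding mult_1 by (rule le_trans[OF _ le_add2])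
        hence "j + n + u = Suc i + (j + n) * n" unfolding u_def by (simp only: le_add_diff_inverse mult.commute)
        hence "\<delta> (j + n + u) = \<delta> (Suc i)" using \<delta>mod by (metis mod_mult_self1)
        thus ?thesis by metis
      qed
      thus ?thesis using all kz'[of i] mpos by auto
    qed
    \<comment> \<open>A closed polygon cannot be straight at all nodes: regrouped by sides, the
      bends add up to minus twice the perimeter.\<close>
    hence "(\<Sum>i<n. kk f i) = 0" by simp
    moreover have "(\<Sum>i<n. (f (Suc (Suc i)) - f (Suc i) - (l (Suc i))\<^sup>2) / l (Suc i)) = (\<Sum>i<n. (f (Suc i) - f i - (l i)\<^sup>2) / l i)"
      by (rule sum_shift_periodic) (metis add_Suc per(1) per(3))
    ultimately have "(\<Sum>i<n. (f i - f (Suc i) - (l i)\<^sup>2) / l i + (f (Suc i) - f i - (l i)\<^sup>2) / l i) = 0"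
      by (simp add: kk_def bend_def sum.distrib)
    moreover have "(f i - f (Suc i) - (l i)\<^sup>2) / l i + (f (Suc i) - f i - (l i)\<^sup>2) / l i = - (2 * l i)" for i
      using l[of i] by (simp add: field_simps power2_eq_square)
    ultimately have "(\<Sum>i<n. 2 * l i) = 0" by (simp add: sum_negf)
    moreover have "0 < (\<Sum>i<n. 2 * l i)" using l n by (intro sum_pos) auto
    ultimately show False by simp
  qed
qed

section \<open>Angles as measures of sets of directions\<close>

definition hits :: "complex \<Rightarrow> complex \<Rightarrow> real \<Rightarrow> bool" where
  "hits a b \<theta> \<longleftrightarrow> (\<exists>\<rho>>0. of_real \<rho> * cis \<theta> \<in> open_segment a b)"

lemma lmeasurable_ivl_Int:
  fixes u w :: real
  assumes "S \<in> sets lebesgue" shows "{u..<w} \<inter> S \<in> lmeasurable"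
proof (rule bounded_set_imp_lmeasurable)
  show "bounded ({u..<w} \<inter> S)" by (rule bounded_subset[of "{u..w}"]) auto
  show "{u..<w} \<inter> S \<in> sets lebesgue" using assms by auto
qed

lemma periodic_2pi_int:
  assumes "\<And>x. P (x + 2 * pi) \<longleftrightarrow> P (x :: real)" shows "P (x + 2 * pi * of_int k) \<longleftrightarrow> P x"
proof -
  have n: "P (x + 2 * pi * of_nat m) \<longleftrightarrow> P x" for m x
  proof (induction m)
    case (Suc m)
    have e: "x + 2 * pi * of_nat (Suc m) = (x + 2 * pi * of_nat m) + 2 * pi" by (simp add: algebra_simps)
    show ?case unfolding e assms by (rule Suc)
  qed simp
  show ?thesis
  proof (cases "0 \<le> k")
    case True
    thus ?thesis using n[of x "nat k"] by simp
  next
    case False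
    thus ?thesis using n[of "x + 2 * pi * of_int k" "nat (- k)"] by simp
  qed
qed

lemma measure_periodic_shift:
  assumes per: "\<And>x. P (x + 2 * pi) \<longleftrightarrow> P (x :: real)" and meas: "{x. P x} \<in> sets borel"
  shows "measure lebesgue {\<theta>\<in>{0..<2*pi}. P (\<theta> - \<alpha>)} = measure lebesgue {\<theta>\<in>{0..<2*pi}. P \<theta>}"
proof -
  define k where "k = \<lfloor>\<alpha> / (2 * pi)\<rfloor>"
  define \<beta> where "\<beta> = \<alpha> - 2 * pi * of_int k"
  have b: "0 \<le> \<beta>" "\<beta> < 2 * pi"
  proof -
    have "of_int k \<le> \<alpha> / (2 * pi)" "\<alpha> / (2 * pi) < of_int k + 1" unfolding k_def by linarith+
    thus "0 \<le> \<beta>" "\<beta> < 2 * pi" by (auto simp: \<beta>_def field_simps)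
  qed
  have P: "P (\<theta> - \<alpha>) \<longleftrightarrow> P (\<theta> - \<beta>)" for \<theta>
    using periodic_2pi_int[of P "\<theta> - \<alpha>" k] per by (simp add: \<beta>_def algebra_simps)
  \<comment> \<open>The period is cut at \<open>2 * pi - \<beta>\<close>; the two pieces are
    translated by different amounts and fill the period again.\<close>
  define A1 A2 where "A1 = {x\<in>{0..<2*pi-\<beta>}. P x}" and "A2 = {x\<in>{2*pi-\<beta>..<2*pi}. P x}"
  have ms: "{x\<in>{u..<w}. P x} \<in> lmeasurable" for u w
  proof -
    have "{x\<in>{u..<w}. P x} = {u..<w} \<inter> {x. P x}" by auto
    moreover have "{x. P x} \<in> sets lebesgue" using meas by auto
    ultimately show ?thesis using lmeasurable_ivl_Int by simp
  qed
  have A: "A1 \<in> lmeasurable" "A2 \<in> lmeasurable" unfolding A1_def A2_def by (rule ms)+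
  have e: "{\<theta>\<in>{0..<2*pi}. P (\<theta> - \<alpha>)} = (+) \<beta> ` A1 \<union> (+) (\<beta> - 2 * pi) ` A2"
  proof (intro set_eqI iffI)
    fix \<theta> assume t: "\<theta> \<in> {\<theta>\<in>{0..<2*pi}. P (\<theta> - \<alpha>)}"
    hence Pt: "P (\<theta> - \<beta>)" using P by simp
    show "\<theta> \<in> (+) \<beta> ` A1 \<union> (+) (\<beta> - 2 * pi) ` A2"
    proof (cases "\<beta> \<le> \<theta>")
      case True
      hence "\<theta> - \<beta> \<in> A1" using t Pt by (auto simp: A1_def)
      thus ?thesis by (intro UnI1 image_eqI[of _ _ "\<theta> - \<beta>"]) auto
    next
      case False
      hence "\<theta> - \<beta> + 2 * pi \<in> A2" using t Pt per[of "\<theta> - \<beta>"] b by (auto simp: A2_def)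
      thus ?thesis by (intro UnI2 image_eqI[of _ _ "\<theta> - \<beta> + 2 * pi"]) auto
    qed
  next
    fix \<theta> assume "\<theta> \<in> (+) \<beta> ` A1 \<union> (+) (\<beta> - 2 * pi) ` A2"
    thus "\<theta> \<in> {\<theta>\<in>{0..<2*pi}. P (\<theta> - \<alpha>)}"
    proof
      assume "\<theta> \<in> (+) \<beta> ` A1"
      thus ?thesis using b P[of \<theta>] by (auto simp: A1_def)
    next
      assume "\<theta> \<in> (+) (\<beta> - 2 * pi) ` A2"
      then obtain x where x: "x \<in> A2" "\<theta> = \<beta> - 2 * pi + x" by auto
      hence "P (\<theta> - \<beta>)" using per[of "\<theta> - \<beta>"] by (simp add: A2_def)
      thus ?thesis using x b P[of \<theta>] by (auto simp: A2_def)
    qed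
  qed
  have disj: "(+) \<beta> ` A1 \<inter> (+) (\<beta> - 2 * pi) ` A2 = {}" by (auto simp: A1_def A2_def)
  have T: "(+) \<beta> ` A1 \<in> lmeasurable" "(+) (\<beta> - 2 * pi) ` A2 \<in> lmeasurable"
    using A by (simp_all only: measurable_translation)
  have "A1 \<inter> A2 = {}" by (auto simp: A1_def A2_def)
  have "measure lebesgue {\<theta>\<in>{0..<2*pi}. P (\<theta> - \<alpha>)} = measure lebesgue A1 + measure lebesgue A2"
    unfolding e measure_Un3[OF T] disj measure_translation by (simp only: measure_empty diff_zero)
  also have "\<dots> = measure lebesgue (A1 \<union> A2)"
    unfolding measure_Un3[OF A] \<open>A1 \<inter> A2 = {}\<close> by (simp only: measure_empty diff_zero)
  also have "A1 \<union> A2 = {\<theta>\<in>{0..<2*pi}. P \<theta>}" using b by (auto simp: A1_def A2_def)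
  finally show ?thesis .
qed

text \<open>The first end is rotated to the positive real axis. The condition is stated by sines,
  and not as \<open>0 < \<eta> < w\<close>, to be periodic in \<eta>.\<close>

lemma sector_iff:
  assumes w: "0 < w" "w < pi" and r: "0 < r" "0 < r'"
  shows "(\<exists>\<rho>>0. of_real \<rho> * cis \<eta> \<in> open_segment (of_real r) (of_real r' * cis w)) \<longleftrightarrow> 0 < sin \<eta> \<and> 0 < sin (w - \<eta>)"
proof -
  have sw: "0 < sin w" using w sin_gt_zero by blast
  have ne: "of_real r \<noteq> of_real r' * cis w"
  proof
    assume "complex_of_real r = of_real r' * cis w"
    hence "Im (complex_of_real r) = Im (of_real r' * cis w)" by (simp only:)
    thus False using sw r by simp
  qed
  show ?thesis
  proof
    assume "\<exists>\<rho>>0. of_real \<rho> * cis \<eta> \<in> open_segment (of_real r) (of_real r' * cis w)"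
    then obtain \<rho> u where u: "0 < \<rho>" "0 < u" "u < 1"
      "of_real \<rho> * cis \<eta> = (1 - u) *\<^sub>R complex_of_real r + u *\<^sub>R (of_real r' * cis w)"
      by (auto simp: in_segment)
    have im: "\<rho> * sin \<eta> = u * (r' * sin w)" using arg_cong[OF u(4), of Im] by simp
    have re: "\<rho> * cos \<eta> = (1 - u) * r + u * (r' * cos w)" using arg_cong[OF u(4), of Re] by simp
    have "\<rho> * sin (w - \<eta>) = sin w * (\<rho> * cos \<eta>) - cos w * (\<rho> * sin \<eta>)"
      by (simp add: sin_diff algebra_simps)
    also have "\<dots> = (1 - u) * r * sin w" unfolding re im by (simp add: algebra_simps)
    finally have "0 < \<rho> * sin (w - \<eta>)" using u r sw by simp
    moreover have "0 < \<rho> * sin \<eta>" unfolding im using u r sw by simp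
    ultimately show "0 < sin \<eta> \<and> 0 < sin (w - \<eta>)" using u(1) by (simp add: zero_less_mult_iff)
  next
    assume s: "0 < sin \<eta> \<and> 0 < sin (w - \<eta>)"
    \<comment> \<open>By the law of sines, \<open>p\<close> and \<open>q\<close> are proportional to
      the barycentric coordinates of the point where the ray meets the segment.\<close>
    define p q where "p = sin (w - \<eta>) / r" and "q = sin \<eta> / r'"
    have pq: "0 < p" "0 < q" using s r by (auto simp: p_def q_def)
    define u where "u = q / (p + q)"
    define \<rho> where "\<rho> = sin w / (p + q)"
    have u: "0 < u" "u < 1" "1 - u = p / (p + q)" using pq by (auto simp: u_def field_simps)
    have "of_real \<rho> * cis \<eta> = (1 - u) *\<^sub>R complex_of_real r + u *\<^sub>R (of_real r' * cis w)"
    proof (rule complex_eqI)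
      have "sin w * cos \<eta> = p * r + q * (r' * cos w)"
        using r by (simp add: p_def q_def sin_diff)
      hence "sin w * cos \<eta> / (p + q) = p / (p + q) * r + q / (p + q) * (r' * cos w)"
        by (simp add: add_divide_distrib)
      thus "Re (of_real \<rho> * cis \<eta>) = Re ((1 - u) *\<^sub>R complex_of_real r + u *\<^sub>R (of_real r' * cis w))"
        unfolding u(3) by (simp add: \<rho>_def u_def)
      show "Im (of_real \<rho> * cis \<eta>) = Im ((1 - u) *\<^sub>R complex_of_real r + u *\<^sub>R (of_real r' * cis w))"
        using r by (simp add: \<rho>_def u_def q_def)
    qed
    moreover have "0 < \<rho>" using pq sw by (simp add: \<rho>_def)
    ultimately show "\<exists>\<rho>>0. of_real \<rho> * cis \<eta> \<in> open_segment (of_real r) (of_real r' * cis w)"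
      using u(1,2) ne unfolding in_segment by blast
  qed
qed

lemma sector_arc:
  assumes w: "0 < w" "w < pi"
  shows "{\<eta>\<in>{0..<2*pi}. 0 < sin \<eta> \<and> 0 < sin (w - \<eta>)} = {0<..<w}"
proof (intro set_eqI iffI)
  fix \<eta> assume e: "\<eta> \<in> {\<eta>\<in>{0..<2*pi}. 0 < sin \<eta> \<and> 0 < sin (w - \<eta>)}"
  have "\<eta> \<noteq> 0" using e by auto
  moreover have "\<eta> < pi" using e sin_le_zero[of \<eta>] by force
  moreover have "\<eta> < w"
  proof (rule ccontr)
    assume "\<not> \<eta> < w"
    hence "0 \<le> sin (\<eta> - w)" using \<open>\<eta> < pi\<close> w by (intro sin_ge_zero) auto
    thus False using e sin_minus[of "\<eta> - w"] by simp
  qed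
  ultimately show "\<eta> \<in> {0<..<w}" using e by auto
next
  fix \<eta> assume "\<eta> \<in> {0<..<w}"
  thus "\<eta> \<in> {\<eta>\<in>{0..<2*pi}. 0 < sin \<eta> \<and> 0 < sin (w - \<eta>)}" using w by (auto intro!: sin_gt_zero)
qed

text \<open>Rotating \<open>a\<close> to the real axis turns the set into the arc from 0 to
  \<open>Arg (cnj a * b)\<close>. For the other orientation the ends are exchanged, which changes
  neither side.\<close>

lemma hits_measure:
  assumes "Im (cnj a * b) \<noteq> 0"
  shows "{\<theta>\<in>{0..<2*pi}. hits a b \<theta>} \<in> lmeasurable"
    and "measure lebesgue {\<theta>\<in>{0..<2*pi}. hits a b \<theta>} = arccos ((a \<bullet> b) / (norm a * norm b))"
proof -
  have main: "{\<theta>\<in>{0..<2*pi}. hits a b \<theta>} \<in> lmeasurable \<and>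
      measure lebesgue {\<theta>\<in>{0..<2*pi}. hits a b \<theta>} = arccos ((a \<bullet> b) / (norm a * norm b))"
    if im: "0 < Im (cnj a * b)" for a b
  proof -
    have nz: "a \<noteq> 0" "b \<noteq> 0" using im by auto
    define \<alpha> where "\<alpha> = Arg a"
    define w where "w = Arg (cnj a * b)"
    have a: "a = of_real (norm a) * cis \<alpha>" unfolding \<alpha>_def using nz rcis_cmod_Arg[of a] by (simp add: rcis_def)
    have cw: "cnj a * b = of_real (norm a * norm b) * cis w"
      unfolding w_def using rcis_cmod_Arg[of "cnj a * b"] by (simp add: rcis_def norm_mult)
    have w: "0 < w" "w < pi" using im Arg_lt_pi[of "cnj a * b"] unfolding w_def by auto
    have "a * (cnj a * b) = (a * cnj a) * b" by simp
    also have "\<dots> = of_real ((norm a)\<^sup>2) * b" by (simp only: complex_norm_square)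
    finally have "of_real ((norm a)\<^sup>2) * b = of_real (norm a) * cis \<alpha> * (of_real (norm a * norm b) * cis w)"
      using a cw by metis
    also have "\<dots> = of_real ((norm a)\<^sup>2) * (of_real (norm b) * (cis \<alpha> * cis w))" by (simp add: power2_eq_square)
    finally have b: "b = cis \<alpha> * (of_real (norm b) * cis w)" using nz by (simp add: mult.left_commute)
    have a': "a = cis \<alpha> * of_real (norm a)" using a by (simp add: mult.commute)
    have seg: "cis \<alpha> * z \<in> open_segment a b \<longleftrightarrow> z \<in> open_segment (of_real (norm a)) (of_real (norm b) * cis w)" for z
    proof -
      have "open_segment a b = (\<lambda>z. cis \<alpha> * z) ` open_segment (of_real (norm a)) (of_real (norm b) * cis w)"
        by (subst open_segment_linear_image[symmetric]) (auto simp: a'[symmetric] b[symmetric] inj_def linear_times)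
      thus ?thesis by (auto simp: image_iff)
    qed
    have h: "hits a b \<theta> \<longleftrightarrow> 0 < sin (\<theta> - \<alpha>) \<and> 0 < sin (w - (\<theta> - \<alpha>))" for \<theta>
    proof -
      have "of_real \<rho> * cis \<theta> = cis \<alpha> * (of_real \<rho> * cis (\<theta> - \<alpha>))" for \<rho>
        by (simp add: mult.left_commute cis_mult)
      hence "hits a b \<theta> \<longleftrightarrow> (\<exists>\<rho>>0. of_real \<rho> * cis (\<theta> - \<alpha>) \<in> open_segment (of_real (norm a)) (of_real (norm b) * cis w))"
        unfolding hits_def by (simp only: seg)
      thus ?thesis using sector_iff[OF w, of "norm a" "norm b" "\<theta> - \<alpha>"] nz by simp
    qed
    let ?P = "\<lambda>\<eta>. 0 < sin \<eta> \<and> 0 < sin (w - \<eta>)"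
    have per: "?P (x + 2 * pi) \<longleftrightarrow> ?P x" for x
      using sin_periodic[of x] sin_periodic[of "w - (x + 2 * pi)"] by (simp add: algebra_simps)
    have op: "open {\<theta>. ?P (\<theta> - \<beta>)}" for \<beta>
      by (intro open_Collect_conj open_Collect_less continuous_intros)
    have "measure lebesgue {\<theta>\<in>{0..<2*pi}. hits a b \<theta>} = measure lebesgue {\<theta>\<in>{0..<2*pi}. ?P \<theta>}"
      unfolding h using measure_periodic_shift[of ?P \<alpha>] per op[of 0] by simp
    also have "\<dots> = w" unfolding sector_arc[OF w] using w by simp
    also have "w = arccos (cos w)" using w by (simp add: arccos_cos)
    also have "cos w = (a \<bullet> b) / (norm a * norm b)"
    proof -
      have "a \<bullet> b = Re (cnj a * b)" by (simp add: inner_complex_def)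
      also have "\<dots> = norm a * norm b * cos w" unfolding cw by simp
      finally show ?thesis using nz by simp
    qed
    finally have m: "measure lebesgue {\<theta>\<in>{0..<2*pi}. hits a b \<theta>} = arccos ((a \<bullet> b) / (norm a * norm b))" .
    have "{\<theta>\<in>{0..<2*pi}. hits a b \<theta>} = {0..<2*pi} \<inter> {\<theta>. ?P (\<theta> - \<alpha>)}" using h by auto
    moreover have "{\<theta>. ?P (\<theta> - \<alpha>)} \<in> sets lebesgue" using op by auto
    ultimately have "{\<theta>\<in>{0..<2*pi}. hits a b \<theta>} \<in> lmeasurable" using lmeasurable_ivl_Int by simp
    thus ?thesis using m by simp
  qed
  have sym: "hits a b = hits b a" by (simp add: hits_def open_segment_commute fun_eq_iff)
  have "Im (cnj b * a) = - Im (cnj a * b)" by (simp add: algebra_simps)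
  then consider "0 < Im (cnj a * b)" | "0 < Im (cnj b * a)" using assms by linarith
  hence "{\<theta>\<in>{0..<2*pi}. hits a b \<theta>} \<in> lmeasurable \<and>
      measure lebesgue {\<theta>\<in>{0..<2*pi}. hits a b \<theta>} = arccos ((a \<bullet> b) / (norm a * norm b))"
  proof cases
    case 1 thus ?thesis by (rule main)
  next
    case 2
    from main[OF this] show ?thesis unfolding sym by (simp add: inner_commute mult.commute)
  qed
  thus "{\<theta>\<in>{0..<2*pi}. hits a b \<theta>} \<in> lmeasurable"
    "measure lebesgue {\<theta>\<in>{0..<2*pi}. hits a b \<theta>} = arccos ((a \<bullet> b) / (norm a * norm b))" by auto
qed

lemma half_circle_measure:
  fixes n :: complex
  assumes "n \<noteq> 0"
  shows "{\<theta>\<in>{0..<2*pi}. 0 \<le> n \<bullet> cis \<theta>} \<in> lmeasurable" "measure lebesgue {\<theta>\<in>{0..<2*pi}. 0 \<le> n \<bullet> cis \<theta>} = pi"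
proof -
  define \<gamma> where "\<gamma> = Arg n"
  have n: "n = of_real (norm n) * cis \<gamma>" unfolding \<gamma>_def using rcis_cmod_Arg[of n] by (simp add: rcis_def)
  have "n \<bullet> cis \<theta> = norm n * cos (\<theta> - \<gamma>)" for \<theta>
    by (subst n) (simp add: inner_complex_def cos_diff algebra_simps)
  hence h: "0 \<le> n \<bullet> cis \<theta> \<longleftrightarrow> 0 \<le> cos (\<theta> - \<gamma>)" for \<theta> using assms by (simp add: zero_le_mult_iff)
  have cl: "closed {\<theta>. 0 \<le> cos (\<theta> - \<beta>)}" for \<beta> :: real by (intro closed_Collect_le continuous_intros)
  have "measure lebesgue {\<theta>\<in>{0..<2*pi}. 0 \<le> n \<bullet> cis \<theta>} = measure lebesgue {\<theta>\<in>{0..<2*pi}. 0 \<le> cos \<theta>}"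
    unfolding h using measure_periodic_shift[of "\<lambda>x. 0 \<le> cos x" \<gamma>] cl[of 0] by simp
  also have "{\<theta>\<in>{0..<2*pi}. 0 \<le> cos \<theta>} = {0..pi/2} \<union> {3*pi/2..<2*pi}"
  proof (intro set_eqI iffI)
    fix \<theta> assume t: "\<theta> \<in> {\<theta>\<in>{0..<2*pi}. 0 \<le> cos \<theta>}"
    show "\<theta> \<in> {0..pi/2} \<union> {3*pi/2..<2*pi}"
    proof (rule ccontr)
      assume "\<not> ?thesis"
      hence "- (pi/2) < \<theta> - pi" "\<theta> - pi < pi / 2" using t by auto
      hence "0 < cos (\<theta> - pi)" by (rule cos_gt_zero_pi)
      thus False using t by (simp add: cos_diff)
    qed
  next
    fix \<theta> assume "\<theta> \<in> {0..pi/2} \<union> {3*pi/2..<2*pi}"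
    thus "\<theta> \<in> {\<theta>\<in>{0..<2*pi}. 0 \<le> cos \<theta>}"
    proof
      assume t: "\<theta> \<in> {0..pi/2}"
      hence "0 \<le> \<theta>" "\<theta> \<le> pi / 2" by auto
      moreover from this have "\<theta> < 2 * pi" "- (pi / 2) \<le> \<theta>" using pi_gt_zero by linarith+
      ultimately show ?thesis using cos_ge_zero[of \<theta>] by simp
    next
      assume t: "\<theta> \<in> {3*pi/2..<2*pi}"
      hence "0 \<le> cos (\<theta> - 2 * pi)" by (intro cos_ge_zero) auto
      thus ?thesis using t by (auto simp: cos_diff)
    qed
  qed
  also have "measure lebesgue ({0..pi/2} \<union> {3*pi/2..<2*pi}) = pi"
  proof -
    have "{3*pi/2..<2*pi} \<in> lmeasurable" using lmeasurable_ivl_Int[of UNIV "3*pi/2" "2*pi"] by simp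
    moreover have "{0..pi/2} \<inter> {3*pi/2..<2*pi} = {}" using pi_gt_zero by auto
    ultimately show ?thesis by (simp add: measure_Un3)
  qed
  finally show "measure lebesgue {\<theta>\<in>{0..<2*pi}. 0 \<le> n \<bullet> cis \<theta>} = pi" .
  have "{\<theta>\<in>{0..<2*pi}. 0 \<le> n \<bullet> cis \<theta>} = {0..<2*pi} \<inter> {\<theta>. 0 \<le> cos (\<theta> - \<gamma>)}" using h by auto
  moreover have "{\<theta>. 0 \<le> cos (\<theta> - \<gamma>)} \<in> sets lebesgue" using cl by auto
  ultimately show "{\<theta>\<in>{0..<2*pi}. 0 \<le> n \<bullet> cis \<theta>} \<in> lmeasurable" using lmeasurable_ivl_Int by simp
qed

text \<open>Measuring sets of directions replaces any argument about orientation or winding: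
  disjoint sets contained in \<open>C\<close> suffice for a bound of an angle sum.\<close>

lemma direction_sum_le:
  fixes a b :: "'k \<Rightarrow> complex"
  assumes fin: "finite K" and nc: "\<And>k. k \<in> K \<Longrightarrow> Im (cnj (a k) * b k) \<noteq> 0"
    and disj: "\<And>k k' \<theta>. k \<in> K \<Longrightarrow> k' \<in> K \<Longrightarrow> hits (a k) (b k) \<theta> \<Longrightarrow> hits (a k') (b k') \<theta> \<Longrightarrow> k = k'"
    and C: "C \<in> lmeasurable" "\<And>k \<theta>. k \<in> K \<Longrightarrow> 0 \<le> \<theta> \<Longrightarrow> \<theta> < 2 * pi \<Longrightarrow> hits (a k) (b k) \<theta> \<Longrightarrow> \<theta> \<in> C"
  shows "(\<Sum>k\<in>K. arccos ((a k \<bullet> b k) / (norm (a k) * norm (b k)))) \<le> measure lebesgue C"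
proof -
  let ?A = "\<lambda>k. {\<theta>\<in>{0..<2*pi}. hits (a k) (b k) \<theta>}"
  have m: "?A k \<in> lmeasurable" if "k \<in> K" for k using hits_measure(1)[OF nc[OF that]] .
  have "(\<Sum>k\<in>K. arccos ((a k \<bullet> b k) / (norm (a k) * norm (b k)))) = (\<Sum>k\<in>K. measure lebesgue (?A k))"
    using hits_measure(2)[OF nc] by (intro sum.cong) auto
  also have "\<dots> = measure lebesgue (\<Union>k\<in>K. ?A k)"
  proof (rule measure_UNION'[symmetric, OF fin m])
    show "pairwise (\<lambda>i j. disjnt (?A i) (?A j)) K" using disj by (force simp: pairwise_def disjnt_def)
  qed
  also have "\<dots> \<le> measure lebesgue C"
    by (rule measure_mono_fmeasurable[OF _ _ C(1)]) (use C(2) m fin in \<open>auto intro!: fmeasurableD sets.finite_UN\<close>)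
  finally show ?thesis .
qed

subsection \<open>Comparison of links\<close>

lemma connected_finite_closed_cover:
  assumes U: "connected U" "U \<noteq> {}" and J: "finite J" "\<And>j. j \<in> J \<Longrightarrow> closed (T j)"
    and cov: "U \<subseteq> (\<Union>j\<in>J. T j)"
    and disj: "\<And>i j. i \<in> J \<Longrightarrow> j \<in> J \<Longrightarrow> i \<noteq> j \<Longrightarrow> T i \<inter> T j \<inter> U = {}"
  shows "\<exists>j\<in>J. U \<subseteq> T j"
proof -
  obtain u where u: "u \<in> U" using U by blast
  then obtain j where j: "j \<in> J" "u \<in> T j" using cov by blast
  have "closed (T j)" "closed (\<Union>i\<in>J - {j}. T i)" using J j by auto
  moreover have "U \<subseteq> T j \<union> (\<Union>i\<in>J - {j}. T i)" using cov by blast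
  moreover have "T j \<inter> (\<Union>i\<in>J - {j}. T i) \<inter> U = {}" using disj[OF j(1)] by blast
  moreover have "T j \<inter> U \<noteq> {}" using u j by blast
  ultimately have "(\<Union>i\<in>J - {j}. T i) \<inter> U = {}" using U(1) unfolding connected_closed by metis
  hence "U \<subseteq> T j" using cov by blast
  thus ?thesis using j by blast
qed

text \<open>The points are unrolled to all natural indices, so that the successor of the last node
  of a period needs no separate treatment.\<close>

lemma circular_order:
  fixes A :: "real set"
  assumes "finite A" "A \<noteq> {}" "A \<subseteq> {0..<2*pi}"
  obtains n :: nat and \<theta> :: "nat \<Rightarrow> real" where "0 < n" "strict_mono \<theta>" "\<And>k. \<theta> (k + n) = \<theta> k + 2 * pi"
    "\<theta> ` {..<n} = A" "\<And>k t m. \<theta> k < t \<Longrightarrow> t < \<theta> (Suc k) \<Longrightarrow> t - 2 * pi * of_int m \<notin> A"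
proof -
  define n where "n = card A"
  have n: "0 < n" using assms by (simp add: n_def card_gt_0_iff)
  define xs where "xs = sorted_list_of_set A"
  have xs: "length xs = n" "set xs = A" "sorted_wrt (<) xs" using assms by (simp_all add: xs_def n_def)
  define \<theta> where "\<theta> k = xs ! (k mod n) + 2 * pi * real (k div n)" for k
  have xA: "xs ! j \<in> A" if "j < n" for j using that xs by (metis nth_mem)
  have per: "\<theta> (k + m * n) = \<theta> k + 2 * pi * real m" for k m
    using n by (simp add: \<theta>_def algebra_simps)
  have "\<theta> k < \<theta> (Suc k)" for k
  proof (cases "Suc (k mod n) = n")
    case True
    hence s: "Suc k mod n = 0" "Suc k div n = Suc (k div n)" by (simp_all add: mod_Suc div_Suc)
    have "xs ! (k mod n) < 2 * pi" "0 \<le> xs ! 0" using xA[of "k mod n"] xA[of 0] n assms(3) by auto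
    thus ?thesis unfolding \<theta>_def s by (simp add: algebra_simps)
  next
    case False
    hence s: "Suc k mod n = Suc (k mod n)" "Suc k div n = k div n" by (simp_all add: mod_Suc div_Suc)
    have "Suc (k mod n) < n" using False mod_less_divisor[OF n, of k] by linarith
    hence "xs ! (k mod n) < xs ! Suc (k mod n)" using xs by (simp add: sorted_wrt_nth_less)
    thus ?thesis unfolding \<theta>_def s by simp
  qed
  hence mono: "strict_mono \<theta>" by (simp add: strict_mono_Suc_iff)
  have im: "\<theta> ` {..<n} = A"
  proof -
    have "\<theta> ` {..<n} = (!) xs ` {..<n}" by (intro image_cong) (auto simp: \<theta>_def)
    thus ?thesis using xs nth_image[of n xs] by (simp add: lessThan_atLeast0)
  qed
  show thesis
  proof
    show "0 < n" "strict_mono \<theta>" "\<theta> ` {..<n} = A" using n mono im by auto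
    show "\<theta> (k + n) = \<theta> k + 2 * pi" for k using per[of k 1] by simp
    fix k t m assume t: "\<theta> k < t" "t < \<theta> (Suc k)"
    show "t - 2 * pi * of_int m \<notin> A"
    proof
      assume "t - 2 * pi * of_int m \<in> A"
      then obtain j where j: "j < n" "t - 2 * pi * of_int m = \<theta> j" using im by (metis imageE lessThan_iff)
      have "0 \<le> \<theta> 0" "\<theta> 0 \<le> \<theta> k" using im n assms(3) mono by (auto simp: strict_mono_less_eq)
      have "\<theta> j < 2 * pi" using im j assms(3) by auto
      have "0 < 2 * pi * of_int m + 2 * pi"
        using j(2) t(1) \<open>0 \<le> \<theta> 0\<close> \<open>\<theta> 0 \<le> \<theta> k\<close> \<open>\<theta> j < 2 * pi\<close> by linarith
      hence "0 < 2 * pi * (of_int m + 1)" by (simp add: algebra_simps)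
      hence "0 \<le> m" by (simp add: zero_less_mult_iff)
      hence "t = \<theta> (j + nat m * n)" using per[of j "nat m"] j(2) by simp
      hence "k < j + nat m * n" "j + nat m * n < Suc k" using t mono by (auto simp: strict_mono_less)
      thus False by linarith
    qed
  qed
qed

text \<open>Stewart's theorem computes the distance from \<open>z\<close> to the point of the
  segment with these ratios, and it is 0.\<close>

lemma segment_of_dists:
  fixes p q z :: "'a::real_inner"
  assumes "norm (p - z) = s * l" "norm (z - q) = (1 - s) * l" "norm (p - q) = l" "0 \<le> s" "s \<le> 1"
  shows "z = (1 - s) *\<^sub>R p + s *\<^sub>R q"
proof -
  have "(norm (z - ((1 - s) *\<^sub>R p + s *\<^sub>R q)))\<^sup>2 = (1 - s) * (norm (p - z))\<^sup>2 + s * (norm (z - q))\<^sup>2 - s * (1 - s) * (norm (p - q))\<^sup>2"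
    unfolding power2_norm_eq_inner
    by (simp add: inner_diff_left inner_diff_right inner_add_left inner_add_right inner_commute algebra_simps)
  also have "\<dots> = 0" unfolding assms by (simp add: power2_eq_square algebra_simps)
  finally show ?thesis by simp
qed

lemma unit_collinear_complex:
  fixes n e1 e2 :: complex
  assumes "n \<noteq> 0" "n \<bullet> e1 = 0" "n \<bullet> e2 = 0" "norm e1 = 1" "norm e2 = 1"
  shows "e1 = e2 \<or> e1 = - e2"
proof -
  have h: "\<exists>c. e = c *\<^sub>R (\<i> * n)" if "n \<bullet> e = 0" for e
  proof (cases "Re n = 0")
    case True
    hence "Im n \<noteq> 0" using assms(1) by (auto simp: complex_eq_iff)
    thus ?thesis using that True
      by (intro exI[of _ "- Re e / Im n"]) (auto simp: complex_eq_iff inner_complex_def)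
  next
    case False
    have "Re e * Re n + Im e * Im n = 0" using that by (simp add: inner_complex_def mult.commute)
    thus ?thesis using False
      by (intro exI[of _ "Im e / Re n"]) (auto simp: complex_eq_iff field_simps)
  qed
  obtain c1 where c1: "e1 = c1 *\<^sub>R (\<i> * n)" using h assms(2) by blast
  obtain c2 where c2: "e2 = c2 *\<^sub>R (\<i> * n)" using h assms(3) by blast
  have "\<bar>c1\<bar> * norm n = \<bar>c2\<bar> * norm n" using assms(4,5) by (simp add: c1 c2 norm_mult)
  hence "c1 = c2 \<or> c1 = - c2" using assms(1) by auto
  thus ?thesis by (auto simp: c1 c2)
qed

lemma perp_both_imp_collinear:
  fixes n :: complex
  assumes "n \<noteq> 0" "n \<bullet> a = 0" "n \<bullet> b = 0" shows "Im (cnj a * b) = 0"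
proof -
  have "Re n * Re a + Im n * Im a = 0" "Re n * Re b + Im n * Im b = 0" using assms by (auto simp: inner_complex_def)
  hence "Re n * Im (cnj a * b) = 0" "Im n * Im (cnj a * b) = 0" by (simp_all, algebra+)
  thus ?thesis using assms(1) by (auto simp: complex_eq_iff)
qed

lemma apex_angle_norm: "apex_angle (norm (a - b)) ((norm a)\<^sup>2) ((norm b)\<^sup>2) = arccos ((a \<bullet> b) / (norm a * norm (b::complex)))"
proof -
  have "(norm a)\<^sup>2 + (norm b)\<^sup>2 - (norm (a - b))\<^sup>2 = 2 * (a \<bullet> b)"
    by (simp add: power2_norm_eq_inner inner_diff_left inner_diff_right inner_commute)
  thus ?thesis unfolding apex_angle_def by (simp add: real_sqrt_mult)
qed

lemma gram_tri_norm: "gram_tri (norm (a - b)) ((norm a)\<^sup>2) ((norm b)\<^sup>2) = 4 * (Im (cnj a * b))\<^sup>2"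
proof -
  have "(norm a)\<^sup>2 + (norm b)\<^sup>2 - (norm (a - b))\<^sup>2 = 2 * (a \<bullet> b)"
    by (simp add: power2_norm_eq_inner inner_diff_left inner_diff_right inner_commute)
  thus ?thesis unfolding gram_tri_def
    by (simp add: cmod_power2 inner_complex_def) (simp add: power2_eq_square algebra_simps)
qed

section \<open>Links as convex curves in the plane\<close>

context cusp_chart
begin

lemma face_of_H_line:
  assumes "i \<in> I" "v \<in> W i"
  obtains n c where "n \<noteq> 0" "\<And>z. z \<in> K \<Longrightarrow> c \<le> n \<bullet> z" "\<And>x. x \<in> H \<Longrightarrow> x \<in> fc i \<Longrightarrow> n \<bullet> y (L x) = c" 
     "W i = V \<Longrightarrow> \<forall>z\<in>K. n \<bullet> z = c"
proof -
  obtain n c where n: "n \<noteq> 0" "\<forall>z\<in>K. c \<le> n \<bullet> z" "\<forall>w\<in>V - {v}. n \<bullet> y (hv w) = c \<longleftrightarrow> w \<in> W i"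
    using face_line[OF assms] by blast
  have w: "n \<bullet> y (hv w) = c" if "w \<in> W i - {v}" for w using n(3) that W_sub[OF assms(1)] by blast
  have "n \<bullet> y (L x) = c" if "x \<in> H" "x \<in> fc i" for x
    using face_line_hull[of i n c "y (L x)"] w y_H_face_mem[OF assms(1) that] by blast
  moreover have "\<forall>z\<in>K. n \<bullet> z = c" if "W i = V"
    using face_line_hull[of i n c] w that unfolding K_def by blast
  ultimately show thesis using that[of n c] n by blast
qed

lemma interior_imp_nonplanar:
  assumes "interior K \<noteq> {}" shows nonplanar
proof (rule ccontr)
  assume "\<not> nonplanar"
  then obtain \<nu> where \<nu>: "\<nu> \<noteq> 0" "\<forall>w\<in>V. mk \<nu> (hv w) = 0" unfolding nonplanar_def by blast
  obtain i where i: "i \<in> I" "v \<in> W i" using V_in_face[OF vq(1)] by blast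
  obtain n c where n: "n \<noteq> 0" "W i = V \<Longrightarrow> \<forall>z\<in>K. n \<bullet> z = c" using face_of_H_line[OF i] by metis
  have "K \<subseteq> {z. n \<bullet> z = c}" using n(2) planar(1)[OF \<nu> i(1)] by blast
  hence "interior K \<subseteq> interior {z. n \<bullet> z = c}" by (rule interior_mono)
  thus False using assms interior_hyperplane[OF n(1)] by auto
qed

text \<open>The bend is \<open>2 * (y0 \<bullet> (e1 + e2))\<close>. For different faces the wedge
  contains the vertex over the origin, so \<open>- y0\<close> is a nonnegative combination of
  \<open>e1\<close> and \<open>e2\<close>, and \<open>e1 \<bullet> e2 \<ge> - 1\<close>. For equal
  faces, as at a node that comes from the other polyhedron, both arms lie on one line; being
  disjoint they point in opposite directions.\<close>

lemma link_kink:
  assumes i: "i \<in> I" "j \<in> I" and x0: "x0 \<in> H" "x0 \<in> fc i" "x0 \<in> fc j"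
    and a1: "\<And>s. 0 < s \<Longrightarrow> s < 1 \<Longrightarrow> ga s \<in> H \<and> ga s \<in> fc i \<and> y (L (ga s)) = (1 - s) *\<^sub>R y (L x0) + s *\<^sub>R p1"
    and a2: "\<And>s. 0 < s \<Longrightarrow> s < 1 \<Longrightarrow> gb s \<in> H \<and> gb s \<in> fc j \<and> y (L (gb s)) = (1 - s) *\<^sub>R y (L x0) + s *\<^sub>R p2"
    and single: "\<And>s. 0 < s \<Longrightarrow> s < 1 \<Longrightarrow> ga s \<in> fc j \<Longrightarrow> i = j" "\<And>s. 0 < s \<Longrightarrow> s < 1 \<Longrightarrow> gb s \<in> fc i \<Longrightarrow> i = j"
    and disj: "\<And>s t. 0 < s \<Longrightarrow> s < 1 \<Longrightarrow> 0 < t \<Longrightarrow> t < 1 \<Longrightarrow> ga s \<noteq> gb t"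
    and ne: "p1 \<noteq> y (L x0)" "p2 \<noteq> y (L x0)"
  shows "bend (norm (p1 - y (L x0))) (norm (p2 - y (L x0))) ((norm p1)\<^sup>2) ((norm (y (L x0)))\<^sup>2) ((norm p2)\<^sup>2) \<le> 0"
proof -
  define y0 where "y0 = y (L x0)"
  define l1 l2 where "l1 = norm (p1 - y0)" and "l2 = norm (p2 - y0)"
  have l: "0 < l1" "0 < l2" using ne by (auto simp: l1_def l2_def y0_def)
  define e1 e2 where "e1 = (1 / l1) *\<^sub>R (p1 - y0)" and "e2 = (1 / l2) *\<^sub>R (p2 - y0)"
  have ne1: "norm e1 = 1" "norm e2 = 1" using l by (auto simp: e1_def e2_def l1_def l2_def)
  have p: "p1 - y0 = l1 *\<^sub>R e1" "p2 - y0 = l2 *\<^sub>R e2" using l by (auto simp: e1_def e2_def)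
  have tm: "((norm p)\<^sup>2 - (norm y0)\<^sup>2 - (norm (p - y0))\<^sup>2) / l = 2 * (y0 \<bullet> ((1 / l) *\<^sub>R (p - y0)))" for p l
  proof -
    have "(norm p)\<^sup>2 - (norm y0)\<^sup>2 - (norm (p - y0))\<^sup>2 = 2 * (y0 \<bullet> (p - y0))"
      by (simp add: power2_norm_eq_inner inner_diff_left inner_diff_right inner_commute)
    thus ?thesis by simp
  qed
  have "y0 \<bullet> (e1 + e2) \<le> 0"
  proof (cases "i = j")
    case False
    have half: "0 < (1/2::real)" "(1/2::real) < 1" by simp_all
    have h: "ga (1/2) \<in> H" "gb (1/2) \<in> H" "ga (1/2) \<in> fc i - fc j" "gb (1/2) \<in> fc j - fc i"
      using a1[OF half] a2[OF half] single(1)[OF half] single(2)[OF half] False by blast+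
    obtain s t where st: "0 \<le> s" "0 \<le> t"
      "y (hv q) - y (L x0) = s *\<^sub>R (y (L (ga (1/2))) - y (L x0)) + t *\<^sub>R (y (L (gb (1/2))) - y (L x0))"
      using edge_in_chart(2)[OF i False x0 h, of q] vq by auto
    have hf: "(1 - 1/2) *\<^sub>R y0 + (1/2) *\<^sub>R p - y0 = (1/2) *\<^sub>R (p - y0)" for p
      by (simp add: scaleR_diff_right scaleR_diff_left)
    have "y (L (ga (1/2))) - y (L x0) = (l1 / 2) *\<^sub>R e1"
      using a1[OF half] hf[of p1] unfolding y0_def[symmetric] p(1) by simp
    moreover have "y (L (gb (1/2))) - y (L x0) = (l2 / 2) *\<^sub>R e2"
      using a2[OF half] hf[of p2] unfolding y0_def[symmetric] p(2) by simp
    ultimately have "- y0 = (s * (l1 / 2)) *\<^sub>R e1 + (t * (l2 / 2)) *\<^sub>R e2"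
      using st(3) y_Q by (simp add: y0_def)
    hence y0: "y0 = - ((s * (l1 / 2)) *\<^sub>R e1 + (t * (l2 / 2)) *\<^sub>R e2)" by (metis minus_minus)
    define k where "k = e1 \<bullet> e2"
    have k: "- 1 \<le> k" using Cauchy_Schwarz_ineq2[of e1 e2] ne1 by (simp add: k_def)
    have ee: "e1 \<bullet> e1 = 1" "e2 \<bullet> e2 = 1" using ne1 by (auto simp: dot_square_norm)
    have "y0 \<bullet> (e1 + e2) = - ((s * (l1 / 2) + t * (l2 / 2)) * (1 + k))"
      unfolding y0 by (simp add: inner_add_left inner_add_right ee k_def[symmetric] inner_commute[of e2 e1] algebra_simps) (simp add: field_simps)
    thus ?thesis using st l k by (simp add: mult_nonneg_nonneg)
  next
    case True
    have vi: "v \<in> W i" using H_face[OF x0(1) i(1) x0(2)] .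
    obtain n c where n: "n \<noteq> 0" "\<And>x. x \<in> H \<Longrightarrow> x \<in> fc i \<Longrightarrow> n \<bullet> y (L x) = c" using face_of_H_line[OF i(1) vi] by metis
    have c0: "n \<bullet> y0 = c" using n(2) x0 by (simp add: y0_def)
    have hs: "(1 - s) *\<^sub>R y0 + s *\<^sub>R p = y0 + s *\<^sub>R (p - y0)" for s p
      by (simp add: scaleR_diff_right scaleR_diff_left)
    have h1: "y (L (ga s)) = y0 + (s * l1) *\<^sub>R e1" if "0 < s" "s < 1" for s
      using a1[OF that] hs[of s p1] unfolding y0_def[symmetric] p(1) by simp
    have h2: "y (L (gb s)) = y0 + (s * l2) *\<^sub>R e2" if "0 < s" "s < 1" for s
      using a2[OF that] hs[of s p2] unfolding y0_def[symmetric] p(2) by simp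
    have "n \<bullet> (y0 + (1/2 * l1) *\<^sub>R e1) = c" "n \<bullet> (y0 + (1/2 * l2) *\<^sub>R e2) = c"
      using n(2)[of "ga (1/2)"] n(2)[of "gb (1/2)"] a1[of "1/2"] a2[of "1/2"] h1[of "1/2"] h2[of "1/2"] True by auto
    hence "n \<bullet> e1 = 0" "n \<bullet> e2 = 0" using c0 l by (auto simp: inner_add_right)
    hence "e1 = e2 \<or> e1 = - e2" using unit_collinear_complex[OF n(1)] ne1 by blast
    moreover have "e1 \<noteq> e2"
    proof
      assume e: "e1 = e2"
      \<comment> \<open>A distance reached on both arms; arms in the same direction would meet
        there.\<close>
      define r where "r = min l1 l2 / 2"
      have r: "0 < r / l1" "r / l1 < 1" "0 < r / l2" "r / l2 < 1" using l by (auto simp: r_def field_simps min_def)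
      have "y (L (ga (r / l1))) = y (L (gb (r / l2)))" using h1[OF r(1,2)] h2[OF r(3,4)] l e by simp
      moreover have m: "ga (r / l1) \<in> H" "gb (r / l2) \<in> H" "ga (r / l1) \<in> fc i" "gb (r / l2) \<in> fc i"
        using a1[OF r(1,2)] a2[OF r(3,4)] True by auto
      ultimately have "L (ga (r / l1)) = L (gb (r / l2))" using y_inj H_M by blast
      hence "ga (r / l1) = gb (r / l2)" using m(3,4) L_face[OF i(1)] by (auto simp: bij_betw_def inj_on_def)
      thus False using disj[OF r] by blast
    qed
    ultimately have "e1 + e2 = 0" by auto
    thus ?thesis by simp
  qed
  moreover have "((norm p1)\<^sup>2 - (norm y0)\<^sup>2 - (norm (p1 - y0))\<^sup>2) / norm (p1 - y0)
     + ((norm p2)\<^sup>2 - (norm y0)\<^sup>2 - (norm (p2 - y0))\<^sup>2) / norm (p2 - y0) = 2 * (y0 \<bullet> (e1 + e2))"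
    unfolding tm e1_def e2_def l1_def l2_def by (simp add: inner_add_right)
  ultimately show ?thesis unfolding y0_def bend_def by simp
qed

end

lemma segment_direction:
  assumes w: "\<theta> < \<theta>'" "\<theta>' < \<theta> + pi" and r: "0 < r" "0 < r'" and s: "0 < s" "s < 1"
    and z: "z = (1 - s) *\<^sub>R (r *\<^sub>R cis \<theta>) + s *\<^sub>R (r' *\<^sub>R cis \<theta>')"
  shows "\<exists>t \<rho>. \<theta> < t \<and> t < \<theta>' \<and> 0 < \<rho> \<and> z = \<rho> *\<^sub>R cis t"
proof -
  define w0 where "w0 = \<theta>' - \<theta>"
  have w0: "0 < w0" "w0 < pi" using w by (auto simp: w0_def)
  define u where "u = z * cis (- \<theta>)"
  have cc: "cis \<theta> * cis (- \<theta>) = 1" "cis \<theta>' * cis (- \<theta>) = cis w0" by (simp_all add: cis_mult w0_def)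
  have u: "u = (1 - s) *\<^sub>R of_real r + s *\<^sub>R (of_real r' * cis w0)"
    unfolding u_def z by (simp add: scaleR_conv_of_real distrib_right mult.assoc cc)
  have sw: "0 < sin w0" using w0 by (simp add: sin_gt_zero)
  have "Im u = s * (r' * sin w0)" unfolding u by simp
  hence "0 < Im u" using s r sw by simp
  hence u0: "u \<noteq> 0" by auto
  define \<eta> where "\<eta> = Arg2pi u"
  have \<eta>: "0 \<le> \<eta>" "\<eta> < 2 * pi" "u = of_real (norm u) * cis \<eta>" using Arg2pi[of u] by (auto simp: \<eta>_def cis_conv_exp is_Arg_def)
  have ne: "of_real r \<noteq> of_real r' * cis w0"
  proof
    assume "of_real r = of_real r' * cis w0"
    hence "Im (of_real r) = Im (of_real r' * cis w0)" by simp
    thus False using r sw by simp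
  qed
  have "u \<in> open_segment (of_real r) (of_real r' * cis w0)" unfolding in_segment using ne s u by blast
  hence "of_real (norm u) * cis \<eta> \<in> open_segment (of_real r) (of_real r' * cis w0)"
    unfolding \<eta>(3)[symmetric] .
  hence "0 < sin \<eta> \<and> 0 < sin (w0 - \<eta>)"
    by (intro iffD1[OF sector_iff[OF w0 r]] exI[of _ "norm u"] conjI) (use u0 in simp_all)
  hence "\<eta> \<in> {\<eta>\<in>{0..<2*pi}. 0 < sin \<eta> \<and> 0 < sin (w0 - \<eta>)}" using \<eta>(1,2) by simp
  hence "\<eta> \<in> {0<..<w0}" unfolding sector_arc[OF w0] .
  moreover have "z = u * cis \<theta>" unfolding u_def by (simp add: mult.assoc cis_mult)
  hence "z = (of_real (norm u) * cis \<eta>) * cis \<theta>" unfolding \<eta>(3)[symmetric] .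
  hence "z = norm u *\<^sub>R cis (\<theta> + \<eta>)"
    unfolding scaleR_conv_of_real mult.assoc cis_mult by (simp only: add.commute)
  ultimately show ?thesis using u0 by (intro exI[of _ "\<theta> + \<eta>"] exI[of _ "norm u"]) (auto simp: w0_def)
qed

text \<open>Beyond the line in this direction the value drops below \<open>c\<close>. Applied to
  supporting lines from both sides, this shows that a ray leaves a link in one point.\<close>

lemma line_ray_le:
  fixes n w :: "'a::real_inner"
  assumes "n \<bullet> (\<rho> *\<^sub>R w) = c" "c < 0" "c \<le> n \<bullet> (\<rho>' *\<^sub>R w)" "0 < \<rho>"
  shows "\<rho>' \<le> \<rho>"
proof (rule ccontr)
  assume "\<not> \<rho>' \<le> \<rho>"
  moreover have "n \<bullet> w < 0" using assms by (auto simp: mult_less_0_iff)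
  ultimately have "\<rho>' * (n \<bullet> w) < \<rho> * (n \<bullet> w)" by (simp add: mult_strict_right_mono_neg)
  thus False using assms by simp
qed

lemma cis_eq_int: "cis x = cis y \<Longrightarrow> \<exists>m::int. x = y + 2 * pi * of_int m"
  using sin_cos_eq_iff[of x y] by (auto simp: complex_eq_iff mult.commute mult.left_commute)

context cusp_chart
begin

lemma y_eq_imp:
  assumes "x \<in> H" "x' \<in> H" "y (L x) = y (L x')" shows "L x = L x'"
  using y_inj[of "L x" "L x'"] assms H_M by auto

lemma face_line_neg:
  assumes int: "0 \<in> interior K" and i: "i \<in> I" "v \<in> W i"
  shows "\<exists>n c. c < 0 \<and> (\<forall>z\<in>K. c \<le> n \<bullet> z) \<and> (\<forall>x\<in>H. x \<in> fc i \<longrightarrow> n \<bullet> y (L x) = c)"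
proof -
  obtain n c where n: "n \<noteq> 0" "\<And>z. z \<in> K \<Longrightarrow> c \<le> n \<bullet> z" "\<And>x. x \<in> H \<Longrightarrow> x \<in> fc i \<Longrightarrow> n \<bullet> y (L x) = c"
    using face_of_H_line[OF i] by metis
  obtain e where e: "0 < e" "cball 0 e \<subseteq> K" using int by (meson mem_interior_cball)
  have "norm ((- (e / norm n)) *\<^sub>R n) = e" using e n by simp
  hence "(- (e / norm n)) *\<^sub>R n \<in> K" using e by (metis dist_0_norm mem_cball order_refl subsetD)
  hence "c \<le> n \<bullet> ((- (e / norm n)) *\<^sub>R n)" using n(2) by blast
  also have "\<dots> = - (e * norm n)" using n(1) by (simp add: dot_square_norm power2_eq_square)
  also have "\<dots> < 0" using e n by simp
  finally show ?thesis using n by blast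
qed

lemma ray_norm_unique:
  assumes x: "x \<in> H" "x \<in> fc i" "x' \<in> H" "x' \<in> fc i'"
    and n: "c < 0" "\<forall>z\<in>K. c \<le> n \<bullet> z" "\<forall>x\<in>H. x \<in> fc i \<longrightarrow> n \<bullet> y (L x) = c"
    and n': "c' < 0" "\<forall>z\<in>K. c' \<le> n' \<bullet> z" "\<forall>x\<in>H. x \<in> fc i' \<longrightarrow> n' \<bullet> y (L x) = c'"
    and t: "y (L x) = \<rho> *\<^sub>R w" "y (L x') = \<rho>' *\<^sub>R w" "0 < \<rho>" "0 < \<rho>'"
  shows "L x = L x'"
proof -
  have "\<rho>' \<le> \<rho>"
    by (rule line_ray_le[of n \<rho> w c]) (use n x t y_H_K[of x'] in auto)
  moreover have "\<rho> \<le> \<rho>'"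
    by (rule line_ray_le[of n' \<rho>' w c']) (use n' x t y_H_K[of x] in auto)
  ultimately have "\<rho> = \<rho>'" by simp
  thus ?thesis using y_eq_imp x t by metis
qed

lemma ray_unique:
  assumes int: "0 \<in> interior K" and x: "x \<in> H" "x' \<in> H"
    and t: "y (L x) = \<rho> *\<^sub>R w" "y (L x') = \<rho>' *\<^sub>R w" "0 < \<rho>" "0 < \<rho>'"
  shows "x = x'"
proof -
  obtain i where i: "i \<in> I" "v \<in> W i" "x \<in> fc i" using H_cover x by blast
  obtain i' where i': "i' \<in> I" "v \<in> W i'" "x' \<in> fc i'" using H_cover x by blast
  obtain n c where n: "c < 0" "\<forall>z\<in>K. c \<le> n \<bullet> z" "\<forall>x\<in>H. x \<in> fc i \<longrightarrow> n \<bullet> y (L x) = c"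
    using face_line_neg[OF int i(1,2)] by blast
  obtain n' c' where n': "c' < 0" "\<forall>z\<in>K. c' \<le> n' \<bullet> z" "\<forall>x\<in>H. x \<in> fc i' \<longrightarrow> n' \<bullet> y (L x) = c'"
    using face_line_neg[OF int i'(1,2)] by blast
  have "L x = L x'" using ray_norm_unique[OF x(1) i(3) x(2) i'(3) n n' t] .
  moreover have nonplanar using interior_imp_nonplanar int by blast
  ultimately show ?thesis using nonplanar_inj x H_M by blast
qed

text \<open>The last point of the ray in the compact set \<open>K\<close> is on its boundary and
  thus belongs to the image of a face.\<close>

lemma ray_ex:
  assumes int: "0 \<in> interior K"
  shows "\<exists>x\<in>H. \<exists>\<rho>>0. y (L x) = \<rho> *\<^sub>R cis t"
proof -
  define S where "S = {\<rho>. 0 \<le> \<rho> \<and> \<rho> *\<^sub>R cis t \<in> K}"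
  have cont: "continuous_on UNIV (\<lambda>\<rho>::real. \<rho> *\<^sub>R cis t)" by (intro continuous_intros)
  have "closed {\<rho>. \<rho> *\<^sub>R cis t \<in> K}"
    using continuous_closed_vimage[OF compact_imp_closed[OF compact_K], of "\<lambda>\<rho>::real. \<rho> *\<^sub>R cis t"] cont
    by (simp add: continuous_on_eq_continuous_at vimage_def)
  hence "closed S" unfolding S_def by (intro closed_Collect_conj closed_Collect_le) (auto intro: continuous_intros)
  moreover have "bounded S"
  proof -
    obtain B where B: "\<forall>z\<in>K. norm z \<le> B" using compact_imp_bounded[OF compact_K] by (auto simp: bounded_iff)
    have "norm \<rho> \<le> B" if "\<rho> \<in> S" for \<rho>
      using B[rule_format, of "\<rho> *\<^sub>R cis t"] that by (simp add: S_def)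
    thus ?thesis by (auto simp: bounded_iff)
  qed
  ultimately have "compact S" by (simp add: compact_eq_bounded_closed)
  moreover have "0 \<in> S" using zero_K by (simp add: S_def)
  ultimately obtain \<rho> where \<rho>: "\<rho> \<in> S" "\<And>r. r \<in> S \<Longrightarrow> r \<le> \<rho>" by (metis compact_attains_sup empty_iff)
  have "\<rho> *\<^sub>R cis t \<notin> interior K"
  proof
    assume "\<rho> *\<^sub>R cis t \<in> interior K"
    then obtain e where e: "0 < e" "cball (\<rho> *\<^sub>R cis t) e \<subseteq> K" by (meson mem_interior_cball)
    have "(\<rho> + e) *\<^sub>R cis t \<in> cball (\<rho> *\<^sub>R cis t) e"
      using e by (simp add: dist_norm scaleR_add_left)
    hence "\<rho> + e \<in> S" using \<rho> e by (auto simp: S_def)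
    thus False using \<rho> e by force
  qed
  then obtain i where i: "i \<in> I" "v \<in> W i" "\<rho> *\<^sub>R cis t \<in> convex hull ((y \<circ> hv) ` (W i - {v}))"
    using boundary_K \<rho>(1) by (auto simp: S_def)
  obtain x where x: "x \<in> H" "x \<in> fc i" "y (L x) = \<rho> *\<^sub>R cis t" using y_H_face_ex[OF i] by blast
  obtain n c where n: "c < 0" "\<forall>x\<in>H. x \<in> fc i \<longrightarrow> n \<bullet> y (L x) = c"
    using face_line_neg[OF int i(1,2)] by blast
  \<comment> \<open>The line of the face does not pass through the origin, because the origin is
    interior.\<close>
  have "\<rho> \<noteq> 0" using n x by force
  hence "0 < \<rho>" using \<rho>(1) by (auto simp: S_def)
  thus ?thesis using x by blast
qed

lemma compact_face_chart: 
  assumes "i \<in> I" shows "compact ((y \<circ> L) ` (H \<inter> fc i))"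
proof (cases "v \<in> W i")
  case True
  thus ?thesis unfolding y_H_face[OF assms True]
    using finite_W[OF assms] by (intro finite_imp_compact_convex_hull) auto
next
  case False
  hence "H \<inter> fc i = {}" using H_face assms by blast
  thus ?thesis by simp
qed

lemma convex_face_chart: 
  assumes "i \<in> I" "x \<in> H \<inter> fc i" "x' \<in> H \<inter> fc i" "0 \<le> s" "s \<le> 1"
  shows "\<exists>z\<in>H \<inter> fc i. y (L z) = (1 - s) *\<^sub>R y (L x) + s *\<^sub>R y (L x')"
proof -
  have "v \<in> W i" using H_face[of x i] assms(1,2) by simp
  hence "convex ((y \<circ> L) ` (H \<inter> fc i))" unfolding y_H_face[OF assms(1) \<open>v \<in> W i\<close>] by simp
  hence "(1 - s) *\<^sub>R (y \<circ> L) x + s *\<^sub>R (y \<circ> L) x' \<in> (y \<circ> L) ` (H \<inter> fc i)"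
    using convexD_alt[OF _ imageI[OF assms(2)] imageI[OF assms(3)] assms(4,5)] by blast
  thus ?thesis by auto
qed

text \<open>The image of a face is compact and avoids the origin, so its radial projection to the
  circle is compact.\<close>

lemma closed_directions:
  assumes int: "0 \<in> interior K" and i: "i \<in> I"
  shows "closed {t. \<exists>x\<in>H \<inter> fc i. \<exists>\<rho>>0. y (L x) = \<rho> *\<^sub>R cis t}"
proof -
  define Z where "Z = (y \<circ> L) ` (H \<inter> fc i)"
  have nz: "z \<noteq> 0" if zZ: "z \<in> Z" for z
  proof -
    obtain x where x: "x \<in> H" "x \<in> fc i" "z = y (L x)" using zZ by (auto simp: Z_def)
    obtain n c where n: "c < 0" "\<forall>x\<in>H. x \<in> fc i \<longrightarrow> n \<bullet> y (L x) = c"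
      using face_line_neg[OF int i H_face[OF x(1) i x(2)]] by blast
    thus ?thesis using x by force
  qed
  have "compact Z" unfolding Z_def using compact_face_chart[OF i] .
  hence "compact (sgn ` Z)"
    by (intro compact_continuous_image continuous_on_sgn continuous_on_id) (use nz in auto)
  hence "closed (cis -` (sgn ` Z))"
    by (intro continuous_closed_vimage compact_imp_closed continuous_intros)
  moreover have "cis -` (sgn ` Z) = {t. \<exists>x\<in>H \<inter> fc i. \<exists>\<rho>>0. y (L x) = \<rho> *\<^sub>R cis t}"
  proof (intro set_eqI iffI)
    fix t assume "t \<in> cis -` (sgn ` Z)"
    then obtain x where x: "x \<in> H \<inter> fc i" "cis t = sgn (y (L x))" by (auto simp: Z_def)
    hence "y (L x) \<noteq> 0" using nz by (auto simp: Z_def)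
    hence "y (L x) = norm (y (L x)) *\<^sub>R cis t" unfolding x(2) by (simp add: sgn_div_norm)
    thus "t \<in> {t. \<exists>x\<in>H \<inter> fc i. \<exists>\<rho>>0. y (L x) = \<rho> *\<^sub>R cis t}" using x \<open>y (L x) \<noteq> 0\<close>
      by (auto intro!: bexI[of _ x] exI[of _ "norm (y (L x))"])
  next
    fix t assume "t \<in> {t. \<exists>x\<in>H \<inter> fc i. \<exists>\<rho>>0. y (L x) = \<rho> *\<^sub>R cis t}"
    then obtain x \<rho> where x: "x \<in> H \<inter> fc i" "0 < \<rho>" "y (L x) = \<rho> *\<^sub>R cis t" by blast
    hence "sgn (y (L x)) = cis t" by (simp add: sgn_scaleR sgn_div_norm[of "cis t"])
    hence "cis t \<in> sgn ` Z" using x(1) unfolding Z_def by force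
    thus "t \<in> cis -` (sgn ` Z)" by simp
  qed
  ultimately show ?thesis by simp
qed

end

text \<open>The assumptions are met at a vertex \<open>v\<close> where the quotient attains a
  maximum above 1. Because of \<open>nonzero\<close> only the second link has the origin in its
  interior, and it supplies the parametrization of both.\<close>

locale link_pair = two_surfaces M d V I W fc L V' I' W' fc' L' +
  C1: cusp_chart M d V I W fc L v q a b B1 B2 N Q + 
  C2: cusp_chart M d V' I' W' fc' L' v' q' a' b' B1' B2' N' Q'
  for M :: "'a set" and d and V :: "(real^3) set" and I :: "'i set" and W fc L
    and V' :: "(real^3) set" and I' :: "'j set" and W' fc' L' 
    and v q a b B1 B2 N Q v' q' a' b' B1' B2' N' Q' +
  assumes H_eq: "C1.H = C2.H"
    and norm_le: "x \<in> C1.H \<Longrightarrow> norm (C1.y (L x)) \<le> norm (C2.y (L' x))"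
    and nonzero: "x \<in> C1.H \<Longrightarrow> C2.y (L' x) \<noteq> 0"
begin

abbreviation "H \<equiv> C1.H"

section \<open>The common subdivision of two links\<close>

definition Y1 :: "'a \<Rightarrow> complex" where "Y1 x = C1.y (L x)"
definition Y2 :: "'a \<Rightarrow> complex" where "Y2 x = C2.y (L' x)"

lemma H2: "C2.H = H" using H_eq by simp

lemma H_M: "x \<in> H \<Longrightarrow> x \<in> M" using C1.H_M by blast

lemma Y2_dist: 
  assumes "x \<in> H" "x' \<in> H" "j \<in> I'" "x \<in> fc' j" "x' \<in> fc' j"
  shows "(norm (Y2 x - Y2 x'))\<^sup>2 = 2 * (cosh (d x x') - 1)"
  using C2.y_dist[of "L' x" "L' x'"] C2.H_M[of x] C2.H_M[of x'] Q.L_eq[OF assms(3-5)] assms(1,2) 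
  unfolding Y2_def H2 by simp

lemma Y1_dist: 
  assumes "x \<in> H" "x' \<in> H" "j \<in> I" "x \<in> fc j" "x' \<in> fc j"
  shows "(norm (Y1 x - Y1 x'))\<^sup>2 = 2 * (cosh (d x x') - 1)"
  using C1.y_dist[of "L x" "L x'"] C1.H_M[of x] C1.H_M[of x'] P.L_eq[OF assms(3-5)] assms(1,2)
  unfolding Y1_def by simp

lemma Y12_dist:
  assumes "x \<in> H" "x' \<in> H" "j \<in> I" "x \<in> fc j" "x' \<in> fc j" "k \<in> I'" "x \<in> fc' k" "x' \<in> fc' k"
  shows "norm (Y1 x - Y1 x') = norm (Y2 x - Y2 x')"
  by (rule power2_eq_imp_eq[OF _ norm_ge_zero norm_ge_zero])
    (simp only: Y1_dist[OF assms(1-5)] Y2_dist[OF assms(1,2,6-8)])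

text \<open>The origin is the projection of a vertex and belongs to \<open>K\<close>; on the
  boundary it would be the image of a point of \<open>H\<close>.\<close>

lemma int2: "0 \<in> interior C2.K"
proof (rule ccontr)
  assume "0 \<notin> interior C2.K"
  then obtain i where i: "i \<in> I'" "v' \<in> W' i" "0 \<in> convex hull ((C2.y \<circ> hv) ` (W' i - {v'}))"
    using C2.boundary_K C2.zero_K by blast
  obtain x where "x \<in> C2.H" "C2.y (L' x) = 0" using C2.y_H_face_ex[OF i] by blast
  thus False using nonzero H2 by blast
qed

lemma Y2_inj: "x \<in> H \<Longrightarrow> x' \<in> H \<Longrightarrow> Y2 x = Y2 x' \<Longrightarrow> x = x'"
  using C2.y_eq_imp[of x x'] C2.nonplanar_inj[of x x'] C2.interior_imp_nonplanar int2 H_M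
  unfolding Y2_def H2 by blast

text \<open>The second link surrounds the origin and meets every ray once, so its points are
  parametrized by their direction; the first link is read along the same parameter.\<close>

definition ct :: "real \<Rightarrow> 'a" where
  "ct t = (THE x. x \<in> H \<and> (\<exists>\<rho>>0. Y2 x = \<rho> *\<^sub>R cis t))"

lemma ct_unique: "x \<in> H \<Longrightarrow> 0 < \<rho> \<Longrightarrow> Y2 x = \<rho> *\<^sub>R cis t \<Longrightarrow> ct t = x"
  unfolding ct_def Y2_def using C2.ray_unique[OF int2] unfolding H2 by (intro the_equality) blast+

lemma ct: "ct t \<in> H" "\<exists>\<rho>>0. Y2 (ct t) = \<rho> *\<^sub>R cis t"
proof -
  obtain x \<rho> where x: "x \<in> H" "0 < \<rho>" "Y2 x = \<rho> *\<^sub>R cis t" using C2.ray_ex[OF int2, of t] unfolding Y2_def H2 by blast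
  thus "ct t \<in> H" "\<exists>\<rho>>0. Y2 (ct t) = \<rho> *\<^sub>R cis t" using ct_unique by auto
qed

lemma ct_eq: assumes "ct t = ct s" shows "\<exists>m::int. t = s + 2 * pi * of_int m"
proof -
  obtain \<rho> where \<rho>: "0 < \<rho>" "Y2 (ct t) = \<rho> *\<^sub>R cis t" using ct by blast
  obtain \<rho>' where \<rho>': "0 < \<rho>'" "Y2 (ct t) = \<rho>' *\<^sub>R cis s" using ct(2)[of s] assms by auto
  have "norm (\<rho> *\<^sub>R cis t) = norm (\<rho>' *\<^sub>R cis s)" using \<rho>(2) \<rho>'(2) by simp
  hence "cis t = cis s" using \<rho> \<rho>' by simp
  thus ?thesis by (rule cis_eq_int)
qed

lemma ct_periodic: "ct (t + 2 * pi) = ct t"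
  unfolding ct_def by (simp add: cis_mult[symmetric])

lemma face2_directions: "j \<in> I' \<Longrightarrow> {t. ct t \<in> fc' j} = {t. \<exists>x\<in>C2.H \<inter> fc' j. \<exists>\<rho>>0. C2.y (L' x) = \<rho> *\<^sub>R cis t}"
  using ct ct_unique unfolding H2 Y2_def by blast

lemma closed_face2: "j \<in> I' \<Longrightarrow> closed {t. ct t \<in> fc' j}"
  unfolding face2_directions by (rule C2.closed_directions[OF int2])

text \<open>Points over the origin of the first link are nodes, so that its edges contain the origin at most
  as an end point.\<close>

definition nodes :: "'a set" where
  "nodes = {x\<in>C1.H. \<exists>i\<in>I. \<exists>j\<in>I. i \<noteq> j \<and> x \<in> fc i \<and> x \<in> fc j}
    \<union> {x\<in>C2.H. \<exists>i\<in>I'. \<exists>j\<in>I'. i \<noteq> j \<and> x \<in> fc' i \<and> x \<in> fc' j} \<union> {x\<in>C1.H. C1.y (L x) = 0}"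

lemma nodes: "finite nodes" "nodes \<subseteq> H"
  unfolding nodes_def using C1.finite_edge_points C2.finite_edge_points C1.finite_fibre(1) H2 by auto

lemma not_nodes:
  assumes "x \<in> H" "x \<notin> nodes"
  shows "i \<in> I \<Longrightarrow> j \<in> I \<Longrightarrow> x \<in> fc i \<Longrightarrow> x \<in> fc j \<Longrightarrow> i = j"
    "i' \<in> I' \<Longrightarrow> j' \<in> I' \<Longrightarrow> x \<in> fc' i' \<Longrightarrow> x \<in> fc' j' \<Longrightarrow> i' = j'" "Y1 x \<noteq> 0"
proof -
  have x: "x \<in> C1.H" "x \<in> C2.H" using assms(1) H2 by simp_all
  have n: "x \<notin> {x\<in>C1.H. \<exists>i\<in>I. \<exists>j\<in>I. i \<noteq> j \<and> x \<in> fc i \<and> x \<in> fc j}"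
    "x \<notin> {x\<in>C2.H. \<exists>i\<in>I'. \<exists>j\<in>I'. i \<noteq> j \<and> x \<in> fc' i \<and> x \<in> fc' j}" "x \<notin> {x\<in>C1.H. C1.y (L x) = 0}"
    using assms(2) unfolding nodes_def Un_iff de_Morgan_disj by blast+
  show "i \<in> I \<Longrightarrow> j \<in> I \<Longrightarrow> x \<in> fc i \<Longrightarrow> x \<in> fc j \<Longrightarrow> i = j" using n(1) x(1) by blast
  show "i' \<in> I' \<Longrightarrow> j' \<in> I' \<Longrightarrow> x \<in> fc' i' \<Longrightarrow> x \<in> fc' j' \<Longrightarrow> i' = j'" using n(2) x(2) by blast
  show "Y1 x \<noteq> 0" using n(3) x(1) by (simp add: Y1_def)
qed

text \<open>Between nodes the closed sets of directions belonging to different faces are disjoint,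
  so the connected gap lies in one of them, and its end points do by closedness.\<close>

lemma gap_face2:
  assumes t: "\<theta> < \<theta>'" and gap: "\<And>t. \<theta> < t \<Longrightarrow> t < \<theta>' \<Longrightarrow> ct t \<notin> nodes"
  obtains j where "j \<in> I'" "\<And>t. \<theta> \<le> t \<Longrightarrow> t \<le> \<theta>' \<Longrightarrow> ct t \<in> fc' j"
proof -
  have "\<exists>j\<in>I'. {\<theta><..<\<theta>'} \<subseteq> {t. ct t \<in> fc' j}"
  proof (rule connected_finite_closed_cover)
    show "{\<theta><..<\<theta>'} \<subseteq> (\<Union>j\<in>I'. {t. ct t \<in> fc' j})" using C2.H_cover ct(1) unfolding H2 by blast
    show "{t. ct t \<in> fc' i} \<inter> {t. ct t \<in> fc' j} \<inter> {\<theta><..<\<theta>'} = {}" if "i \<in> I'" "j \<in> I'" "i \<noteq> j" for i j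
      using not_nodes(2)[OF ct(1) gap that(1,2)] that(3) by (auto simp: disjoint_iff)
  qed (use t Q.finite_I closed_face2 in auto)
  then obtain j where j: "j \<in> I'" "{\<theta><..<\<theta>'} \<subseteq> {t. ct t \<in> fc' j}" by blast
  have "closure {\<theta><..<\<theta>'} \<subseteq> {t. ct t \<in> fc' j}" using closure_minimal[OF j(2) closed_face2[OF j(1)]] .
  hence "{\<theta>..\<theta>'} \<subseteq> {t. ct t \<in> fc' j}" using t by simp
  hence "ct t \<in> fc' j" if "\<theta> \<le> t" "t \<le> \<theta>'" for t using that by auto
  thus thesis using that[of j] j(1) by blast
qed

text \<open>All points of one face lie on a line on which some functional is negative; opposite
  directions cannot both have negative values.\<close>

lemma gap_lt_pi:
  assumes "j \<in> I'" and f: "\<And>t. \<theta> \<le> t \<Longrightarrow> t \<le> \<theta>' \<Longrightarrow> ct t \<in> fc' j"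
  shows "\<theta>' < \<theta> + pi"
proof (rule ccontr)
  assume n: "\<not> \<theta>' < \<theta> + pi"
  have f2: "ct \<theta> \<in> fc' j" "ct (\<theta> + pi) \<in> fc' j" using f[of \<theta>] f[of "\<theta> + pi"] n pi_gt_zero by linarith+
  have "v' \<in> W' j" using C2.H_face[of "ct \<theta>" j] ct assms(1) f2 H2 by blast
  then obtain n c where n: "c < 0" "\<forall>x\<in>H. x \<in> fc' j \<longrightarrow> n \<bullet> Y2 x = c"
    using C2.face_line_neg[OF int2 assms(1)] unfolding Y2_def H2 by blast
  have "n \<bullet> cis t < 0" if c: "ct t \<in> fc' j" for t
  proof -
    obtain \<rho> where \<rho>: "0 < \<rho>" "Y2 (ct t) = \<rho> *\<^sub>R cis t" using ct by blast
    have "n \<bullet> Y2 (ct t) < 0" using n ct(1) c by auto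
    thus ?thesis using \<rho> by (simp add: mult_less_0_iff)
  qed
  from this[OF f2(1)] this[OF f2(2)] show False by (simp add: cis_mult[symmetric])
qed

text \<open>A side of the common subdivision: it lies in one face of each polyhedron and is a
  segment of the same length in both charts.\<close>

definition is_arc :: "real \<Rightarrow> real \<Rightarrow> (real \<Rightarrow> 'a) \<Rightarrow> 'i \<Rightarrow> 'j \<Rightarrow> bool" where
  "is_arc \<theta> \<theta>' e i j \<longleftrightarrow> i \<in> I \<and> j \<in> I' \<and> e 0 = ct \<theta> \<and> e 1 = ct \<theta>' \<and>
    (\<forall>s. 0 \<le> s \<longrightarrow> s \<le> 1 \<longrightarrow> e s \<in> H \<and> e s \<in> fc i \<and> e s \<in> fc' j \<and> 
       Y1 (e s) = (1 - s) *\<^sub>R Y1 (ct \<theta>) + s *\<^sub>R Y1 (ct \<theta>') \<and> Y2 (e s) = (1 - s) *\<^sub>R Y2 (ct \<theta>) + s *\<^sub>R Y2 (ct \<theta>')) \<and>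
    (\<forall>s. 0 < s \<longrightarrow> s < 1 \<longrightarrow> (\<exists>t. \<theta> < t \<and> t < \<theta>' \<and> e s = ct t)) \<and>
    norm (Y1 (ct \<theta>) - Y1 (ct \<theta>')) = norm (Y2 (ct \<theta>) - Y2 (ct \<theta>'))"

text \<open>The segment is drawn in the second link, where the gap lies in one face. Its open part
  contains no nodes, so connectedness puts it into one face of the first polyhedron too. There
  distances are also exact, and \<open>segment_of_dists\<close> makes its image a segment.\<close>

lemma arc:
  assumes t: "\<theta> < \<theta>'" and gap: "\<And>t. \<theta> < t \<Longrightarrow> t < \<theta>' \<Longrightarrow> ct t \<notin> nodes"
  shows "\<theta>' < \<theta> + pi \<and> (\<exists>e i j. is_arc \<theta> \<theta>' e i j)"
proof -
  obtain j where j: "j \<in> I'" "\<And>t. \<theta> \<le> t \<Longrightarrow> t \<le> \<theta>' \<Longrightarrow> ct t \<in> fc' j" using gap_face2[OF t gap] by blast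
  have lt: "\<theta>' < \<theta> + pi" using gap_lt_pi[OF j] .
  let ?x = "ct \<theta>" and ?x' = "ct \<theta>'"
  have xj: "?x \<in> fc' j" "?x' \<in> fc' j" using j(2) t by simp_all
  have "\<forall>s. \<exists>z. 0 \<le> s \<longrightarrow> s \<le> 1 \<longrightarrow> z \<in> H \<inter> fc' j \<and> Y2 z = (1 - s) *\<^sub>R Y2 ?x + s *\<^sub>R Y2 ?x'"
  proof
    fix s :: real
    show "\<exists>z. 0 \<le> s \<longrightarrow> s \<le> 1 \<longrightarrow> z \<in> H \<inter> fc' j \<and> Y2 z = (1 - s) *\<^sub>R Y2 ?x + s *\<^sub>R Y2 ?x'"
      using C2.convex_face_chart[OF j(1), of ?x ?x' s] xj ct(1) unfolding Y2_def H2 by blast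
  qed
  from choice[OF this] obtain e where
    e: "\<And>s. 0 \<le> s \<Longrightarrow> s \<le> 1 \<Longrightarrow> e s \<in> H \<inter> fc' j \<and> Y2 (e s) = (1 - s) *\<^sub>R Y2 ?x + s *\<^sub>R Y2 ?x'" by blast
  define l where "l = norm (Y2 ?x - Y2 ?x')"
  have e01: "e 0 = ?x" "e 1 = ?x'"
    using e[of 0] e[of 1] ct(1) by (auto intro!: Y2_inj)
  have dir: "\<exists>t. \<theta> < t \<and> t < \<theta>' \<and> e s = ct t" if s: "0 < s" "s < 1" for s
  proof -
    obtain r where r: "0 < r" "Y2 ?x = r *\<^sub>R cis \<theta>" using ct by blast
    obtain r' where r': "0 < r'" "Y2 ?x' = r' *\<^sub>R cis \<theta>'" using ct by blast
    have es: "e s \<in> H" "Y2 (e s) = (1 - s) *\<^sub>R (r *\<^sub>R cis \<theta>) + s *\<^sub>R (r' *\<^sub>R cis \<theta>')"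
      using e[of s] s r r' by auto
    obtain u \<rho> where u: "\<theta> < u" "u < \<theta>'" "0 < \<rho>" "Y2 (e s) = \<rho> *\<^sub>R cis u"
      using segment_direction[OF t lt r(1) r'(1) s es(2)] by blast
    have "ct u = e s" using ct_unique[OF es(1) u(3,4)] .
    thus ?thesis using u by metis
  qed
  have nn: "e s \<in> H" "e s \<notin> nodes" if "0 < s" "s < 1" for s using dir[OF that] gap ct(1) by auto
  have e2d: "norm (Y2 (e s) - Y2 (e s')) = \<bar>s - s'\<bar> * l" if "0 \<le> s" "s \<le> 1" "0 \<le> s'" "s' \<le> 1" for s s'
  proof -
    have "Y2 (e s) - Y2 (e s') = (s' - s) *\<^sub>R (Y2 ?x - Y2 ?x')"
      using e[OF that(1,2)] e[OF that(3,4)] by (simp add: scaleR_diff_left scaleR_diff_right)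
    thus ?thesis by (simp add: l_def abs_minus_commute)
  qed
  have half: "B = 1 + A / 2" if h: "A = 2 * (B - 1)" for A B :: real
  proof -
    have "A / 2 = B - 1" unfolding h by (rule nonzero_mult_div_cancel_left) simp
    thus ?thesis by (simp only: diff_eq_eq) 
  qed
  have ed: "cosh (d (e s) (e s')) = 1 + (\<bar>s - s'\<bar> * l)\<^sup>2 / 2" if "0 \<le> s" "s \<le> 1" "0 \<le> s'" "s' \<le> 1" for s s'
  proof -
    have m: "e s \<in> H" "e s' \<in> H" "e s \<in> fc' j" "e s' \<in> fc' j" using e[OF that(1,2)] e[OF that(3,4)] by auto
    show ?thesis using Y2_dist[OF m(1,2) j(1) m(3,4)] unfolding e2d[OF that] by (rule half)
  qed
  \<comment> \<open>These sets are closed: along the segment \<open>d\<close> is an explicit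
    continuous function of the parameters, and points outside a face have a positive distance from
    it.\<close>
  define T where "T i = {s. 0 \<le> s \<and> s \<le> 1 \<and> e s \<in> fc i}" for i
  have cl: "closed (T i)" if i: "i \<in> I" for i
    unfolding closed_sequential_limits
  proof (intro allI impI, elim conjE)
    fix u s assume u: "\<forall>n. u n \<in> T i" and lim: "u \<longlonglongrightarrow> s"
    have s: "0 \<le> s" "s \<le> 1" using LIMSEQ_le_const[OF lim, of 0] LIMSEQ_le_const2[OF lim, of 1] u
      by (auto simp: T_def)
    have "e s \<in> fc i"
    proof (rule ccontr)
      assume "e s \<notin> fc i"
      then obtain \<epsilon> where \<epsilon>: "\<epsilon> > 0" "\<forall>y\<in>fc i. \<epsilon> \<le> d (e s) y"
        using P.face_closed[OF i, of "e s"] e[OF s] H_M by blast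
      have "cosh \<epsilon> \<le> 1 + (\<bar>s - u n\<bar> * l)\<^sup>2 / 2" for n
      proof -
        have un: "0 \<le> u n" "u n \<le> 1" "e (u n) \<in> fc i" using u by (auto simp: T_def)
        hence "cosh \<epsilon> \<le> cosh (d (e s) (e (u n)))" using \<epsilon> by (intro cosh_real_nonneg_le_iff[THEN iffD2]) auto
        thus ?thesis using ed[OF s un(1,2)] by simp
      qed
      moreover have "(\<lambda>n. 1 + (\<bar>s - u n\<bar> * l)\<^sup>2 / 2) \<longlonglongrightarrow> 1 + (\<bar>s - s\<bar> * l)\<^sup>2 / 2"
        by (intro tendsto_intros lim) simp
      ultimately have "cosh \<epsilon> \<le> 1 + (\<bar>s - s\<bar> * l)\<^sup>2 / 2" by (intro LIMSEQ_le_const) auto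
      hence "cosh \<epsilon> \<le> cosh 0" by simp
      thus False using \<epsilon>(1) by (metis cosh_real_nonneg_le_iff less_imp_le not_less order_refl)
    qed
    thus "s \<in> T i" using s by (simp add: T_def)
  qed
  have "\<exists>i\<in>I. {0<..<1} \<subseteq> T i"
  proof (rule connected_finite_closed_cover)
    show "{0<..<1::real} \<subseteq> (\<Union>i\<in>I. T i)"
    proof
      fix s :: real assume "s \<in> {0<..<1}"
      thus "s \<in> (\<Union>i\<in>I. T i)" using C1.H_cover[OF nn(1)[of s]] by (auto simp: T_def)
    qed
    show "T i \<inter> T j \<inter> {0<..<1} = {}" if "i \<in> I" "j \<in> I" "i \<noteq> j" for i j
      using not_nodes(1)[OF nn that(1,2)] that(3) by (auto simp: disjoint_iff T_def)
  qed (use P.finite_I cl in auto)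
  then obtain i where i: "i \<in> I" "{0<..<1} \<subseteq> T i" by blast
  have "closure {0<..<1} \<subseteq> T i" using closure_minimal[OF i(2) cl[OF i(1)]] .
  hence ei: "e s \<in> fc i" if "0 \<le> s" "s \<le> 1" for s using that by (auto simp: T_def)
  have e1d: "norm (Y1 (e s) - Y1 (e s')) = \<bar>s - s'\<bar> * l" if "0 \<le> s" "s \<le> 1" "0 \<le> s'" "s' \<le> 1" for s s'
  proof -
    have m: "e s \<in> H" "e s' \<in> H" "e s \<in> fc' j" "e s' \<in> fc' j" using e[OF that(1,2)] e[OF that(3,4)] by auto
    show ?thesis using Y12_dist[OF m(1,2) i(1) ei[OF that(1,2)] ei[OF that(3,4)] j(1) m(3,4)] e2d[OF that] by simp
  qed
  have e1: "Y1 (e s) = (1 - s) *\<^sub>R Y1 ?x + s *\<^sub>R Y1 ?x'" if s: "0 \<le> s" "s \<le> 1" for s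
    unfolding e01[symmetric]
    by (rule segment_of_dists[of _ _ _ l]) (use e1d[of 0 s] e1d[of s 1] e1d[of 0 1] s in auto)
  have l1: "norm (Y1 ?x - Y1 ?x') = l" using e1d[of 0 1] e01 by simp
  show ?thesis unfolding is_arc_def
  proof (intro conjI exI)
    show "i \<in> I" "j \<in> I'" "e 0 = ?x" "e 1 = ?x'" "\<theta>' < \<theta> + pi" using i j e01 lt by auto
    show "\<forall>s. 0 \<le> s \<longrightarrow> s \<le> 1 \<longrightarrow> e s \<in> H \<and> e s \<in> fc i \<and> e s \<in> fc' j \<and> 
       Y1 (e s) = (1 - s) *\<^sub>R Y1 (ct \<theta>) + s *\<^sub>R Y1 (ct \<theta>') \<and> Y2 (e s) = (1 - s) *\<^sub>R Y2 (ct \<theta>) + s *\<^sub>R Y2 (ct \<theta>')"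
      using e ei e1 by blast
    show "\<forall>s. 0 < s \<longrightarrow> s < 1 \<longrightarrow> (\<exists>t. \<theta> < t \<and> t < \<theta>' \<and> e s = ct t)" using dir by blast
    show "norm (Y1 (ct \<theta>) - Y1 (ct \<theta>')) = norm (Y2 (ct \<theta>) - Y2 (ct \<theta>'))" using l1 by (simp add: l_def)
  qed
qed

end

lemma polar_pair:
  assumes "\<theta> < \<theta>'" "\<theta>' < \<theta> + pi" "0 < r" "0 < r'" "a = r *\<^sub>R cis \<theta>" "b = r' *\<^sub>R cis \<theta>'"
  shows "arccos ((a \<bullet> b) / (norm a * norm b)) = \<theta>' - \<theta>" "0 < Im (cnj a * b)"
proof -
  have "cis \<theta> \<bullet> cis \<theta>' = cos (\<theta>' - \<theta>)" by (simp add: inner_complex_def cos_diff)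
  hence "(a \<bullet> b) / (norm a * norm b) = cos (\<theta>' - \<theta>)" using assms by (simp add: field_simps)
  thus "arccos ((a \<bullet> b) / (norm a * norm b)) = \<theta>' - \<theta>" using assms(1,2) by (simp add: arccos_cos)
  have "Im (cnj a * b) = r * r' * sin (\<theta>' - \<theta>)" unfolding assms(5,6) by (simp add: sin_diff algebra_simps)
  thus "0 < Im (cnj a * b)" using assms(1-4) by (simp add: sin_gt_zero)
qed

text \<open>On a line through the origin, with the origin not strictly between the ends, the angle
  is 0; if an end is the origin, division by 0 gives \<open>arccos 0 = pi / 2\<close>.\<close>

lemma collinear_angle:
  assumes "Im (cnj a * b) = 0" and z: "\<And>s. 0 < s \<Longrightarrow> s < 1 \<Longrightarrow> (1 - s) *\<^sub>R a + s *\<^sub>R b \<noteq> 0"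
  shows "arccos ((a \<bullet> b) / (norm a * norm b)) \<le> (if a = 0 then pi / 2 else 0) + (if b = 0 then pi / 2 else 0)"
proof (cases "a = 0 \<or> b = 0")
  case True
  hence z0: "(a \<bullet> b) / (norm a * norm b) = 0" by auto
  have e: "arccos ((a \<bullet> b) / (norm a * norm b)) = pi / 2" unfolding z0 by (rule arccos_0)
  show ?thesis unfolding e using True by (auto simp: pi_ge_zero)
next
  case False
  define c where "c = (a \<bullet> b) / (norm a)\<^sup>2"
  have "cnj a * b = of_real (a \<bullet> b)" using assms(1) by (simp add: complex_eq_iff inner_complex_def)
  hence "a * (cnj a * b) = (a \<bullet> b) *\<^sub>R a" by (simp add: scaleR_conv_of_real mult.commute)
  hence "(norm a)\<^sup>2 *\<^sub>R b = (a \<bullet> b) *\<^sub>R a" by (simp only: mult.assoc[symmetric] complex_norm_square[symmetric] scaleR_conv_of_real of_real_power)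
  hence "(1 / (norm a)\<^sup>2) *\<^sub>R ((norm a)\<^sup>2 *\<^sub>R b) = (1 / (norm a)\<^sup>2) *\<^sub>R ((a \<bullet> b) *\<^sub>R a)" by simp
  hence b: "b = c *\<^sub>R a" using False by (simp add: c_def)
  have "0 < c"
  proof (rule ccontr)
    assume "\<not> 0 < c"
    moreover have "c \<noteq> 0" using b False by auto
    ultimately have c: "c < 0" by simp
    define s where "s = 1 / (1 - c)"
    have s: "0 < s" "s < 1" using c by (auto simp: s_def field_simps)
    have "(1 - s) *\<^sub>R a + s *\<^sub>R b = (1 - s + s * c) *\<^sub>R a" unfolding b by (simp add: scaleR_add_left)
    also have "1 - s + s * c = 1 - s * (1 - c)" by (simp add: algebra_simps)
    also have "\<dots> = 0" using c by (simp add: s_def)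
    finally show False using z[OF s] by simp
  qed
  hence z1: "(a \<bullet> b) / (norm a * norm b) = 1" unfolding b using False by (simp add: dot_square_norm power2_eq_square)
  have "arccos ((a \<bullet> b) / (norm a * norm b)) = 0" unfolding z1 by (rule arccos_1)
  thus ?thesis using False by simp
qed

context link_pair
begin

lemma ct_Arg: "x \<in> H \<Longrightarrow> ct (Arg2pi (Y2 x)) = x"
proof -
  assume x: "x \<in> H"
  have "Y2 x = norm (Y2 x) *\<^sub>R cis (Arg2pi (Y2 x))"
    using Arg2pi[of "Y2 x"] by (simp add: is_Arg_def cis_conv_exp scaleR_conv_of_real)
  thus ?thesis using ct_unique[OF x, of "norm (Y2 x)"] nonzero[OF x] by (simp add: Y2_def)
qed

lemma arc_line:
  assumes e: "is_arc \<theta> \<theta>' e i j"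
  obtains n c where "n \<noteq> 0" "c \<le> 0" "\<And>z. z \<in> C1.K \<Longrightarrow> c \<le> n \<bullet> z" "n \<bullet> Y1 (ct \<theta>) = c" "n \<bullet> Y1 (ct \<theta>') = c"
    "\<And>s. 0 < s \<Longrightarrow> s < 1 \<Longrightarrow> n \<bullet> Y1 (e s) = c"
    "Im (cnj (Y1 (ct \<theta>)) * Y1 (ct \<theta>')) \<noteq> 0 \<Longrightarrow> c < 0 \<and> C1.nonplanar"
proof -
  have e': "i \<in> I" "e 0 = ct \<theta>" "e 1 = ct \<theta>'" "\<And>s. 0 \<le> s \<Longrightarrow> s \<le> 1 \<Longrightarrow> e s \<in> H \<and> e s \<in> fc i"
    using e unfolding is_arc_def by blast+
  have "v \<in> W i" using C1.H_face[of "e 0" i] e'(1) e'(4)[of 0] by simp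
  then obtain n c where n: "n \<noteq> 0" "\<And>z. z \<in> C1.K \<Longrightarrow> c \<le> n \<bullet> z" "\<And>x. x \<in> H \<Longrightarrow> x \<in> fc i \<Longrightarrow> n \<bullet> Y1 x = c"
      "W i = V \<Longrightarrow> \<forall>z\<in>C1.K. n \<bullet> z = c" using C1.face_of_H_line[OF e'(1)] unfolding Y1_def by metis
  have c0: "c \<le> 0" using n(2)[OF C1.zero_K] by simp
  have ns: "n \<bullet> Y1 (e s) = c" if "0 \<le> s" "s \<le> 1" for s using n(3) e'(4)[OF that] by blast
  have n01: "n \<bullet> Y1 (ct \<theta>) = c" "n \<bullet> Y1 (ct \<theta>') = c" using ns[of 0] ns[of 1] e' by simp_all
  have ncp: "c < 0 \<and> C1.nonplanar" if nc: "Im (cnj (Y1 (ct \<theta>)) * Y1 (ct \<theta>')) \<noteq> 0"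
  proof -
    have "c \<noteq> 0" using perp_both_imp_collinear[OF n(1)] n01 nc by blast
    moreover have "C1.nonplanar"
    proof (rule ccontr)
      assume "\<not> C1.nonplanar"
      then obtain \<nu> where \<nu>: "\<nu> \<noteq> 0" "\<forall>w\<in>V. mk \<nu> (hv w) = 0" unfolding C1.nonplanar_def by blast
      have "n \<bullet> 0 = c" using n(4) P.planar(1)[OF \<nu> e'(1)] C1.zero_K by blast
      thus False using \<open>c \<noteq> 0\<close> by simp
    qed
    ultimately show ?thesis using c0 by simp
  qed
  show thesis by (rule that[OF n(1) c0 n(2) n01 ns ncp]) simp_all
qed

lemma arc_zero:
  assumes e: "is_arc \<theta> \<theta>' e i j" and gap: "\<And>t. \<theta> < t \<Longrightarrow> t < \<theta>' \<Longrightarrow> ct t \<notin> nodes" and s: "0 < s" "s < 1"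
  shows "(1 - s) *\<^sub>R Y1 (ct \<theta>) + s *\<^sub>R Y1 (ct \<theta>') \<noteq> 0" "e s \<in> H" "e s \<notin> nodes"
proof -
  obtain t where t: "\<theta> < t" "t < \<theta>'" "e s = ct t" using e s unfolding is_arc_def by blast
  show n: "e s \<in> H" "e s \<notin> nodes" using t gap ct by auto
  have "Y1 (e s) = (1 - s) *\<^sub>R Y1 (ct \<theta>) + s *\<^sub>R Y1 (ct \<theta>')"
    using e s unfolding is_arc_def by (meson less_imp_le)
  thus "(1 - s) *\<^sub>R Y1 (ct \<theta>) + s *\<^sub>R Y1 (ct \<theta>') \<noteq> 0" using not_nodes(3)[OF n] by simp
qed

text \<open>The first arc is reversed so that both arcs start at the common node, as
  \<open>link_kink\<close> requires. Equal side lengths transfer nondegeneracy from the second link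
  to the first.\<close>

lemma arc_kinks:
  assumes e1: "is_arc \<theta> \<theta>' e i j" and gap1: "\<And>t. \<theta> < t \<Longrightarrow> t < \<theta>' \<Longrightarrow> ct t \<notin> nodes"
    and e2: "is_arc \<theta>' \<theta>'' e' i' j'" and gap2: "\<And>t. \<theta>' < t \<Longrightarrow> t < \<theta>'' \<Longrightarrow> ct t \<notin> nodes"
    and lt: "\<theta> < \<theta>'" "\<theta>' < \<theta> + pi" "\<theta>' < \<theta>''" "\<theta>'' < \<theta>' + pi"
  shows "bend (norm (Y1 (ct \<theta>) - Y1 (ct \<theta>'))) (norm (Y1 (ct \<theta>'') - Y1 (ct \<theta>')))
      ((norm (Y1 (ct \<theta>)))\<^sup>2) ((norm (Y1 (ct \<theta>')))\<^sup>2) ((norm (Y1 (ct \<theta>'')))\<^sup>2) \<le> 0" (is ?A)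
  "bend (norm (Y2 (ct \<theta>) - Y2 (ct \<theta>'))) (norm (Y2 (ct \<theta>'') - Y2 (ct \<theta>')))
      ((norm (Y2 (ct \<theta>)))\<^sup>2) ((norm (Y2 (ct \<theta>')))\<^sup>2) ((norm (Y2 (ct \<theta>'')))\<^sup>2) \<le> 0" (is ?B)
   "Y2 (ct \<theta>) \<noteq> Y2 (ct \<theta>')"
proof -
  have ij: "i \<in> I" "i' \<in> I" "j \<in> I'" "j' \<in> I'" using e1 e2 unfolding is_arc_def by blast+
  have f1: "e s \<in> H" "e s \<in> fc i" "e s \<in> fc' j" "Y1 (e s) = (1 - s) *\<^sub>R Y1 (ct \<theta>) + s *\<^sub>R Y1 (ct \<theta>')"
    "Y2 (e s) = (1 - s) *\<^sub>R Y2 (ct \<theta>) + s *\<^sub>R Y2 (ct \<theta>')" if "0 \<le> s" "s \<le> 1" for s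
    using e1 that unfolding is_arc_def by blast+
  have f2: "e' s \<in> H" "e' s \<in> fc i'" "e' s \<in> fc' j'" "Y1 (e' s) = (1 - s) *\<^sub>R Y1 (ct \<theta>') + s *\<^sub>R Y1 (ct \<theta>'')"
    "Y2 (e' s) = (1 - s) *\<^sub>R Y2 (ct \<theta>') + s *\<^sub>R Y2 (ct \<theta>'')" if "0 \<le> s" "s \<le> 1" for s
    using e2 that unfolding is_arc_def by blast+
  have ends: "e 1 = ct \<theta>'" "e' 0 = ct \<theta>'" using e1 e2 unfolding is_arc_def by blast+
  have ll: "norm (Y1 (ct \<theta>) - Y1 (ct \<theta>')) = norm (Y2 (ct \<theta>) - Y2 (ct \<theta>'))"
    "norm (Y1 (ct \<theta>') - Y1 (ct \<theta>'')) = norm (Y2 (ct \<theta>') - Y2 (ct \<theta>''))" using e1 e2 unfolding is_arc_def by blast+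
  have x0: "ct \<theta>' \<in> H" "ct \<theta>' \<in> fc i" "ct \<theta>' \<in> fc i'" "ct \<theta>' \<in> fc' j" "ct \<theta>' \<in> fc' j'"
    using f1[of 1] f2[of 0] ends by auto
  have ne: "ct a \<noteq> ct b" if "a < b" "b < a + pi" for a b
  proof
    assume "ct a = ct b"
    then obtain m :: int where m: "b = a + 2 * pi * of_int m" using ct_eq[of b a] by auto
    hence "0 < 2 * pi * real_of_int m" "2 * pi * real_of_int m < 2 * pi * 1" using that pi_gt_zero by linarith+
    thus False using pi_gt_zero by (simp add: zero_less_mult_iff)
  qed
  have n2: "Y2 (ct \<theta>) \<noteq> Y2 (ct \<theta>')" "Y2 (ct \<theta>'') \<noteq> Y2 (ct \<theta>')"
    using ne[OF lt(1,2)] ne[OF lt(3,4)] Y2_inj ct(1) by metis+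
  hence n1: "Y1 (ct \<theta>) \<noteq> Y1 (ct \<theta>')" "Y1 (ct \<theta>'') \<noteq> Y1 (ct \<theta>')" using ll by auto
  show "Y2 (ct \<theta>) \<noteq> Y2 (ct \<theta>')" using n2 by simp
  \<comment> \<open>Common points would have directions differing by a multiple of
    \<open>2 * pi\<close>, but the directions of both arcs lie within an interval shorter than
    that.\<close>
  have disj: "e (1 - s) \<noteq> e' t" if s: "0 < s" "s < 1" and t: "0 < t" "t < 1" for s t
  proof
    assume eq: "e (1 - s) = e' t"
    have "0 < 1 - s" "1 - s < 1" using s by simp_all
    then obtain u where u: "\<theta> < u" "u < \<theta>'" "e (1 - s) = ct u" using e1 unfolding is_arc_def by blast
    obtain w where w: "\<theta>' < w" "w < \<theta>''" "e' t = ct w" using e2 t unfolding is_arc_def by blast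
    obtain m :: int where m: "w = u + 2 * pi * of_int m" using ct_eq[of w u] eq u w by auto
    hence "0 < 2 * pi * real_of_int m" "2 * pi * real_of_int m < 2 * pi * 1" using u w lt by linarith+
    thus False using pi_gt_zero by (simp add: zero_less_mult_iff)
  qed
  have a1: "e (1 - s) \<in> H \<and> e (1 - s) \<in> fc i \<and> Y1 (e (1 - s)) = (1 - s) *\<^sub>R Y1 (ct \<theta>') + s *\<^sub>R Y1 (ct \<theta>)"
     "e (1 - s) \<in> H \<and> e (1 - s) \<in> fc' j \<and> Y2 (e (1 - s)) = (1 - s) *\<^sub>R Y2 (ct \<theta>') + s *\<^sub>R Y2 (ct \<theta>)"
     "e (1 - s) \<notin> nodes" if "0 < s" "s < 1" for s
    using f1[of "1 - s"] that arc_zero(3)[OF e1 gap1, of "1 - s"] by auto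
  have a2: "e' s \<in> H \<and> e' s \<in> fc i' \<and> Y1 (e' s) = (1 - s) *\<^sub>R Y1 (ct \<theta>') + s *\<^sub>R Y1 (ct \<theta>'')"
     "e' s \<in> H \<and> e' s \<in> fc' j' \<and> Y2 (e' s) = (1 - s) *\<^sub>R Y2 (ct \<theta>') + s *\<^sub>R Y2 (ct \<theta>'')"
     "e' s \<notin> nodes" if "0 < s" "s < 1" for s
    using f2[of s] that arc_zero(3)[OF e2 gap2, of s] by auto
  show ?A
    unfolding Y1_def
  proof (rule C1.link_kink[where ga = "\<lambda>s. e (1 - s)" and gb = e', OF ij(1,2) x0(1-3)]; (fold Y1_def)?)
    fix s :: real assume s: "0 < s" "s < 1"
    show "e (1 - s) \<in> H \<and> e (1 - s) \<in> fc i \<and> Y1 (e (1 - s)) = (1 - s) *\<^sub>R Y1 (ct \<theta>') + s *\<^sub>R Y1 (ct \<theta>)" using a1(1)[OF s] .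
    show "e' s \<in> H \<and> e' s \<in> fc i' \<and> Y1 (e' s) = (1 - s) *\<^sub>R Y1 (ct \<theta>') + s *\<^sub>R Y1 (ct \<theta>'')" using a2(1)[OF s] .
    show "i = i'" if "e (1 - s) \<in> fc i'" using not_nodes(1)[OF _ a1(3)[OF s] ij(1,2) _ that] a1(1)[OF s] by blast
    show "i = i'" if "e' s \<in> fc i" using not_nodes(1)[OF _ a2(3)[OF s] ij(1,2) that] a2(1)[OF s] by blast
    fix t :: real assume "0 < t" "t < 1"
    thus "e (1 - s) \<noteq> e' t" using disj s by blast
  qed (rule n1)+
  show ?B
    unfolding Y2_def
  proof (rule C2.link_kink[where ga = "\<lambda>s. e (1 - s)" and gb = e', OF ij(3,4) x0(1)[folded H2] x0(4,5)]; (fold Y2_def)?; (unfold H2)?)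
    fix s :: real assume s: "0 < s" "s < 1"
    show "e (1 - s) \<in> H \<and> e (1 - s) \<in> fc' j \<and> Y2 (e (1 - s)) = (1 - s) *\<^sub>R Y2 (ct \<theta>') + s *\<^sub>R Y2 (ct \<theta>)" using a1(2)[OF s] .
    show "e' s \<in> H \<and> e' s \<in> fc' j' \<and> Y2 (e' s) = (1 - s) *\<^sub>R Y2 (ct \<theta>') + s *\<^sub>R Y2 (ct \<theta>'')" using a2(2)[OF s] .
    show "j = j'" if "e (1 - s) \<in> fc' j'" using not_nodes(2)[OF _ a1(3)[OF s] ij(3,4) _ that] a1(2)[OF s] by blast
    show "j = j'" if "e' s \<in> fc' j" using not_nodes(2)[OF _ a2(3)[OF s] ij(3,4) that] a2(2)[OF s] by blast
    fix t :: real assume "0 < t" "t < 1"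
    thus "e (1 - s) \<noteq> e' t" using disj s by blast
  qed (rule n2)+
qed

end

context link_pair
begin

text \<open>Edges not collinear with the origin are seen in disjoint sets of directions. A collinear edge
  contributes \<open>pi / 2\<close> for each end point at the origin; if there is such a node, then the origin is
  on the boundary of the link and the other edges are seen in a half plane.\<close>

lemma link_angle_sum:
  assumes n: "0 < n" "strict_mono \<theta>" "\<And>k. \<theta> (k + n) = \<theta> k + 2 * pi" 
    and gap: "\<And>k t. \<theta> k < t \<Longrightarrow> t < \<theta> (Suc k) \<Longrightarrow> ct t \<notin> nodes"
    and arcs: "\<And>k. is_arc (\<theta> k) (\<theta> (Suc k)) (e k) (i k) (j k)"
  shows "(\<Sum>k<n. arccos ((Y1 (ct (\<theta> k)) \<bullet> Y1 (ct (\<theta> (Suc k)))) / (norm (Y1 (ct (\<theta> k))) * norm (Y1 (ct (\<theta> (Suc k))))))) \<le> 2 * pi"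
proof -
  define a where "a k = Y1 (ct (\<theta> k))" for k
  define ang where "ang k = arccos ((a k \<bullet> a (Suc k)) / (norm (a k) * norm (a (Suc k))))" for k
  define NC where "NC = {k\<in>{..<n}. Im (cnj (a k) * a (Suc k)) \<noteq> 0}"
  define CO where "CO = {k\<in>{..<n}. Im (cnj (a k) * a (Suc k)) = 0}"
  define Z where "Z = {k\<in>{..<n}. a k = 0}"
  have a_per: "a (k + n) = a k" for k unfolding a_def n(3) ct_periodic ..
  have mono: "\<theta> k < \<theta> m \<longleftrightarrow> k < m" "\<theta> k \<le> \<theta> m \<longleftrightarrow> k \<le> m" for k m
    using n(2) by (simp_all add: strict_mono_less strict_mono_less_eq)
  \<comment> \<open>Within a window of length \<open>2 * pi\<close> the direction of a point is
    unique.\<close>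
  have win: "t = t'" if w: "\<theta> 0 \<le> t" "t < \<theta> n" "\<theta> 0 \<le> t'" "t' < \<theta> n" "ct t = ct t'" for t t'
  proof -
    obtain m :: int where m: "t = t' + 2 * pi * of_int m" using ct_eq[OF w(5)] by blast
    have "\<theta> n = \<theta> 0 + 2 * pi" using n(3)[of 0] by simp
    hence "2 * pi * real_of_int m < 2 * pi * 1" "2 * pi * (-1) < 2 * pi * real_of_int m" using m w by linarith+
    hence "real_of_int m < 1" "- 1 < real_of_int m" using pi_gt_zero by (simp_all only: mult_less_cancel_left_pos[of "2 * pi"] mult_pos_pos zero_less_numeral)
    hence "m = 0" by linarith
    thus ?thesis using m by simp
  qed
  have win_k: "\<theta> 0 \<le> t \<and> t < \<theta> n" if "k < n" "\<theta> k \<le> t" "t < \<theta> (Suc k)" for k t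
    using that mono(2)[of 0 k] mono(2)[of "Suc k" n] by linarith
  have arc_inj: "k = k'" if k: "k < n" "\<theta> k < t" "t < \<theta> (Suc k)" and k': "k' < n" "\<theta> k' < t'" "t' < \<theta> (Suc k')" and eq: "ct t = ct t'" for k k' t t'
  proof -
    have "t = t'" using win[of t t'] win_k[of k t] win_k[of k' t'] k k' eq by simp
    hence "\<theta> k < \<theta> (Suc k')" "\<theta> k' < \<theta> (Suc k)" using k k' by linarith+
    hence "k < Suc k'" "k' < Suc k" unfolding mono .
    thus ?thesis by simp
  qed
  have fin: "finite NC" "finite CO" "finite Z" by (auto simp: NC_def CO_def Z_def)
  have cardZ: "card Z \<le> card {x\<in>C1.H. C1.y (L x) = 0}"
  proof (rule card_inj_on_le[of "\<lambda>k. ct (\<theta> k)"])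
    show "inj_on (\<lambda>k. ct (\<theta> k)) Z"
    proof (rule inj_onI)
      fix k k' assume "k \<in> Z" "k' \<in> Z" "ct (\<theta> k) = ct (\<theta> k')"
      hence "\<theta> k = \<theta> k'" using win[of "\<theta> k" "\<theta> k'"] mono by (auto simp: Z_def)
      thus "k = k'" using n(2) by (simp add: strict_mono_eq)
    qed
    show "(\<lambda>k. ct (\<theta> k)) ` Z \<subseteq> {x\<in>C1.H. C1.y (L x) = 0}" using ct(1) by (auto simp: Z_def a_def Y1_def)
  qed (rule C1.finite_fibre)
  \<comment> \<open>A node at the origin is an end of two sides and contributes
    \<open>pi / 2\<close> to each.\<close>
  have CO_sum: "(\<Sum>k\<in>CO. ang k) \<le> pi * card Z"
  proof -
    define h where "h k = (if a k = 0 then pi / 2 else 0)" for k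
    have "(\<Sum>k\<in>CO. ang k) \<le> (\<Sum>k\<in>CO. h k + h (Suc k))"
    proof (rule sum_mono)
      fix k assume k: "k \<in> CO"
      show "ang k \<le> h k + h (Suc k)" unfolding ang_def h_def
        by (rule collinear_angle) (use k arc_zero(1)[OF arcs gap] in \<open>auto simp: CO_def a_def\<close>)
    qed
    also have "\<dots> \<le> (\<Sum>k<n. h k + h (Suc k))"
      by (rule sum_mono2) (auto simp: CO_def h_def)
    also have "\<dots> = 2 * (\<Sum>k<n. h k)"
      using sum_shift_periodic[of h n] a_per by (simp add: sum.distrib h_def)
    also have "(\<Sum>k<n. h k) = (\<Sum>k\<in>Z. pi / 2)" unfolding h_def Z_def by (rule sum.inter_filter[symmetric]) simp
    finally show ?thesis by (simp add: mult.commute)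
  qed
  have split: "(\<Sum>k<n. ang k) = (\<Sum>k\<in>NC. ang k) + (\<Sum>k\<in>CO. ang k)"
    by (subst sum.union_disjoint[symmetric]) (auto simp: NC_def CO_def intro!: sum.cong)
  have "(\<Sum>k<n. ang k) \<le> 2 * pi"
  proof (cases "NC = {}")
    case True
    \<comment> \<open>If all sides are collinear with the origin, the bound comes from the fibres of
      \<open>L\<close>: at most two points of the horosphere section lie over the origin.\<close>
    have "card Z \<le> 2" using cardZ C1.finite_fibre(2)[of 0] by linarith
    hence "pi * real (card Z) \<le> pi * 2" by (intro mult_left_mono) auto
    moreover have "(\<Sum>k\<in>NC. ang k) = 0" using True by simp
    ultimately show ?thesis using split CO_sum by linarith
  next
    case False
    have line: "\<exists>nn c. c < 0 \<and> (\<forall>z\<in>C1.K. c \<le> nn \<bullet> z) \<and> nn \<bullet> a k = c \<and> nn \<bullet> a (Suc k) = c \<and> (\<forall>s. 0 < s \<longrightarrow> s < 1 \<longrightarrow> nn \<bullet> Y1 (e k s) = c) \<and> C1.nonplanar"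
      if k: "k \<in> NC" for k
    proof -
      obtain nn c where "nn \<noteq> 0" "c \<le> 0" "\<And>z. z \<in> C1.K \<Longrightarrow> c \<le> nn \<bullet> z" "nn \<bullet> a k = c" "nn \<bullet> a (Suc k) = c"
         "\<And>s. 0 < s \<Longrightarrow> s < 1 \<Longrightarrow> nn \<bullet> Y1 (e k s) = c"
         "Im (cnj (a k) * a (Suc k)) \<noteq> 0 \<Longrightarrow> c < 0 \<and> C1.nonplanar"
        using arc_line[OF arcs[of k]] unfolding a_def by blast
      thus ?thesis using k unfolding NC_def by blast
    qed
    hence np: "C1.nonplanar" using False by blast
    have seg: "\<exists>s. 0 < s \<and> s < 1 \<and> e k s \<in> H \<and> Y1 (e k s) = of_real \<rho> * cis \<eta> \<and> (\<exists>t. \<theta> k < t \<and> t < \<theta> (Suc k) \<and> e k s = ct t)"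
      if h: "of_real \<rho> * cis \<eta> \<in> open_segment (a k) (a (Suc k))" for k \<rho> \<eta>
    proof -
      obtain s where s: "0 < s" "s < 1" "of_real \<rho> * cis \<eta> = (1 - s) *\<^sub>R a k + s *\<^sub>R a (Suc k)"
        using h unfolding in_segment by blast
      have "e k s \<in> H" "Y1 (e k s) = (1 - s) *\<^sub>R a k + s *\<^sub>R a (Suc k)" "\<exists>t. \<theta> k < t \<and> t < \<theta> (Suc k) \<and> e k s = ct t"
        using arcs[of k] s(1,2) unfolding is_arc_def a_def by (meson less_imp_le)+
      thus ?thesis using s by metis
    qed
    have disj: "k = k'" if k: "k \<in> NC" "k' \<in> NC" and h: "hits (a k) (a (Suc k)) \<eta>" "hits (a k') (a (Suc k')) \<eta>" for k k' \<eta>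
    proof -
      obtain \<rho> s t where 1: "0 < \<rho>" "0 < s" "s < 1" "e k s \<in> H" "Y1 (e k s) = of_real \<rho> * cis \<eta>" "\<theta> k < t" "t < \<theta> (Suc k)" "e k s = ct t"
        using h(1) seg unfolding hits_def by blast
      obtain \<rho>' s' t' where 2: "0 < \<rho>'" "0 < s'" "s' < 1" "e k' s' \<in> H" "Y1 (e k' s') = of_real \<rho>' * cis \<eta>" "\<theta> k' < t'" "t' < \<theta> (Suc k')" "e k' s' = ct t'"
        using h(2) seg unfolding hits_def by blast
      obtain nn c where l1: "c < 0" "\<forall>z\<in>C1.K. c \<le> nn \<bullet> z" "nn \<bullet> Y1 (e k s) = c" using line[OF k(1)] 1(2,3) by blast
      obtain nn' c' where l2: "c' < 0" "\<forall>z\<in>C1.K. c' \<le> nn' \<bullet> z" "nn' \<bullet> Y1 (e k' s') = c'" using line[OF k(2)] 2(2,3) by blast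
      have K: "Y1 (e k s) \<in> C1.K" "Y1 (e k' s') \<in> C1.K" using C1.y_H_K 1(4) 2(4) unfolding Y1_def by blast+
      have s1: "Y1 (e k s) = \<rho> *\<^sub>R cis \<eta>" "Y1 (e k' s') = \<rho>' *\<^sub>R cis \<eta>" unfolding 1(5) 2(5) scaleR_conv_of_real by simp_all
      have "\<rho>' \<le> \<rho>" by (rule line_ray_le[of nn \<rho> "cis \<eta>" c \<rho>']) (use l1 K(2) 1(1) s1 in auto)
      moreover have "\<rho> \<le> \<rho>'" by (rule line_ray_le[of nn' \<rho>' "cis \<eta>" c' \<rho>]) (use l2 K(1) 2(1) s1 in auto)
      ultimately have "Y1 (e k s) = Y1 (e k' s')" using s1 by simp
      hence "L (e k s) = L (e k' s')" using C1.y_eq_imp 1(4) 2(4) unfolding Y1_def by blast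
      hence "e k s = e k' s'" using C1.nonplanar_inj[OF np] H_M 1(4) 2(4) by blast
      thus ?thesis using arc_inj[of k t k' t'] 1 2 k by (simp add: NC_def)
    qed
    \<comment> \<open>A side not collinear with the origin forces the vertices off a common circle;
      then \<open>L\<close> is injective and at most one point lies over the origin.\<close>
    have "card Z \<le> 1"
    proof -
      have "x = x'" if "x \<in> C1.H" "x' \<in> C1.H" "C1.y (L x) = 0" "C1.y (L x') = 0" for x x'
        using C1.y_eq_imp[of x x'] C1.nonplanar_inj[OF np, of x x'] H_M that by simp
      hence "card {x\<in>C1.H. C1.y (L x) = 0} \<le> Suc 0"
        by (subst card_le_Suc0_iff_eq[OF C1.finite_fibre(1)]) auto
      thus ?thesis using cardZ by linarith
    qed
    have NCsum: "(\<Sum>k\<in>NC. ang k) \<le> measure lebesgue C"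
      if "C \<in> lmeasurable" "\<And>k \<theta>. k \<in> NC \<Longrightarrow> 0 \<le> \<theta> \<Longrightarrow> \<theta> < 2 * pi \<Longrightarrow> hits (a k) (a (Suc k)) \<theta> \<Longrightarrow> \<theta> \<in> C" for C
      unfolding ang_def by (rule direction_sum_le[OF fin(1) _ disj that]) (auto simp: NC_def)
    show ?thesis
    proof (cases "Z = {}")
      case True
      have "(\<Sum>k\<in>NC. ang k) \<le> measure lebesgue {0..<2*pi}"
        by (rule NCsum) (use lmeasurable_ivl_Int[of UNIV 0 "2 * pi"] in auto)
      also have "\<dots> = 2 * pi" by simp
      finally show ?thesis using split CO_sum True by simp
    next
      case False
      then obtain k0 where k0: "k0 < n" "a k0 = 0" by (auto simp: Z_def)
      obtain nn c where nn: "nn \<noteq> 0" "\<And>z. z \<in> C1.K \<Longrightarrow> c \<le> nn \<bullet> z" "nn \<bullet> a k0 = c"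
      proof (rule arc_line[OF arcs[of k0]])
        fix n c assume "n \<noteq> 0" "\<And>z. z \<in> C1.K \<Longrightarrow> c \<le> n \<bullet> z" "n \<bullet> Y1 (ct (\<theta> k0)) = c"
        thus thesis by (rule that[unfolded a_def])
      qed
      \<comment> \<open>The supporting line of the side at the node \<open>k0\<close> passes through
        the origin, so the link is seen within a half plane: the other sides contribute at most
        \<open>pi\<close>, and so do the two sides at the node together.\<close>
      have K0: "0 \<le> nn \<bullet> z" if "z \<in> C1.K" for z using nn(2)[OF that] nn(3) k0 by simp
      have "(\<Sum>k\<in>NC. ang k) \<le> measure lebesgue {\<theta>\<in>{0..<2*pi}. 0 \<le> nn \<bullet> cis \<theta>}"
      proof (rule NCsum)
        fix k \<eta> assume k: "k \<in> NC" "0 \<le> \<eta>" "\<eta> < 2 * pi" "hits (a k) (a (Suc k)) \<eta>"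
        obtain \<rho> s where 1: "0 < \<rho>" "e k s \<in> H" "Y1 (e k s) = of_real \<rho> * cis \<eta>"
          using k(4) seg unfolding hits_def by blast
        have "0 \<le> nn \<bullet> (\<rho> *\<^sub>R cis \<eta>)" using K0[of "Y1 (e k s)"] C1.y_H_K[OF 1(2)] 1(3) unfolding Y1_def scaleR_conv_of_real by simp
        thus "\<eta> \<in> {\<theta>\<in>{0..<2*pi}. 0 \<le> nn \<bullet> cis \<theta>}" using 1(1) k by (simp add: zero_le_mult_iff)
      qed (rule half_circle_measure(1)[OF nn(1)])
      also have "\<dots> = pi" by (rule half_circle_measure(2)[OF nn(1)])
      finally have "(\<Sum>k\<in>NC. ang k) \<le> pi" .
      moreover have "pi * real (card Z) \<le> pi * 1" using \<open>card Z \<le> 1\<close> by (intro mult_left_mono) auto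
      ultimately show ?thesis using split CO_sum by linarith
    qed
  qed
  thus ?thesis unfolding ang_def a_def .
qed

text \<open>The point \<open>x\<close> is added to the nodes, so that the rigidity of polygons,
  which speaks of nodes only, applies to it. An additional node has bend 0 where both links are
  straight.\<close>

theorem norm_eq:
  assumes x: "x \<in> H" shows "norm (Y1 x) = norm (Y2 x)"
proof -
  define X where "X = insert x nodes"
  have X: "finite X" "X \<subseteq> H" "X \<noteq> {}" using nodes x by (auto simp: X_def)
  define A where "A = (\<lambda>z. Arg2pi (Y2 z)) ` X"
  have A: "finite A" "A \<noteq> {}" "A \<subseteq> {0..<2*pi}" using X Arg2pi by (auto simp: A_def)
  obtain n \<theta> where n: "0 < n" "strict_mono \<theta>" "\<And>k. \<theta> (k + n) = \<theta> k + 2 * pi"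
    and im: "\<theta> ` {..<n} = A" and gapA: "\<And>k t m. \<theta> k < t \<Longrightarrow> t < \<theta> (Suc k) \<Longrightarrow> t - 2 * pi * of_int m \<notin> A"
    using circular_order[OF A] by metis
  have gap: "ct t \<notin> nodes" if "\<theta> k < t" "t < \<theta> (Suc k)" for k t
  proof
    assume "ct t \<in> nodes"
    hence "Arg2pi (Y2 (ct t)) \<in> A" by (simp add: A_def X_def)
    moreover obtain m :: int where "t = Arg2pi (Y2 (ct t)) + 2 * pi * of_int m"
      using ct_eq[of t "Arg2pi (Y2 (ct t))"] ct_Arg[OF ct(1)[of t]] by auto
    hence "t - 2 * pi * of_int m = Arg2pi (Y2 (ct t))" by (simp add: diff_eq_eq)
    ultimately show False using gapA[OF that, of m] by simp
  qed
  have lt: "\<theta> k < \<theta> (Suc k)" for k using n(2) by (simp add: strict_mono_less)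
  have arc: "\<theta> (Suc k) < \<theta> k + pi \<and> (\<exists>e i j. is_arc (\<theta> k) (\<theta> (Suc k)) e i j)" for k
    by (rule arc[OF lt]) (rule gap)
  have "\<forall>k. \<exists>e. \<exists>i j. is_arc (\<theta> k) (\<theta> (Suc k)) e i j" using arc by blast
  from choice[OF this] obtain e where "\<forall>k. \<exists>i. \<exists>j. is_arc (\<theta> k) (\<theta> (Suc k)) (e k) i j" by blast
  from choice[OF this] obtain i where "\<forall>k. \<exists>j. is_arc (\<theta> k) (\<theta> (Suc k)) (e k) (i k) j" by blast
  from choice[OF this] obtain j where arcs: "\<And>k. is_arc (\<theta> k) (\<theta> (Suc k)) (e k) (i k) (j k)" by blast
  define f where "f k = (norm (Y1 (ct (\<theta> k))))\<^sup>2" for k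
  define g where "g k = (norm (Y2 (ct (\<theta> k))))\<^sup>2" for k
  define l where "l k = norm (Y2 (ct (\<theta> k)) - Y2 (ct (\<theta> (Suc k))))" for k
  have l1: "l k = norm (Y1 (ct (\<theta> k)) - Y1 (ct (\<theta> (Suc k))))" for k
    using arcs[of k] unfolding is_arc_def l_def by simp
  note kinks = arc_kinks[OF arcs gap arcs gap lt conjunct1[OF arc] lt conjunct1[OF arc]]
  have polar: "arccos ((Y2 (ct (\<theta> k)) \<bullet> Y2 (ct (\<theta> (Suc k)))) / (norm (Y2 (ct (\<theta> k))) * norm (Y2 (ct (\<theta> (Suc k)))))) = \<theta> (Suc k) - \<theta> k \<and>
     0 < Im (cnj (Y2 (ct (\<theta> k))) * Y2 (ct (\<theta> (Suc k))))" for k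
  proof -
    obtain r where r: "0 < r" "Y2 (ct (\<theta> k)) = r *\<^sub>R cis (\<theta> k)" using ct by blast
    obtain r' where r': "0 < r'" "Y2 (ct (\<theta> (Suc k))) = r' *\<^sub>R cis (\<theta> (Suc k))" using ct by blast
    show ?thesis using polar_pair[OF lt conjunct1[OF arc] r(1) r'(1) r(2) r'(2)] by blast
  qed
  have fg: "f k = g k" for k
  proof (rule angle_sum_rigidity[OF n(1), of f g l])
    fix k
    show "f (k + n) = f k" "g (k + n) = g k" "l (k + n) = l k"
      using n(3)[of k] n(3)[of "Suc k"] by (simp_all add: f_def g_def l_def ct_periodic)
    show "0 < l k" using kinks(3)[of k] by (simp add: l_def)
    show "0 \<le> f k" by (simp add: f_def)
    show "f k \<le> g k" using norm_le[OF ct(1)] by (simp add: f_def g_def Y1_def Y2_def)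
    show "0 < g k" using nonzero[OF ct(1)] by (simp add: g_def Y2_def)
    show "0 \<le> gram_tri (l k) (f k) (f (Suc k))" unfolding l1 f_def gram_tri_norm by simp
    show "0 < gram_tri (l k) (g k) (g (Suc k))" unfolding l_def g_def gram_tri_norm using polar[of k] by simp
    have c: "norm (a - b) = norm (b - a)" for a b :: complex by (rule norm_minus_commute)
    show "bend (l k) (l (Suc k)) (f k) (f (Suc k)) (f (Suc (Suc k))) \<le> 0"
      using kinks(1)[of k] unfolding l1 f_def c[of "Y1 (ct (\<theta> (Suc k)))" "Y1 (ct (\<theta> (Suc (Suc k))))"] .
    show "bend (l k) (l (Suc k)) (g k) (g (Suc k)) (g (Suc (Suc k))) \<le> 0"
      using kinks(2)[of k] unfolding l_def g_def c[of "Y2 (ct (\<theta> (Suc k)))" "Y2 (ct (\<theta> (Suc (Suc k))))"] .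
  next
    \<comment> \<open>In the second link each apex angle is the difference of consecutive
      directions, so the sum telescopes.\<close>
    have "(\<Sum>k<n. apex_angle (l k) (g k) (g (Suc k))) = (\<Sum>k<n. \<theta> (Suc k) - \<theta> k)"
      unfolding l_def g_def apex_angle_norm using polar by simp
    also have "\<dots> = \<theta> n - \<theta> 0" by (rule sum_lessThan_telescope)
    also have "\<dots> = 2 * pi" using n(3)[of 0] by simp
    finally have "(\<Sum>k<n. apex_angle (l k) (g k) (g (Suc k))) = 2 * pi" .
    moreover have "(\<Sum>k<n. apex_angle (l k) (f k) (f (Suc k))) \<le> 2 * pi"
      unfolding l1 f_def apex_angle_norm by (rule link_angle_sum[OF n gap arcs])
    ultimately show "(\<Sum>k<n. apex_angle (l k) (f k) (f (Suc k))) \<le> (\<Sum>k<n. apex_angle (l k) (g k) (g (Suc k)))" by simp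
  qed
  have "Arg2pi (Y2 x) \<in> \<theta> ` {..<n}" unfolding im by (simp add: A_def X_def)
  then obtain k where "Arg2pi (Y2 x) = \<theta> k" by blast
  hence "ct (\<theta> k) = x" using ct_Arg[OF x] by simp
  thus ?thesis using fg[of k] by (simp add: f_def g_def)
qed

end

subsection \<open>Equality of the Gram matrices\<close>

lemma affine_limit_nonneg:
  fixes A B \<delta> :: real
  assumes "0 < \<delta>" "\<And>s. 0 < s \<Longrightarrow> s \<le> \<delta> \<Longrightarrow> 0 \<le> A + s * B"
  shows "0 \<le> A"
proof (rule ccontr)
  assume n: "\<not> 0 \<le> A"
  define s where "s = min \<delta> (- A / (2 * (\<bar>B\<bar> + 1)))"
  have s: "0 < s" "s \<le> \<delta>" "s \<le> - A / (2 * (\<bar>B\<bar> + 1))" using assms(1) n by (auto simp: s_def divide_neg_pos)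
  have "s * B \<le> s * (\<bar>B\<bar> + 1)" using s by (intro mult_left_mono) auto
  also have "\<dots> \<le> - A / (2 * (\<bar>B\<bar> + 1)) * (\<bar>B\<bar> + 1)" using s by (intro mult_right_mono) auto
  also have "\<dots> = - A / 2" by (simp add: field_simps add_nonneg_pos)
  finally show False using assms(2)[OF s(1,2)] n by linarith
qed

lemma sum_two_points:
  fixes f :: "'b \<Rightarrow> 'c::real_vector"
  assumes "finite A" "v \<in> A" "w \<in> A" "v \<noteq> w"
  shows "(\<Sum>z\<in>A. (if z = v then \<alpha> else if z = w then \<beta> else 0) *\<^sub>R f z) = \<alpha> *\<^sub>R f v + \<beta> *\<^sub>R f w"
proof -
  have "(\<Sum>z\<in>A. (if z = v then \<alpha> else if z = w then \<beta> else 0) *\<^sub>R f z)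
      = (\<Sum>z\<in>{v, w}. (if z = v then \<alpha> else if z = w then \<beta> else 0) *\<^sub>R f z)"
    by (rule sum.mono_neutral_right) (use assms in auto)
  thus ?thesis using assms(4) by auto
qed

context cusp_chart
begin

text \<open>The vertical line over the origin of the chart is the geodesic from \<open>v\<close> to
  \<open>q\<close>.\<close>

lemma zero_in_chart:
  assumes "x \<in> H" "y (L x) = 0"
  shows "\<exists>\<alpha> \<beta>. 0 < \<alpha> \<and> 0 < \<beta> \<and> L x = \<alpha> *\<^sub>R hv v + \<beta> *\<^sub>R hv q"
proof -
  have m: "mk (L x) N = 1" using H_M assms(1) by blast
  have "mk (L x) Q / mk N Q = 1 / 2" using y_norm[OF m] H_M(3)[OF assms(1)] assms(2) by simp
  moreover have "mk (L x) B1 = 0" "mk (L x) B2 = 0" using assms(2) m by (auto simp: y_def complex_eq_iff)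
  ultimately have "L x = (1 / 2) *\<^sub>R N + (1 / mk N Q) *\<^sub>R Q" using frame[of "L x"] m by simp
  hence "L x = (a / 2) *\<^sub>R hv v + (b / mk N Q) *\<^sub>R hv q" by (simp add: N[symmetric] Q[symmetric]) (simp add: N Q)
  thus ?thesis using a b NQ by (intro exI[of _ "a / 2"] exI[of _ "b / mk N Q"]) simp
qed

end

context ideal_surface
begin

text \<open>The normal vector of the face is nonnegative at both ends and vanishes on their positive
  combination \<open>L x\<close>, hence at both ends.\<close>

lemma face_of_chord:
  assumes i: "i \<in> I" "x \<in> fc i" and ab: "0 < \<alpha>" "0 < \<beta>" "L x = \<alpha> *\<^sub>R hv v + \<beta> *\<^sub>R hv w" and vw: "v \<in> V" "w \<in> V"
  shows "v \<in> W i" "w \<in> W i"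
proof -
  obtain \<nu> where \<nu>: "\<forall>v\<in>V. 0 \<le> mk \<nu> (hv v) \<and> (mk \<nu> (hv v) = 0 \<longleftrightarrow> v \<in> W i)" using normal[OF i(1)] by blast
  obtain t where t: "L x = (\<Sum>v\<in>W i. t v *\<^sub>R hv v)" using cone_onE[OF L_cone[OF i]] by metis
  have "mk \<nu> (L x) = (\<Sum>v\<in>W i. t v * mk \<nu> (hv v))" unfolding t mk_sum_right by (simp add: mk_linear)
  also have "\<dots> = 0" using \<nu> W_sub[OF i(1)] by (intro sum.neutral) auto
  finally have e: "\<alpha> * mk \<nu> (hv v) + \<beta> * mk \<nu> (hv w) = 0" unfolding ab(3) by (simp add: mk_linear)
  moreover have "0 \<le> \<alpha> * mk \<nu> (hv v)" "0 \<le> \<beta> * mk \<nu> (hv w)" using \<nu> vw ab by auto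
  ultimately have "\<alpha> * mk \<nu> (hv v) = 0" "\<beta> * mk \<nu> (hv w) = 0" by linarith+
  thus "v \<in> W i" "w \<in> W i" using \<nu> vw ab by auto
qed

text \<open>Finite unions of faces are closed in \<open>M\<close>, and faces with a common point
  share a vertex; so the faces in \<open>A\<close> and the remaining ones would separate
  \<open>M\<close>.\<close>

lemma connected_faces:
  assumes conn: "connected_space mtopology" and A: "A \<subseteq> I" "A \<noteq> {}"
    and step: "\<And>i j. i \<in> A \<Longrightarrow> j \<in> I \<Longrightarrow> W i \<inter> W j \<noteq> {} \<Longrightarrow> j \<in> A"
  shows "A = I"
proof (rule ccontr)
  assume "A \<noteq> I"
  have cl: "closedin mtopology (\<Union>i\<in>B. fc i)" if B: "B \<subseteq> I" for B
  proof (rule closedin_Union)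
    show "finite (fc ` B)" using finite_I B finite_subset by blast
    fix S assume "S \<in> fc ` B"
    then obtain i where i: "i \<in> I" "S = fc i" using B by blast
    show "closedin mtopology S" unfolding closedin_metric
    proof (intro conjI allI impI)
      show "S \<subseteq> M" using cover i by blast
      fix x assume "x \<in> M - S"
      then obtain e where "e > 0" "\<forall>y\<in>fc i. e \<le> d x y" using face_closed i by blast
      thus "\<exists>r>0. disjnt S (mball x r)" unfolding i(2) disjnt_iff by (intro exI[of _ e]) (auto simp: in_mball)
    qed
  qed
  have fne: "fc i \<noteq> {}" if "i \<in> I" for i
    using W_two[OF that] fcone_nonempty[OF that] sec_props(1)[OF that] by blast
  have "fc i \<inter> fc j = {}" if ij: "i \<in> A" "j \<in> I - A" for i j
  proof (rule ccontr)
    assume "fc i \<inter> fc j \<noteq> {}"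
    then obtain x where x: "x \<in> fc i" "x \<in> fc j" by blast
    have "i \<in> I" "j \<in> I" "i \<noteq> j" using ij A by auto
    from edge[OF this x] have "W i \<inter> W j \<noteq> {}" by (elim exE conjE) (simp add: disjoint_iff, blast)
    thus False using step[OF ij(1)] ij(2) by blast
  qed
  hence dj: "(\<Union>i\<in>A. fc i) \<inter> (\<Union>i\<in>I - A. fc i) = {}" by blast
  have "M \<subseteq> (\<Union>i\<in>A. fc i) \<union> (\<Union>i\<in>I - A. fc i)" using cover by blast
  moreover have "(\<Union>i\<in>A. fc i) \<noteq> {}" using A fne by blast
  moreover have "(\<Union>i\<in>I - A. fc i) \<noteq> {}" using \<open>A \<noteq> I\<close> A fne by blast
  ultimately show False using conn cl[OF A(1)] cl[of "I - A"] dj unfolding connected_space_closedin topspace_mtopology by blast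
qed

end

section \<open>Horospheres, Jensen's inequality and chords to the vertex u\<close>

context two_surfaces
begin

lemma cusp_map_unique:
  assumes "cusp_map p p1 c1" "cusp_map p p2 c2" shows "p1 = p2" "c1 = c2"
proof -
  obtain i where i: "i \<in> I" "p \<in> W i" using P.V_in_face cusp_map_V(1)[OF assms(1)] by blast
  obtain T where T: "T \<in> P.fcone i" using P.fcone_nonempty[OF i] by blast
  have r: "ray_data i p p1 c1" "ray_data i p p2 c2" using assms i by (auto simp: cusp_map_def)
  show "p1 = p2" "c1 = c2" using ray_data_share[OF i i T T refl r] by auto
qed

lemma cusp_map_inj:
  assumes "cusp_map p p' c" "cusp_map r p' e" shows "p = r"
  using two_surfaces.cusp_map_unique(1)[OF swap cusp_map_inverse[OF assms(1)] cusp_map_inverse[OF assms(2)]] .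

lemma dev_L: assumes "i \<in> I" "x \<in> fc i" shows "dev i (L x) = L' x"
  using P.sec_L[OF assms] P.L_hyp[OF P.fc_M[OF assms]] by (simp add: dev_def hyp_def)

text \<open>\<open>horofunction_le\<close> gives one inequality. It places \<open>L' x\<close> in
  the closed horoball, so the face of the second polyhedron through \<open>x\<close> has the vertex
  \<open>v'\<close>, and the inverse cusp map gives the opposite inequality.\<close>

lemma horosphere_sub:
  assumes C1: "cusp_chart M d V I W fc L v q a b B1 B2 N Q"
    and C2: "cusp_chart M d V' I' W' fc' L' v' q' a' b' B1' B2' N' Q'"
    and m: "cusp_map v v' c" and a: "a' = a * c" and x: "x \<in> M" "mk (L x) N = 1"
  shows "mk (L' x) N' = 1"
proof -
  interpret C1: cusp_chart M d V I W fc L v q a b B1 B2 N Q by fact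
  interpret C2: cusp_chart M d V' I' W' fc' L' v' q' a' b' B1' B2' N' Q' by fact
  have c: "0 < c" using cusp_map_V[OF m] by blast
  have "x \<in> C1.H" using x by (simp add: C1.H_def)
  then obtain i where i: "i \<in> I" "v \<in> W i" "x \<in> fc i" using C1.H_cover by blast
  have N: "mk X N = a * mk X (hv v)" "mk X N' = a * (c * mk X (hv v'))" for X
    by (simp_all add: C1.N C2.N a mk_linear)
  have le: "mk (L' x) N' \<le> 1"
    using mult_left_mono[OF horofunction_le[OF m i(1,2,3)], of a] C1.a x(2) unfolding N by simp
  obtain j where j: "j \<in> I'" "x \<in> fc' j" using x Q.cover by blast
  have "v' \<in> W' j"
  proof (rule ccontr)
    assume "v' \<notin> W' j"
    hence "W' j \<subseteq> V' - {v'}" using Q.W_sub[OF j(1)] by blast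
    hence "L' x \<in> cone_on (V' - {v'})" using Q.L_cone[OF j] cone_on_mono[of "W' j" "V' - {v'}"] Q.finite_V by auto
    thus False using C2.horoball[of "L' x"] Q.L_hyp[OF x(1)] le by simp
  qed
  hence "1 / c * mk (L x) (hv v) \<le> mk (L' x) (hv v')"
    using two_surfaces.horofunction_le[OF swap cusp_map_inverse[OF m] j(1) _ j(2)] by blast
  hence "mk (L x) (hv v) \<le> c * mk (L' x) (hv v')" using c by (simp add: field_simps)
  hence "a * mk (L x) (hv v) \<le> a * (c * mk (L' x) (hv v'))" using C1.a by (intro mult_left_mono) auto
  hence "1 \<le> mk (L' x) N'" using x(2) unfolding N by simp
  thus ?thesis using le by simp
qed

lemma dev_superadditive_sum:
  assumes i: "i \<in> I" and v: "v \<in> V'" and A: "finite A" "A \<noteq> {}" "\<And>k. k \<in> A \<Longrightarrow> X k \<in> P.fcone i"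
  shows "(\<Sum>k\<in>A. X k) \<in> P.fcone i \<and> (\<Sum>k\<in>A. mk (dev i (X k)) (hv v)) \<le> mk (dev i (\<Sum>k\<in>A. X k)) (hv v)"
  using A
proof (induction A rule: finite_ne_induct)
  case (insert k F)
  have X: "X k \<in> P.fcone i" "(\<Sum>k\<in>F. X k) \<in> P.fcone i" using insert by auto
  have "mk (dev i (X k)) (hv v) + mk (dev i (\<Sum>k\<in>F. X k)) (hv v) \<le> mk (dev i (X k + (\<Sum>k\<in>F. X k))) (hv v)"
    by (rule dev_superadditive[OF i X v])
  moreover have "X k + (\<Sum>k\<in>F. X k) \<in> P.fcone i" using P.fcone_comb[OF i X, of 1 1] by simp
  ultimately show ?case using insert by fastforce
qed simp

text \<open>The vertices are not timelike; \<open>T\<close> is approximated by the combination of the \<open>hv w + s *\<^sub>R T\<close>.\<close>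

lemma dev_jensen:
  assumes i: "i \<in> I" and cm: "\<And>w. w \<in> W i \<Longrightarrow> cusp_map w (\<sigma> w) (c w)" and v: "v \<in> V'"
    and T: "T \<in> P.fcone i" "T = (\<Sum>w\<in>W i. t w *\<^sub>R hv w)" and t: "\<And>w. w \<in> W i \<Longrightarrow> 0 \<le> t w"
  shows "(\<Sum>w\<in>W i. t w * (c w * mk (hv (\<sigma> w)) (hv v))) \<le> mk (dev i T) (hv v)"
proof -
  have "\<forall>w\<in>W i. \<exists>\<delta>. \<exists>Y. 0 < \<delta> \<and> (\<forall>s. 0 < s \<longrightarrow> s \<le> \<delta> \<longrightarrow> dev i (hv w + s *\<^sub>R T) = c w *\<^sub>R hv (\<sigma> w) + s *\<^sub>R Y)"
  proof
    fix w assume w: "w \<in> W i"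
    have "ray_data i w (\<sigma> w) (c w)" using cm[OF w] i w by (simp add: cusp_map_def)
    from ray_data_E[OF this T(1)] show "\<exists>\<delta>. \<exists>Y. 0 < \<delta> \<and> (\<forall>s. 0 < s \<longrightarrow> s \<le> \<delta> \<longrightarrow> dev i (hv w + s *\<^sub>R T) = c w *\<^sub>R hv (\<sigma> w) + s *\<^sub>R Y)"
      by metis
  qed
  from bchoice[OF this] obtain \<delta> where "\<forall>w\<in>W i. \<exists>Y. 0 < \<delta> w \<and> (\<forall>s. 0 < s \<longrightarrow> s \<le> \<delta> w \<longrightarrow> dev i (hv w + s *\<^sub>R T) = c w *\<^sub>R hv (\<sigma> w) + s *\<^sub>R Y)" by blast
  from bchoice[OF this] obtain Y where \<delta>: "\<And>w. w \<in> W i \<Longrightarrow> 0 < \<delta> w"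
    and Y: "\<And>w s. w \<in> W i \<Longrightarrow> 0 < s \<Longrightarrow> s \<le> \<delta> w \<Longrightarrow> dev i (hv w + s *\<^sub>R T) = c w *\<^sub>R hv (\<sigma> w) + s *\<^sub>R Y w" by blast
  define A where "A = {w\<in>W i. 0 < t w}"
  have finA: "finite A" using P.finite_W[OF i] by (simp add: A_def)
  have TA: "T = (\<Sum>w\<in>A. t w *\<^sub>R hv w)" unfolding T(2)
    by (rule sum.mono_neutral_right) (use P.finite_W[OF i] t in \<open>force simp: A_def\<close>)+
  have Ane: "A \<noteq> {}"
  proof
    assume "A = {}"
    hence "T = 0" using TA by simp
    thus False using P.fcone_future[OF T(1)] by (simp add: future_def)
  qed
  define \<tau> where "\<tau> = (\<Sum>w\<in>A. t w)"
  have \<tau>: "0 < \<tau>" unfolding \<tau>_def by (rule sum_pos[OF finA Ane]) (simp add: A_def)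
  define D where "D = mk (dev i T) (hv v)"
  define S where "S = (\<Sum>w\<in>A. t w * (c w * mk (hv (\<sigma> w)) (hv v)))"
  define S' where "S' = (\<Sum>w\<in>A. t w * mk (Y w) (hv v))"
  define \<delta>0 where "\<delta>0 = Min (\<delta> ` A)"
  have \<delta>0: "0 < \<delta>0" "\<And>w. w \<in> A \<Longrightarrow> \<delta>0 \<le> \<delta> w" using finA Ane \<delta> by (auto simp: \<delta>0_def A_def)
  \<comment> \<open>Superadditivity for the vectors
    \<open>t w *\<^sub>R (hv w + s *\<^sub>R T)\<close>, whose sum is a multiple of \<open>T\<close>
    and whose developments are affine in \<open>s\<close>; only the constant terms matter in the
    end.\<close>
  have "0 \<le> (D - S) + s * (\<tau> * D - S')" if s: "0 < s" "s \<le> \<delta>0" for s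
  proof -
    define X where "X w = t w *\<^sub>R (hv w + s *\<^sub>R T)" for w
    have X: "X w \<in> P.fcone i" "mk (dev i (X w)) (hv v) = t w * (c w * mk (hv (\<sigma> w)) (hv v)) + s * (t w * mk (Y w) (hv v))"
      if w: "w \<in> A" for w
    proof -
      have w': "w \<in> W i" "0 < t w" "s \<le> \<delta> w" using w \<delta>0(2)[OF w] s by (auto simp: A_def)
      show "X w \<in> P.fcone i" unfolding X_def using P.fcone_scale[OF ray_fcone[OF i w'(1) T(1) s(1)] w'(2)] .
      show "mk (dev i (X w)) (hv v) = t w * (c w * mk (hv (\<sigma> w)) (hv v)) + s * (t w * mk (Y w) (hv v))"
        unfolding X_def dev_scale[OF w'(2)] Y[OF w'(1) s(1) w'(3)] by (simp add: mk_linear algebra_simps)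
    qed
    have sumX: "(\<Sum>w\<in>A. X w) = (1 + s * \<tau>) *\<^sub>R T"
    proof -
      have "(\<Sum>w\<in>A. X w) = (\<Sum>w\<in>A. t w *\<^sub>R hv w) + (\<Sum>w\<in>A. (t w * s) *\<^sub>R T)"
        unfolding X_def by (simp add: scaleR_add_right sum.distrib)
      also have "(\<Sum>w\<in>A. (t w * s) *\<^sub>R T) = (\<tau> * s) *\<^sub>R T" unfolding \<tau>_def by (simp add: scaleR_sum_left sum_distrib_right)
      finally show ?thesis unfolding TA[symmetric] by (simp add: scaleR_add_left mult.commute)
    qed
    have "(\<Sum>w\<in>A. mk (dev i (X w)) (hv v)) \<le> mk (dev i (\<Sum>w\<in>A. X w)) (hv v)"
      using dev_superadditive_sum[where X = X, OF i v finA Ane X(1)] by blast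
    moreover have "(\<Sum>w\<in>A. mk (dev i (X w)) (hv v)) = S + s * S'"
      unfolding S_def S'_def sum_distrib_left sum.distrib[symmetric] using X(2) by (intro sum.cong) auto
    moreover have "mk (dev i (\<Sum>w\<in>A. X w)) (hv v) = (1 + s * \<tau>) * D"
    proof -
      have p: "0 < 1 + s * \<tau>" using s \<tau> by (simp add: add_pos_pos)
      show ?thesis unfolding sumX D_def dev_scale[OF p] by (simp only: mk_scale_left)
    qed
    ultimately have "S + s * S' \<le> (1 + s * \<tau>) * D" by simp
    thus ?thesis by (simp add: algebra_simps)
  qed
  from affine_limit_nonneg[OF \<delta>0(1) this] have "S \<le> D" by simp
  moreover have "S = (\<Sum>w\<in>W i. t w * (c w * mk (hv (\<sigma> w)) (hv v)))" unfolding S_def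
    by (rule sum.mono_neutral_left) (use P.finite_W[OF i] t in \<open>force simp: A_def\<close>)+
  ultimately show ?thesis unfolding D_def by simp
qed

text \<open>Superadditivity passes equality at \<open>T\<close> on to a summand
  \<open>r *\<^sub>R S\<close> on the ray from \<open>u\<close>. There the development is explicit,
  and comparison of norms makes the two pairings equal without the factor \<open>k\<close>; so
  \<open>k\<close> would be at most 1.\<close>

lemma chord_contra:
  assumes i: "i \<in> I" "v \<in> W i" "u \<in> W i" "v \<noteq> u" and m: "cusp_map u u' c" and k: "1 < k"
    and nonneg: "\<And>T. T \<in> P.fcone i \<Longrightarrow> mk T (hv u) \<le> k * (c * mk (dev i T) (hv u'))"
    and T: "T = \<alpha> *\<^sub>R hv v + \<beta> *\<^sub>R hv u" "0 < \<alpha>" "0 < \<beta>"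
    and eq: "k * (c * mk (dev i T) (hv u')) \<le> mk T (hv u)"
  shows False
proof -
  define T0 where "T0 = 1 *\<^sub>R hv v + 1 *\<^sub>R hv u"
  have T0: "T0 \<in> P.fcone i" unfolding T0_def by (rule P.two_vertices_fcone[OF i]) simp_all
  have u': "u' \<in> V'" "norm u' = 1" and c: "0 < c" using cusp_map_V[OF m] Q.norm_V by auto
  have "ray_data i u u' c" using m i by (simp add: cusp_map_def)
  from ray_data_E[OF this T0] obtain \<delta> Y where j: "0 < \<delta>"
    "\<And>s. 0 < s \<Longrightarrow> s \<le> \<delta> \<Longrightarrow> dev i (hv u + s *\<^sub>R T0) = c *\<^sub>R hv u' + s *\<^sub>R Y" by metis
  have Y: "c * mk (hv u') Y = mk (hv u) T0" using ray_mk(1)[OF i(1) i(3) T0 j(1) u'(2) j(2)] .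
  have n: "norm v = 1" "norm u = 1" using P.norm_V P.W_sub i by blast+
  have m0: "0 < mk (hv v) (hv u)" using mk_hv_sphere_pos n i(4) by blast
  have T0o: "mk T0 (hv u) = mk (hv v) (hv u)" by (simp add: T0_def mk_linear mk_hv_self_sphere n)
  \<comment> \<open>Small enough for both coefficients of the remainder \<open>T'\<close> to be
    positive.\<close>
  define r where "r = min (\<alpha> / \<delta>) (\<beta> / (1 + \<delta>)) / 2"
  have r: "0 < r" "r * \<delta> < \<alpha>" "r * (1 + \<delta>) < \<beta>"
  proof -
    show "0 < r" using T j by (simp add: r_def)
    have "0 < \<alpha> / \<delta>" "0 < \<beta> / (1 + \<delta>)" using T(2,3) j(1) by simp_all
    hence "r < \<alpha> / \<delta>" "r < \<beta> / (1 + \<delta>)" 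
      using min.cobounded1[of "\<alpha> / \<delta>" "\<beta> / (1 + \<delta>)"] min.cobounded2[of "\<alpha> / \<delta>" "\<beta> / (1 + \<delta>)"]
      unfolding r_def by (smt (verit, best) field_sum_of_halves min_def)+
    thus "r * \<delta> < \<alpha>" "r * (1 + \<delta>) < \<beta>" using j(1) by (auto simp: field_simps)
  qed
  define S where "S = hv u + \<delta> *\<^sub>R T0"
  have S: "r *\<^sub>R S \<in> P.fcone i" unfolding S_def using P.fcone_scale[OF ray_fcone[OF i(1,3) T0 j(1)] r(1)] .
  define T' where "T' = (\<alpha> - r * \<delta>) *\<^sub>R hv v + (\<beta> - r * (1 + \<delta>)) *\<^sub>R hv u"
  have T': "T' \<in> P.fcone i" unfolding T'_def using r by (intro P.two_vertices_fcone i) auto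
  have TT: "T = r *\<^sub>R S + T'" unfolding T(1) S_def T'_def T0_def by (simp add: algebra_simps)
  have "mk (dev i (r *\<^sub>R S)) (hv u') + mk (dev i T') (hv u') \<le> mk (dev i T) (hv u')"
    unfolding TT by (rule dev_superadditive[OF i(1) S T' u'(1)])
  hence "k * (c * (mk (dev i (r *\<^sub>R S)) (hv u') + mk (dev i T') (hv u'))) \<le> mk T (hv u)"
    using eq c k by (smt (verit) mult_left_mono)
  hence "k * (c * mk (dev i (r *\<^sub>R S)) (hv u')) + k * (c * mk (dev i T') (hv u')) \<le> mk (r *\<^sub>R S) (hv u) + mk T' (hv u)"
    unfolding TT by (simp add: mk_linear distrib_left)
  hence "k * (c * mk (dev i (r *\<^sub>R S)) (hv u')) \<le> mk (r *\<^sub>R S) (hv u)" using nonneg[OF T'] by linarith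
  moreover have "c * mk (dev i (r *\<^sub>R S)) (hv u') = r * (\<delta> * mk (hv v) (hv u))"
  proof -
    have "dev i (r *\<^sub>R S) = r *\<^sub>R (c *\<^sub>R hv u' + \<delta> *\<^sub>R Y)" unfolding dev_scale[OF r(1)] S_def using j by simp
    hence "c * mk (dev i (r *\<^sub>R S)) (hv u') = r * (\<delta> * (c * mk (hv u') Y))"
      by (simp add: mk_linear mk_hv_self_sphere u' mk_commute[of Y])
    thus ?thesis unfolding Y mk_commute[of "hv u" T0] T0o .
  qed
  moreover have "mk (r *\<^sub>R S) (hv u) = r * (\<delta> * mk (hv v) (hv u))" unfolding S_def by (simp add: mk_linear mk_hv_self_sphere n T0o)
  ultimately have "k * (r * (\<delta> * mk (hv v) (hv u))) \<le> 1 * (r * (\<delta> * mk (hv v) (hv u)))" by simp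
  moreover have "0 < r * (\<delta> * mk (hv v) (hv u))" using r j m0 by simp
  ultimately show False using k by (simp only: mult_le_cancel_right_pos)
qed

end

section \<open>Propagation of the maximal quotient\<close>

context two_surfaces
begin

text \<open>Charts at \<open>v\<close> and \<open>\<sigma> v\<close>, with \<open>u\<close> and
  \<open>\<sigma> u\<close> over the origins, form a \<open>link_pair\<close>.
  \<open>norm_eq\<close> gives equality on the whole horosphere section; at a point between
  \<open>v\<close> and \<open>w\<close> Jensen's inequality then leaves no room for a strict
  inequality at \<open>w\<close>.\<close>

lemma link_face_step:
  assumes cm: "\<And>w. w \<in> V \<Longrightarrow> cusp_map w (\<sigma> w) (c w)" and vu: "v \<in> V" "u \<in> V" "v \<noteq> u" and k: "1 < k"
    and max: "\<And>w. w \<in> V \<Longrightarrow> mk (hv w) (hv u) \<le> k * (c w * (c u * mk (hv (\<sigma> w)) (hv (\<sigma> u))))"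
    and eq: "mk (hv v) (hv u) = k * (c v * (c u * mk (hv (\<sigma> v)) (hv (\<sigma> u))))"
    and i: "i \<in> I" "v \<in> W i" and w: "w \<in> W i"
  shows "w \<noteq> u \<and> mk (hv w) (hv u) = k * (c w * (c u * mk (hv (\<sigma> w)) (hv (\<sigma> u))))"
proof -
  define G where "G w = mk (hv w) (hv u)" for w
  define R where "R w = k * (c w * (c u * mk (hv (\<sigma> w)) (hv (\<sigma> u))))" for w
  have cV: "0 < c w" "\<sigma> w \<in> V'" if "w \<in> V" for w using cusp_map_V[OF cm[OF that]] by auto
  have jensen: "(\<Sum>w\<in>W i. t w * (R w - G w)) \<le> k * (c u * mk (dev i T) (hv (\<sigma> u))) - mk T (hv u)"
    if "i \<in> I" "T \<in> P.fcone i" "T = (\<Sum>w\<in>W i. t w *\<^sub>R hv w)" "\<And>w. w \<in> W i \<Longrightarrow> 0 \<le> t w" for i T t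
  proof -
    have "(\<Sum>w\<in>W i. t w * (c w * mk (hv (\<sigma> w)) (hv (\<sigma> u)))) \<le> mk (dev i T) (hv (\<sigma> u))"
      using dev_jensen[OF that(1) _ cV(2)[OF vu(2)] that(2-4)] cm P.W_sub[OF that(1)] by blast
    hence "k * c u * (\<Sum>w\<in>W i. t w * (c w * mk (hv (\<sigma> w)) (hv (\<sigma> u)))) \<le> k * c u * mk (dev i T) (hv (\<sigma> u))"
      using k cV(1)[OF vu(2)] by (intro mult_left_mono) auto
    moreover have "k * c u * (\<Sum>w\<in>W i. t w * (c w * mk (hv (\<sigma> w)) (hv (\<sigma> u)))) = (\<Sum>w\<in>W i. t w * R w)"
      unfolding sum_distrib_left R_def by (intro sum.cong) (simp_all add: algebra_simps)
    moreover have "mk T (hv u) = (\<Sum>w\<in>W i. t w * G w)" unfolding that(3) mk_sum_left G_def by (simp add: mk_linear)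
    ultimately show ?thesis by (simp add: right_diff_distrib sum_subtractf mult.assoc)
  qed
  have nonneg: "mk T (hv u) \<le> k * (c u * mk (dev i T) (hv (\<sigma> u)))" if T: "i \<in> I" "T \<in> P.fcone i" for i T
  proof -
    have "T \<in> cone_on (W i)" using T by (simp add: P.fcone_def)
    then obtain t where t: "\<And>w. w \<in> W i \<Longrightarrow> 0 \<le> t w" "T = (\<Sum>w\<in>W i. t w *\<^sub>R hv w)" using cone_onE by metis
    have "0 \<le> (\<Sum>w\<in>W i. t w * (R w - G w))"
      using t(1) max P.W_sub[OF T(1)] by (intro sum_nonneg mult_nonneg_nonneg) (auto simp: R_def G_def)
    thus ?thesis using jensen[OF T t(2,1)] by linarith
  qed
  have cvu: "0 < c v" "0 < c u" "\<sigma> v \<in> V'" "\<sigma> u \<in> V'" using cV vu by auto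
  have \<sigma>ne: "\<sigma> v \<noteq> \<sigma> u" using cusp_map_inj cm vu by metis
  define m0 where "m0 = mk (hv (\<sigma> v)) (hv (\<sigma> u))"
  have m0: "0 < m0" unfolding m0_def using mk_hv_sphere_pos Q.norm_V cvu \<sigma>ne by blast
  have Gv: "0 < G v" "G v = k * (c v * (c u * m0))"
    using mk_hv_sphere_pos[OF P.norm_V[OF vu(1)] P.norm_V[OF vu(2)] vu(3)] eq unfolding G_def m0_def by blast+
  obtain a0 where a0: "a0 > 0" "\<And>a b. a \<ge> a0 \<Longrightarrow> b > 0 \<Longrightarrow> \<exists>B1 B2. cusp_chart M d V I W fc L v u a b B1 B2 (a *\<^sub>R hv v) (b *\<^sub>R hv u)"
    using P.cusp_chart_exists[OF vu] by blast
  obtain a0' where a0': "a0' > 0" "\<And>a b. a \<ge> a0' \<Longrightarrow> b > 0 \<Longrightarrow>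
      \<exists>B1 B2. cusp_chart M d V' I' W' fc' L' (\<sigma> v) (\<sigma> u) a b B1 B2 (a *\<^sub>R hv (\<sigma> v)) (b *\<^sub>R hv (\<sigma> u))"
    using Q.cusp_chart_exists[OF cvu(3,4) \<sigma>ne] by blast
  \<comment> \<open>Large enough for both horoballs; the scale in the second chart must be
    \<open>a * c v\<close> for the two horosphere sections to be the same subset of
    \<open>M\<close>.\<close>
  define a where "a = max a0 (a0' / c v)"
  define a' where "a' = a * c v"
  have a: "0 < a" "a0 \<le> a" using a0 by (auto simp: a_def)
  have a': "a0' \<le> a'" "0 < a'"
  proof -
    have "a0' / c v * c v \<le> a * c v" using cvu by (intro mult_right_mono) (auto simp: a_def)
    thus "a0' \<le> a'" using cvu by (simp add: a'_def)
    thus "0 < a'" using a0' by simp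
  qed
  obtain B1 B2 where C1: "cusp_chart M d V I W fc L v u a 1 B1 B2 (a *\<^sub>R hv v) (1 *\<^sub>R hv u)" using a0(2)[OF a(2), of 1] by auto
  obtain B1' B2' where C2: "cusp_chart M d V' I' W' fc' L' (\<sigma> v) (\<sigma> u) a' 1 B1' B2' (a' *\<^sub>R hv (\<sigma> v)) (1 *\<^sub>R hv (\<sigma> u))" using a0'(2)[OF a'(1), of 1] by auto
  interpret C1: cusp_chart M d V I W fc L v u a 1 B1 B2 "a *\<^sub>R hv v" "1 *\<^sub>R hv u" by fact
  interpret C2: cusp_chart M d V' I' W' fc' L' "\<sigma> v" "\<sigma> u" a' 1 B1' B2' "a' *\<^sub>R hv (\<sigma> v)" "1 *\<^sub>R hv (\<sigma> u)" by fact
  have H12: "C1.H = C2.H"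
  proof -
    have "a = a' * (1 / c v)" using cvu by (simp add: a'_def)
    hence "mk (L x) (a *\<^sub>R hv v) = 1" if "x \<in> M" "mk (L' x) (a' *\<^sub>R hv (\<sigma> v)) = 1" for x
      using two_surfaces.horosphere_sub[OF swap C2 C1 cusp_map_inverse[OF cm[OF vu(1)]] _ that] by blast
    moreover have "mk (L' x) (a' *\<^sub>R hv (\<sigma> v)) = 1" if "x \<in> M" "mk (L x) (a *\<^sub>R hv v) = 1" for x
      using horosphere_sub[OF C1 C2 cm[OF vu(1)] a'_def that] .
    ultimately show ?thesis unfolding C1.H_def C2.H_def by blast
  qed
  \<comment> \<open>The gap in the inequality at \<open>x\<close>. Equality at \<open>v\<close>
    gives both links the same scale, so up to the factor \<open>2 / (a * G v)\<close> this is the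
    difference of the squared distances to the origins.\<close>
  define def where "def x = k * (c u * mk (L' x) (hv (\<sigma> u))) - mk (L x) (hv u)" for x
  have def0: "0 \<le> def x" if x: "x \<in> M" for x
  proof -
    obtain j where j: "j \<in> I" "x \<in> fc j" using x P.cover by blast
    show ?thesis using nonneg[OF j(1) P.sec_L(1)[OF j]] unfolding def_def dev_L[OF j] by simp
  qed
  have norms: "(norm (C2.y (L' x)))\<^sup>2 - (norm (C1.y (L x)))\<^sup>2 = 2 / (a * G v) * def x" if x: "x \<in> C1.H" for x
  proof -
    have x2: "x \<in> C2.H" using x H12 by simp
    have "(norm (C1.y (L x)))\<^sup>2 = 2 * mk (L x) (hv u) / (a * G v) - 1"
      using C1.y_norm[of "L x"] C1.H_M[OF x] by (simp add: mk_linear G_def)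
    moreover have "(norm (C2.y (L' x)))\<^sup>2 = 2 * mk (L' x) (hv (\<sigma> u)) / (a' * m0) - 1"
      using C2.y_norm[of "L' x"] C2.H_M[OF x2] by (simp add: mk_linear m0_def)
    moreover have "2 * mk (L' x) (hv (\<sigma> u)) / (a' * m0) = 2 * (k * (c u * mk (L' x) (hv (\<sigma> u)))) / (a * G v)"
      unfolding Gv(2) a'_def using cvu k m0 a by (simp add: field_simps)
    ultimately show ?thesis unfolding def_def by (simp add: diff_divide_distrib right_diff_distrib)
  qed
  have aG: "0 < 2 / (a * G v)" using a Gv by simp
  have le: "norm (C1.y (L x)) \<le> norm (C2.y (L' x))" if x: "x \<in> C1.H" for x
  proof -
    have "0 \<le> 2 / (a * G v) * def x" using aG def0[OF C1.H_M(1)[OF x]] by simp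
    hence "(norm (C1.y (L x)))\<^sup>2 \<le> (norm (C2.y (L' x)))\<^sup>2" unfolding norms[OF x, symmetric] by (rule diff_ge_0_iff_ge[THEN iffD1])
    thus ?thesis by (rule power2_le_imp_le) (rule norm_ge_zero)
  qed
  have nz: "C2.y (L' x) \<noteq> 0" if x: "x \<in> C1.H" for x
  proof
    assume y0: "C2.y (L' x) = 0"
    hence y1: "C1.y (L x) = 0" using le[OF x] by simp
    have "2 / (a * G v) * def x = 0" unfolding norms[OF x, symmetric] y0 y1 by simp
    \<comment> \<open>A point of the second link at the origin would put \<open>x\<close> on the
      geodesic from \<open>v\<close> to \<open>u\<close> with equality there, which
      \<open>chord_contra\<close> excludes.\<close>
    hence d0: "def x = 0" using aG by (metis less_irrefl mult_eq_0_iff)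
    obtain \<alpha> \<beta> where ab: "0 < \<alpha>" "0 < \<beta>" "L x = \<alpha> *\<^sub>R hv v + \<beta> *\<^sub>R hv u" using C1.zero_in_chart[OF x y1] by blast
    obtain j where j: "j \<in> I" "v \<in> W j" "x \<in> fc j" using C1.H_cover[OF x] by blast
    have uj: "u \<in> W j" using P.face_of_chord[OF j(1,3) ab vu(1,2)] by blast
    show False
      by (rule chord_contra[OF j(1,2) uj vu(3) cm[OF vu(2)] k nonneg[OF j(1)] ab(3,1,2)])
        (use d0 in \<open>simp_all add: def_def dev_L[OF j(1,3)]\<close>)
  qed
  interpret link_pair M d V I W fc L V' I' W' fc' L' v u a 1 B1 B2 "a *\<^sub>R hv v" "1 *\<^sub>R hv u"
    "\<sigma> v" "\<sigma> u" a' 1 B1' B2' "a' *\<^sub>R hv (\<sigma> v)" "1 *\<^sub>R hv (\<sigma> u)"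
    by unfold_locales (use H12 le nz in auto)
  have zero: "def x = 0" if x: "x \<in> C1.H" for x
  proof -
    have "2 / (a * G v) * def x = 0"
      unfolding norms[OF x, symmetric] using norm_eq[OF x] unfolding Y1_def Y2_def by simp
    thus ?thesis using aG by (metis less_irrefl mult_eq_0_iff)
  qed
  show ?thesis
  proof (cases "w = v")
    case True
    thus ?thesis using vu eq by simp
  next
    case False
    have wV: "w \<in> V" using w P.W_sub i by blast
    define m where "m = mk (hv v) (hv w)"
    have m: "0 < m" unfolding m_def using mk_hv_sphere_pos P.norm_V vu(1) wV False by metis
    \<comment> \<open>The point where the geodesic from \<open>v\<close> to \<open>w\<close> crosses
      the horosphere: norm 1 and pairing 1 with \<open>a *\<^sub>R hv v\<close>.\<close>
    define \<alpha> \<beta> where "\<alpha> = a / 2" and "\<beta> = 1 / (a * m)"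
    have ab: "0 < \<alpha>" "0 < \<beta>" using a m by (auto simp: \<alpha>_def \<beta>_def)
    define T where "T = \<alpha> *\<^sub>R hv v + \<beta> *\<^sub>R hv w"
    have T: "T \<in> P.fcone i" unfolding T_def by (rule P.two_vertices_fcone[OF i w]) (use False ab in auto)
    have TT: "mk T T = 1" "mk T (a *\<^sub>R hv v) = 1"
      using a m P.norm_V[OF vu(1)] P.norm_V[OF wV]
      by (simp_all add: T_def mk_linear mk_hv_self_sphere mk_commute[of "hv w" "hv v"] m_def[symmetric] \<alpha>_def \<beta>_def)
    have Th: "unitv T = T" by (simp add: unitv_def TT)
    define x where "x = P.sec i T"
    have x: "x \<in> fc i" "x \<in> M" "L x = T" using P.sec_props[OF i(1) T] Th by (auto simp: x_def)
    have "x \<in> C1.H" using x TT by (simp add: C1.H_def)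
    hence d0: "k * (c u * mk (dev i T) (hv (\<sigma> u))) - mk T (hv u) = 0"
      using zero[of x] dev_L[OF i(1) x(1)] unfolding def_def x(3) by simp
    define t where "t z = (if z = v then \<alpha> else if z = w then \<beta> else 0)" for z
    have fW: "finite (W i)" using P.finite_W[OF i(1)] .
    have Tt: "T = (\<Sum>z\<in>W i. t z *\<^sub>R hv z)" unfolding T_def t_def
      using sum_two_points[OF fW i(2) w, of \<alpha> \<beta> hv] False by simp
    have t0: "0 \<le> t z" for z using ab by (simp add: t_def)
    have "(\<Sum>z\<in>W i. t z * (R z - G z)) \<le> 0" using jensen[OF i(1) T Tt t0] d0 by simp
    moreover have "(\<Sum>z\<in>W i. t z * (R z - G z)) = \<alpha> * (R v - G v) + \<beta> * (R w - G w)"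
      using sum_two_points[OF fW i(2) w, of \<alpha> \<beta> "\<lambda>z. R z - G z"] False unfolding t_def by simp
    moreover have "R v = G v" using eq by (simp add: R_def G_def)
    ultimately have "\<beta> * (R w - G w) \<le> 0" by simp
    hence "R w \<le> G w" using ab by (simp add: mult_le_0_iff)
    hence RG: "R w = G w" using max[OF wV] by (simp add: R_def G_def)
    have "w \<noteq> u"
    proof
      assume wu: "w = u"
      show False
        by (rule chord_contra[OF i(1,2) w[unfolded wu] vu(3) cm[OF vu(2)] k nonneg[OF i(1)] T_def[unfolded wu] ab])
          (use d0 in \<open>simp_all\<close>)
    qed
    thus ?thesis using RG by (simp add: R_def G_def)
  qed
qed

theorem gram_le:
  assumes conn: "connected_space P.mtopology" and cm: "\<And>w. w \<in> V \<Longrightarrow> cusp_map w (\<sigma> w) (c w)"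
    and vu: "v \<in> V" "u \<in> V"
  shows "mk (hv v) (hv u) \<le> c v * (c u * mk (hv (\<sigma> v)) (hv (\<sigma> u)))"
proof (rule ccontr)
  assume less: "\<not> ?thesis"
  have cV: "0 < c w" "\<sigma> w \<in> V'" if "w \<in> V" for w using cusp_map_V[OF cm[OF that]] by auto
  define R where "R w = c w * (c u * mk (hv (\<sigma> w)) (hv (\<sigma> u)))" for w
  have R: "0 < R w" if w: "w \<in> V - {u}" for w
  proof -
    have "\<sigma> w \<noteq> \<sigma> u" using cusp_map_inj cm vu w by (metis DiffE insertI1)
    hence "0 < mk (hv (\<sigma> w)) (hv (\<sigma> u))" using mk_hv_sphere_pos Q.norm_V cV(2) vu w by blast
    thus ?thesis using cV(1) vu w by (simp add: R_def)
  qed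
  have Ru: "R u = 0" "mk (hv u) (hv u) = 0" using Q.norm_V[OF cV(2)] P.norm_V vu by (auto simp: R_def mk_hv_self_sphere)
  have "v \<noteq> u" using less Ru by (auto simp: R_def)
  \<comment> \<open>The vertex \<open>u\<close> is left out since both sides vanish there; for the
    same reason the inequality with factor \<open>k\<close> holds at \<open>u\<close> too.\<close>
  define k where "k = Max ((\<lambda>w. mk (hv w) (hv u) / R w) ` (V - {u}))"
  have fin: "finite ((\<lambda>w. mk (hv w) (hv u) / R w) ` (V - {u}))" "(\<lambda>w. mk (hv w) (hv u) / R w) ` (V - {u}) \<noteq> {}"
    using P.finite_V vu \<open>v \<noteq> u\<close> by auto
  have kle: "mk (hv w) (hv u) \<le> k * R w" if w: "w \<in> V" for w
  proof (cases "w = u")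
    case False
    hence "mk (hv w) (hv u) / R w \<le> k" unfolding k_def using fin w by (intro Max_ge) auto
    thus ?thesis using R[of w] w False by (simp add: pos_divide_le_eq)
  qed (use Ru in auto)
  have "k \<in> (\<lambda>w. mk (hv w) (hv u) / R w) ` (V - {u})" unfolding k_def using fin by (rule Max_in)
  then obtain v1 where v1: "v1 \<in> V" "v1 \<noteq> u" "k = mk (hv v1) (hv u) / R v1" by blast
  hence v1k: "mk (hv v1) (hv u) = k * R v1" using R[of v1] by simp
  have "1 < k"
  proof -
    have "R v < mk (hv v) (hv u)" using less by (simp add: R_def)
    hence "1 * R v < k * R v" using kle[OF vu(1)] by simp
    thus ?thesis using R[of v] vu \<open>v \<noteq> u\<close> by simp
  qed
  define S where "S = {w\<in>V. w \<noteq> u \<and> mk (hv w) (hv u) = k * R w}"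
  have step: "W i \<subseteq> S" if i: "i \<in> I" and S: "z \<in> W i" "z \<in> S" for i z
  proof
    fix w assume w: "w \<in> W i"
    have z: "z \<in> V" "z \<noteq> u" "mk (hv z) (hv u) = k * R z" using S by (auto simp: S_def)
    have "w \<noteq> u \<and> mk (hv w) (hv u) = k * (c w * (c u * mk (hv (\<sigma> w)) (hv (\<sigma> u))))"
      by (rule link_face_step[OF cm z(1) vu(2) z(2) \<open>1 < k\<close> kle[unfolded R_def] z(3)[unfolded R_def] i S(1) w])
    thus "w \<in> S" using w P.W_sub[OF i] by (auto simp: S_def R_def)
  qed
  define A where "A = {i\<in>I. W i \<inter> S \<noteq> {}}"
  have "A = I"
  proof (rule P.connected_faces[OF conn])
    obtain i where "i \<in> I" "v1 \<in> W i" using P.V_in_face[OF v1(1)] by blast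
    thus "A \<noteq> {}" using v1 v1k by (auto simp: A_def S_def)
    fix i j assume "i \<in> A" "j \<in> I" "W i \<inter> W j \<noteq> {}"
    thus "j \<in> A" using step unfolding A_def by blast
  qed (auto simp: A_def)
  \<comment> \<open>Equality spreads to a face with vertex \<open>u\<close>, hence to
    \<open>u\<close> itself, although \<open>link_face_step\<close> never reaches
    \<open>u\<close>.\<close>
  obtain i where i: "i \<in> I" "u \<in> W i" using P.V_in_face[OF vu(2)] by blast
  hence "i \<in> A" using \<open>A = I\<close> by simp
  hence "u \<in> S" using step i unfolding A_def by blast
  thus False by (simp add: S_def)
qed

text \<open>The exchanged polyhedra have the inverse cusp correspondence with ratios
  \<open>1 / c v\<close>, and \<open>gram_le\<close> for them is the opposite inequality.\<close>

theorem gram_eq: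
  assumes conn: "connected_space P.mtopology"
  shows "\<exists>\<sigma> c. bij_betw \<sigma> V V' \<and> (\<forall>v\<in>V. 0 < c v) \<and>
    (\<forall>v\<in>V. \<forall>u\<in>V. mk (hv v) (hv u) = c v * (c u * mk (hv (\<sigma> v)) (hv (\<sigma> u))))"
proof -
  have "\<forall>v\<in>V. \<exists>p c. cusp_map v p c" using cusp_map_exists by blast
  from bchoice[OF this] obtain \<sigma> where "\<forall>v\<in>V. \<exists>c. cusp_map v (\<sigma> v) c" by blast
  from bchoice[OF this] obtain c where cm: "\<And>v. v \<in> V \<Longrightarrow> cusp_map v (\<sigma> v) (c v)" by blast
  have cV: "0 < c w" "\<sigma> w \<in> V'" if "w \<in> V" for w using cusp_map_V[OF cm[OF that]] by auto
  interpret S: two_surfaces M d V' I' W' fc' L' V I W fc L by (rule swap)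
  have inj: "inj_on \<sigma> V" using cusp_map_inj cm by (metis inj_onI)
  have "V' \<subseteq> \<sigma> ` V"
  proof
    fix p assume "p \<in> V'"
    then obtain w e where m: "S.cusp_map p w e" using S.cusp_map_exists by blast
    hence "cusp_map w p (1 / e)" using S.cusp_map_inverse by blast
    moreover have "w \<in> V" using S.cusp_map_V[OF m] by blast
    ultimately have "\<sigma> w = p" using cusp_map_unique(1) cm by blast
    thus "p \<in> \<sigma> ` V" using \<open>w \<in> V\<close> by blast
  qed
  hence bij: "bij_betw \<sigma> V V'" using inj cV by (auto simp: bij_betw_def)
  define \<tau> where "\<tau> = the_inv_into V \<sigma>"
  have \<tau>: "\<tau> (\<sigma> v) = v" if "v \<in> V" for v using the_inv_into_f_f[OF inj that] by (simp add: \<tau>_def)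
  have cm': "S.cusp_map p (\<tau> p) (1 / c (\<tau> p))" if p: "p \<in> V'" for p
  proof -
    obtain v where v: "v \<in> V" "p = \<sigma> v" using \<open>V' \<subseteq> \<sigma> ` V\<close> p by blast
    show ?thesis using cusp_map_inverse[OF cm[OF v(1)]] \<tau>[OF v(1)] v(2) by simp
  qed
  have "mk (hv v) (hv u) = c v * (c u * mk (hv (\<sigma> v)) (hv (\<sigma> u)))" if vu: "v \<in> V" "u \<in> V" for v u
  proof (rule antisym)
    show "mk (hv v) (hv u) \<le> c v * (c u * mk (hv (\<sigma> v)) (hv (\<sigma> u)))" using gram_le[OF conn cm vu] .
    have "mk (hv (\<sigma> v)) (hv (\<sigma> u)) \<le> 1 / c v * (1 / c u * mk (hv v) (hv u))"
      using S.gram_le[OF conn cm' cV(2)[OF vu(1)] cV(2)[OF vu(2)]] \<tau> vu by simp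
    thus "c v * (c u * mk (hv (\<sigma> v)) (hv (\<sigma> u))) \<le> mk (hv v) (hv u)"
      using cV(1)[OF vu(1)] cV(1)[OF vu(2)] by (simp add: field_simps)
  qed
  thus ?thesis using bij cV by blast
qed

end

subsection \<open>From Gram matrices to congruence\<close>

text \<open>A past timelike vector pairs negatively with future causal vectors, so the sign of one
  pairing decides the time orientation.\<close>

lemma snd_pos_of_mk:
  assumes "0 < mk X X" "0 < mk X Y" "0 \<le> mk Y Y" "0 < snd Y" shows "X \<in> future"
proof -
  have "snd X \<noteq> 0" using assms(1) by (auto simp: mk_self)
  moreover have "\<not> snd X < 0"
  proof
    assume "snd X < 0"
    hence "- X \<in> future" using assms(1) by (simp add: future_def mk_linear)
    hence "0 < mk (- X) Y" using mk_future_causal_pos assms by blast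
    thus False using assms(2) by (simp add: mk_linear)
  qed
  ultimately show ?thesis using assms(1) by (simp add: future_def)
qed

lemma hv_future: "norm x < 1 \<Longrightarrow> hv x \<in> future"
  using one_minus_inner_pos[of x] by (simp add: future_def mk_hv)

lemma mk_nondegenerate: assumes "\<And>Y. mk X Y = 0" shows "X = 0"
proof -
  have "mk X (- fst X, snd X) = (norm (fst X))\<^sup>2 + (snd X)\<^sup>2" by (simp add: mk_def dot_square_norm power2_eq_square)
  hence "(norm (fst X))\<^sup>2 + (snd X)\<^sup>2 = 0" using assms by metis
  hence "fst X = 0" "snd X = 0" by (simp_all add: sum_power2_eq_zero_iff)
  thus ?thesis by (simp add: prod_eq_iff)
qed

text \<open>One null ray going to a future null ray fixes the time orientation. Then \<Lambda>,
  projected back to the ball, preserves \<open>hdist\<close>, and it carries hull to hull since it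
  carries the cone over \<open>V\<close> to that over \<open>V'\<close>.\<close>

lemma lorentz_congruent:
  fixes \<Lambda> :: "mink \<Rightarrow> mink"
  assumes lin: "linear \<Lambda>" and mkp: "\<And>X Y. mk (\<Lambda> X) (\<Lambda> Y) = mk X Y"
    and V: "finite V" "V \<noteq> {}" "V \<subseteq> sphere 0 1" and V': "V' \<subseteq> sphere 0 1"
    and \<sigma>: "bij_betw \<sigma> V V'" and c: "\<And>v. v \<in> V \<Longrightarrow> 0 < c v" and \<Lambda>v: "\<And>v. v \<in> V \<Longrightarrow> \<Lambda> (hv v) = c v *\<^sub>R hv (\<sigma> v)"
  shows "congruent_bodies (ideal_hull V) (ideal_hull V')"
proof -
  interpret linear \<Lambda> by fact
  have inj: "inj \<Lambda>"
  proof (rule injI)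
    fix X Y assume eq: "\<Lambda> X = \<Lambda> Y"
    have "mk (X - Y) Z = 0" for Z
    proof -
      have "mk (X - Y) Z = mk (\<Lambda> (X - Y)) (\<Lambda> Z)" using mkp by simp
      also have "\<dots> = 0" by (simp add: diff eq mk_linear)
      finally show ?thesis .
    qed
    thus "X = Y" using mk_nondegenerate[of "X - Y"] by simp
  qed
  have surj: "surj \<Lambda>" using linear_injective_imp_surjective[OF lin inj refl] .
  have fV': "finite V'" using \<sigma> V bij_betw_finite by blast
  obtain v where v: "v \<in> V" using V by blast
  have nv: "norm v = 1" "norm (\<sigma> v) = 1" "\<sigma> v \<in> V'" using v V V' \<sigma> by (auto simp: bij_betw_def)
  have fut: "\<Lambda> X \<in> future \<longleftrightarrow> X \<in> future" for X
  proof
    assume X: "X \<in> future"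
    have "0 < mk X (hv v)" using mk_future_causal_pos[OF X, of "hv v"] nv by (simp add: mk_hv_self_sphere)
    hence "0 < c v * mk (\<Lambda> X) (hv (\<sigma> v))" using mkp[of X "hv v"] by (simp add: \<Lambda>v[OF v] mk_linear)
    hence "0 < mk (\<Lambda> X) (hv (\<sigma> v))" using c[OF v] by (simp add: zero_less_mult_iff)
    thus "\<Lambda> X \<in> future"
      using snd_pos_of_mk[of "\<Lambda> X" "hv (\<sigma> v)"] X nv mkp by (simp add: mk_hv_self_sphere future_def)
  next
    assume X: "\<Lambda> X \<in> future"
    have "0 < mk (\<Lambda> X) (\<Lambda> (hv v))" unfolding \<Lambda>v[OF v]
      using mk_future_causal_pos[OF X, of "hv (\<sigma> v)"] nv c[OF v] by (simp add: mk_hv_self_sphere mk_linear)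
    thus "X \<in> future"
      using snd_pos_of_mk[of X "hv v"] X nv mkp by (simp add: mk_hv_self_sphere future_def)
  qed
  define f where "f x = kpos (\<Lambda> (hv x))" for x
  have fb: "norm (f x) < 1" if "norm x < 1" for x unfolding f_def using norm_kpos fut hv_future[OF that] by blast
  have iso: "hdist (f x) (f y) = hdist x y" if xy: "norm x < 1" "norm y < 1" for x y
  proof -
    note h = hv_future[OF xy(1)] hv_future[OF xy(2)]
    have k: "kpos (hv z) = z" for z :: "real^3" by (simp add: kpos_def)
    have "cosh (hdist (f x) (f y)) = mk (unitv (\<Lambda> (hv x))) (unitv (\<Lambda> (hv y)))"
      using cosh_hyd[of "\<Lambda> (hv x)" "\<Lambda> (hv y)"] fut h by (simp add: hyd_def f_def)
    also have "\<dots> = mk (unitv (hv x)) (unitv (hv y))" by (simp add: unitv_def mk_linear mkp)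
    also have "\<dots> = cosh (hdist x y)" using cosh_hyd[OF h] by (simp add: hyd_def k)
    finally have "cosh (hdist (f x) (f y)) = cosh (hdist x y)" .
    moreover have "0 \<le> hdist (f x) (f y)" "0 \<le> hdist x y"
      using hdist_nonneg[of "f x" "f y" "f x"] hdist_nonneg[of x y x] xy fb[OF xy(1)] fb[OF xy(2)] by simp_all
    ultimately show ?thesis using cosh_eq_real_nonneg by blast
  qed
  have onto: "\<exists>x. norm x < 1 \<and> f x = z" if z: "norm z < 1" for z
  proof -
    obtain X where X: "\<Lambda> X = hv z" using surj by (metis surjD)
    have Xf: "X \<in> future" using fut[of X] X hv_future[OF z] by simp
    hence s: "0 < snd X" by (simp add: future_def)
    have "hv (kpos X) = (1 / snd X) *\<^sub>R X" using s by (simp add: kpos_def hv_def prod_eq_iff divide_inverse_commute)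
    hence "\<Lambda> (hv (kpos X)) = (1 / snd X) *\<^sub>R hv z" by (simp add: scale X)
    moreover from this have "f (kpos X) = z" using s by (simp add: f_def kpos_scale) (simp add: kpos_def)
    ultimately show ?thesis using norm_kpos[OF Xf] s by (intro exI[of _ "kpos X"]) auto
  qed
  have "isometry_onto (ball 0 1) hdist (ball 0 1) hdist f"
    unfolding isometry_onto_def bij_betw_def
  proof (intro conjI ballI)
    show "inj_on f (ball 0 1)"
    proof (rule inj_onI)
      fix x y assume xy: "x \<in> ball 0 1" "y \<in> ball 0 1" "f x = f y"
      hence "hdist x y = hdist (f y) (f y)" using iso[of x y] by simp
      also have "\<dots> = 0" using hdist_eq_0[of "f y" "f y" "f y"] fb[of y] xy by simp
      finally show "x = y" using hdist_eq_0[of x y x] xy by simp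
    qed
    show "f ` ball 0 1 = ball 0 1"
    proof (intro set_eqI iffI)
      fix z :: "real^3" assume "z \<in> ball 0 1"
      hence "norm z < 1" by simp
      then obtain x where "norm x < 1" "f x = z" using onto by blast
      thus "z \<in> f ` ball 0 1" by (intro image_eqI[of z f x]) simp_all
    next
      fix z assume "z \<in> f ` ball 0 1"
      then obtain x where "norm x < 1" "z = f x" by auto
      thus "z \<in> ball 0 1" using fb by simp
    qed
  qed (simp add: iso)
  moreover have hull: "f x \<in> convex hull V' \<longleftrightarrow> x \<in> convex hull V" if x: "norm x < 1" for x
  proof -
    have "f x \<in> convex hull V' \<longleftrightarrow> \<Lambda> (hv x) \<in> cone_on V'"
    proof -
      have "\<Lambda> (hv x) \<in> future" using fut hv_future[OF x] by blast
      hence "0 < snd (\<Lambda> (hv x))" by (simp add: future_def)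
      from cone_on_normalize[OF this fV'] show ?thesis by (simp add: f_def kpos_def)
    qed
    also have "\<dots> \<longleftrightarrow> hv x \<in> cone_on V"
    proof
      assume "\<Lambda> (hv x) \<in> cone_on V'"
      then obtain t where t: "\<And>v. v \<in> V' \<Longrightarrow> 0 \<le> t v" "\<Lambda> (hv x) = (\<Sum>v\<in>V'. t v *\<^sub>R hv v)" using cone_onE by metis
      have "\<Lambda> (hv x) = (\<Sum>v\<in>V. t (\<sigma> v) *\<^sub>R hv (\<sigma> v))" unfolding t(2) by (rule sum.reindex_bij_betw[OF \<sigma>, symmetric])
      also have "\<dots> = (\<Sum>v\<in>V. (t (\<sigma> v) / c v) *\<^sub>R \<Lambda> (hv v))"
      proof (rule sum.cong[OF refl])
        fix v assume v: "v \<in> V"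
        show "t (\<sigma> v) *\<^sub>R hv (\<sigma> v) = (t (\<sigma> v) / c v) *\<^sub>R \<Lambda> (hv v)" unfolding \<Lambda>v[OF v] using c[OF v] by simp
      qed
      also have "\<dots> = \<Lambda> (\<Sum>v\<in>V. (t (\<sigma> v) / c v) *\<^sub>R hv v)" by (simp add: sum scale)
      finally have e: "hv x = (\<Sum>v\<in>V. (t (\<sigma> v) / c v) *\<^sub>R hv v)" using inj by (simp add: inj_eq)
      show "hv x \<in> cone_on V" unfolding e
        using t(1) c \<sigma> by (intro cone_onI divide_nonneg_pos) (auto simp: bij_betw_def)
    next
      assume "hv x \<in> cone_on V"
      then obtain t where t: "\<And>v. v \<in> V \<Longrightarrow> 0 \<le> t v" "hv x = (\<Sum>v\<in>V. t v *\<^sub>R hv v)" using cone_onE by metis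
      have "\<Lambda> (hv x) = (\<Sum>v\<in>V. t v *\<^sub>R \<Lambda> (hv v))" unfolding t(2) by (simp add: sum scale)
      also have "\<dots> \<in> cone_on V'"
      proof (rule cone_on_sum)
        fix v assume v: "v \<in> V"
        hence "\<sigma> v \<in> V'" using \<sigma> by (auto simp: bij_betw_def)
        thus "t v *\<^sub>R \<Lambda> (hv v) \<in> cone_on V'" unfolding \<Lambda>v[OF v]
          using t(1)[OF v] c[OF v] fV' by (intro cone_on_scale cone_on_hv) auto
      qed
      finally show "\<Lambda> (hv x) \<in> cone_on V'" .
    qed
    also have "\<dots> \<longleftrightarrow> x \<in> convex hull V" by (rule hv_cone_on_iff[OF V(1)])
    finally show ?thesis .
  qed
  moreover have "f ` ideal_hull V = ideal_hull V'"
  proof (intro set_eqI iffI)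
    fix z assume "z \<in> f ` ideal_hull V"
    then obtain x where "norm x < 1" "x \<in> convex hull V" "z = f x" by (auto simp: ideal_hull_def)
    thus "z \<in> ideal_hull V'" using hull fb by (simp add: ideal_hull_def)
  next
    fix z assume z: "z \<in> ideal_hull V'"
    hence "norm z < 1" by (simp add: ideal_hull_def)
    then obtain x where x: "norm x < 1" "f x = z" using onto by blast
    hence "x \<in> ideal_hull V" using z hull[OF x(1)] by (simp add: ideal_hull_def)
    thus "z \<in> f ` ideal_hull V" using x by blast
  qed
  ultimately show ?thesis unfolding congruent_bodies_def by blast
qed

text \<open>Division by \<open>z w\<close> and \<open>z' w\<close> turns the distinguished vectors
  into 1. Then the real parts agree, and so do all products of imaginary parts; hence the imaginary
  parts agree up to one common sign. The sign -1 is the orientation-reversing case and is realized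
  by \<open>cnj\<close>.\<close>

lemma planar_gram_congruent:
  fixes z z' :: "'b \<Rightarrow> complex"
  assumes w: "w \<in> V" "z w \<noteq> 0" and g: "\<And>u s. u \<in> V \<Longrightarrow> s \<in> V \<Longrightarrow> z u \<bullet> z s = z' u \<bullet> z' s"
  obtains R where "linear R" "\<And>a b. R a \<bullet> R b = a \<bullet> b" "\<And>u. u \<in> V \<Longrightarrow> R (z u) = z' u"
proof -
  define p p' where "p u = z u / z w" and "p' u = z' u / z' w" for u
  have nw: "norm (z' w) = norm (z w)" using g[OF w(1) w(1)] by (simp add: norm_eq_sqrt_inner)
  hence w': "z' w \<noteq> 0" using w by auto
  have nz: "z u = z w * p u" "z' u = z' w * p' u" for u using w w' by (auto simp: p_def p'_def)
  have inner_mult: "(a * b) \<bullet> (a * c) = (norm a)\<^sup>2 * (b \<bullet> c)" for a b c :: complex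
    by (simp add: inner_complex_def cmod_power2) (simp add: power2_eq_square algebra_simps)
  have pp: "p u \<bullet> p s = p' u \<bullet> p' s" if "u \<in> V" "s \<in> V" for u s
  proof -
    have "(norm (z w))\<^sup>2 * (p u \<bullet> p s) = (norm (z' w))\<^sup>2 * (p' u \<bullet> p' s)"
      using g[OF that] nz[of u] nz[of s] inner_mult by metis
    thus ?thesis using w unfolding nw by simp
  qed
  have pw: "p w = 1" "p' w = 1" using w w' by (auto simp: p_def p'_def)
  have re: "Re (p u) = Re (p' u)" if "u \<in> V" for u
    using pp[OF that w(1)] pw by (simp add: inner_complex_def)
  have im: "Im (p u) * Im (p s) = Im (p' u) * Im (p' s)" if "u \<in> V" "s \<in> V" for u s
    using pp[OF that] re[OF that(1)] re[OF that(2)] by (simp add: inner_complex_def)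
  have "\<exists>h. linear h \<and> (\<forall>a b. h a \<bullet> h b = a \<bullet> b) \<and> (\<forall>u\<in>V. h (p u) = p' u)"
  proof (cases "\<forall>u\<in>V. Im (p u) = Im (p' u)")
    case True
    thus ?thesis using re by (intro exI[of _ id]) (auto simp: complex_eq_iff linear_id)
  next
    case False
    then obtain s where s: "s \<in> V" "Im (p s) \<noteq> Im (p' s)" by blast
    have "Im (p s) = - Im (p' s)" using im[OF s(1) s(1)] s(2) by (auto simp: square_eq_iff)
    hence s0: "Im (p' s) \<noteq> 0" "Im (p s) = - Im (p' s)" using s(2) by auto
    have "Im (p u) = - Im (p' u)" if "u \<in> V" for u
    proof -
      have "(- Im (p u)) * Im (p' s) = Im (p' u) * Im (p' s)" using im[OF that s(1)] s0 by simp
      hence "- Im (p u) = Im (p' u)" using s0(1) mult_right_cancel by blast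
      thus ?thesis by simp
    qed
    thus ?thesis using re
      by (intro exI[of _ cnj]) (auto simp: complex_eq_iff inner_complex_def intro: linearI)
  qed
  then obtain h where h: "linear h" "\<And>a b. h a \<bullet> h b = a \<bullet> b" "\<And>u. u \<in> V \<Longrightarrow> h (p u) = p' u" by blast
  define R where "R a = z' w * h (inverse (z w) * a)" for a
  show thesis
  proof (rule that[of R])
    show "linear R" unfolding R_def
      by (rule linearI) (simp_all add: distrib_left linear_add[OF h(1)] linear_scale[OF h(1)])
    show "R a \<bullet> R b = a \<bullet> b" for a b
      unfolding R_def inner_mult h(2) nw using w by (simp add: norm_inverse power_inverse)
    show "R (z u) = z' u" if "u \<in> V" for u
      using nz(2)[of u] h(3)[OF that] by (simp add: R_def p_def divide_inverse mult.commute)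
  qed
qed

text \<open>In null frames over \<open>v\<close>, \<open>q\<close> and over their images, the Gram
  matrix determines the null coordinates of each vertex and the inner products of the plane
  coordinates. A plane isometry matches the latter, and with the frames it makes up a Lorentz
  map.\<close>

lemma gram_imp_congruent:
  fixes V V' :: "(real^3) set"
  assumes V: "finite V" "3 \<le> card V" "V \<subseteq> sphere 0 1" and V': "V' \<subseteq> sphere 0 1"
    and \<sigma>: "bij_betw \<sigma> V V'" and c: "\<And>v. v \<in> V \<Longrightarrow> 0 < c v"
    and gram: "\<And>v u. v \<in> V \<Longrightarrow> u \<in> V \<Longrightarrow> mk (hv v) (hv u) = c v * (c u * mk (hv (\<sigma> v)) (hv (\<sigma> u)))"
  shows "congruent_bodies (ideal_hull V) (ideal_hull V')"
proof -
  have nV: "norm v = 1" if "v \<in> V" for v using that V by auto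
  have nV': "norm (\<sigma> v) = 1" if "v \<in> V" for v using that V' \<sigma> by (auto simp: bij_betw_def)
  obtain v q w where vqw: "v \<in> V" "q \<in> V" "w \<in> V" "v \<noteq> q" "w \<noteq> v" "w \<noteq> q"
  proof -
    have ne: "\<exists>x. x \<in> A" if "1 \<le> card A" for A :: "(real^3) set"
      using that by (cases "A = {}") auto
    have "\<exists>v. v \<in> V" using ne[of V] V by simp
    then obtain v where v: "v \<in> V" by blast
    have "2 \<le> card (V - {v})" using v V by simp
    hence "\<exists>q. q \<in> V - {v}" using ne[OF order_trans[OF one_le_numeral]] by blast
    then obtain q where q: "q \<in> V - {v}" by blast
    have "1 \<le> card (V - {v} - {q})" using v q V by simp
    hence "\<exists>w. w \<in> V - {v} - {q}" using ne by blast
    then obtain w where "w \<in> V - {v} - {q}" by blast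
    thus thesis using that v q by blast
  qed
  define X where "X u = hv u" for u :: "real^3"
  define X' where "X' u = c u *\<^sub>R hv (\<sigma> u)" for u
  have XX: "mk (X u) (X s) = mk (X' u) (X' s)" if "u \<in> V" "s \<in> V" for u s
    unfolding X_def X'_def using gram[OF that] by (simp add: mk_linear)
  have \<sigma>ne: "\<sigma> v \<noteq> \<sigma> q" using \<sigma> vqw by (auto simp: bij_betw_def inj_on_def)
  define n where "n = mk (X v) (X q)"
  have n: "0 < n" "mk (X' v) (X' q) = n" 
    using mk_hv_sphere_pos[OF nV[OF vqw(1)] nV[OF vqw(2)] vqw(4)] XX[OF vqw(1,2)] unfolding n_def X_def by simp_all
  obtain B1 B2 where B: "mk B1 B1 = - 1" "mk B2 B2 = - 1" "mk B1 B2 = 0"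
    "\<And>Y. Y = (mk Y (hv q) / mk (hv v) (hv q)) *\<^sub>R hv v + (mk Y (hv v) / mk (hv v) (hv q)) *\<^sub>R hv q - mk Y B1 *\<^sub>R B1 - mk Y B2 *\<^sub>R B2"
    using null_frame[OF nV[OF vqw(1)] nV[OF vqw(2)] vqw(4)] by blast
  obtain B1' B2' where B': "mk B1' B1' = - 1" "mk B2' B2' = - 1" "mk B1' B2' = 0"
    "\<And>Y. Y = (mk Y (hv (\<sigma> q)) / mk (hv (\<sigma> v)) (hv (\<sigma> q))) *\<^sub>R hv (\<sigma> v)
       + (mk Y (hv (\<sigma> v)) / mk (hv (\<sigma> v)) (hv (\<sigma> q))) *\<^sub>R hv (\<sigma> q) - mk Y B1' *\<^sub>R B1' - mk Y B2' *\<^sub>R B2'"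
    using null_frame[OF nV'[OF vqw(1)] nV'[OF vqw(2)] \<sigma>ne] by blast
  define z where "z Y = Complex (mk Y B1) (mk Y B2)" for Y
  define z' where "z' Y = Complex (mk Y B1') (mk Y B2')" for Y
  have ex: "Y = (mk Y (X q) / n) *\<^sub>R X v + (mk Y (X v) / n) *\<^sub>R X q - Re (z Y) *\<^sub>R B1 - Im (z Y) *\<^sub>R B2" for Y
    using B(4)[of Y] by (simp add: X_def n_def z_def)
  have ex': "Y = (mk Y (X' q) / n) *\<^sub>R X' v + (mk Y (X' v) / n) *\<^sub>R X' q - Re (z' Y) *\<^sub>R B1' - Im (z' Y) *\<^sub>R B2'" for Y
  proof -
    have "n = c v * (c q * mk (hv (\<sigma> v)) (hv (\<sigma> q)))" using gram vqw by (simp add: n_def X_def)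
    hence "(mk Y (X' q) / n) *\<^sub>R X' v = (mk Y (hv (\<sigma> q)) / mk (hv (\<sigma> v)) (hv (\<sigma> q))) *\<^sub>R hv (\<sigma> v)"
      "(mk Y (X' v) / n) *\<^sub>R X' q = (mk Y (hv (\<sigma> v)) / mk (hv (\<sigma> v)) (hv (\<sigma> q))) *\<^sub>R hv (\<sigma> q)"
      using c[OF vqw(1)] c[OF vqw(2)] by (simp_all add: X'_def mk_linear)
    thus ?thesis using B'(4)[of Y] by (simp add: z'_def)
  qed
  have mke: "mk Y Z = (mk Y (X q) * mk Z (X v) + mk Y (X v) * mk Z (X q)) / n - z Y \<bullet> z Z" for Y Z
  proof -
    have "mk Y Z = mk ((mk Y (X q) / n) *\<^sub>R X v + (mk Y (X v) / n) *\<^sub>R X q - Re (z Y) *\<^sub>R B1 - Im (z Y) *\<^sub>R B2) Z"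
      using ex[of Y] by (rule arg_cong)
    also have "\<dots> = (mk Y (X q) * mk Z (X v) + mk Y (X v) * mk Z (X q)) / n - z Y \<bullet> z Z"
      by (simp add: mk_linear inner_complex_def z_def mk_commute[of _ Z] add_divide_distrib)
    finally show ?thesis .
  qed
  have mke': "mk Y Z = (mk Y (X' q) * mk Z (X' v) + mk Y (X' v) * mk Z (X' q)) / n - z' Y \<bullet> z' Z" for Y Z
  proof -
    have "mk Y Z = mk ((mk Y (X' q) / n) *\<^sub>R X' v + (mk Y (X' v) / n) *\<^sub>R X' q - Re (z' Y) *\<^sub>R B1' - Im (z' Y) *\<^sub>R B2') Z"
      using ex'[of Y] by (rule arg_cong)
    also have "\<dots> = (mk Y (X' q) * mk Z (X' v) + mk Y (X' v) * mk Z (X' q)) / n - z' Y \<bullet> z' Z"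
      by (simp add: mk_linear inner_complex_def z'_def mk_commute[of _ Z] add_divide_distrib)
    finally show ?thesis .
  qed
  have zg: "z (X u) \<bullet> z (X s) = z' (X' u) \<bullet> z' (X' s)" if "u \<in> V" "s \<in> V" for u s
    using mke[of "X u" "X s"] mke'[of "X' u" "X' s"] XX[OF that] XX[OF that(1) vqw(1)] XX[OF that(1) vqw(2)]
      XX[OF that(2) vqw(1)] XX[OF that(2) vqw(2)] by simp
  \<comment> \<open>A null vector in the span of \<open>X v\<close> and \<open>X q\<close> is a
    multiple of one of them, so a third vertex has nonzero plane coordinates; this is where three
    vertices are needed.\<close>
  have zw: "z (X w) \<noteq> 0"
  proof
    assume "z (X w) = 0"
    hence "mk (X w) (X w) = 2 * (mk (X w) (X q) * mk (X w) (X v)) / n" using mke[of "X w" "X w"] by (simp add: mult.commute)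
    moreover have "mk (X w) (X w) = 0" using nV vqw by (simp add: X_def mk_hv_self_sphere)
    moreover have "0 < mk (X w) (X q)" "0 < mk (X w) (X v)" 
      using mk_hv_sphere_pos[OF nV nV] vqw unfolding X_def by blast+
    ultimately show False using n by simp
  qed
  obtain R where R: "linear R" "\<And>a b. R a \<bullet> R b = a \<bullet> b" "\<And>u. u \<in> V \<Longrightarrow> R (z (X u)) = z' (X' u)"
    using planar_gram_congruent[of w V "\<lambda>u. z (X u)" "\<lambda>u. z' (X' u)"] vqw zw zg by blast
  define \<Lambda> where "\<Lambda> Y = (mk Y (X q) / n) *\<^sub>R X' v + (mk Y (X v) / n) *\<^sub>R X' q - Re (R (z Y)) *\<^sub>R B1' - Im (R (z Y)) *\<^sub>R B2'" for Y
  have zlin: "z (Y + Z) = z Y + z Z" "z (a *\<^sub>R Y) = a *\<^sub>R z Y" for Y Z a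
    by (simp_all add: z_def mk_linear complex_eq_iff)
  have lin: "linear \<Lambda>" unfolding \<Lambda>_def
    by (rule linearI) (simp_all add: zlin linear_add[OF R(1)] linear_scale[OF R(1)] mk_linear add_divide_distrib scaleR_add_left algebra_simps)
  have O': "mk (X' v) (X' v) = 0" "mk (X' q) (X' q) = 0" "mk (X' v) B1' = 0" "mk (X' v) B2' = 0" "mk (X' q) B1' = 0" "mk (X' q) B2' = 0"
  proof -
    show O1: "mk (X' v) (X' v) = 0" "mk (X' q) (X' q) = 0" using nV' vqw by (simp_all add: X'_def mk_linear mk_hv_self_sphere)
    have "z' (X' v) \<bullet> z' (X' v) = 0" "z' (X' q) \<bullet> z' (X' q) = 0"
      using mke'[of "X' v" "X' v"] mke'[of "X' q" "X' q"] O1 by simp_all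
    thus "mk (X' v) B1' = 0" "mk (X' v) B2' = 0" "mk (X' q) B1' = 0" "mk (X' q) B2' = 0"
      by (simp_all add: z'_def complex_eq_iff)
  qed
  have co: "mk (\<Lambda> Y) (X' v) = mk Y (X v)" "mk (\<Lambda> Y) (X' q) = mk Y (X q)" "z' (\<Lambda> Y) = R (z Y)" for Y
    using n O' by (simp_all add: \<Lambda>_def z'_def mk_linear mk_commute[of "X' q" "X' v"] mk_commute[of B1' "X' _"] mk_commute[of B2' "X' _"] B' mk_commute[of B2' B1'] complex_eq_iff)
  have mkp: "mk (\<Lambda> Y) (\<Lambda> Z) = mk Y Z" for Y Z
    unfolding mke'[of "\<Lambda> Y" "\<Lambda> Z"] mke[of Y Z] co R(2) ..
  have \<Lambda>v: "\<Lambda> (hv u) = c u *\<^sub>R hv (\<sigma> u)" if "u \<in> V" for u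
  proof -
    have "\<Lambda> (X u) = (mk (X' u) (X' q) / n) *\<^sub>R X' v + (mk (X' u) (X' v) / n) *\<^sub>R X' q - Re (z' (X' u)) *\<^sub>R B1' - Im (z' (X' u)) *\<^sub>R B2'"
      unfolding \<Lambda>_def R(3)[OF that] XX[OF that vqw(1)] XX[OF that vqw(2)] ..
    also have "\<dots> = X' u" by (rule ex'[symmetric])
    finally have "\<Lambda> (X u) = X' u" .
    thus ?thesis by (simp add: X_def X'_def)
  qed
  show ?thesis
    by (rule lorentz_congruent[OF lin mkp V(1) _ V(3) V' \<sigma> c \<Lambda>v]) (use vqw in auto)
qed

subsection \<open>Boundary surfaces of ideal polyhedra\<close>

lemma hdist_commute: "hdist x y = hdist y x"
  by (simp add: hdist_def inner_commute mult.commute)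

text \<open>The squared hyperbolic sine is an explicit quotient; omitting the square
  \<open>(x \<bullet> (x - y))\<^sup>2\<close> and the factor \<open>1 - y \<bullet> y\<close>
  leaves the Euclidean distance. So sets that are apart in the Euclidean sense are apart in the
  hyperbolic sense.\<close>

lemma dist_le_sinh_hdist:
  fixes x y :: "'a::euclidean_space"
  assumes "norm x < 1" "norm y < 1"
  shows "norm (x - y) \<le> sinh (hdist x y)"
proof -
  have p: "0 < 1 - x \<bullet> x" "0 < 1 - y \<bullet> y" using one_minus_inner_pos assms by auto
  have h0: "0 \<le> hdist x y" using hdist_nonneg[of x y x] assms by simp
  have c: "(cosh (hdist x y))\<^sup>2 = (1 - x \<bullet> y)\<^sup>2 / ((1 - x \<bullet> x) * (1 - y \<bullet> y))"
  proof -
    have "cosh (hdist x y) = (1 - x \<bullet> y) / sqrt ((1 - x \<bullet> x) * (1 - y \<bullet> y))"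
      unfolding mk_ulift[OF assms, symmetric] using p by (simp add: ulift_def mk_linear mk_hv real_sqrt_mult)
    thus ?thesis using p by (simp add: power_divide)
  qed
  have "(sinh (hdist x y))\<^sup>2 = ((1 - x \<bullet> y)\<^sup>2 - (1 - x \<bullet> x) * (1 - y \<bullet> y)) / ((1 - x \<bullet> x) * (1 - y \<bullet> y))"
    using c p by (simp add: sinh_square_eq diff_divide_distrib)
  also have "(1 - x \<bullet> y)\<^sup>2 - (1 - x \<bullet> x) * (1 - y \<bullet> y) = (1 - x \<bullet> x) * (norm (x - y))\<^sup>2 + (x \<bullet> (x - y))\<^sup>2"
    by (simp add: power2_norm_eq_inner inner_diff_left inner_diff_right inner_commute)
      (simp add: power2_eq_square algebra_simps)
  finally have s: "(sinh (hdist x y))\<^sup>2 = ((1 - x \<bullet> x) * (norm (x - y))\<^sup>2 + (x \<bullet> (x - y))\<^sup>2) / ((1 - x \<bullet> x) * (1 - y \<bullet> y))" .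
  have "(norm (x - y))\<^sup>2 * ((1 - x \<bullet> x) * (1 - y \<bullet> y)) \<le> (norm (x - y))\<^sup>2 * ((1 - x \<bullet> x) * 1)"
    using p by (intro mult_left_mono) auto
  also have "\<dots> \<le> (1 - x \<bullet> x) * (norm (x - y))\<^sup>2 + (x \<bullet> (x - y))\<^sup>2" by (simp add: mult.commute)
  finally have "(norm (x - y))\<^sup>2 \<le> (sinh (hdist x y))\<^sup>2" unfolding s using p by (simp add: pos_le_divide_eq)
  moreover have "0 \<le> sinh (hdist x y)" using h0 by simp
  ultimately show ?thesis by (rule power2_le_imp_le)
qed

lemma hdist_ge_of_dist:
  fixes x :: "'a::euclidean_space"
  assumes "norm x < 1" "0 < e"
  shows "\<exists>e'>0. \<forall>y. norm y < 1 \<longrightarrow> e \<le> norm (x - y) \<longrightarrow> e' \<le> hdist x y"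
proof (intro exI[of _ "arsinh e"] conjI allI impI)
  show "0 < arsinh e" using assms(2) arsinh_real_strict_mono[of 0 e] by simp
  fix y assume y: "norm y < 1" "e \<le> norm (x - y)"
  have "e \<le> sinh (hdist x y)" using dist_le_sinh_hdist[OF assms(1) y(1)] y(2) by linarith
  hence "sinh (arsinh e) \<le> sinh (hdist x y)" by simp
  thus "arsinh e \<le> hdist x y" by (simp only: sinh_real_le_iff)
qed

lemma continuous_on_ulift: "S \<subseteq> ball 0 1 \<Longrightarrow> continuous_on S (ulift :: 'a::euclidean_space \<Rightarrow> _)"
  unfolding ulift_def hv_def
  by (intro continuous_intros) (use one_minus_inner_pos in \<open>force simp: subset_iff\<close>)+

lemma continuous_on_hdist:
  fixes S :: "'a::euclidean_space set"
  assumes "x \<in> ball 0 1" "S \<subseteq> ball 0 1" shows "continuous_on S (hdist x)"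
proof -
  define m where "m y = mk (ulift x) (ulift y)" for y
  have m1: "1 \<le> m y" if "y \<in> S" for y
    unfolding m_def using assms that by (intro mk_hyp_ge_1 ulift_hyp) auto
  have cm: "continuous_on S m" unfolding m_def by (intro continuous_intros continuous_on_ulift assms)
  have "0 < m y + sqrt ((m y)\<^sup>2 - 1)" if "y \<in> S" for y
    using m1[OF that] by (intro add_pos_nonneg) auto
  hence "continuous_on S (\<lambda>y. ln (m y + sqrt ((m y)\<^sup>2 - 1)))"
    by (intro continuous_intros cm) force
  moreover have "ln (m y + sqrt ((m y)\<^sup>2 - 1)) = hdist x y" if y: "y \<in> S" for y
  proof -
    have n: "norm x < 1" "norm y < 1" using assms y by auto
    have "ln (m y + sqrt ((m y)\<^sup>2 - 1)) = arcosh (m y)" using arcosh_real_def[OF m1[OF y]] by simp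
    also have "\<dots> = hdist x y" unfolding m_def mk_ulift[OF n]
      using hdist_nonneg[of x y x] n by (intro arcosh_cosh_real) auto
    finally show ?thesis .
  qed
  ultimately show ?thesis using continuous_on_cong[of S S] by (metis (no_types, lifting))
qed

text \<open>The hyperbolic cosine of the distance is at least
  \<open>(1 - norm x) / sqrt (1 - w \<bullet> w)\<close>, which is unbounded near the
  sphere.\<close>

lemma hdist_proper:
  fixes x :: "'a::euclidean_space"
  assumes x: "norm x < 1"
  shows "\<exists>r<1. \<forall>w. norm w < 1 \<longrightarrow> r < norm w \<longrightarrow> D < hdist x w"
proof -
  define k where "k = 1 - norm x"
  define c where "c = cosh (\<bar>D\<bar> + 1)"
  have k: "0 < k" "k \<le> 1" using x by (auto simp: k_def)
  have c: "1 \<le> c" unfolding c_def by (rule cosh_real_ge_1)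
  define r where "r = sqrt (1 - (k / c)\<^sup>2)"
  have kc: "0 < k / c" "k / c \<le> 1" using k c by auto
  have kc2: "0 < (k / c)\<^sup>2" "(k / c)\<^sup>2 \<le> 1" using kc power_le_one[of "k / c" 2] by auto
  have r: "r < 1" "r\<^sup>2 = 1 - (k / c)\<^sup>2" "0 \<le> r" using kc2 by (auto simp: r_def real_sqrt_lt_1_iff)
  have "D < hdist x w" if w: "norm w < 1" "r < norm w" for w
  proof -
    have p: "0 < 1 - x \<bullet> x" "0 < 1 - w \<bullet> w" using one_minus_inner_pos x w by auto
    have "r\<^sup>2 < (norm w)\<^sup>2" using r w by (intro power_strict_mono) auto
    hence "1 - w \<bullet> w < (k / c)\<^sup>2" using r by (simp add: dot_square_norm)
    hence "sqrt (1 - w \<bullet> w) < sqrt ((k / c)\<^sup>2)" by (rule real_sqrt_less_mono)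
    also have "sqrt ((k / c)\<^sup>2) = k / c" using kc(1) by (simp only: real_sqrt_abs abs_of_pos)
    finally have s1: "sqrt (1 - w \<bullet> w) < k / c" .
    have "(1 - x \<bullet> x) * (1 - w \<bullet> w) \<le> 1 * (1 - w \<bullet> w)" using p by (intro mult_right_mono) auto
    hence "sqrt ((1 - x \<bullet> x) * (1 - w \<bullet> w)) \<le> sqrt (1 - w \<bullet> w)" by (intro real_sqrt_le_mono) simp
    with s1 have s: "sqrt ((1 - x \<bullet> x) * (1 - w \<bullet> w)) < k / c" by linarith
    have "x \<bullet> w \<le> norm x * norm w" by (rule norm_cauchy_schwarz)
    also have "\<dots> \<le> norm x * 1" using w by (intro mult_left_mono) auto
    finally have "k \<le> 1 - x \<bullet> w" by (simp add: k_def)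
    moreover have "c * sqrt ((1 - x \<bullet> x) * (1 - w \<bullet> w)) < k" using s c by (simp add: pos_less_divide_eq mult.commute)
    ultimately have "c < (1 - x \<bullet> w) / sqrt ((1 - x \<bullet> x) * (1 - w \<bullet> w))" using p by (simp add: pos_less_divide_eq)
    also have "\<dots> = cosh (hdist x w)"
      unfolding mk_ulift[OF x w(1), symmetric] using p by (simp add: ulift_def mk_linear mk_hv real_sqrt_mult)
    finally have "cosh (\<bar>D\<bar> + 1) < cosh (hdist x w)" by (simp add: c_def)
    hence "\<bar>D\<bar> + 1 < hdist x w" using hdist_nonneg[of x w x] x w by (simp add: cosh_real_nonneg_less_iff)
    thus ?thesis by linarith
  qed
  thus ?thesis using r by blast
qed

section \<open>The path metric of the boundary\<close>

lemma path_dist_ge_hdist: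
  assumes "x \<in> S" "y \<in> S" shows "ennreal (hdist x y) \<le> path_dist S hdist x y"
  unfolding path_dist_def
proof (rule INF_greatest)
  fix g :: "real \<Rightarrow> 'a" assume "g \<in> {g. continuous_map (top_of_set {0..1}) (Metric_space.mtopology S hdist) g \<and> g 0 = x \<and> g 1 = y}"
  hence g: "g 0 = x" "g 1 = y" by auto
  \<comment> \<open>Partitions are infinite monotone sequences; this one jumps from 0 to 1, so one
    summand compares the ends of the curve.\<close>
  define t where "t n = (if n = 0 then 0 else 1 :: real)" for n :: nat
  have "(\<Sum>i<1. ennreal (hdist (g (t i)) (g (t (Suc i))))) \<le> curve_length hdist g"
    unfolding curve_length_def by (rule SUP_upper2[of "(1, t)"]) (auto simp: t_def mono_def)
  thus "ennreal (hdist x y) \<le> curve_length hdist g" using g by (simp add: t_def)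
qed

text \<open>Along a chord distances are additive, so the sum over any partition telescopes.\<close>

lemma path_dist_segment:
  fixes S :: "'a::euclidean_space set"
  assumes S: "S \<subseteq> ball 0 1" and xy: "closed_segment x y \<subseteq> S"
  shows "path_dist S hdist x y = ennreal (hdist x y)"
proof (rule antisym)
  have xyS: "x \<in> S" "y \<in> S" using xy by auto
  show "ennreal (hdist x y) \<le> path_dist S hdist x y" using path_dist_ge_hdist xyS by blast
  interpret MS: Metric_space S hdist using Metric_space.subspace[OF Metric_space_hdist S] .
  define g where "g s = (1 - s) *\<^sub>R x + s *\<^sub>R y" for s
  have "g s \<in> closed_segment x y" if "0 \<le> s" "s \<le> 1" for s using that by (auto simp: g_def in_segment)
  hence gS: "g s \<in> S" if "0 \<le> s" "s \<le> 1" for s using xy that by blast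
  have gb: "g s \<in> ball 0 1" if "0 \<le> s" "s \<le> 1" for s using gS[OF that] S by blast
  have seg: "hdist (g a) (g b) + hdist (g b) (g c) = hdist (g a) (g c)"
    if "0 \<le> a" "a \<le> b" "b \<le> c" "c \<le> 1" for a b c
  proof (cases "a = c")
    case False
    define u where "u = (b - a) / (c - a)"
    have "g b = (1 - u) *\<^sub>R g a + u *\<^sub>R g c"
    proof -
      have "u * (c - a) = b - a" using False by (simp add: u_def)
      hence e: "(1 - u) * a + u * c = b" by (simp add: algebra_simps)
      have "(1 - u) *\<^sub>R g a + u *\<^sub>R g c = ((1 - u) * (1 - a) + u * (1 - c)) *\<^sub>R x + ((1 - u) * a + u * c) *\<^sub>R y"
        by (simp add: g_def scaleR_add_right scaleR_add_left)
      also have "(1 - u) * (1 - a) + u * (1 - c) = 1 - ((1 - u) * a + u * c)" by (simp add: algebra_simps)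
      finally show ?thesis unfolding e g_def by simp
    qed
    moreover have "0 \<le> u" "u \<le> 1" using that False by (auto simp: u_def divide_le_eq_1)
    ultimately have "g b \<in> closed_segment (g a) (g c)" by (auto simp: in_segment)
    thus ?thesis using hdist_between_iff[of "g a" "g c" "g b"] gb that by simp
  next
    case True
    hence "b = a" using that by simp
    thus ?thesis using True hdist_eq_0[of "g a" "g a" "g a"] gb[of a] that by simp
  qed
  have cont: "continuous_map (top_of_set {0..1}) MS.mtopology g"
    unfolding MS.continuous_map_to_metric
  proof (intro ballI allI impI)
    fix s \<epsilon> :: real assume "s \<in> topspace (top_of_set {0..1})" and \<epsilon>: "0 < \<epsilon>"
    hence s: "0 \<le> s" "s \<le> 1" by auto
    have "continuous_on {0..1} (\<lambda>u. hdist (g s) (g u))"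
    proof (rule continuous_on_compose2[OF continuous_on_hdist[OF gb[OF s], of "ball 0 1"]])
      show "continuous_on {0..1} g" unfolding g_def by (intro continuous_intros)
    qed (use gb in auto)
    hence "openin (top_of_set {0..1}) ({0..1} \<inter> (\<lambda>u. hdist (g s) (g u)) -` {..<\<epsilon>})"
      by (rule continuous_openin_preimage_gen) simp
    moreover have "hdist (g s) (g s) = 0" using hdist_eq_0[of "g s" "g s" "g s"] gb[OF s] by simp
    ultimately show "\<exists>U. openin (top_of_set {0..1}) U \<and> s \<in> U \<and> (\<forall>y\<in>U. g y \<in> MS.mball (g s) \<epsilon>)"
      using s \<epsilon> gS by (intro exI[of _ "{0..1} \<inter> (\<lambda>u. hdist (g s) (g u)) -` {..<\<epsilon>}"]) (auto simp: MS.in_mball)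
  qed
  have "path_dist S hdist x y \<le> curve_length hdist g"
    unfolding path_dist_def by (rule INF_lower) (use cont in \<open>simp add: g_def\<close>)
  also have "\<dots> \<le> ennreal (hdist x y)"
    unfolding curve_length_def
  proof (rule SUP_least)
    fix p :: "nat \<times> (nat \<Rightarrow> real)" assume p: "p \<in> {(n, t). mono t \<and> range t \<subseteq> {0..1}}"
    obtain n t where pt: "p = (n, t)" by (cases p)
    have t: "mono t" "range t \<subseteq> {0..1}" using p by (simp_all add: pt)
    have t01: "0 \<le> t i" "t i \<le> 1" for i using t(2) by (auto simp: subset_iff)
    have tm: "t i \<le> t j" if "i \<le> j" for i j using t(1) that by (simp add: monoD)
    have nn: "0 \<le> hdist (g a) (g b)" if "0 \<le> a" "a \<le> 1" "0 \<le> b" "b \<le> 1" for a b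
      using hdist_nonneg[of "g a" "g b" "g a"] gb that by blast
    have "(\<Sum>i<n. hdist (g (t i)) (g (t (Suc i)))) = hdist (g (t 0)) (g (t n))"
    proof (induction n)
      case 0
      show ?case using seg[of "t 0" "t 0" "t 0"] t01[of 0] by simp
    next
      case (Suc n)
      thus ?case using seg[of "t 0" "t n" "t (Suc n)"] t01 tm by simp
    qed
    also have "\<dots> \<le> hdist (g 0) (g 1)"
    proof -
      have "hdist (g 0) (g (t 0)) + hdist (g (t 0)) (g 1) = hdist (g 0) (g 1)"
        by (rule seg) (use t01 in auto)
      moreover have "hdist (g (t 0)) (g (t n)) + hdist (g (t n)) (g 1) = hdist (g (t 0)) (g 1)"
        by (rule seg) (use t01 tm in auto)
      moreover have "0 \<le> hdist (g 0) (g (t 0))" "0 \<le> hdist (g (t n)) (g 1)"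
        by (rule nn; use t01 in auto)+
      ultimately show ?thesis by linarith
    qed
    finally have "(\<Sum>i<n. hdist (g (t i)) (g (t (Suc i)))) \<le> hdist x y" by (simp add: g_def)
    thus "(case p of (n, t) \<Rightarrow> \<Sum>i<n. ennreal (hdist (g (t i)) (g (t (Suc i))))) \<le> ennreal (hdist x y)"
      unfolding pt using nn t01 by (simp add: sum_ennreal ennreal_leI)
  qed
  finally show "path_dist S hdist x y \<le> ennreal (hdist x y)" .
qed

text \<open>Finite path distances provide curves, as an infimum over no curves would be
  infinite.\<close>

lemma hyperbolic_surface_connected:
  assumes "hyperbolic_surface M d" shows "connected_space (Metric_space.mtopology M d)"
proof (rule path_connected_imp_connected_space)
  interpret Metric_space M d using assms by (simp add: hyperbolic_surface_def)
  show "path_connected_space (Metric_space.mtopology M d)"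
    unfolding path_connected_space_def
  proof (intro ballI)
    fix x y assume "x \<in> topspace mtopology" "y \<in> topspace mtopology"
    hence "ennreal (d x y) = path_dist M d x y" using assms by (simp add: hyperbolic_surface_def)
    hence nt: "path_dist M d x y \<noteq> top" by (metis ennreal_neq_top)
    thus "\<exists>g. pathin mtopology g \<and> g 0 = x \<and> g 1 = y" by (auto simp: path_dist_def pathin_def)
  qed
qed

section \<open>Faces of polytopes inscribed in the sphere\<close>

lemma sphere_collinear:
  fixes a b c :: "'a::euclidean_space"
  assumes "norm a = 1" "norm b = 1" "norm c = 1" "a \<noteq> b" "collinear {a, b, c}"
  shows "c = a \<or> c = b"
proof -
  have b: "z = x \<or> z = y" if "between (x, y) z" "norm x = 1" "norm y = 1" "norm z = 1" for x y z :: 'a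
  proof -
    have "z \<in> convex hull {x, y}" using that(1) by (simp add: between_mem_segment segment_convex_hull)
    thus ?thesis using sphere_hull_mem[of "{x, y}" z] that by auto
  qed
  have "between (b, c) a \<or> between (c, a) b \<or> between (a, b) c" using assms(5) collinear_between_cases by blast
  thus ?thesis using b[of b c a] b[of c a b] b[of a b c] assms by auto
qed

lemma face_hull_vertices:
  fixes V :: "'a::euclidean_space set"
  assumes "finite V" "F face_of convex hull V" shows "F = convex hull (V \<inter> F)"
proof
  obtain S where S: "S \<subseteq> V" "F = convex hull S"
    using face_of_convex_hull_subset[OF finite_imp_compact[OF assms(1)] assms(2)] by metis
  have "S \<subseteq> V \<inter> F" using S hull_subset[of S convex] by auto
  thus "F \<subseteq> convex hull (V \<inter> F)" unfolding S(2)[symmetric] using hull_mono[of S "V \<inter> F"] S by simp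
  show "convex hull (V \<inter> F) \<subseteq> F" using face_of_imp_convex[OF assms(2)] by (intro hull_minimal) auto
qed

lemma edge_face:
  fixes V :: "'a::euclidean_space set"
  assumes V: "finite V" "V \<subseteq> sphere 0 1" and E: "E face_of convex hull V" "aff_dim E \<le> 1" "E \<noteq> {}" "\<And>a. E \<noteq> {a}"
  obtains a b where "a \<noteq> b" "V \<inter> E = {a, b}" "E = closed_segment a b" 
proof -
  have EV: "E = convex hull (V \<inter> E)" using face_hull_vertices[OF V(1) E(1)] .
  have "V \<inter> E \<noteq> {}" using EV E(3) by auto
  then obtain a where a: "a \<in> V \<inter> E" by blast
  have "\<exists>b\<in>V \<inter> E. b \<noteq> a"
  proof (rule ccontr)
    assume "\<not> ?thesis"
    hence "V \<inter> E = {a}" using a by blast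
    thus False using EV E(4)[of a] by simp
  qed
  then obtain b where b: "b \<in> V \<inter> E" "b \<noteq> a" by blast
  have "V \<inter> E \<subseteq> {a, b}"
  proof
    fix c assume c: "c \<in> V \<inter> E"
    have "aff_dim {a, b, c} \<le> 1" using aff_dim_subset[of "{a, b, c}" E] E a b c by simp
    hence "collinear {a, b, c}" by (simp add: collinear_aff_dim)
    moreover have "norm a = 1" "norm b = 1" "norm c = 1" using a b c V(2) by auto
    ultimately show "c \<in> {a, b}" using sphere_collinear[of a b c] b(2) by blast
  qed
  hence "V \<inter> E = {a, b}" using a b by blast
  thus thesis using that[of a b] b EV by (simp add: segment_convex_hull)
qed

lemma edge_face_open:
  fixes V :: "'a::euclidean_space set"
  assumes V: "finite V" "V \<subseteq> sphere 0 1" and E: "E face_of convex hull V" "aff_dim E \<le> 1" and p: "p \<in> E" "norm p < 1"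
  obtains a b where "a \<noteq> b" "V \<inter> E = {a, b}" "E = closed_segment a b" "p \<in> open_segment a b"
proof -
  have "p \<notin> V" using p V by auto
  have "E \<noteq> {a}" for a
  proof
    assume e: "E = {a}"
    have "V \<inter> E = {} \<or> V \<inter> E = {a}" using e by blast
    thus False using face_hull_vertices[OF V(1) E(1)] e p \<open>p \<notin> V\<close> by auto
  qed
  then obtain a b where ab: "a \<noteq> b" "V \<inter> E = {a, b}" "E = closed_segment a b" using edge_face[OF V E] p by blast
  thus thesis using that[of a b] p \<open>p \<notin> V\<close> by (auto simp: open_segment_def)
qed

lemma open_segment_sphere:
  fixes a b :: "'a::euclidean_space"
  assumes "norm a = 1" "norm b = 1" "p \<in> open_segment a b" shows "norm p < 1"
proof -
  have "p \<in> convex hull {a, b}" using assms(3) by (simp add: segment_convex_hull[symmetric] open_segment_def)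
  moreover have "p \<noteq> a" "p \<noteq> b" using assms(3) by (auto simp: open_segment_def)
  ultimately have "norm p \<noteq> 1" using sphere_hull_mem[of "{a, b}" p] assms by auto
  moreover have "dist 0 p < max (dist 0 a) (dist 0 b)"
    using dist_decreases_open_segment[OF assms(3), of 0] by (auto simp: dist_commute)
  ultimately show ?thesis using assms by simp
qed

lemma open_segment_cone:
  assumes "x \<in> open_segment a b" shows "\<exists>\<alpha> \<beta>. 0 < \<alpha> \<and> 0 < \<beta> \<and> hv x = \<alpha> *\<^sub>R hv a + \<beta> *\<^sub>R hv b"
proof -
  obtain u where u: "0 < u" "u < 1" "x = (1 - u) *\<^sub>R a + u *\<^sub>R b" using assms by (auto simp: in_segment)
  thus ?thesis by (intro exI[of _ "1 - u"] exI[of _ u]) (simp add: hv_def prod_eq_iff)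
qed

lemma kpos_open_segment:
  assumes "a \<noteq> b" "0 < \<alpha>" "0 < \<beta>" shows "kpos (\<alpha> *\<^sub>R hv a + \<beta> *\<^sub>R hv b) \<in> open_segment a b"
proof -
  define u where "u = \<beta> / (\<alpha> + \<beta>)"
  have s: "0 < \<alpha> + \<beta>" using assms by simp
  have u: "0 < u" "u < 1" "1 - u = \<alpha> / (\<alpha> + \<beta>)" using assms s by (auto simp: u_def field_simps)
  have "kpos (\<alpha> *\<^sub>R hv a + \<beta> *\<^sub>R hv b) = (1 - u) *\<^sub>R a + u *\<^sub>R b"
    unfolding u(3) by (simp add: kpos_def hv_def u_def scaleR_add_right divide_inverse_commute)
  thus ?thesis using assms(1) u(1,2) by (auto simp: in_segment)
qed

text \<open>The complement of the span of the two null vectors is a Euclidean plane with coordinates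
  \<open>z\<close>, and \<mu>, \<nu> live in it. If \<open>z X\<close> were nonzero, both would be
  orthogonal to it and hence proportional, but \<mu> vanishes at \<open>Y\<close> and \<nu> does
  not.\<close>

lemma span_of_two_null:
  fixes a b :: "real^3"
  assumes ab: "norm a = 1" "norm b = 1" "a \<noteq> b" and \<mu>: "\<mu> \<noteq> 0" "mk \<mu> (hv a) = 0" "mk \<mu> (hv b) = 0"
    and \<nu>: "mk \<nu> (hv a) = 0" "mk \<nu> (hv b) = 0" and Y: "mk \<mu> Y = 0" "mk \<nu> Y \<noteq> 0" and X: "mk \<mu> X = 0" "mk \<nu> X = 0"
  shows "\<exists>\<alpha> \<beta>. X = \<alpha> *\<^sub>R hv a + \<beta> *\<^sub>R hv b"
proof -
  obtain B1 B2 where B: "\<And>X. X = (mk X (hv b) / mk (hv a) (hv b)) *\<^sub>R hv a + (mk X (hv a) / mk (hv a) (hv b)) *\<^sub>R hv b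
     - mk X B1 *\<^sub>R B1 - mk X B2 *\<^sub>R B2" using null_frame[OF ab] by blast
  define z where "z X = Complex (mk X B1) (mk X B2)" for X
  have ex: "mk \<kappa> X = - (z \<kappa> \<bullet> z X)" if k: "mk \<kappa> (hv a) = 0" "mk \<kappa> (hv b) = 0" for \<kappa> X
  proof -
    have "mk \<kappa> X = mk ((mk \<kappa> (hv b) / mk (hv a) (hv b)) *\<^sub>R hv a + (mk \<kappa> (hv a) / mk (hv a) (hv b)) *\<^sub>R hv b
     - mk \<kappa> B1 *\<^sub>R B1 - mk \<kappa> B2 *\<^sub>R B2) X" using B[of \<kappa>] by (rule arg_cong)
    thus ?thesis by (simp add: k mk_linear z_def inner_complex_def mk_commute[of X])
  qed
  have "z X = 0"
  proof (rule ccontr)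
    assume zX: "z X \<noteq> 0"
    have "z X \<bullet> z \<mu> = 0" "z X \<bullet> z \<nu> = 0" using ex[OF \<mu>(2,3), of X] ex[OF \<nu>, of X] X by (simp_all add: inner_commute)
    hence col: "Im (cnj (z \<mu>) * z \<nu>) = 0" using perp_both_imp_collinear[OF zX] by blast
    have z\<mu>: "z \<mu> \<noteq> 0"
    proof
      assume "z \<mu> = 0"
      hence "mk \<mu> X = 0" for X using ex[OF \<mu>(2,3), of X] by simp
      thus False using mk_nondegenerate \<mu>(1) by blast
    qed
    define k where "k = Re (cnj (z \<mu>) * z \<nu>) / (norm (z \<mu>))\<^sup>2"
    have "cnj (z \<mu>) * z \<nu> = of_real (Re (cnj (z \<mu>) * z \<nu>))" using col by (simp add: complex_eq_iff)
    hence "z \<mu> * (cnj (z \<mu>) * z \<nu>) = z \<mu> * of_real (Re (cnj (z \<mu>) * z \<nu>))" by simp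
    hence "of_real ((norm (z \<mu>))\<^sup>2) * z \<nu> = of_real (Re (cnj (z \<mu>) * z \<nu>)) * z \<mu>"
      by (simp add: mult.assoc[symmetric] complex_norm_square[symmetric] mult.commute)
    hence "z \<nu> = of_real k * z \<mu>" using z\<mu> by (simp add: k_def field_simps)
    hence "mk \<nu> Y = k * mk \<mu> Y" unfolding ex[OF \<mu>(2,3)] ex[OF \<nu>] by (simp add: scaleR_conv_of_real[symmetric])
    thus False using Y by simp
  qed
  hence "mk X B1 = 0" "mk X B2 = 0" by (auto simp: z_def complex_eq_iff)
  thus ?thesis using B[of X] by auto
qed

text \<open>The functionals of two faces vanish on their common edge and read off the coefficients
  of \<open>Y\<close> and \<open>Z\<close>. The alternative \<open>mk \<mu> X = 0\<close> serves the
  doubled polygon, where \<mu> vanishes on everything and the coefficient of \<open>Z\<close> is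
  0.\<close>

lemma in_wedge_functionals:
  fixes a b :: "real^3"
  assumes ab: "norm a = 1" "norm b = 1" "a \<noteq> b" and \<mu>: "\<mu> \<noteq> 0" "mk \<mu> (hv a) = 0" "mk \<mu> (hv b) = 0"
    and \<nu>: "mk \<nu> (hv a) = 0" "mk \<nu> (hv b) = 0" and Y: "mk \<mu> Y = 0" "0 < mk \<nu> Y" and X: "0 \<le> mk \<mu> X" "0 \<le> mk \<nu> X"
    and Z: "mk \<mu> X = 0 \<or> 0 < mk \<mu> Z \<and> mk \<nu> Z = 0"
  shows "in_wedge (hv a) (hv b) Y Z X"
proof -
  define s t where "s = mk \<nu> X / mk \<nu> Y" and "t = (if mk \<mu> X = 0 then 0 else mk \<mu> X / mk \<mu> Z)"
  have st: "0 \<le> s" "0 \<le> t" using X Y Z by (auto simp: s_def t_def)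
  have "mk \<mu> (X - s *\<^sub>R Y - t *\<^sub>R Z) = 0" "mk \<nu> (X - s *\<^sub>R Y - t *\<^sub>R Z) = 0"
    using Y Z by (auto simp: mk_linear s_def t_def)
  from span_of_two_null[OF ab \<mu> \<nu> Y(1) less_imp_neq[OF Y(2), THEN not_sym] this]
  obtain \<alpha> \<beta> where "X - s *\<^sub>R Y - t *\<^sub>R Z = \<alpha> *\<^sub>R hv a + \<beta> *\<^sub>R hv b" by blast
  hence "X = \<alpha> *\<^sub>R hv a + \<beta> *\<^sub>R hv b + s *\<^sub>R Y + t *\<^sub>R Z" by (simp add: diff_eq_eq)
  thus ?thesis unfolding in_wedge_def using st by blast
qed

lemma mk_hv_right: "mk \<nu> (hv x) = snd \<nu> - fst \<nu> \<bullet> x"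
  by (simp add: mk_def)

lemma mk_nonneg_hull:
  assumes "\<And>v. v \<in> V \<Longrightarrow> 0 \<le> mk \<nu> (hv v)" "x \<in> convex hull V" shows "0 \<le> mk \<nu> (hv x)"
proof -
  have "convex hull V \<subseteq> {x. fst \<nu> \<bullet> x \<le> snd \<nu>}"
    by (rule hull_minimal) (use assms(1) in \<open>auto simp: mk_hv_right convex_halfspace_le\<close>)
  thus ?thesis using assms(2) by (auto simp: mk_hv_right)
qed

lemma face_functional:
  assumes "polyhedron K" "F face_of K" "F \<noteq> K"
  shows "\<exists>\<nu>. \<nu> \<noteq> 0 \<and> (\<forall>x\<in>K. 0 \<le> mk \<nu> (hv x)) \<and> (\<forall>x\<in>K. mk \<nu> (hv x) = 0 \<longleftrightarrow> x \<in> F)"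
proof -
  have "F exposed_face_of K" using exposed_face_of_polyhedron assms by blast
  then obtain a b where ab: "K \<subseteq> {x. a \<bullet> x \<le> b}" "F = K \<inter> {x. a \<bullet> x = b}" unfolding exposed_face_of_def by blast
  have "(a, b) \<noteq> 0" using ab assms(3) by (auto simp: zero_prod_def)
  thus ?thesis using ab by (intro exI[of _ "(a, b)"]) (auto simp: mk_hv_right)
qed

text \<open>The zero set of a supporting functional is a proper nonempty face of the hull, and such
  a face is contained in a facet.\<close>

lemma support_facet:
  fixes V :: "'a::euclidean_space set"
  assumes V: "finite V" and \<nu>: "\<And>v. v \<in> V \<Longrightarrow> 0 \<le> mk \<nu> (hv v)" and w: "w \<in> V" "mk \<nu> (hv w) = 0" and u: "u \<in> V" "mk \<nu> (hv u) \<noteq> 0"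
  obtains F where "F facet_of convex hull V" "{v\<in>V. mk \<nu> (hv v) = 0} \<subseteq> F"
proof -
  define K where "K = convex hull V"
  define F where "F = K \<inter> {x. fst \<nu> \<bullet> x = snd \<nu>}"
  have le: "fst \<nu> \<bullet> x \<le> snd \<nu>" if "x \<in> K" for x using mk_nonneg_hull[of V \<nu> x] \<nu> that by (simp add: K_def mk_hv_right)
  have VK: "V \<subseteq> K" unfolding K_def by (rule hull_subset)
  have "F face_of K" unfolding F_def by (rule face_of_Int_supporting_hyperplane_le) (use le in \<open>auto simp: K_def\<close>)
  moreover have "w \<in> F" "u \<in> K" "u \<notin> F" using w u VK by (auto simp: F_def mk_hv_right)
  hence "F \<noteq> {}" "F \<noteq> K" by blast+
  moreover have "polyhedron K" unfolding K_def using V polytope_imp_polyhedron polytope_convex_hull by blast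
  ultimately obtain G where G: "G facet_of K" "F \<subseteq> G" using face_of_polyhedron_subset_facet by metis
  have "{v\<in>V. mk \<nu> (hv v) = 0} \<subseteq> F" using VK by (auto simp: F_def mk_hv_right)
  thus thesis using that[of G] G unfolding K_def by blast
qed

text \<open>Restates the conditions in the Klein ball, where faces are convex hulls and edges are
  Euclidean segments; \<open>ulift\<close> translates them to cones in Minkowski space.\<close>

lemma ideal_surfaceI:
  fixes pos :: "'a \<Rightarrow> real^3" and W :: "'i \<Rightarrow> (real^3) set"
  assumes MS: "Metric_space M d" and V: "finite V" "V \<subseteq> sphere 0 1" and I: "finite I" "\<And>i. i \<in> I \<Longrightarrow> W i \<subseteq> V"
    and two: "\<And>i. i \<in> I \<Longrightarrow> \<exists>v\<in>W i. \<exists>w\<in>W i. v \<noteq> w" and cover: "M = (\<Union>i\<in>I. fc i)"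
    and bij: "\<And>i. i \<in> I \<Longrightarrow> bij_betw pos (fc i) (ideal_hull (W i))"
    and le: "\<And>x y. x \<in> M \<Longrightarrow> y \<in> M \<Longrightarrow> hdist (pos x) (pos y) \<le> d x y"
    and eq: "\<And>i x y. i \<in> I \<Longrightarrow> x \<in> fc i \<Longrightarrow> y \<in> fc i \<Longrightarrow> d x y = hdist (pos x) (pos y)"
    and geo: "\<And>i x0 x z y. i \<in> I \<Longrightarrow> x0 \<in> fc i \<Longrightarrow> x \<in> fc i \<Longrightarrow> z \<in> fc i \<Longrightarrow> y \<in> M \<Longrightarrow> x0 \<noteq> x \<Longrightarrow>
        d x0 x + d x y + d y z = d x0 z \<Longrightarrow> y \<in> fc i"
    and closed: "\<And>i x. i \<in> I \<Longrightarrow> x \<in> M \<Longrightarrow> x \<notin> fc i \<Longrightarrow> \<exists>e>0. \<forall>y\<in>fc i. e \<le> d x y"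
    and edge: "\<And>i j x. i \<in> I \<Longrightarrow> j \<in> I \<Longrightarrow> i \<noteq> j \<Longrightarrow> x \<in> fc i \<Longrightarrow> x \<in> fc j \<Longrightarrow>
        \<exists>a b. a \<in> W i \<inter> W j \<and> b \<in> W i \<inter> W j \<and> a \<noteq> b \<and> pos x \<in> open_segment a b \<and>
          (\<forall>p\<in>open_segment a b. \<exists>x'\<in>fc i \<inter> fc j. pos x' = p) \<and>
          (\<forall>v\<in>V. \<forall>y\<in>fc i - fc j. \<forall>z\<in>fc j - fc i. in_wedge (hv a) (hv b) (hv (pos y)) (hv (pos z)) (hv v))"
    and normal: "\<And>i. i \<in> I \<Longrightarrow> \<exists>\<nu>. \<nu> \<noteq> 0 \<and> (\<forall>v\<in>V. 0 \<le> mk \<nu> (hv v) \<and> (mk \<nu> (hv v) = 0 \<longleftrightarrow> v \<in> W i))"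
    and support: "\<And>\<nu>. \<nu> \<noteq> 0 \<Longrightarrow> (\<forall>v\<in>V. 0 \<le> mk \<nu> (hv v)) \<Longrightarrow> \<exists>i\<in>I. {v\<in>V. mk \<nu> (hv v) = 0} \<subseteq> W i"
    and fibre: "\<And>p. finite {x\<in>M. pos x = p} \<and> card {x\<in>M. pos x = p} \<le> 2"
    and not_inj: "\<And>x y. x \<in> M \<Longrightarrow> y \<in> M \<Longrightarrow> pos x = pos y \<Longrightarrow> x \<noteq> y \<Longrightarrow> \<exists>\<nu>. \<nu> \<noteq> 0 \<and> (\<forall>v\<in>V. mk \<nu> (hv v) = 0)"
    and planar: "\<And>\<nu> i. \<nu> \<noteq> 0 \<Longrightarrow> (\<forall>v\<in>V. mk \<nu> (hv v) = 0) \<Longrightarrow> i \<in> I \<Longrightarrow> W i = V"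
      "\<And>\<nu> i j v. \<nu> \<noteq> 0 \<Longrightarrow> (\<forall>v\<in>V. mk \<nu> (hv v) = 0) \<Longrightarrow> i \<in> I \<Longrightarrow> j \<in> I \<Longrightarrow> v \<in> V \<Longrightarrow>
        \<exists>b\<in>V. b \<noteq> v \<and> (\<forall>p\<in>open_segment v b. \<exists>x\<in>fc i \<inter> fc j. pos x = p)"
  shows "ideal_surface M d V I W fc (\<lambda>x. ulift (pos x))"
proof -
  have fW: "finite (W i)" if "i \<in> I" for i using I(2)[OF that] V(1) finite_subset by blast
  have pos_hull: "pos x \<in> ideal_hull (W i)" if "i \<in> I" "x \<in> fc i" for i x using bij[OF that(1)] that(2) by (auto simp: bij_betw_def)
  have pos_b: "norm (pos x) < 1" if "x \<in> M" for x using that pos_hull cover by (fastforce simp: ideal_hull_def)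
  have fM: "x \<in> M" if "i \<in> I" "x \<in> fc i" for i x using cover that by blast
  have nV: "norm v = 1" if "v \<in> V" for v using V that by auto
  have chord: "kpos X \<in> open_segment a b \<and> ulift (kpos X) = X"
    if "a \<noteq> b" "0 < \<alpha>" "0 < \<beta>" "X = \<alpha> *\<^sub>R hv a + \<beta> *\<^sub>R hv b" "X \<in> hyp" for a b :: "real^3" and \<alpha> \<beta> X
    using kpos_open_segment[OF that(1-3)] ulift_of_hyp(2)[OF that(5)] unfolding that(4) kpos_def by simp
  have scale: "0 < 1 / sqrt (1 - pos x \<bullet> pos x)" "ulift (pos x) = (1 / sqrt (1 - pos x \<bullet> pos x)) *\<^sub>R hv (pos x)" if "x \<in> M" for x
    using one_minus_inner_pos[OF pos_b[OF that]] by (simp_all add: ulift_def)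
  have edge': "\<exists>a b. a \<in> W i \<inter> W j \<and> b \<in> W i \<inter> W j \<and> a \<noteq> b \<and>
          (\<exists>\<alpha> \<beta>. 0 < \<alpha> \<and> 0 < \<beta> \<and> ulift (pos x) = \<alpha> *\<^sub>R hv a + \<beta> *\<^sub>R hv b) \<and>
          covers_chord (fc i \<inter> fc j) (\<lambda>x. ulift (pos x)) a b \<and>
          (\<forall>v\<in>V. \<forall>y\<in>fc i - fc j. \<forall>z\<in>fc j - fc i. in_wedge (hv a) (hv b) (ulift (pos y)) (ulift (pos z)) (hv v))"
    if ij: "i \<in> I" "j \<in> I" "i \<noteq> j" "x \<in> fc i" "x \<in> fc j" for i j x
  proof -
    obtain a b where ab: "a \<in> W i \<inter> W j" "b \<in> W i \<inter> W j" "a \<noteq> b" and px: "pos x \<in> open_segment a b"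
       and op: "\<And>p. p \<in> open_segment a b \<Longrightarrow> \<exists>x'\<in>fc i \<inter> fc j. pos x' = p"
       and we: "\<And>v y z. v \<in> V \<Longrightarrow> y \<in> fc i - fc j \<Longrightarrow> z \<in> fc j - fc i \<Longrightarrow> in_wedge (hv a) (hv b) (hv (pos y)) (hv (pos z)) (hv v)"
      using edge[OF ij] by - (erule exE, erule exE, (erule conjE)+, rule that; (assumption | (drule bspec, assumption)+, assumption | drule bspec, assumption))
    show ?thesis
    proof (rule exI[of _ a], rule exI[of _ b], intro conjI)
      show "a \<in> W i \<inter> W j" "b \<in> W i \<inter> W j" "a \<noteq> b" using ab .
      obtain \<alpha> \<beta> where "0 < \<alpha>" "0 < \<beta>" "hv (pos x) = \<alpha> *\<^sub>R hv a + \<beta> *\<^sub>R hv b" using open_segment_cone[OF px] by blast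
      thus "\<exists>\<alpha> \<beta>. 0 < \<alpha> \<and> 0 < \<beta> \<and> ulift (pos x) = \<alpha> *\<^sub>R hv a + \<beta> *\<^sub>R hv b"
        using scale[OF fM[OF ij(1,4)]]
        by (intro exI[of _ "1 / sqrt (1 - pos x \<bullet> pos x) * \<alpha>"] exI[of _ "1 / sqrt (1 - pos x \<bullet> pos x) * \<beta>"])
          (simp add: scaleR_add_right)
      show "covers_chord (fc i \<inter> fc j) (\<lambda>x. ulift (pos x)) a b"
        unfolding covers_chord_def using chord[OF ab(3) _ _ refl] op by metis
      show "\<forall>v\<in>V. \<forall>y\<in>fc i - fc j. \<forall>z\<in>fc j - fc i. in_wedge (hv a) (hv b) (ulift (pos y)) (ulift (pos z)) (hv v)"
      proof (intro ballI)
        fix v y z assume v: "v \<in> V" and y: "y \<in> fc i - fc j" and z: "z \<in> fc j - fc i"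
        obtain \<alpha> \<beta> s t where st: "0 \<le> s" "0 \<le> t" "hv v = \<alpha> *\<^sub>R hv a + \<beta> *\<^sub>R hv b + s *\<^sub>R hv (pos y) + t *\<^sub>R hv (pos z)"
          using we[OF v y z] unfolding in_wedge_def by blast
        define k l where "k = 1 / sqrt (1 - pos y \<bullet> pos y)" and "l = 1 / sqrt (1 - pos z \<bullet> pos z)"
        have "y \<in> M" "z \<in> M" using fM ij y z by blast+
        hence kl: "0 < k" "ulift (pos y) = k *\<^sub>R hv (pos y)" "0 < l" "ulift (pos z) = l *\<^sub>R hv (pos z)"
          using scale unfolding k_def l_def by blast+
        show "in_wedge (hv a) (hv b) (ulift (pos y)) (ulift (pos z)) (hv v)"
          unfolding in_wedge_def using st kl by (intro exI[of _ \<alpha>] exI[of _ \<beta>] exI[of _ "s / k"] exI[of _ "t / l"]) simp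
      qed
    qed
  qed
  have bijL: "bij_betw (\<lambda>x. ulift (pos x)) (fc i) (hyp \<inter> cone_on (W i))" if i: "i \<in> I" for i
  proof -
    have "bij_betw ulift (ideal_hull (W i)) (hyp \<inter> cone_on (W i))"
      unfolding bij_betw_def
    proof
      show "inj_on ulift (ideal_hull (W i))" by (rule inj_onI) (auto simp: ideal_hull_def intro: ulift_inj)
      show "ulift ` ideal_hull (W i) = hyp \<inter> cone_on (W i)"
      proof (intro set_eqI iffI)
        fix X assume "X \<in> ulift ` ideal_hull (W i)"
        then obtain x where x: "x \<in> convex hull (W i)" "norm x < 1" "X = ulift x" by (auto simp: ideal_hull_def)
        thus "X \<in> hyp \<inter> cone_on (W i)"
          using ulift_hyp[OF x(2)] hv_cone_on_iff[OF fW[OF i], of x] one_minus_inner_pos[OF x(2)] by (simp add: ulift_def cone_on_scale)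
      next
        fix X assume X: "X \<in> hyp \<inter> cone_on (W i)"
        hence "0 < snd X" by (simp add: hyp_def)
        hence "fst X /\<^sub>R snd X \<in> convex hull (W i)" using cone_on_normalize[OF _ fW[OF i]] X by blast
        thus "X \<in> ulift ` ideal_hull (W i)"
          using ulift_of_hyp[of X] X by (intro image_eqI[of _ _ "fst X /\<^sub>R snd X"]) (auto simp: ideal_hull_def)
      qed
    qed
    from bij_betw_trans[OF bij[OF i] this] show ?thesis by (simp add: comp_def)
  qed
  have hd: "mk (ulift (pos x)) (ulift (pos y)) = cosh (hdist (pos x) (pos y))" if "x \<in> M" "y \<in> M" for x y
    using mk_ulift pos_b that by blast
  have fibreL: "finite {x\<in>M. ulift (pos x) = X} \<and> card {x\<in>M. ulift (pos x) = X} \<le> 2" for X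
  proof (cases "{x\<in>M. ulift (pos x) = X} = {}")
    case False
    then obtain x0 where x0: "x0 \<in> M" "ulift (pos x0) = X" by blast
    have "{x\<in>M. ulift (pos x) = X} = {x\<in>M. pos x = pos x0}"
    proof (intro set_eqI iffI)
      fix x assume "x \<in> {x\<in>M. ulift (pos x) = X}"
      thus "x \<in> {x\<in>M. pos x = pos x0}" using ulift_inj[of "pos x" "pos x0"] pos_b x0 by simp
    qed (use x0 in auto)
    thus ?thesis using fibre[of "pos x0"] by simp
  next
    case True
    thus ?thesis by (metis card.empty finite.emptyI zero_le)
  qed
  interpret Metric_space M d by fact
  show ?thesis
  proof (unfold_locales)
    fix x y assume xy: "x \<in> M" "y \<in> M"
    have "0 \<le> hdist (pos x) (pos y)" using hdist_nonneg[of "pos x" "pos y" "pos x"] pos_b xy by simp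
    thus "mk (ulift (pos x)) (ulift (pos y)) \<le> cosh (d x y)"
      unfolding hd[OF xy] using le[OF xy] by (subst cosh_real_nonneg_le_iff) auto
    show "\<exists>\<nu>. \<nu> \<noteq> 0 \<and> (\<forall>v\<in>V. mk \<nu> (hv v) = 0)" if "ulift (pos x) = ulift (pos y)" "x \<noteq> y"
      using not_inj[OF xy _ that(2)] ulift_inj[of "pos x" "pos y"] pos_b xy that(1) by blast
  next
    fix i x y assume "i \<in> I" "x \<in> fc i" "y \<in> fc i"
    thus "mk (ulift (pos x)) (ulift (pos y)) = cosh (d x y)" using eq hd fM by metis
  next
    fix \<nu> i j v assume h: "\<nu> \<noteq> 0" "\<forall>v\<in>V. mk \<nu> (hv v) = 0" "i \<in> I" "j \<in> I" "v \<in> V"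
    obtain b where b: "b \<in> V" "b \<noteq> v" "\<And>p. p \<in> open_segment v b \<Longrightarrow> \<exists>x\<in>fc i \<inter> fc j. pos x = p"
      using planar(2)[OF h] by blast
    show "\<exists>b\<in>V. b \<noteq> v \<and> covers_chord (fc i \<inter> fc j) (\<lambda>x. ulift (pos x)) v b"
      unfolding covers_chord_def using chord[OF b(2)[symmetric] _ _ refl] b by metis
  qed (rule V I two cover bijL normal support planar(1) edge' closed geo conjunct1[OF fibreL] conjunct2[OF fibreL]; assumption)+
qed

text \<open>If a detour bounded below by hyperbolic distances has the length of the direct way, then
  all triangle inequalities involved are equalities.\<close>

lemma hdist_chain:
  fixes a b c e :: "'a::euclidean_space"
  assumes n: "norm a < 1" "norm b < 1" "norm c < 1" "norm e < 1"
    and s: "hdist a b + s + t = hdist a e" "hdist b c \<le> s" "hdist c e \<le> t"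
  shows "c \<in> closed_segment a e" "b \<in> closed_segment a c" "s = hdist b c"
proof -
  have t: "hdist a c \<le> hdist a b + hdist b c" "hdist a e \<le> hdist a c + hdist c e"
    using hdist_triangle[of a c b] hdist_triangle[of a e c] n by simp_all
  show "s = hdist b c" using s t by linarith
  have "hdist a c + hdist c e = hdist a e" "hdist a b + hdist b c = hdist a c" using s t by linarith+
  thus "c \<in> closed_segment a e" "b \<in> closed_segment a c"
    using hdist_between_iff[of a e c] hdist_between_iff[of a c b] n by simp_all
qed

lemma face_closed_hdist:
  fixes x :: "'a::euclidean_space"
  assumes "closed F" "x \<notin> F" "norm x < 1"
  shows "\<exists>e>0. \<forall>y\<in>F. norm y < 1 \<longrightarrow> e \<le> hdist x y"
proof -
  obtain r where r: "r > 0" "\<And>y. y \<in> F \<Longrightarrow> r \<le> dist x y" using separate_point_closed[OF assms(1,2)] by blast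
  obtain e where "e > 0" "\<And>y. norm y < 1 \<Longrightarrow> r \<le> norm (x - y) \<Longrightarrow> e \<le> hdist x y" using hdist_ge_of_dist[OF assms(3) r(1)] by blast
  thus ?thesis using r(2) by (intro exI[of _ e]) (auto simp: dist_norm)
qed

section \<open>Polyhedra with interior and doubled polygons\<close>

locale ideal_vertices =
  fixes V :: "(real^3) set"
  assumes finV: "finite V" and card3: "3 \<le> card V" and Vs: "V \<subseteq> sphere 0 1"
begin

definition K :: "(real^3) set" where "K = convex hull V"

lemma VK: "V \<subseteq> K" unfolding K_def by (rule hull_subset)

lemma normV: "v \<in> V \<Longrightarrow> norm v = 1" using Vs by auto

lemma polyK: "polyhedron K" and convK: "convex K" and compK: "compact K" and closK: "closed K"
proof -
  show "polyhedron K" unfolding K_def using finV polytope_imp_polyhedron polytope_convex_hull by blast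
  show "convex K" by (simp add: K_def)
  show "compact K" unfolding K_def by (rule finite_imp_compact_convex_hull[OF finV])
  thus "closed K" by (rule compact_imp_closed)
qed

lemma K_cball: "K \<subseteq> cball 0 1"
  unfolding K_def by (rule hull_minimal) (use Vs in auto)

lemma interior_P: "interior (ideal_hull V) = interior K"
proof -
  have "interior K \<subseteq> ball 0 1" using interior_mono[OF K_cball] by (simp add: interior_cball)
  thus ?thesis unfolding ideal_hull_def K_def[symmetric] by (auto simp: interior_open)
qed

lemma other_vertex: "\<exists>u\<in>V. u \<noteq> v"
proof (rule ccontr)
  assume "\<not> ?thesis"
  hence "V \<subseteq> {v}" by blast
  hence "card V \<le> 1" using card_mono[of "{v}" V] by simp
  thus False using card3 by simp
qed

lemma vertex_facet:
  assumes "v \<in> V" obtains F where "F facet_of K" "v \<in> F"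
proof -
  obtain u where u: "u \<in> V" "u \<noteq> v" using other_vertex by blast
  show thesis
  proof (rule support_facet[OF finV, of "hv v" v u])
    show "0 \<le> mk (hv v) (hv w)" if "w \<in> V" for w using mk_hv_sphere_nonneg normV assms that by blast
    show "mk (hv v) (hv v) = 0" using mk_hv_self_sphere normV assms by blast
    show "mk (hv v) (hv u) \<noteq> 0" using mk_hv_sphere_eq_0[of v u] normV assms u by auto
    show thesis if "F facet_of convex hull V" "{w\<in>V. mk (hv v) (hv w) = 0} \<subseteq> F" for F
      using that(1)[folded K_def] \<open>\<And>F. F facet_of K \<Longrightarrow> v \<in> F \<Longrightarrow> thesis\<close> that(2) assms mk_hv_self_sphere normV by blast
  qed (use assms u in auto)
qed

lemma facet_props:
  assumes "F facet_of K"
  shows "F face_of K" "F \<subseteq> K" "F \<noteq> {}" "F \<noteq> K" "F \<inter> rel_interior K = {}" "convex F" "closed F" "F = convex hull (V \<inter> F)"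
    "aff_dim F = aff_dim K - 1"
proof -
  show F: "F face_of K" "F \<noteq> {}" "aff_dim F = aff_dim K - 1" using assms by (auto simp: facet_of_def)
  show "F \<subseteq> K" "convex F" using F face_of_imp_subset face_of_imp_convex by auto
  show ne: "F \<noteq> K" using assms by auto
  show "F \<inter> rel_interior K = {}" using face_of_disjoint_rel_interior F ne by blast
  show "closed F" using face_of_imp_closed[OF convK closK F(1)] .
  show "F = convex hull (V \<inter> F)" using face_hull_vertices[OF finV] F(1) unfolding K_def by blast
qed

lemma frontier_K: "K - rel_interior K = \<Union> {F. F facet_of K}"
  using rel_frontier_of_polyhedron[OF polyK] closK by (simp add: rel_frontier_def)

lemma facet_two_vertices:
  assumes F: "F facet_of K" and a: "2 \<le> aff_dim K" shows "\<exists>v\<in>V \<inter> F. \<exists>w\<in>V \<inter> F. v \<noteq> w"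
proof (rule ccontr)
  assume n: "\<not> ?thesis"
  note p = facet_props[OF F]
  have "V \<inter> F \<noteq> {}" using p(3,8) by auto
  then obtain v where "v \<in> V \<inter> F" by blast
  hence "V \<inter> F = {v}" using n by blast
  hence "F = {v}" using p(8) by simp
  hence "aff_dim F = 0" by simp
  thus False using p(9) a by simp
qed

lemma planar_hyperplane:
  assumes "\<nu> \<noteq> 0" "\<forall>v\<in>V. mk \<nu> (hv v) = 0" shows "interior K = {}"
proof -
  obtain v where v: "v \<in> V" using card3 by (cases "V = {}") auto
  have a: "fst \<nu> \<noteq> 0"
  proof
    assume "fst \<nu> = 0"
    hence "snd \<nu> = 0" using assms(2) v by (auto simp: mk_hv_right)
    thus False using \<open>fst \<nu> = 0\<close> assms(1) by (simp add: prod_eq_iff)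
  qed
  have "K \<subseteq> {x. fst \<nu> \<bullet> x = snd \<nu>}" unfolding K_def
    by (rule hull_minimal) (use assms(2) in \<open>auto simp: mk_hv_right convex_hyperplane\<close>)
  hence "interior K \<subseteq> interior {x. fst \<nu> \<bullet> x = snd \<nu>}" by (rule interior_mono)
  thus ?thesis using interior_hyperplane[OF a] by auto
qed

text \<open>The faces are the facets of the hull. Each is convex, so the path metric agrees with
  \<open>hdist\<close> on it, and the supporting functionals of two facets along their common edge
  describe the wedge.\<close>

lemma nondegenerate_structure:
  assumes MS: "Metric_space M d" and int: "interior (ideal_hull V) \<noteq> {}"
    and iso: "isometry_onto M (\<lambda>x y. ennreal (d x y)) (ideal_hull V - interior (ideal_hull V))
      (path_dist (ideal_hull V - interior (ideal_hull V)) hdist) f"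
  shows "ideal_surface M d V {F. F facet_of K} (\<lambda>F. V \<inter> F) (\<lambda>F. {x\<in>M. f x \<in> F}) (\<lambda>x. ulift (f x))"
proof -
  interpret Metric_space M d by fact
  define S where "S = ideal_hull V - interior (ideal_hull V)"
  have intK: "interior K \<noteq> {}" using int interior_P by simp
  have dimK: "aff_dim K = 3" using aff_dim_nonempty_interior[OF intK] by simp
  have ri: "rel_interior K = interior K" using rel_interior_nonempty_interior[OF intK] .
  have Sb: "S \<subseteq> ball 0 1" by (auto simp: S_def ideal_hull_def)
  have S_iff: "x \<in> S \<longleftrightarrow> norm x < 1 \<and> (\<exists>F. F facet_of K \<and> x \<in> F)" for x
  proof -
    have "x \<in> S \<longleftrightarrow> norm x < 1 \<and> x \<in> K - rel_interior K"
      unfolding S_def interior_P ri by (auto simp: ideal_hull_def K_def)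
    thus ?thesis unfolding frontier_K by blast
  qed
  have bijf: "bij_betw f M S" and df: "\<And>x y. x \<in> M \<Longrightarrow> y \<in> M \<Longrightarrow> path_dist S hdist (f x) (f y) = ennreal (d x y)"
    using iso unfolding isometry_onto_def S_def by blast+
  have fS: "f x \<in> S" if "x \<in> M" for x using bijf that by (auto simp: bij_betw_def)
  have fn: "norm (f x) < 1" if "x \<in> M" for x using S_iff fS[OF that] by blast
  have finj: "x = y" if "x \<in> M" "y \<in> M" "f x = f y" for x y using bijf that by (auto simp: bij_betw_def inj_on_def)
  have fsurj: "\<exists>x\<in>M. f x = p" if "p \<in> S" for p using bijf that by (auto simp: bij_betw_def)
  have le: "hdist (f x) (f y) \<le> d x y" if xy: "x \<in> M" "y \<in> M" for x y
  proof -
    have "ennreal (hdist (f x) (f y)) \<le> ennreal (d x y)" using path_dist_ge_hdist[OF fS fS] df xy by metis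
    thus ?thesis by (simp add: ennreal_le_iff)
  qed
  have eq: "d x y = hdist (f x) (f y)" if F: "F facet_of K" and xy: "x \<in> M" "y \<in> M" "f x \<in> F" "f y \<in> F" for F x y
  proof -
    have "closed_segment (f x) (f y) \<subseteq> S"
    proof
      fix p assume p: "p \<in> closed_segment (f x) (f y)"
      have "p \<in> F" using p closed_segment_subset[OF xy(3,4) facet_props(6)[OF F]] by blast
      moreover have "closed_segment (f x) (f y) \<subseteq> ball 0 1"
        by (rule closed_segment_subset) (use fn[OF xy(1)] fn[OF xy(2)] in simp_all)
      hence "p \<in> ball 0 1" using p by blast
      ultimately show "p \<in> S" using S_iff F by auto
    qed
    hence "ennreal (d x y) = ennreal (hdist (f x) (f y))" using path_dist_segment[OF Sb] df[OF xy(1,2)] by simp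
    moreover have "0 \<le> hdist (f x) (f y)" using hdist_nonneg[of "f x" "f y" "f x"] fn xy by simp
    ultimately show ?thesis by simp
  qed
  note np = planar_hyperplane
  let ?fc = "\<lambda>F. {x\<in>M. f x \<in> F}"
  show ?thesis
  proof (rule ideal_surfaceI[OF MS finV Vs])
    show "finite {F. F facet_of K}" using finite_polyhedron_facets polyK by blast
    show "M = (\<Union>F\<in>{F. F facet_of K}. ?fc F)" using fS S_iff by blast
    show "\<And>F. F \<in> {F. F facet_of K} \<Longrightarrow> \<exists>v\<in>V \<inter> F. \<exists>w\<in>V \<inter> F. v \<noteq> w" using facet_two_vertices dimK by auto
    show "hdist (f x) (f y) \<le> d x y" if "x \<in> M" "y \<in> M" for x y using le[OF that] .
    show "d x y = hdist (f x) (f y)" if "F \<in> {F. F facet_of K}" "x \<in> ?fc F" "y \<in> ?fc F" for F x y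
      using eq that by blast
  next
    fix F assume "F \<in> {F. F facet_of K}"
    hence F: "F facet_of K" by simp
    note p = facet_props[OF F]
    have hull: "x \<in> ideal_hull (V \<inter> F) \<longleftrightarrow> norm x < 1 \<and> x \<in> F" for x unfolding ideal_hull_def p(8)[symmetric] by auto
    show "bij_betw f (?fc F) (ideal_hull (V \<inter> F))"
      unfolding bij_betw_def
    proof
      show "inj_on f (?fc F)" using finj by (auto intro: inj_onI)
      show "f ` ?fc F = ideal_hull (V \<inter> F)"
      proof (intro set_eqI iffI)
        fix q assume "q \<in> f ` ?fc F"
        thus "q \<in> ideal_hull (V \<inter> F)" using fn hull by blast
      next
        fix q assume "q \<in> ideal_hull (V \<inter> F)"
        hence q: "norm q < 1" "q \<in> F" using hull by auto
        then obtain x where "x \<in> M" "f x = q" using fsurj[of q] S_iff F by blast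
        thus "q \<in> f ` ?fc F" using q by blast
      qed
    qed
    show "\<exists>\<nu>. \<nu> \<noteq> 0 \<and> (\<forall>v\<in>V. 0 \<le> mk \<nu> (hv v) \<and> (mk \<nu> (hv v) = 0 \<longleftrightarrow> v \<in> V \<inter> F))"
      using face_functional[OF polyK p(1,4)] VK by blast
    show "\<exists>e>0. \<forall>y\<in>?fc F. e \<le> d x y" if x: "x \<in> M" "x \<notin> ?fc F" for x
    proof -
      obtain e where e: "e > 0" "\<And>q. q \<in> F \<Longrightarrow> norm q < 1 \<Longrightarrow> e \<le> hdist (f x) q"
        using face_closed_hdist[OF p(7), of "f x"] x fn by blast
      have "e \<le> d x y" if y: "y \<in> ?fc F" for y
      proof -
        have y: "y \<in> M" "f y \<in> F" using y by auto
        show ?thesis using e(2)[OF y(2) fn[OF y(1)]] le[OF x(1) y(1)] by linarith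
      qed
      thus ?thesis using e(1) by blast
    qed
    show "y \<in> ?fc F" if x: "x0 \<in> ?fc F" "x \<in> ?fc F" "z \<in> ?fc F" "y \<in> M"
      and s: "d x0 x + d x y + d y z = d x0 z" for x0 x z y
    proof -
      have m: "x0 \<in> M" "x \<in> M" "z \<in> M" "f x0 \<in> F" "f x \<in> F" "f z \<in> F" using x by auto
      have "f y \<in> closed_segment (f x0) (f z)"
      proof (rule hdist_chain(1))
        show "hdist (f x0) (f x) + d x y + d y z = hdist (f x0) (f z)"
          using s eq[OF F m(1,2,4,5)] eq[OF F m(1,3,4,6)] by simp
      qed (use fn m x(4) le in auto)
      hence "f y \<in> F" using closed_segment_subset[OF m(4,6) p(6)] by blast
      thus ?thesis using x(4) by simp
    qed
    fix G x assume G': "G \<in> {F. F facet_of K}" and FG: "F \<noteq> G" and x: "x \<in> ?fc F" "x \<in> ?fc G"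
    have G: "G facet_of K" using G' by simp
    note g = facet_props[OF G]
    define E where "E = F \<inter> G"
    have E: "E face_of K" unfolding E_def using face_of_Int p(1) g(1) by blast
    \<comment> \<open>Different facets have the same dimension, so neither contains the other and
      their intersection is at most an edge.\<close>
    have "aff_dim E < aff_dim F"
    proof (rule face_of_aff_dim_lt[OF p(6)])
      show "E face_of F" using face_of_subset[OF E _ p(2)] by (simp add: E_def)
      show "E \<noteq> F"
      proof
        assume "E = F"
        hence "F \<subseteq> G" by (auto simp: E_def)
        hence "F face_of G" using face_of_subset[OF p(1) _ g(2)] by blast
        hence "aff_dim F < aff_dim G" using face_of_aff_dim_lt[OF g(6) _ FG] by blast
        thus False using p(9) g(9) by simp
      qed
    qed
    hence E1: "aff_dim E \<le> 1" using p(9) dimK by simp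
    have fx: "f x \<in> E" "norm (f x) < 1" using x fn by (auto simp: E_def)
    obtain a b where ab: "a \<noteq> b" "V \<inter> E = {a, b}" "E = closed_segment a b" "f x \<in> open_segment a b"
      using edge_face_open[OF finV Vs E[unfolded K_def] E1 fx] by blast
    have abV: "a \<in> V" "b \<in> V" "a \<in> E" "b \<in> E" using ab(2) by auto
    obtain \<mu> where \<mu>: "\<mu> \<noteq> 0" "\<forall>x\<in>K. 0 \<le> mk \<mu> (hv x)" "\<forall>x\<in>K. mk \<mu> (hv x) = 0 \<longleftrightarrow> x \<in> F" using face_functional[OF polyK p(1,4)] by blast
    obtain \<nu> where \<nu>: "\<forall>x\<in>K. 0 \<le> mk \<nu> (hv x)" "\<forall>x\<in>K. mk \<nu> (hv x) = 0 \<longleftrightarrow> x \<in> G" using face_functional[OF polyK g(1,4)] by blast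
    show "\<exists>a b. a \<in> (V \<inter> F) \<inter> (V \<inter> G) \<and> b \<in> (V \<inter> F) \<inter> (V \<inter> G) \<and> a \<noteq> b \<and> f x \<in> open_segment a b \<and>
          (\<forall>p\<in>open_segment a b. \<exists>x'\<in>?fc F \<inter> ?fc G. f x' = p) \<and>
          (\<forall>v\<in>V. \<forall>y\<in>?fc F - ?fc G. \<forall>z\<in>?fc G - ?fc F. in_wedge (hv a) (hv b) (hv (f y)) (hv (f z)) (hv v))"
    proof (rule exI[of _ a], rule exI[of _ b], intro conjI ballI)
      show "a \<in> (V \<inter> F) \<inter> (V \<inter> G)" "b \<in> (V \<inter> F) \<inter> (V \<inter> G)" using abV by (auto simp: E_def)
      show "a \<noteq> b" "f x \<in> open_segment a b" using ab by auto
    next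
      fix q assume q: "q \<in> open_segment a b"
      hence "norm q < 1" using open_segment_sphere normV abV by blast
      moreover have "q \<in> E" using q ab(3) by (auto simp: open_segment_def)
      ultimately have "q \<in> S" using S_iff F by (auto simp: E_def)
      then obtain x' where "x' \<in> M" "f x' = q" using fsurj by blast
      thus "\<exists>x'\<in>?fc F \<inter> ?fc G. f x' = q" using \<open>q \<in> E\<close> by (auto simp: E_def)
    next
      fix v y z assume v: "v \<in> V" and y: "y \<in> ?fc F - ?fc G" and z: "z \<in> ?fc G - ?fc F"
      have yz: "f y \<in> F" "f y \<notin> G" "f z \<in> G" "f z \<notin> F" "f y \<in> K" "f z \<in> K" using y z p(2) g(2) by auto
      have vK: "v \<in> K" "a \<in> K" "b \<in> K" using v abV VK by auto
      have m0: "mk \<mu> (hv (f y)) = 0" "mk \<nu> (hv (f z)) = 0" "mk \<mu> (hv a) = 0" "mk \<mu> (hv b) = 0" "mk \<nu> (hv a) = 0" "mk \<nu> (hv b) = 0"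
        using \<mu>(3) \<nu>(2) yz vK abV by (auto simp: E_def)
      have y0: "0 < mk \<nu> (hv (f y))" and z0: "0 < mk \<mu> (hv (f z))" 
        using \<mu>(2,3) \<nu> yz by (metis less_eq_real_def)+
      show "in_wedge (hv a) (hv b) (hv (f y)) (hv (f z)) (hv v)"
        by (rule in_wedge_functionals[of a b \<mu> \<nu>]) (use normV abV ab m0 y0 z0 \<mu>(1,2) \<nu>(1) vK in auto)
    qed
  next
    fix \<nu> :: "mink" assume \<nu>: "\<nu> \<noteq> 0" "\<forall>v\<in>V. 0 \<le> mk \<nu> (hv v)"
    show "\<exists>F\<in>{F. F facet_of K}. {v\<in>V. mk \<nu> (hv v) = 0} \<subseteq> V \<inter> F"
    proof (cases "\<exists>w\<in>V. mk \<nu> (hv w) = 0")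
      case True
      then obtain w where w: "w \<in> V" "mk \<nu> (hv w) = 0" by blast
      obtain u where u: "u \<in> V" "mk \<nu> (hv u) \<noteq> 0" using np[OF \<nu>(1)] intK by blast
      obtain F where "F facet_of convex hull V" "{v\<in>V. mk \<nu> (hv v) = 0} \<subseteq> F"
        using support_facet[OF finV _ w u] \<nu>(2) by blast
      thus ?thesis unfolding K_def by blast
    next
      case False
      obtain v where "v \<in> V" using other_vertex by blast
      then obtain F where "F facet_of K" using vertex_facet by blast
      thus ?thesis using False by blast
    qed
  next
    fix q
    show "finite {x\<in>M. f x = q} \<and> card {x\<in>M. f x = q} \<le> 2"
    proof (cases "\<exists>x\<in>M. f x = q")
      case True
      then obtain x where "x \<in> M" "f x = q" by blast
      hence "{x\<in>M. f x = q} = {x}" using finj by blast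
      thus ?thesis by simp
    next
      case False
      hence e: "{x\<in>M. f x = q} = {}" by blast
      show ?thesis unfolding e by simp
    qed
  qed (use np intK finj in blast)+
qed

end

context ideal_vertices
begin

lemma sphere_not_rel_interior: assumes "v \<in> K" "norm v = 1" shows "v \<notin> rel_interior K"
proof -
  have v: "v \<in> V" using sphere_hull_mem[OF finV Vs] assms by (simp add: K_def)
  obtain F where F: "F facet_of K" "v \<in> F" using vertex_facet[OF v] by blast
  thus ?thesis using facet_props(5) by blast
qed

lemma rel_interior_ball: "rel_interior K \<subseteq> ball 0 1"
proof
  fix x assume x: "x \<in> rel_interior K"
  hence xK: "x \<in> K" using rel_interior_subset by blast
  hence "norm x \<le> 1" using K_cball by auto
  moreover have "norm x \<noteq> 1" using sphere_not_rel_interior[OF xK] x by blast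
  ultimately show "x \<in> ball 0 1" by simp
qed

lemma rel_interior_P: "rel_interior (ideal_hull V) = rel_interior K"
proof -
  have ne: "rel_interior K \<noteq> {}" using convK other_vertex VK rel_interior_eq_empty by blast
  have rb: "rel_interior (ball 0 1 :: (real^3) set) = ball 0 1" by (simp add: rel_interior_open)
  have "rel_interior (K \<inter> ball 0 1) = rel_interior K \<inter> rel_interior (ball 0 1)"
    by (rule convex_rel_interior_inter_two[OF convK convex_ball]) (use ne rel_interior_ball rb in auto)
  thus ?thesis using rb rel_interior_ball by (auto simp: ideal_hull_def K_def)
qed

lemma aff_dim_ge_2: "2 \<le> aff_dim K"
proof (rule ccontr)
  assume "\<not> 2 \<le> aff_dim K"
  hence k: "aff_dim K \<le> 1" by simp
  have ne: "\<exists>x. x \<in> A" if "1 \<le> card A" for A :: "(real^3) set" using that by (cases "A = {}") auto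
  obtain v where v: "v \<in> V" using other_vertex by blast
  obtain q where q: "q \<in> V" "q \<noteq> v" using other_vertex by blast
  have "card (V - {v} - {q}) \<ge> 1" using v q finV card3 by simp
  then obtain w where w: "w \<in> V" "w \<noteq> v" "w \<noteq> q" using ne by blast
  have "{v, q, w} \<subseteq> K" using v q w VK by blast
  hence "aff_dim {v, q, w} \<le> 1" using aff_dim_subset k by (meson order_trans)
  hence "collinear {v, q, w}" by (simp add: collinear_aff_dim)
  thus False using sphere_collinear[of v q w] normV v q w by auto
qed

text \<open>The two copies are the faces, each with all vertices. Points of the rim occur once, with
  label \<open>True\<close>, and belong to both; all other points belong to the face of their
  label.\<close>

lemma double_structure:
  assumes MS: "Metric_space M d" and int: "interior (ideal_hull V) = {}"
    and iso: "isometry_onto M (\<lambda>x y. ennreal (d x y)) (double (ideal_hull V)) (double_dist (ideal_hull V)) f"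
  shows "ideal_surface M d V (UNIV :: bool set) (\<lambda>_. V) (\<lambda>i. {x\<in>M. snd (f x) = i \<or> fst (f x) \<notin> rel_interior K}) (\<lambda>x. ulift (fst (f x)))"
proof -
  interpret Metric_space M d by fact
  define R where "R = rel_interior K"
  define pos where "pos x = fst (f x)" for x
  define lab where "lab x = snd (f x)" for x
  define fc where "fc i = {x\<in>M. lab x = i \<or> pos x \<notin> R}" for i
  obtain a b where ab: "a \<noteq> 0" "K \<subseteq> {x. a \<bullet> x = b}"
    using empty_interior_subset_hyperplane[OF convK] int interior_P by metis
  define \<mu> where "\<mu> = (a, b)"
  have \<mu>: "\<mu> \<noteq> 0" "\<And>x. x \<in> K \<Longrightarrow> mk \<mu> (hv x) = 0" using ab by (auto simp: \<mu>_def zero_prod_def mk_hv_right)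
  have dimK: "aff_dim K = 2"
  proof -
    have "aff_dim K \<le> aff_dim {x. a \<bullet> x = b}" by (rule aff_dim_subset[OF ab(2)])
    thus ?thesis using aff_dim_ge_2 aff_dim_hyperplane[OF ab(1), of b] by simp
  qed
  have RK: "R \<subseteq> K" "R \<subseteq> ball 0 1" using rel_interior_subset rel_interior_ball by (auto simp: R_def)
  have convR: "convex R" unfolding R_def using convex_rel_interior[OF convK] .
  have closB: "closed (K - R)" using closed_rel_frontier[of K] closK by (simp add: rel_frontier_def R_def)
  have rim: "ideal_hull V - rel_interior (ideal_hull V) = (K - R) \<inter> ball 0 1"
    unfolding rel_interior_P R_def by (auto simp: ideal_hull_def K_def)
  have dbl: "(p, l) \<in> double (ideal_hull V) \<longleftrightarrow> p \<in> K \<and> norm p < 1 \<and> (l \<or> p \<in> R)" for p l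
    unfolding double_def rel_interior_P using RK by (cases l) (auto simp: ideal_hull_def K_def R_def)
  have bijf: "bij_betw f M (double (ideal_hull V))"
    and df: "\<And>x y. x \<in> M \<Longrightarrow> y \<in> M \<Longrightarrow> double_dist (ideal_hull V) (f x) (f y) = ennreal (d x y)"
    using iso unfolding isometry_onto_def by blast+
  have pl: "f x = (pos x, lab x)" for x by (simp add: pos_def lab_def)
  have fD: "pos x \<in> K" "norm (pos x) < 1" "lab x \<or> pos x \<in> R" if x: "x \<in> M" for x
  proof -
    have "f x \<in> double (ideal_hull V)" using bijf x by (auto simp: bij_betw_def)
    thus "pos x \<in> K" "norm (pos x) < 1" "lab x \<or> pos x \<in> R" unfolding pl dbl by blast+
  qed
  have fsurj: "\<exists>x\<in>M. pos x = p \<and> lab x = l" if "p \<in> K" "norm p < 1" "l \<or> p \<in> R" for p l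
  proof -
    have "(p, l) \<in> f ` M" using bijf dbl[of p l] that by (simp add: bij_betw_def)
    thus ?thesis using pl by force
  qed
  have finj: "x = y" if "x \<in> M" "y \<in> M" "pos x = pos y" "lab x = lab y" for x y
    using bijf that pl[of x] pl[of y] by (auto simp: bij_betw_def inj_on_def)
  have hnn: "0 \<le> hdist (pos x) (pos y)" if "x \<in> M" "y \<in> M" for x y
    using hdist_nonneg[of "pos x" "pos y" "pos x"] fD that by simp
  have dsame: "d x y = hdist (pos x) (pos y)" if "x \<in> M" "y \<in> M" "lab x = lab y" for x y
    using df[OF that(1,2)] hnn[OF that(1,2)] that(3) unfolding pl double_dist_def by simp
  have ddiff: "ennreal (d x y) = (INF z\<in>(K - R) \<inter> ball 0 1. ennreal (hdist (pos x) z + hdist z (pos y)))"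
    if "x \<in> M" "y \<in> M" "lab x \<noteq> lab y" for x y
    using df[OF that(1,2)] that(3) unfolding pl double_dist_def rim by simp
  have lower: "c \<le> d x y" if "x \<in> M" "y \<in> M" "lab x \<noteq> lab y"
    and "\<And>z. z \<in> K - R \<Longrightarrow> norm z < 1 \<Longrightarrow> c \<le> hdist (pos x) z + hdist z (pos y)" for x y c
  proof -
    have "ennreal c \<le> ennreal (d x y)" unfolding ddiff[OF that(1-3)]
      by (rule INF_greatest) (use that(4) in \<open>auto intro: ennreal_leI\<close>)
    thus ?thesis by (cases "0 \<le> c") (auto simp: ennreal_le_iff intro: order_trans[of _ 0])
  qed
  have upper: "d x y \<le> hdist (pos x) z + hdist z (pos y)" if "x \<in> M" "y \<in> M" "lab x \<noteq> lab y" "z \<in> K - R" "norm z < 1" for x y z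
  proof -
    have "ennreal (d x y) \<le> ennreal (hdist (pos x) z + hdist z (pos y))" unfolding ddiff[OF that(1-3)]
      by (rule INF_lower) (use that in auto)
    moreover have "0 \<le> hdist (pos x) z + hdist z (pos y)"
      using hdist_nonneg[of "pos x" z z] hdist_nonneg[of z "pos y" z] fD that by (simp add: add_nonneg_nonneg)
    ultimately show ?thesis by (simp add: ennreal_le_iff)
  qed
  have le: "hdist (pos x) (pos y) \<le> d x y" if xy: "x \<in> M" "y \<in> M" for x y
  proof (cases "lab x = lab y")
    case True
    thus ?thesis using dsame xy by simp
  next
    case False
    show ?thesis
      by (rule lower[OF xy False]) (use hdist_triangle[of "pos x" "pos y"] fD xy in auto)
  qed
  have h0: "hdist p p = 0" if "norm p < 1" for p :: "real^3" using hdist_eq_0[of p p p] that by simp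
  have eq: "d x y = hdist (pos x) (pos y)" if xy: "x \<in> fc i" "y \<in> fc i" for i x y
  proof (cases "lab x = lab y")
    case True
    thus ?thesis using dsame xy by (simp add: fc_def)
  next
    case False
    have m: "x \<in> M" "y \<in> M" using xy by (auto simp: fc_def)
    have "pos x \<notin> R \<or> pos y \<notin> R" using xy False by (auto simp: fc_def)
    hence "d x y \<le> hdist (pos x) (pos y)"
      using upper[OF m False, of "pos x"] upper[OF m False, of "pos y"] fD[OF m(1)] fD[OF m(2)] h0 by auto
    thus ?thesis using le[OF m] by simp
  qed
  \<comment> \<open>Passing to the other copy costs a positive amount for inner points. The rim is
    not compact, but far away points of it are excluded by \<open>hdist_proper\<close>; on the
    compact rest the minimum is attained off the segment between the points, which stays in the
    relative interior.\<close>
  have strict: "hdist (pos x) (pos y) < d x y" if xy: "x \<in> M" "y \<in> M" "lab x \<noteq> lab y" "pos x \<in> R" "pos y \<in> R" for x y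
  proof -
    define D where "D = hdist (pos x) (pos y)"
    note n = fD(2)[OF xy(1)] fD(2)[OF xy(2)]
    obtain r where r: "r < 1" "\<And>w. norm w < 1 \<Longrightarrow> r < norm w \<Longrightarrow> D + 1 < hdist (pos x) w" using hdist_proper[OF n(1), of "D + 1"] by blast
    define B where "B = (K - R) \<inter> cball 0 r"
    have compB: "compact B" unfolding B_def by (rule closed_Int_compact[OF closB compact_cball])
    define h where "h z = hdist (pos x) z + hdist (pos y) z" for z
    have Bb: "B \<subseteq> ball 0 1" using r by (auto simp: B_def)
    have "continuous_on B h" unfolding h_def
      by (intro continuous_on_add continuous_on_hdist) (use n Bb in auto)
    have "\<exists>c>D. \<forall>z\<in>B. c \<le> h z"
    proof (cases "B = {}")
      case False
      obtain w where w: "w \<in> B" "\<And>z. z \<in> B \<Longrightarrow> h w \<le> h z" using continuous_attains_inf[OF compB False \<open>continuous_on B h\<close>] by blast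
      have wn: "norm w < 1" "w \<notin> R" using w Bb by (auto simp: B_def)
      have "w \<notin> closed_segment (pos x) (pos y)" using wn(2) closed_segment_subset[OF xy(4,5) convR] by blast
      hence "hdist (pos x) w + hdist w (pos y) \<noteq> D" unfolding D_def using hdist_between_iff[of "pos x" "pos y" w] n wn by simp
      moreover have "D \<le> hdist (pos x) w + hdist w (pos y)" unfolding D_def using hdist_triangle[of "pos x" "pos y" w] n wn by simp
      ultimately have "D < h w" by (simp add: h_def hdist_commute)
      thus ?thesis using w(2) by blast
    qed (auto intro: exI[of _ "D + 1"])
    then obtain c where c: "D < c" "\<And>z. z \<in> B \<Longrightarrow> c \<le> h z" by blast
    have "min c (D + 1) \<le> d x y"
    proof (rule lower[OF xy(1-3)])
      fix z assume z: "z \<in> K - R" "norm z < 1"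
      show "min c (D + 1) \<le> hdist (pos x) z + hdist z (pos y)"
      proof (cases "norm z \<le> r")
        case True
        hence "z \<in> B" using z by (simp add: B_def)
        from c(2)[OF this] show ?thesis by (simp add: h_def hdist_commute)
      next
        case False
        hence "D + 1 < hdist (pos x) z" using r(2) z by simp
        moreover have "0 \<le> hdist z (pos y)" using hdist_nonneg[of z "pos y" z] z n by simp
        ultimately show ?thesis by linarith
      qed
    qed
    thus ?thesis using c(1) unfolding D_def[symmetric] by linarith
  qed
  have edge_pts: "\<exists>x\<in>fc i \<inter> fc j. pos x = p" if E: "E facet_of K" and p: "p \<in> E" "norm p < 1" for E p i j
  proof -
    have "p \<in> K" "p \<notin> R" using facet_props(2,5)[OF E] p by (auto simp: R_def)
    then obtain x where "x \<in> M" "pos x = p" using fsurj[of p True] p by auto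
    thus ?thesis using \<open>p \<notin> R\<close> by (auto simp: fc_def)
  qed
  have "ideal_surface M d V (UNIV :: bool set) (\<lambda>_. V) fc (\<lambda>x. ulift (pos x))"
  proof (rule ideal_surfaceI[OF MS finV Vs])
    show "finite (UNIV :: bool set)" by simp
    show "\<exists>v\<in>V. \<exists>w\<in>V. v \<noteq> w" using other_vertex by metis
    show "M = (\<Union>i\<in>UNIV. fc i)" by (auto simp: fc_def)
    show "hdist (pos x) (pos y) \<le> d x y" if "x \<in> M" "y \<in> M" for x y using le[OF that] .
    show "d x y = hdist (pos x) (pos y)" if "x \<in> fc i" "y \<in> fc i" for i x y using eq[OF that] .
    show "finite {x\<in>M. pos x = p} \<and> card {x\<in>M. pos x = p} \<le> 2" for p
    proof -
      have inj: "inj_on lab {x\<in>M. pos x = p}" using finj by (auto intro: inj_onI)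
      have f: "finite {x\<in>M. pos x = p}" using inj_on_finite[OF inj, of UNIV] by simp
      moreover have "card {x\<in>M. pos x = p} \<le> card (UNIV :: bool set)" using card_inj_on_le[OF inj, of UNIV] by simp
      ultimately show ?thesis by simp
    qed
    show "\<exists>\<nu>. \<nu> \<noteq> 0 \<and> (\<forall>v\<in>V. 0 \<le> mk \<nu> (hv v) \<and> (mk \<nu> (hv v) = 0 \<longleftrightarrow> v \<in> V))"
      using \<mu> VK by (intro exI[of _ \<mu>]) auto
    show "\<exists>\<nu>. \<nu> \<noteq> 0 \<and> (\<forall>v\<in>V. mk \<nu> (hv v) = 0)" using \<mu> VK by (intro exI[of _ \<mu>]) auto
    show "\<exists>i\<in>(UNIV :: bool set). {v\<in>V. mk \<nu> (hv v) = 0} \<subseteq> V" for \<nu> by auto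
  next
    fix i
    show "bij_betw pos (fc i) (ideal_hull V)"
      unfolding bij_betw_def
    proof
      show "inj_on pos (fc i)"
      proof (rule inj_onI)
        fix x y assume xy: "x \<in> fc i" "y \<in> fc i" "pos x = pos y"
        have m: "x \<in> M" "y \<in> M" using xy by (auto simp: fc_def)
        have "d x y = 0" using eq[OF xy(1,2)] xy(3) h0 fD(2)[OF m(2)] by simp
        thus "x = y" using m by simp
      qed
      show "pos ` fc i = ideal_hull V"
      proof (intro set_eqI iffI)
        fix p assume "p \<in> pos ` fc i"
        thus "p \<in> ideal_hull V" using fD(1,2) by (auto simp: fc_def ideal_hull_def K_def)
      next
        fix p assume "p \<in> ideal_hull V"
        hence p: "p \<in> K" "norm p < 1" by (auto simp: ideal_hull_def K_def)
        have "\<exists>x\<in>fc i. pos x = p"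
        proof (cases "p \<in> R")
          case True
          thus ?thesis using fsurj[OF p, of i] by (auto simp: fc_def)
        next
          case False
          thus ?thesis using fsurj[OF p, of True] by (auto simp: fc_def)
        qed
        thus "p \<in> pos ` fc i" by blast
      qed
    qed
    show "\<exists>e>0. \<forall>y\<in>fc i. e \<le> d x y" if x: "x \<in> M" "x \<notin> fc i" for x
    proof -
      have xr: "lab x \<noteq> i" "pos x \<in> R" using x by (auto simp: fc_def)
      obtain e where e: "e > 0" "\<And>z. z \<in> K - R \<Longrightarrow> norm z < 1 \<Longrightarrow> e \<le> hdist (pos x) z"
        using face_closed_hdist[OF closB, of "pos x"] xr fD(2)[OF x(1)] by blast
      have "e \<le> d x y" if y: "y \<in> fc i" for y
      proof -
        have m: "y \<in> M" using y by (simp add: fc_def)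
        show ?thesis
        proof (cases "lab y = lab x")
          case True
          hence "pos y \<in> K - R" using y xr fD(1)[OF m] by (auto simp: fc_def)
          hence "e \<le> hdist (pos x) (pos y)" using e(2) fD(2)[OF m] by blast
          thus ?thesis using le[OF x(1) m] by linarith
        next
          case False
          show ?thesis
          proof (rule lower[OF x(1) m])
            fix z assume z: "z \<in> K - R" "norm z < 1"
            have "0 \<le> hdist z (pos y)" using hdist_nonneg[of z "pos y" z] z fD(2)[OF m] by simp
            thus "e \<le> hdist (pos x) z + hdist z (pos y)" using e(2)[OF z] by linarith
          qed (use False in auto)
        qed
      qed
      thus ?thesis using e(1) by blast
    qed
    show "y \<in> fc i" if x: "x0 \<in> fc i" "x \<in> fc i" "z \<in> fc i" "y \<in> M" "x0 \<noteq> x" and s: "d x0 x + d x y + d y z = d x0 z" for x0 x z y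
    proof (rule ccontr)
      assume "y \<notin> fc i"
      hence y: "lab y \<noteq> i" "pos y \<in> R" using x(4) by (auto simp: fc_def)
      have m: "x0 \<in> M" "x \<in> M" "z \<in> M" using x by (auto simp: fc_def)
      have s': "hdist (pos x0) (pos x) + d x y + d y z = hdist (pos x0) (pos z)" using s eq[OF x(1,2)] eq[OF x(1,3)] by simp
      note ch = hdist_chain[OF fD(2)[OF m(1)] fD(2)[OF m(2)] fD(2)[OF x(4)] fD(2)[OF m(3)] s' le[OF m(2) x(4)] le[OF x(4) m(3)]]
      have ne: "pos x0 \<noteq> pos x"
      proof
        assume "pos x0 = pos x"
        hence "d x0 x = 0" using eq[OF x(1,2)] h0 fD(2)[OF m(2)] by simp
        thus False using x(5) m by simp
      qed
      \<comment> \<open>The point \<open>pos x\<close> lies between \<open>pos x0\<close> and the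
        inner point \<open>pos y\<close>, and differs from \<open>pos x0\<close>; hence it is an
        inner point as well. This uses the initial piece from \<open>x0\<close> to
        \<open>x\<close>.\<close>
      have "pos x \<in> R"
      proof (cases "pos x = pos y")
        case False
        hence "pos x \<in> open_segment (pos y) (pos x0)" using ch(2) ne by (auto simp: open_segment_def closed_segment_commute)
        thus ?thesis using rel_interior_closure_convex_segment[OF convK, of "pos y" "pos x0"] y(2) fD(1)[OF m(1)] closure_subset
          unfolding R_def by blast
      qed (use y in simp)
      hence "lab x = i" using x(2) by (auto simp: fc_def)
      hence "hdist (pos x) (pos y) < d x y" using strict[OF m(2) x(4)] y \<open>pos x \<in> R\<close> by simp
      thus False using ch(3) by simp
    qed
    fix j x assume ij: "i \<noteq> j" and x: "x \<in> fc i" "x \<in> fc j"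
    have m: "x \<in> M" using x by (simp add: fc_def)
    have "pos x \<in> K - R" using x ij fD(1)[OF m] by (auto simp: fc_def)
    then obtain E where E: "E facet_of K" "pos x \<in> E" using frontier_K unfolding R_def by blast
    note e = facet_props[OF E(1)]
    have E1: "aff_dim E \<le> 1" using e(9) dimK by simp
    obtain a b where ab: "a \<noteq> b" "V \<inter> E = {a, b}" "E = closed_segment a b" "pos x \<in> open_segment a b"
      using edge_face_open[OF finV Vs e(1)[unfolded K_def] E1 E(2) fD(2)[OF m]] by blast
    have abV: "a \<in> V" "b \<in> V" "a \<in> E" "b \<in> E" using ab(2) by auto
    obtain \<nu> where \<nu>: "\<forall>x\<in>K. 0 \<le> mk \<nu> (hv x)" "\<forall>x\<in>K. mk \<nu> (hv x) = 0 \<longleftrightarrow> x \<in> E" using face_functional[OF polyK e(1,4)] by blast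
    show "\<exists>a b. a \<in> V \<inter> V \<and> b \<in> V \<inter> V \<and> a \<noteq> b \<and> pos x \<in> open_segment a b \<and>
          (\<forall>p\<in>open_segment a b. \<exists>x'\<in>fc i \<inter> fc j. pos x' = p) \<and>
          (\<forall>v\<in>V. \<forall>y\<in>fc i - fc j. \<forall>z\<in>fc j - fc i. in_wedge (hv a) (hv b) (hv (pos y)) (hv (pos z)) (hv v))"
    proof (rule exI[of _ a], rule exI[of _ b], intro conjI ballI)
      show "a \<in> V \<inter> V" "b \<in> V \<inter> V" "a \<noteq> b" "pos x \<in> open_segment a b" using abV ab by auto
    next
      fix q assume q: "q \<in> open_segment a b"
      have "norm q < 1" using open_segment_sphere[OF _ _ q] normV abV by blast
      moreover have "q \<in> E" using q ab(3) by (auto simp: open_segment_def)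
      ultimately show "\<exists>x'\<in>fc i \<inter> fc j. pos x' = q" using edge_pts[OF E(1)] by blast
    next
      fix v y z assume v: "v \<in> V" and y: "y \<in> fc i - fc j" and z: "z \<in> fc j - fc i"
      have yR: "y \<in> M" "pos y \<in> R" using y by (auto simp: fc_def)
      have yE: "pos y \<in> K" "pos y \<notin> E" using yR RK e(5) by (auto simp: R_def)
      have vK: "v \<in> K" "a \<in> K" "b \<in> K" using v abV VK by auto
      have y0: "0 < mk \<nu> (hv (pos y))" using \<nu> yE by (metis less_eq_real_def)
      show "in_wedge (hv a) (hv b) (hv (pos y)) (hv (pos z)) (hv v)"
        by (rule in_wedge_functionals[of a b \<mu> \<nu>]) (use normV abV ab \<mu> \<nu> vK yE y0 in auto)
    qed
  next
    fix i j v assume v: "v \<in> V"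
    obtain E where E: "E facet_of K" "v \<in> E" using vertex_facet[OF v] by blast
    note e = facet_props[OF E(1)]
    have E1: "aff_dim E \<le> 1" using e(9) dimK by simp
    have "E \<noteq> {c}" for c using e(9) dimK by auto
    then obtain a b where ab: "a \<noteq> b" "V \<inter> E = {a, b}" "E = closed_segment a b"
      using edge_face[OF finV Vs e(1)[unfolded K_def] E1 e(3)] by blast
    have "\<exists>c\<in>V. c \<noteq> v \<and> E = closed_segment v c"
    proof (cases "v = a")
      case True
      have "b \<in> V" using ab(2) by blast
      thus ?thesis unfolding True using ab(1,3) by (intro bexI[of _ b]) auto
    next
      case False
      hence vb: "v = b" using ab(2) v E by blast
      have "a \<in> V" using ab(2) by blast
      thus ?thesis unfolding vb using ab(1,3) closed_segment_commute[of a b] by (intro bexI[of _ a]) auto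
    qed
    then obtain c where c: "c \<in> V" "c \<noteq> v" "E = closed_segment v c" by blast
    have "\<exists>x\<in>fc i \<inter> fc j. pos x = p" if p: "p \<in> open_segment v c" for p
    proof -
      have "norm p < 1" using open_segment_sphere[OF _ _ p] normV v c by blast
      moreover have "p \<in> E" using p c(3) by (auto simp: open_segment_def)
      ultimately show ?thesis using edge_pts[OF E(1)] by blast
    qed
    thus "\<exists>b\<in>V. b \<noteq> v \<and> (\<forall>p\<in>open_segment v b. \<exists>x\<in>fc i \<inter> fc j. pos x = p)" using c by blast
  qed simp_all
  thus ?thesis unfolding fc_def pos_def lab_def R_def .
qed

end

lemma ideal_surfaces_congruent:
  assumes "ideal_surface M d V I W fc L" "ideal_surface M d V' I' W' fc' L'"
    and conn: "connected_space (Metric_space.mtopology M d)" and card: "3 \<le> card V"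
  shows "congruent_bodies (ideal_hull V) (ideal_hull V')"
proof -
  interpret two_surfaces M d V I W fc L V' I' W' fc' L' using assms(1,2) by (simp add: two_surfaces_def)
  obtain \<sigma> c where "bij_betw \<sigma> V V'" "\<forall>v\<in>V. 0 < c v"
    "\<forall>v\<in>V. \<forall>u\<in>V. mk (hv v) (hv u) = c v * (c u * mk (hv (\<sigma> v)) (hv (\<sigma> u)))"
    using gram_eq[OF conn] by blast
  thus ?thesis using gram_imp_congruent[OF P.finite_V card P.V_sphere Q.V_sphere] by blast
qed

text \<open>The faces are indexed by facets or by the two copies. A type cannot be quantified
  existentially, hence the disjunction.\<close>

lemma polyhedron_structure:
  assumes MS: "Metric_space M d" and V: "finite V" "3 \<le> card V" "V \<subseteq> sphere 0 1"
    and bd: "boundary_isometric_to (ideal_hull V) M d"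
  shows "(\<exists>(I :: (real^3) set set) W fc L. ideal_surface M d V I W fc L) \<or> (\<exists>(I :: bool set) W fc L. ideal_surface M d V I W fc L)"
proof -
  interpret ideal_vertices V using V by unfold_locales
  show ?thesis
  proof (cases "interior (ideal_hull V) = {}")
    case True
    then obtain f where "isometry_onto M (\<lambda>x y. ennreal (d x y)) (double (ideal_hull V)) (double_dist (ideal_hull V)) f"
      using bd by (auto simp: boundary_isometric_to_def)
    from double_structure[OF MS True this] show ?thesis by blast
  next
    case False
    then obtain f where "isometry_onto M (\<lambda>x y. ennreal (d x y)) (ideal_hull V - interior (ideal_hull V))
      (path_dist (ideal_hull V - interior (ideal_hull V)) hdist) f"
      using bd by (auto simp: boundary_isometric_to_def)
    from nondegenerate_structure[OF MS False this] show ?thesis by blast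
  qed
qed

theorem theorem1p2:
  fixes N :: nat
    and M :: "'a set" and d :: "'a \<Rightarrow> 'a \<Rightarrow> real"
    and P Q :: "(real^3) set"
  assumes "N \<ge> 3"
    and "hyperbolic_surface M d"
    and "Metric_space.mcomplete M d"
    and "surface_area M d < \<infinity>"
    and "punctured_sphere N (Metric_space.mtopology M d)"
    and "ideal_polyhedron P" and "boundary_isometric_to P M d"
    and "ideal_polyhedron Q" and "boundary_isometric_to Q M d"
  shows "congruent_bodies P Q"
proof -
  have MS: "Metric_space M d" using assms(2) by (simp add: hyperbolic_surface_def)
  note conn = hyperbolic_surface_connected[OF assms(2)]
  obtain V where V: "finite V" "3 \<le> card V" "V \<subseteq> sphere 0 1" "P = ideal_hull V"
    using assms(6) by (auto simp: ideal_polyhedron_def)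
  obtain V' where V': "finite V'" "3 \<le> card V'" "V' \<subseteq> sphere 0 1" "Q = ideal_hull V'"
    using assms(8) by (auto simp: ideal_polyhedron_def)
  have "(\<exists>(I :: (real^3) set set) W fc L. ideal_surface M d V I W fc L) \<or> (\<exists>(I :: bool set) W fc L. ideal_surface M d V I W fc L)"
    using polyhedron_structure[OF MS V(1-3)] assms(7) V(4) by blast
  moreover have "(\<exists>(I :: (real^3) set set) W fc L. ideal_surface M d V' I W fc L) \<or> (\<exists>(I :: bool set) W fc L. ideal_surface M d V' I W fc L)"
    using polyhedron_structure[OF MS V'(1-3)] assms(9) V'(4) by blast
  \<comment> \<open>The four cases include a polyhedron with interior against a doubled polygon;
    they need no separate treatment because the two index types are independent.\<close>
  ultimately show ?thesis unfolding V(4) V'(4)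
    by (elim disjE exE) (rule ideal_surfaces_congruent[OF _ _ conn V(2)]; assumption)+
qed

end
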